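(* Let $d\ge 1$ be an integer, $\alpha\in(1,2)$, $q>1$, and let $f=(f_1,\dots,f_d):\mathbb{R}\to\mathbb{R}^d$ be a $C^1$ vector field for which there is a constant $C_f>0$ such that $$|f(u)|\le C_f|u|^q\quad\text{and}\quad |f(u)-f(v)|\le C_f|u-v|\bigl(|u|^{q-1}+|v|^{q-1}\bigr)\qquad\text{for all }u,v\in\mathbb{R}.$$ Let $u_0\in L^\infty_{\alpha+d}$ and let $u=u(x,t)$ be the solution of $$\partial_t u+(-\Delta)^{\alpha/2}u+\nabla\cdot f(u)=0\quad (x\in\mathbb{R}^d,\ t>0),\qquad u(x,0)=u_0(x).$$ For $x\in\mathbb{R}^d\setminus\{0\}$ and $t>0$ define $\mathcal{R}(x,t)$ by $$u(x,t)=S_\alpha(t)u_0(x)+\frac{c_1\,x}{|x|^{\alpha+d+2}}\cdot\int_0^t\int_{\mathbb{R}^d}(t-s)\,f(u(y,s))\,dy\,ds+\mathcal{R}(x,t).$$ (i) As $|x|\to\infty$, $$\mathcal{R}(x,t)=O\Bigl(\max\bigl\{|x|^{-q(\alpha+d)};\,|x|^{-(\alpha+d+2)}\bigr\}\Bigr),$$ uniformly for $t$ in any time interval $[0,T]$, $T>0$. (ii) If in addition $\nabla u_0\in L^\infty_{\alpha+d+1}$, then, as $|x|\to\infty$, $$\mathcal{R}(x,t)=O\Bigl(\max\bigl\{|x|^{-q(\alpha+d)-1};\,|x|^{-(\alpha+d+2)}\bigr\}\Bigr),$$ uniformly for $t$ in any time interval $[0,T]$, $T>0$. (iii) There is an exponent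 $N=N(\alpha,q,d)\le 3$, independent of $u_0$, such that the following holds. If there is a constant $C>0$ independent of $x,t$ such that $|u(x,t)|\le C\,p_\alpha(x,1+t)$ for all $x\in\mathbb{R}^d$ and $t>0$, then, as $|x|\to\infty$, $$\mathcal{R}(x,t)=O\Bigl((1+t)^N\max\bigl\{|x|^{-q(\alpha+d)};\,|x|^{-(\alpha+d+2)}\bigr\}\Bigr)$$ uniformly in $t\in[0,\infty)$. If, in addition, there is a constant $C>0$ independent of $t$ such that $\|\nabla u(t)\|_{L^\infty_{\alpha+d+1}}\le C(1+t)$ for all $t>0$, then (for some exponent $N=N(\alpha,q,d)\le 3$ independent of $u_0$), as $|x|\to\infty$, $$\mathcal{R}(x,t)=O\Bigl((1+t)^N\max\bigl\{|x|^{-q(\alpha+d)-1};\,|x|^{-(\alpha+d+2)}\bigr\}\Bigr)$$ uniformly in $t\in[0,\infty)$.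
   Context: Kernel and semigroup: $p_\alpha(x,t)$ is the fundamental solution of $\partial_t v+(-\Delta)^{\alpha/2}v=0$ on $\mathbb{R}^d$, determined by $\widehat{p_\alpha}(\xi,t)=e^{-t|\xi|^\alpha}$; thus $p_\alpha(x,t)=t^{-d/\alpha}P_\alpha(xt^{-1/\alpha})$, where $P_\alpha$ is the inverse Fourier transform of $e^{-|\xi|^\alpha}$ (so $\int P_\alpha=1$). $S_\alpha(t)v_0=p_\alpha(\cdot,t)*v_0$. Constant: $$c_1=2\pi\alpha2^{\alpha-1}\pi^{-(d+4)/2}\sin(\alpha\pi/2)\,\Gamma\Bigl(\frac{\alpha+d+2}{2}\Bigr)\Gamma\Bigl(\frac{\alpha}{2}\Bigr);$$ it is the constant for which $\nabla P_\alpha(x)=-c_1x|x|^{-(\alpha+d+2)}+O(|x|^{-(2\alpha+d+1)})$ as $|x|\to\infty$. Weighted spaces: for $\vartheta\ge0$, $L^\infty_\vartheta=\{v\in L^\infty(\mathbb{R}^d):\|v\|_{L^\infty_\vartheta}=\operatorname{ess\,sup}_{x\in\mathbb{R}^d}|v(x)|(1+|x|)^\vartheta<\infty\}$ (same notation for vector-valued functions). Solution: for $u_0\in L^1(\mathbb{R}^d)$ the Cauchy problem is known to have a unique solution $u\in C([0,\infty),L^1(\mathbb{R}^d))$; it satisfies $u\in C((0,\infty),W^{1,p}(\mathbb{R}^d))$ for every $p\in[1,\infty]$, the bounds $\|u(t)\|_p\le Ct^{-\frac d\alpha(1-\frac1p)}\|u_0\|_1$ ($C$ independent of $t,u_0$)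 and, if $u_0\in L^p$, $\|u(t)\|_p\le\|u_0\|_p$, as well as the Duhamel formula $u(t)=S_\alpha(t)u_0-\int_0^t\nabla S_\alpha(t-s)\cdot f(u(s))\,ds$. Note $L^\infty_{\alpha+d}\subset L^1\cap L^\infty$. Meaning of the $O$-statements: "$\mathcal{R}(x,t)=O(g(x,t))$ as $|x|\to\infty$ uniformly in $t\in I$" means there are constants $K,R>0$, independent of $x$ and of $t\in I$ (but possibly depending on $u$ and on $I$), such that $|\mathcal{R}(x,t)|\le K g(x,t)$ for all $|x|\ge R$ and all $t\in I$, $t>0$. *)

theory Defs
  imports "HOL-Analysis.Analysis" "HOL-Probability.Essential_Supremum"
begin

text \<open>Lebesgue norms and spaces on \<open>\<real>\<^sup>d\<close>. An element of a function space is represented by a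
  Borel function; the exponent \<open>p\<close> ranges over \<open>[1,\<infinity>]\<close>, as an extended nonnegative real.\<close>

definition Lp_norm :: "ennreal \<Rightarrow> ('a::euclidean_space \<Rightarrow> 'b::real_normed_vector) \<Rightarrow> ennreal" where
  "Lp_norm p g =
    (if p = \<infinity> then esssup lborel (\<lambda>x. ennreal (norm (g x)))
     else (let I = \<integral>\<^sup>+x. ennreal (norm (g x) powr enn2real p) \<partial>lborel
           in if I = \<infinity> then \<infinity> else ennreal (enn2real I powr (1 / enn2real p))))"

definition in_Lp :: "ennreal \<Rightarrow> ('a::euclidean_space \<Rightarrow> 'b::real_normed_vector) \<Rightarrow> bool" where
  "in_Lp p g \<longleftrightarrow> g \<in> borel_measurable lborel \<and> Lp_norm p g < \<infinity>"

definition Linf_weighted_norm ::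
    "real \<Rightarrow> ('a::euclidean_space \<Rightarrow> 'b::real_normed_vector) \<Rightarrow> ennreal" where
  "Linf_weighted_norm \<theta> g = esssup lborel (\<lambda>x. ennreal (norm (g x) * (1 + norm x) powr \<theta>))"

definition in_Linf_weighted ::
    "real \<Rightarrow> ('a::euclidean_space \<Rightarrow> 'b::real_normed_vector) \<Rightarrow> bool" where
  "in_Linf_weighted \<theta> g \<longleftrightarrow> g \<in> borel_measurable lborel \<and> Linf_weighted_norm \<theta> g < \<infinity>"

definition grad :: "(real^'n \<Rightarrow> real) \<Rightarrow> real^'n \<Rightarrow> real^'n" where
  "grad g x = (\<chi> i. frechet_derivative g (at x) (axis i 1))"

text \<open>Weak derivatives are tested against compactly supported \<open>C\<^sup>1\<close> functions; by mollification
  this is equivalent to testing against compactly supported smooth functions.\<close>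

definition test_function :: "(real^'n \<Rightarrow> real) \<Rightarrow> bool" where
  "test_function \<phi> \<longleftrightarrow> (\<forall>x. \<phi> differentiable (at x)) \<and> continuous_on UNIV (grad \<phi>)
     \<and> (\<exists>r. \<forall>x. norm x > r \<longrightarrow> \<phi> x = 0)"

definition locally_integrable ::
    "('a::euclidean_space \<Rightarrow> 'b::{banach,second_countable_topology}) \<Rightarrow> bool" where
  "locally_integrable g \<longleftrightarrow>
     g \<in> borel_measurable lborel \<and> (\<forall>K. compact K \<longrightarrow> set_integrable lborel K g)"

definition is_weak_gradient :: "(real^'n \<Rightarrow> real) \<Rightarrow> (real^'n \<Rightarrow> real^'n) \<Rightarrow> bool" where
  "is_weak_gradient g G \<longleftrightarrow> locally_integrable g \<and> locally_integrable G \<and>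
     (\<forall>\<phi>. test_function \<phi> \<longrightarrow>
        (\<integral>x. g x *\<^sub>R grad \<phi> x \<partial>lborel) = - (\<integral>x. \<phi> x *\<^sub>R G x \<partial>lborel))"

definition weakly_differentiable :: "(real^'n \<Rightarrow> real) \<Rightarrow> bool" where
  "weakly_differentiable g \<longleftrightarrow> (\<exists>G. is_weak_gradient g G)"

text \<open>The weak gradient is unique up to null sets, and everything below is insensitive to the
  choice of the representative.\<close>

definition weak_grad :: "(real^'n \<Rightarrow> real) \<Rightarrow> real^'n \<Rightarrow> real^'n" where
  "weak_grad g = (SOME G. is_weak_gradient g G)"

definition in_W1p :: "ennreal \<Rightarrow> (real^'n \<Rightarrow> real) \<Rightarrow> bool" where
  "in_W1p p g \<longleftrightarrow> in_Lp p g \<and> weakly_differentiable g \<and> in_Lp p (weak_grad g)"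

definition W1p_norm :: "ennreal \<Rightarrow> (real^'n \<Rightarrow> real) \<Rightarrow> ennreal" where
  "W1p_norm p g = Lp_norm p g + Lp_norm p (weak_grad g)"

definition continuous_in_time ::
    "(('a \<Rightarrow> real) \<Rightarrow> ennreal) \<Rightarrow> real set \<Rightarrow> (real \<Rightarrow> 'a \<Rightarrow> real) \<Rightarrow> bool" where
  "continuous_in_time N I u \<longleftrightarrow>
     (\<forall>t\<in>I. ((\<lambda>s. N (\<lambda>x. u s x - u t x)) \<longlongrightarrow> 0) (at t within I))"

text \<open>The Fourier transform is normalised as \<open>\<integral> e\<^sup>-\<^sup>i\<^sup>x\<^sup>\<xi> g(x) dx\<close>, so that its inverse carries the factor
  \<open>(2\<pi>)\<^sup>-\<^sup>d\<close> and a kernel whose transform is \<open>e\<^sup>-\<^sup>t\<^sup>|\<^sup>\<xi>\<^sup>|\<^sup>^\<^sup>\<alpha>\<close> has total mass one.\<close>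

definition fourier :: "(real^'n \<Rightarrow> real) \<Rightarrow> real^'n \<Rightarrow> complex" where
  "fourier g \<xi> = (\<integral>x. cis (- (x \<bullet> \<xi>)) * complex_of_real (g x) \<partial>lborel)"

definition p_kernel :: "real \<Rightarrow> real^'n \<Rightarrow> real \<Rightarrow> real" where
  "p_kernel \<alpha> x t =
     Re (\<integral>\<xi>. cis (x \<bullet> \<xi>) * complex_of_real (exp (- t * norm \<xi> powr \<alpha>)) \<partial>lborel)
       / (2 * pi) ^ CARD('n)"

definition semigroup :: "real \<Rightarrow> real \<Rightarrow> (real^'n \<Rightarrow> real) \<Rightarrow> real^'n \<Rightarrow> real" where
  "semigroup \<alpha> t v x = (\<integral>y. p_kernel \<alpha> (x - y) t * v y \<partial>lborel)"

text \<open>\<open>grad_semigroup \<alpha> t w\<close> is \<open>\<nabla>S\<^sub>\<alpha>(t) \<cdot> w\<close>, the convolution of the vector kernel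
  \<open>\<nabla>p\<^sub>\<alpha>(\<cdot>,t)\<close> with the vector field \<open>w\<close>.\<close>

definition grad_semigroup :: "real \<Rightarrow> real \<Rightarrow> (real^'n \<Rightarrow> real^'n) \<Rightarrow> real^'n \<Rightarrow> real" where
  "grad_semigroup \<alpha> t w x = (\<integral>y. grad (\<lambda>z. p_kernel \<alpha> z t) (x - y) \<bullet> w y \<partial>lborel)"

definition c1 :: "real \<Rightarrow> real \<Rightarrow> real" where
  "c1 \<alpha> d = 2 * pi * \<alpha> * 2 powr (\<alpha> - 1) * pi powr (- (d + 4) / 2) * sin (\<alpha> * pi / 2)
     * Gamma ((\<alpha> + d + 2) / 2) * Gamma (\<alpha> / 2)"

definition admissible_flux :: "real \<Rightarrow> (real \<Rightarrow> real^'n) \<Rightarrow> bool" where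
  "admissible_flux q f \<longleftrightarrow> f C1_differentiable_on UNIV \<and>
     (\<exists>C>0. \<forall>a b. norm (f a) \<le> C * \<bar>a\<bar> powr q \<and>
        norm (f a - f b) \<le> C * \<bar>a - b\<bar> * (\<bar>a\<bar> powr (q - 1) + \<bar>b\<bar> powr (q - 1)))"

text \<open>The Cauchy problem for \<open>\<partial>\<^sub>t u + (-\<Delta>)\<^sup>\<alpha>\<^sup>/\<^sup>2 u + \<nabla>\<cdot>f(u) = 0\<close> in \<open>C([0,\<infinity>), L\<^sup>1)\<close>.
  Here \<open>(-\<Delta>)\<^sup>\<alpha>\<^sup>/\<^sup>2\<close> is the Fourier multiplier with symbol \<open>|\<xi>|\<^sup>\<alpha>\<close>. As \<open>u(t)\<close> and \<open>f(u(t))\<close> are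
  integrable for \<open>t > 0\<close>, their transforms are continuous functions, and the equation between
  tempered distributions amounts to the ordinary differential equation below for every
  frequency \<open>\<xi>\<close>.\<close>

definition cauchy_solution ::
    "real \<Rightarrow> (real \<Rightarrow> real^'n) \<Rightarrow> (real^'n \<Rightarrow> real) \<Rightarrow> (real \<Rightarrow> real^'n \<Rightarrow> real) \<Rightarrow> bool" where
  "cauchy_solution \<alpha> f u\<^sub>0 u \<longleftrightarrow>
     (\<forall>t\<ge>0. in_Lp 1 (u t)) \<and> continuous_in_time (Lp_norm 1) {0..} u \<and>
     (AE x in lborel. u 0 x = u\<^sub>0 x) \<and>
     (\<forall>t>0. integrable lborel (\<lambda>x. f (u t x))) \<and>
     (\<forall>t>0. \<forall>\<xi>. ((\<lambda>s. fourier (u s) \<xi>) has_vector_derivative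
        - (complex_of_real (norm \<xi> powr \<alpha>) * fourier (u t) \<xi>)
        - \<i> * (\<Sum>j\<in>UNIV. complex_of_real (\<xi> $ j) * fourier (\<lambda>x. f (u t x) $ j) \<xi>)) (at t))"

text \<open>The standing facts about the solution: Sobolev regularity for positive times (with
  \<open>u(t)\<close> the continuous representative of its class), decay and nonexpansion of the Lebesgue
  norms, and the Duhamel formula. Note \<open>inverse \<infinity> = 0\<close>, so that \<open>1 - 1/p\<close> is \<open>1\<close> for
  \<open>p = \<infinity>\<close>.\<close>

definition standing_properties ::
    "real \<Rightarrow> (real \<Rightarrow> real^'n) \<Rightarrow> (real^'n \<Rightarrow> real) \<Rightarrow> (real \<Rightarrow> real^'n \<Rightarrow> real) \<Rightarrow> bool" where
  "standing_properties \<alpha> f u\<^sub>0 u \<longleftrightarrow>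
     (\<forall>t>0. continuous_on UNIV (u t)) \<and>
     (\<forall>p\<ge>1. (\<forall>t>0. in_W1p p (u t)) \<and> continuous_in_time (W1p_norm p) {0<..} u) \<and>
     (\<forall>p\<ge>1. \<exists>C\<ge>0. \<forall>t>0. Lp_norm p (u t)
        \<le> ennreal (C * t powr (- (real CARD('n) / \<alpha> * (1 - enn2real (inverse p))))) * Lp_norm 1 u\<^sub>0) \<and>
     (\<forall>p\<ge>1. in_Lp p u\<^sub>0 \<longrightarrow> (\<forall>t>0. Lp_norm p (u t) \<le> Lp_norm p u\<^sub>0)) \<and>
     (\<forall>t>0. \<forall>x. u t x = semigroup \<alpha> t u\<^sub>0 x
        - (LINT s:{0..t}|lborel. grad_semigroup \<alpha> (t - s) (\<lambda>y. f (u s y)) x))"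

definition remainder ::
    "real \<Rightarrow> (real \<Rightarrow> real^'n) \<Rightarrow> (real^'n \<Rightarrow> real) \<Rightarrow> (real \<Rightarrow> real^'n \<Rightarrow> real)
      \<Rightarrow> real^'n \<Rightarrow> real \<Rightarrow> real" where
  "remainder \<alpha> f u\<^sub>0 u x t = u t x - semigroup \<alpha> t u\<^sub>0 x
     - ((c1 \<alpha> (real CARD('n)) / norm x powr (\<alpha> + real CARD('n) + 2)) *\<^sub>R x)
       \<bullet> (LINT s:{0..t}|lborel. (\<integral>y. (t - s) *\<^sub>R f (u s y) \<partial>lborel))"

definition far_field_bigo ::
    "real set \<Rightarrow> (real^'n \<Rightarrow> real \<Rightarrow> real) \<Rightarrow> (real^'n \<Rightarrow> real \<Rightarrow> real) \<Rightarrow> bool" where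
  "far_field_bigo I r g \<longleftrightarrow>
     (\<exists>K>0. \<exists>\<rho>>0. \<forall>x t. norm x \<ge> \<rho> \<and> t \<in> I \<and> t > 0 \<longrightarrow> \<bar>r x t\<bar> \<le> K * g x t)"

end

theory Submission
  imports Defs "HOL-Complex_Analysis.Complex_Analysis" "HOL-Real_Asymp.Real_Asymp" "HOL-Probability.Characteristic_Functions"
begin

text \<open>The kernel \<open>p\<^sub>\<alpha>\<close> is a Gaussian subordinated by the one-sided \<open>\<alpha>/2\<close>-stable law. The density of that law is
  an integral over a ray on which both exponentials decay, and expanding there gives its behaviour at
  infinity, hence the pointwise bounds on \<open>\<nabla>p\<^sub>\<alpha>\<close> and the constant \<open>c\<^sub>1\<close>.

  In the Duhamel integral, the convolution \<open>\<nabla>p\<^sub>\<alpha>(t-s) * f(u(s))\<close> at \<open>x\<close> is split at \<open>|x-y| = |x|/2\<close>. Away from \<open>x\<close>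
  the kernel is replaced by its value at \<open>x\<close>, hence by its asymptotics; the error is \<open>|y||x|\<^sup>-\<^sup>(\<^sup>\<alpha>\<^sup>+\<^sup>d\<^sup>+\<^sup>2\<^sup>)\<close>,
  and the first moment of \<open>|f(u)|\<close> is finite. Near \<open>x\<close>, \<open>|f(u)|\<close> is of order \<open>|x|\<^sup>-\<^sup>q\<^sup>(\<^sup>\<alpha>\<^sup>+\<^sup>d\<^sup>)\<close>; under a gradient bound, the
  oddness of \<open>\<nabla>p\<^sub>\<alpha>\<close> lets one subtract \<open>f(u(x))\<close>, which gains one more power of \<open>|x|\<close>. The decay of \<open>u\<close> and of
  its difference quotients is propagated from the initial datum by a Gronwall argument in weighted spaces.\<close>

section \<open>Contour rotation and Gamma integrals\<close>

text \<open>The symbol exp(-|\<xi>|^\<alpha>) is not smooth at the origin, and this singularity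
  produces the algebraic tail of the kernel. Subordination moves it into one complex variable: the
  tail of a single density \<open>\<eta>\<close>, the same in every dimension, gives the kernel, its
  gradient and the variation of the gradient, because a derivative in |x|^2 only shifts the index of
  \<open>gk\<close>. The error bounds for \<open>\<eta>\<close> hold for all s > 0, so they can be
  inserted under the subordination integral without splitting it. The condition \<alpha> > 1 decides
  three later steps: the mass (t-s)^(-1/\<alpha>) of the gradient kernel must be integrable in time;
  the first moment of f(u) needs \<alpha> + d - 1 > d; and the second-order kernel error
  |x|^-(2\<alpha>+d+1) has to be dominated by |x|^-(\<alpha>+d+2). The solution is handled through
  uniform bounds, continuity in time in L^1 and the Duhamel formula. Hence decay is propagated by
  suprema, and regularity by differences with a fixed shift, which need no derivative of u.\<close>

lemma Im_sector_segment:
  fixes \<phi> x :: real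
  assumes "0 < \<phi>" "\<phi> < pi" "0 \<le> R" "z \<in> closed_segment (of_real R) (of_real R * cis \<phi>)"
  shows "0 \<le> Im z" "Im (z * cis (-\<phi>)) \<le> 0"
proof -
  from assms(4) obtain u where u: "0 \<le> u" "u \<le> 1" "z = (1-u) *\<^sub>R of_real R + u *\<^sub>R (of_real R * cis \<phi>)"
    by (auto simp: closed_segment_def)
  have s: "sin \<phi> > 0" using assms by (simp add: sin_gt_zero)
  show "0 \<le> Im z" using u s assms(3) by simp
  have "z * cis (-\<phi>) = (1-u) *\<^sub>R (of_real R * cis (-\<phi>)) + u *\<^sub>R of_real R"
    unfolding u(3) by (simp add: scaleR_conv_of_real algebra_simps cis_mult)
  then show "Im (z * cis (-\<phi>)) \<le> 0" using u s assms(3) by (simp add: mult_nonneg_nonneg)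
qed

text \<open>An argument above \<phi> would, after turning by -\<phi>, still lie strictly between 0
  and \<pi> and give a positive imaginary part, against \<open>Im_sector_segment\<close>. The bound
  is what later keeps the real part of z^\<beta> positive on the whole chord.\<close>

lemma Arg_sector_segment:
  assumes "0 < \<phi>" "\<phi> < pi" "0 < R" "z \<in> closed_segment (of_real R) (of_real R * cis \<phi>)"
  shows "0 \<le> Arg z" "Arg z \<le> \<phi>"
proof -
  note I = Im_sector_segment[OF assms(1,2) less_imp_le[OF assms(3)] assms(4)]
  show *: "0 \<le> Arg z" using I(1) Arg_eq_0 Arg_less_0 by (metis not_less)
  show "Arg z \<le> \<phi>"
  proof (rule ccontr)
    assume a: "\<not> Arg z \<le> \<phi>"
    then have "z \<noteq> 0" using assms(1) by (auto simp: Arg_zero)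
    have "z = of_real (cmod z) * cis (Arg z)"
      using rcis_cmod_Arg[of z] by (simp add: rcis_def)
    then have "z * cis (-\<phi>) = of_real (cmod z) * cis (Arg z - \<phi>)"
      by (metis (no_types, lifting) cis_mult mult.assoc uminus_add_conv_diff add.commute)
    moreover have "sin (Arg z - \<phi>) > 0" using a Arg_le_pi[of z] assms by (intro sin_gt_zero) auto
    ultimately have "Im (z * cis (-\<phi>)) > 0" using \<open>z \<noteq> 0\<close> by simp
    with I show False by simp
  qed
qed

text \<open>The point of the chord nearest to the origin is its midpoint, at distance R |cos
  (\<phi>/2)|; in the computation this is u (1-u) \<le> 1/4.\<close>

lemma norm_sector_segment:
  assumes "0 \<le> R" "z \<in> closed_segment (of_real R) (of_real R * cis \<phi>)"
  shows "R * \<bar>cos (\<phi>/2)\<bar> \<le> cmod z"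
proof -
  from assms(2) obtain u where u: "0 \<le> u" "u \<le> 1" "z = (1-u) *\<^sub>R of_real R + u *\<^sub>R (of_real R * cis \<phi>)"
    by (auto simp: closed_segment_def)
  have c: "(cos (\<phi>/2))\<^sup>2 = (1 + cos \<phi>)/2" using cos_double_cos[of "\<phi>/2"] by simp
  have sc: "(sin \<phi>)\<^sup>2 = 1 - (cos \<phi>)\<^sup>2" by (rule sin_squared_eq)
  have "(R * \<bar>cos (\<phi>/2)\<bar>)\<^sup>2 = R\<^sup>2 * ((1 + cos \<phi>)/2)" using c by (simp add: power_mult_distrib)
  also have "\<dots> \<le> R\<^sup>2 * (1 - 2*u*(1-u)*(1-cos \<phi>))"
  proof (rule mult_left_mono)
    have "u*(1-u) \<le> 1/4" by (sos)
    then have "u*(1-u)*(1-cos \<phi>) \<le> 1/4*(1-cos \<phi>)" by (rule mult_right_mono) simp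
    then show "(1 + cos \<phi>)/2 \<le> 1 - 2*u*(1-u)*(1-cos \<phi>)" by (simp add: field_simps)
  qed simp
  also have "\<dots> = (cmod z)\<^sup>2"
    unfolding u(3) cmod_power2 by (simp add: power_mult_distrib power2_sum sc) (simp add: algebra_simps power2_eq_square)
  finally show ?thesis by (rule power2_le_imp_le) simp
qed

lemma has_integral_ray:
  fixes F :: "complex \<Rightarrow> complex"
  assumes "0 < R" "continuous_on ((\<lambda>r. of_real r * w) ` {0..R}) F"
  shows "(F has_contour_integral (integral {0..R} (\<lambda>r. F (of_real r * w) * w))) (linepath 0 (of_real R * w))"
proof -
  have "((\<lambda>r. F (of_real r * w) * w) has_integral (integral {0..R} (\<lambda>r. F (of_real r * w) * w))) {0..R}"
    by (intro integrable_integral integrable_continuous_interval continuous_intros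
          continuous_on_compose2[OF assms(2)]) auto
  from has_integral_stretch_real[OF this, of R]
  have "((\<lambda>x. F (of_real (R * x) * w) * w) has_integral (1/R) *\<^sub>R integral {0..R} (\<lambda>r. F (of_real r * w) * w)) ((\<lambda>x. x / R) ` {0..R})"
    using assms(1) by simp
  from has_integral_cmul[OF this, of R] assms(1)
  have "((\<lambda>x. F (linepath 0 (of_real R * w) x) * (of_real R * w - 0)) has_integral integral {0..R} (\<lambda>r. F (of_real r * w) * w)) ((\<lambda>x. x / R) ` {0..R})"
    by (simp add: linepath_def scaleR_conv_of_real mult_ac)
  moreover have "(\<lambda>x. x / R) ` {0..R} = {0..1}"
    using assms(1) image_divide_atLeastAtMost by force
  ultimately show ?thesis unfolding has_contour_integral_linepath by simp
qed

text \<open>The principal power z^\<beta> with \<beta> > 0 is continuous on the slit plane with the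
  origin added, but holomorphic only off the slit. The triangle fits this: it lies in the first set
  and its interior avoids the real axis, so a vertex at the branch point does no harm.\<close>

lemma convex_hull_sector:
  assumes "0 < \<phi>" "\<phi> < pi" "0 < R"
  shows "convex hull {0, of_real R, of_real R * cis \<phi>} \<subseteq> {z. Im z \<noteq> 0 \<or> 0 \<le> Re z}"
    and "interior (convex hull {0, of_real R, of_real R * cis \<phi>}) \<subseteq> {z. Im z \<noteq> 0}"
proof -
  have s: "sin \<phi> > 0" using assms by (simp add: sin_gt_zero)
  show "convex hull {0, of_real R, of_real R * cis \<phi>} \<subseteq> {z. Im z \<noteq> 0 \<or> 0 \<le> Re z}"
    using s assms by (auto simp: convex_hull_3)
  have "convex hull {0, of_real R, of_real R * cis \<phi>} \<subseteq> {z. 0 \<le> Im z}"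
    using s assms by (auto simp: convex_hull_3)
  then have "interior (convex hull {0, of_real R, of_real R * cis \<phi>}) \<subseteq> interior {z. 0 \<le> Im z}"
    by (rule interior_mono)
  also have "interior {z. 0 \<le> Im z} = {z. 0 < Im z}"
    using interior_halfspace_ge[of "\<i>" 0] by (simp add: inner_complex_def)
  finally show "interior (convex hull {0, of_real R, of_real R * cis \<phi>}) \<subseteq> {z. Im z \<noteq> 0}" by auto
qed

text \<open>Cauchy's theorem on the triangle with vertices \<open>0\<close>, \<open>R\<close>, \<open>R e\<^sup>i\<^sup>\<phi>\<close>.\<close>

lemma ray_rotation:
  fixes F :: "complex \<Rightarrow> complex"
  assumes \<phi>: "0 < \<phi>" "\<phi> < pi"
    and cont: "continuous_on {z. Im z \<noteq> 0 \<or> 0 \<le> Re z} F"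
    and diff: "\<And>z. Im z \<noteq> 0 \<Longrightarrow> F field_differentiable at z"
    and bound: "\<forall>\<^sub>F R in at_top. \<forall>z\<in>closed_segment (of_real R) (of_real R * cis \<phi>). norm (F z) \<le> B R"
    and lim: "((\<lambda>R. R * B R) \<longlongrightarrow> 0) at_top"
  shows "((\<lambda>R. integral {0..R} (\<lambda>r. F (of_real r * cis \<phi>) * cis \<phi>) - integral {0..R} (\<lambda>r. F (of_real r))) \<longlongrightarrow> 0) at_top"
proof (rule Lim_null_comparison)
  \<comment> \<open>The chord from R to R cis \<phi> has length at most 2R.\<close>
  have "((\<lambda>R. 2 * (R * B R)) \<longlongrightarrow> 2 * 0) at_top" by (intro tendsto_intros lim)
  then show "((\<lambda>R. 2 * (R * B R)) \<longlongrightarrow> 0) at_top" by simp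
  show "\<forall>\<^sub>F R in at_top. norm (integral {0..R} (\<lambda>r. F (of_real r * cis \<phi>) * cis \<phi>) - integral {0..R} (\<lambda>r. F (of_real r))) \<le> 2 * (R * B R)"
    using bound eventually_gt_at_top[of 0]
  proof eventually_elim
    case (elim R)
    let ?a = "of_real R :: complex" and ?b = "of_real R * cis \<phi>"
    note hull = convex_hull_sector[OF \<phi> elim(2)]
    have "(F has_contour_integral 0) (linepath 0 ?a +++ linepath ?a ?b +++ linepath ?b 0)"
      by (rule Cauchy_theorem_triangle_cofinite[where S="{}"])
        (use hull cont diff in \<open>auto intro: continuous_on_subset\<close>)
    then have sum: "contour_integral (linepath 0 ?a) F + contour_integral (linepath ?a ?b) F + contour_integral (linepath ?b 0) F = 0"
      by (rule has_chain_integral_chain_integral3)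
    have "continuous_on (closed_segment ?a ?b) F"
      by (rule continuous_on_subset[OF cont order_trans[OF _ hull(1)]]) (simp add: segments_subset_convex_hull)
    then have j: "F contour_integrable_on (linepath ?a ?b)"
      by (rule contour_integrable_continuous_linepath)
    have c1: "continuous_on ((\<lambda>r. of_real r * cis \<phi>) ` {0..R}) F"
      by (rule continuous_on_subset[OF cont]) (use \<phi> sin_gt_zero in \<open>force\<close>)
    have c2: "continuous_on ((\<lambda>r. of_real r * 1) ` {0..R}) F"
      by (rule continuous_on_subset[OF cont]) auto
    have "contour_integral (linepath 0 ?a) F = integral {0..R} (\<lambda>r. F (of_real r))"
      using contour_integral_unique[OF has_integral_ray[OF elim(2) c2]] by simp
    moreover have "contour_integral (linepath ?b 0) F = - integral {0..R} (\<lambda>r. F (of_real r * cis \<phi>) * cis \<phi>)"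
      using contour_integral_unique[OF has_contour_integral_reversepath[OF _ has_integral_ray[OF elim(2) c1]]] by simp
    ultimately have eq: "integral {0..R} (\<lambda>r. F (of_real r * cis \<phi>) * cis \<phi>) - integral {0..R} (\<lambda>r. F (of_real r)) = contour_integral (linepath ?a ?b) F"
      using sum by (simp add: algebra_simps)
    have B: "0 \<le> B R" using elim(1) norm_ge_zero order_trans by (metis ends_in_segment(1))
    have "norm (contour_integral (linepath ?a ?b) F) \<le> B R * norm (?b - ?a)"
      by (rule contour_integral_bound_linepath[OF j B]) (use elim in auto)
    also have "\<dots> \<le> B R * (R + R)"
      by (rule mult_left_mono[OF order_trans[OF norm_triangle_ineq4]]) (use elim B in \<open>auto simp: norm_mult\<close>)
    finally show ?case unfolding eq by (simp add: mult_ac)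
  qed
qed

lemma has_bochner_integral_Gamma_scaled:
  fixes z a :: real
  assumes "0 < z" "0 < a"
  shows "has_bochner_integral lborel (\<lambda>r. indicator {0<..} r * (r powr (z - 1) * exp (- (a * r)))) (Gamma z / a powr z)"
proof -
  let ?f = "\<lambda>t::real. indicator {0..} t * t powr (z - 1) / exp t"
  have "has_bochner_integral lborel ?f (Gamma z)"
    by (rule has_bochner_integral_nn_integral)
      (use assms Gamma_real_pos[OF assms(1)] in \<open>auto simp: Gamma_conv_nn_integral_real indicator_def\<close>)
  then have "has_bochner_integral lborel (\<lambda>r. ?f (0 + a * r)) (Gamma z /\<^sub>R \<bar>a\<bar>)"
    using lborel_has_bochner_integral_real_affine_iff[of a ?f "Gamma z" 0] assms by simp
  then have "has_bochner_integral lborel (\<lambda>r. a powr (1 - z) * ?f (0 + a * r)) (a powr (1 - z) * (Gamma z /\<^sub>R \<bar>a\<bar>))"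
    by (rule has_bochner_integral_mult_right)
  moreover have "a powr (1 - z) * ?f (0 + a * r) = indicator {0<..} r * (r powr (z - 1) * exp (- (a * r)))" for r
    using assms by (cases "r > 0") (auto simp: indicator_def powr_mult exp_minus field_simps powr_diff zero_le_mult_iff)
  moreover have "a powr (1 - z) * (Gamma z /\<^sub>R \<bar>a\<bar>) = Gamma z / a powr z"
    using assms by (simp add: powr_diff field_simps)
  ultimately show ?thesis by simp
qed

text \<open>The value of \<open>0 powr _\<close> is 0 by convention, so the integrand vanishes at
  the endpoint and both forms agree pointwise.\<close>

lemma has_bochner_integral_Gamma_scaled':
  fixes z a :: real
  assumes "0 < z" "0 < a"
  shows "has_bochner_integral lborel (\<lambda>r. indicator {0..} r * (r powr (z - 1) * exp (- (a * r)))) (Gamma z / a powr z)"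
proof -
  have e: "(\<lambda>r. indicator {0..} r * (r powr (z - 1) * exp (- (a * r)))) = (\<lambda>r. indicator {0<..} r * (r powr (z - 1) * exp (- (a * r))))"
    by (auto simp: fun_eq_iff indicator_def)
  show ?thesis unfolding e by (rule has_bochner_integral_Gamma_scaled[OF assms])
qed

text \<open>The substitution s = 1/r turns Euler's integral into this one. It is the time integral
  that subordination produces: the power comes from the tail of the density and the Gaussian
  normalisation, exp(-\<rho>/s) from the Gaussian itself.\<close>

lemma has_bochner_integral_inverse_Gamma:
  fixes k \<rho> :: real
  assumes "0 < k" "0 < \<rho>"
  shows "has_bochner_integral lborel (\<lambda>s. indicator {0..} s * (s powr (- k - 1) * exp (- (\<rho> / s)))) (Gamma k / \<rho> powr k)"
proof -
  let ?f = "\<lambda>s. s powr (- k - 1) * exp (- (\<rho> / s))"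
  let ?g = "\<lambda>r. r powr (k - 1) * exp (- (\<rho> * r))"
  have im: "(\<lambda>x::real. 1 / x) ` {0<..} = {0<..}"
  proof safe
    fix x :: real assume "0 < x" then show "x \<in> (\<lambda>x. 1 / x) ` {0<..}" by (intro image_eqI[of _ _ "1/x"]) auto
  qed auto
  have eq: "\<bar>- 1 / x\<^sup>2\<bar> * ?f (1/x) = ?g x" if "x \<in> {0<..}" for x :: real
    using that by (simp add: powr_divide powr_diff powr_minus field_simps power2_eq_square)
  have g: "has_bochner_integral lborel (\<lambda>r. indicator {0<..} r *\<^sub>R ?g r) (Gamma k / \<rho> powr k)"
    using has_bochner_integral_Gamma_scaled[OF assms] by simp
  then have g': "set_integrable lborel {0<..} ?g" "(LBINT r:{0<..}. ?g r) = Gamma k / \<rho> powr k"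
    unfolding set_integrable_def set_lebesgue_integral_def by (auto simp: has_bochner_integral_iff)
  have "?g absolutely_integrable_on {0<..}"
    using g'(1) unfolding set_integrable_def by (simp add: integrable_completion)
  have der: "((\<lambda>x. 1/x) has_field_derivative -1/x\<^sup>2) (at x within {0<..})" if "x \<in> {0<..}" for x :: real
    using that by (auto simp: power2_eq_square intro!: derivative_eq_intros)
  have e1: "(\<lambda>x. \<bar>- 1 / x\<^sup>2\<bar> * ?f (1/x)) absolutely_integrable_on {0<..} \<longleftrightarrow> ?g absolutely_integrable_on {0<..}"
    by (rule set_integrable_cong[OF refl refl eq])
  have e2: "integral {0<..} (\<lambda>x. \<bar>- 1 / x\<^sup>2\<bar> * ?f (1/x)) = integral {0<..} ?g"
    by (rule integral_cong[OF eq])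
  have "integral {0<..} ?g = Gamma k / \<rho> powr k"
    using set_borel_integral_eq_integral(2)[OF g'(1)] g'(2) by simp
  with \<open>?g absolutely_integrable_on _\<close> have "(\<lambda>x. \<bar>- 1 / x\<^sup>2\<bar> * ?f (1/x)) absolutely_integrable_on {0<..} \<and> integral {0<..} (\<lambda>x. \<bar>- 1 / x\<^sup>2\<bar> * ?f (1/x)) = Gamma k / \<rho> powr k"
    unfolding e1 e2 ..
  then have f: "?f absolutely_integrable_on {0<..}" "integral {0<..} ?f = Gamma k / \<rho> powr k"
    using has_absolute_integral_change_of_variables_1'[of "{0<..}" "\<lambda>x. 1/x" "\<lambda>x. -1/x\<^sup>2" ?f "Gamma k / \<rho> powr k"] im der
    by (auto simp: inj_on_def)
  have "set_integrable lborel {0<..} ?f"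
    using f(1) unfolding set_integrable_def by (subst (asm) integrable_completion) auto
  with f(2) set_borel_integral_eq_integral(2)[OF this]
  have "has_bochner_integral lborel (\<lambda>s. indicator {0<..} s * ?f s) (Gamma k / \<rho> powr k)"
    unfolding set_integrable_def set_lebesgue_integral_def by (simp add: has_bochner_integral_iff)
  moreover have e: "(\<lambda>s. indicator {0..} s * ?f s) = (\<lambda>s. indicator {0<..} s * ?f s)"
    by (auto simp: fun_eq_iff indicator_def)
  ultimately show ?thesis unfolding e by simp
qed

text \<open>Substituting r = x^(1/\<beta>) leaves a Gamma integrand of index 1/\<beta>. The function
  is the majorant for the integrals along the tilted ray.\<close>

lemma set_integrable_exp_minus_powr:
  fixes c \<beta> :: real
  assumes "0 < c" "0 < \<beta>"
  shows "set_integrable lborel {0..} (\<lambda>r. exp (- (c * r powr \<beta>)))"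
proof -
  let ?f = "\<lambda>r. exp (- (c * r powr \<beta>))"
  have im: "(\<lambda>x::real. x powr (1/\<beta>)) ` {0<..} = {0<..}"
  proof safe
    fix x :: real assume "0 < x" then show "x \<in> (\<lambda>x. x powr (1/\<beta>)) ` {0<..}"
      using assms by (intro image_eqI[of _ _ "x powr \<beta>"]) (auto simp: powr_powr)
  qed auto
  have inj: "inj_on (\<lambda>x::real. x powr (1/\<beta>)) {0<..}"
  proof (rule inj_onI)
    fix x y :: real assume "x \<in> {0<..}" "y \<in> {0<..}" "x powr (1/\<beta>) = y powr (1/\<beta>)"
    then have "(x powr (1/\<beta>)) powr \<beta> = (y powr (1/\<beta>)) powr \<beta>" by simp
    then show "x = y" using \<open>x \<in> _\<close> \<open>y \<in> _\<close> assms by (simp add: powr_powr)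
  qed
  have der: "((\<lambda>x. x powr (1/\<beta>)) has_field_derivative 1/\<beta> * x powr (1/\<beta> - 1)) (at x within {0<..})" if "x \<in> {0<..}" for x :: real
    using that by (intro has_real_derivative_powr[THEN has_field_derivative_at_within]) simp
  have "set_integrable lborel {0<..} (\<lambda>x. 1/\<beta> * (x powr (1/\<beta> - 1) * exp (- (c * x))))"
    using has_bochner_integral_Gamma_scaled[of "1/\<beta>" c] assms unfolding set_integrable_def
    by (simp add: has_bochner_integral_iff)
  then have "set_integrable lborel {0<..} (\<lambda>x. \<bar>1/\<beta> * x powr (1/\<beta> - 1)\<bar> * ?f (x powr (1/\<beta>)))"
    by (rule iffD1[OF set_integrable_cong[OF refl refl], rotated]) (use assms in \<open>simp add: powr_powr\<close>)
  then have "(\<lambda>x. \<bar>1/\<beta> * x powr (1/\<beta> - 1)\<bar> * ?f (x powr (1/\<beta>))) absolutely_integrable_on {0<..}"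
    unfolding set_integrable_def by (simp add: integrable_completion)
  then have "?f absolutely_integrable_on {0<..}"
    using absolutely_integrable_change_of_variables_1'[OF _ der inj, of ?f] im by simp
  then have "set_integrable lborel {0<..} ?f"
    unfolding set_integrable_def by (subst (asm) integrable_completion) auto
  moreover have "set_integrable lborel {0<..} ?f \<longleftrightarrow> set_integrable lborel {0..} ?f"
    unfolding set_integrable_def
    by (rule integrable_cong_AE) (use AE_lborel_singleton[of 0] in \<open>auto simp: indicator_def elim!: eventually_mono\<close>)
  ultimately show ?thesis by simp
qed

text \<open>On the right half-plane all derivatives of exp(-w) have modulus at most 1, so the Taylor
  remainders of order one and two carry no exponential factor.\<close>

lemma cmod_exp_minus_le:
  assumes "0 \<le> Re w"
  shows "cmod (exp (- w) - 1) \<le> cmod w" "cmod (exp (- w) - 1 + w) \<le> (cmod w)\<^sup>2"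
proof -
  let ?S = "{z. Re z \<ge> 0}"
  have S: "convex ?S" by (rule convex_halfspace_Re_ge)
  have d: "((\<lambda>x. (-1)^i * exp (- x)) has_field_derivative (-1)^(Suc i) * exp (- x)) (at x within ?S)" for i and x :: complex
    by (auto intro!: derivative_eq_intros)
  have B: "cmod ((-1)^i * exp (- x)) \<le> 1" if "x \<in> ?S" for i x
    using that by (simp add: norm_mult norm_power)
  show "cmod (exp (- w) - 1) \<le> cmod w"
    using complex_Taylor[of ?S 0 "\<lambda>i x. (-1)^i * exp (- x)" 1 0 w, OF S d B] assms by simp
  show "cmod (exp (- w) - 1 + w) \<le> (cmod w)\<^sup>2"
    using complex_Taylor[of ?S 1 "\<lambda>i x. (-1)^i * exp (- x)" 1 0 w, OF S d B] assms
    by (simp add: power2_eq_square algebra_simps)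
qed

lemma powr_ray:
  assumes "0 \<le> r" "-pi < \<theta>" "\<theta> \<le> pi"
  shows "(of_real r * cis \<theta>) powr of_real \<beta> = of_real (r powr \<beta>) * cis (\<beta> * \<theta>)"
proof (cases "r = 0")
  case False
  then have "r > 0" using assms by simp
  have "Ln (of_real r * cis \<theta>) = of_real (ln r) + \<i> * of_real \<theta>"
    using Ln_times_of_real[of r "cis \<theta>"] \<open>r > 0\<close> assms by (simp add: Ln_of_real cis_conv_exp)
  then show ?thesis using \<open>r > 0\<close>
    by (simp add: powr_def ring_distribs exp_add cis_conv_exp mult_ac flip: exp_of_real)
qed simp

lemma integrable_pair_mult:
  fixes g :: "'a::euclidean_space \<Rightarrow> real" and h :: "'b::euclidean_space \<Rightarrow> real"
  assumes [measurable]: "integrable lborel g" "integrable lborel h"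
  shows "integrable (lborel \<Otimes>\<^sub>M lborel) (\<lambda>(x, y). g x * h y)"
proof (rule lborel_pair.Fubini_integrable)
  show "integrable lborel (\<lambda>x. \<integral>y. norm (case (x, y) of (x, y) \<Rightarrow> g x * h y) \<partial>lborel)"
    using assms by (simp add: abs_mult)
qed (use assms in auto)

lemma laplace_one:
  assumes "0 < Re w"
  shows "set_integrable lborel {0..} (\<lambda>s. exp (- (of_real s * w)))"
    and "(LBINT s:{0..}. exp (- (of_real s * w))) = 1 / w"
proof -
  have i0: "integrable lborel (\<lambda>s. indicator {0<..} s * (s powr (1-1) * exp (- (Re w * s))))"
    using has_bochner_integral_Gamma_scaled[of 1 "Re w"] assms by (simp add: has_bochner_integral_iff)
  have b0: "AE s in lborel. norm (indicator {0..} s *\<^sub>R exp (- (of_real s * w))) \<le> norm (indicator {0<..} s * (s powr (1-1) * exp (- (Re w * s))))"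
    using AE_lborel_singleton[of 0] by eventually_elim (auto simp: indicator_def mult.commute)
  show i: "set_integrable lborel {0..} (\<lambda>s. exp (- (of_real s * w)))"
    unfolding set_integrable_def by (rule Bochner_Integration.integrable_bound[OF i0 _ b0]) simp
  have "w \<noteq> 0" using assms by auto
  have "(LBINT s:{0..b}. exp (- (of_real s * w))) = 1/w - exp (- (of_real b * w)) / w" if "0 \<le> b" for b
  proof -
    have "(LBINT s:{0..b}. exp (- (of_real s * w))) = - exp (- (of_real b * w)) / w - (- exp (- (of_real 0 * w)) / w)"
      unfolding set_lebesgue_integral_def
      by (rule integral_FTC_Icc[OF that])
        (use \<open>w \<noteq> 0\<close> in \<open>auto intro!: derivative_eq_intros continuous_intros has_vector_derivative_real_field simp: field_simps\<close>)
    then show ?thesis by simp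
  qed
  then have "\<forall>\<^sub>F b in at_top. 1/w - exp (- (of_real b * w)) / w = (LBINT s:{0..b}. exp (- (of_real s * w)))"
    by (metis (mono_tags, lifting) eventually_at_top_linorderI)
  moreover have "((\<lambda>b. exp (- (of_real b * w))) \<longlongrightarrow> 0) at_top"
  proof (rule tendsto_norm_zero_cancel)
    have "((\<lambda>b. exp (- (b * Re w))) \<longlongrightarrow> 0) at_top" using assms by real_asymp
    then show "((\<lambda>b. norm (exp (- (of_real b * w)))) \<longlongrightarrow> 0) at_top" by simp
  qed
  then have "((\<lambda>b. 1/w - exp (- (of_real b * w)) / w) \<longlongrightarrow> 1/w - 0/w) at_top"
    using \<open>w \<noteq> 0\<close> by (intro tendsto_intros) auto
  ultimately have "((\<lambda>b. LBINT s:{0..b}. exp (- (of_real s * w))) \<longlongrightarrow> 1/w) at_top"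
    by (rule Lim_transform_eventually[rotated, THEN iffD1[OF arg_cong2[where f="\<lambda>x y. (x \<longlongrightarrow> y) at_top"], rotated -1]]) simp_all
  moreover have "((\<lambda>b. LBINT s:{0..b}. exp (- (of_real s * w))) \<longlongrightarrow> (LBINT s:{0..}. exp (- (of_real s * w)))) at_top"
    by (rule tendsto_set_lebesgue_integral_at_top) (use i in auto)
  ultimately show "(LBINT s:{0..}. exp (- (of_real s * w))) = 1 / w"
    using tendsto_unique by (metis trivial_limit_at_top_linorder)
qed

section \<open>The one-sided stable density\<close>

text \<open>The index \<beta> stands for \<alpha>/2: a time change with Laplace exponent l^\<beta>
  turns the Gaussian symbol |\<xi>|^2 into |\<xi>|^\<alpha>.\<close>

locale subordinator_index =
  fixes \<beta> :: real
  assumes \<beta>: "1/2 < \<beta>" "\<beta> < 1"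
begin

text \<open>On the ray of argument \<open>ang\<close> both \<open>e\<^sup>s\<^sup>z\<close> and \<open>exp (- z\<^sup>\<beta>)\<close> decay; \<open>\<eta>\<close> is the inverse Laplace transform of \<open>exp (- l\<^sup>\<beta>)\<close>,
  with the Bromwich contour folded onto this ray and its conjugate.\<close>

definition "ang = pi * (1 + \<beta>) / (4 * \<beta>)"
definition "\<kappa> = - cos ang"
definition "\<mu> = cos (\<beta> * ang)"
definition ray :: "real \<Rightarrow> real \<Rightarrow> complex" where
  "ray s r = exp (of_real (s * r) * cis ang - of_real (r powr \<beta>) * cis (\<beta> * ang)) * cis ang"
definition \<eta> :: "real \<Rightarrow> real" where
  "\<eta> s = Im (LBINT r:{0..}. ray s r) / pi"

text \<open>Decay of e^(sz) asks for an angle above \<pi>/2, decay of exp(-z^\<beta>) for one below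
  \<pi>/(2\<beta>). The chosen \<open>ang\<close> is the midpoint of this interval, and \<beta> >
  1/2 keeps it below \<pi>, inside the range of the principal branch.\<close>

lemma ang: "pi/2 < ang" "ang < pi" "0 < ang" "0 < \<beta> * ang" "\<beta> * ang < pi/2"
proof -
  have e: "\<beta> * ang = pi * (1 + \<beta>) / 4" using \<beta> by (simp add: ang_def field_simps)
  show "0 < \<beta> * ang" unfolding e using \<beta> by simp
  show "\<beta> * ang < pi/2" unfolding e using \<beta> by simp
  have "pi * (2 * \<beta>) < pi * (1 + \<beta>)" using \<beta> by simp
  then show a: "pi/2 < ang" unfolding ang_def using \<beta> by (simp add: field_simps)
  then show "0 < ang" using pi_gt_zero by linarith
  have "pi * (1 + \<beta>) < pi * (4 * \<beta>)" using \<beta> by simp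
  then show "ang < pi" unfolding ang_def using \<beta> by (simp add: field_simps)
qed

text \<open>Along the ray, e^(sz) decays like exp(-\<kappa> s r) and exp(-z^\<beta>) like exp(-\<mu>
  r^\<beta>); the two signs restate the two conditions on the angle.\<close>

lemma kappa_mu: "0 < \<kappa>" "0 < \<mu>"
proof -
  have "cos ang < cos (pi/2)" using ang by (subst cos_mono_less_eq) auto
  then show "0 < \<kappa>" by (simp add: \<kappa>_def)
  show "0 < \<mu>" unfolding \<mu>_def using ang by (intro cos_gt_zero_pi) auto
qed

lemma norm_ray: "cmod (ray s r) = exp (- (\<kappa> * (s * r))) * exp (- (\<mu> * r powr \<beta>))"
  by (simp add: ray_def norm_mult \<kappa>_def \<mu>_def exp_diff norm_divide exp_minus field_simps)

lemma Re_resolvent: "0 \<le> r \<Longrightarrow> Re (of_real l - of_real r * cis ang) \<ge> l"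
  using kappa_mu by (simp add: \<kappa>_def mult_nonneg_nonpos)

text \<open>Arguments on the chord stay between 0 and \<open>ang\<close>, so Re (z^\<beta>) is at
  least \<mu> |z|^\<beta>, and |z| is smallest at the midpoint. This disposes of the closing arc of
  the contour.\<close>

lemma norm_exp_minus_powr_segment:
  assumes "0 < R" "z \<in> closed_segment (of_real R) (of_real R * cis ang)"
  shows "cmod (exp (- (z powr of_real \<beta>))) \<le> exp (- (\<mu> * (R * cos (ang/2)) powr \<beta>))"
proof -
  note A = Arg_sector_segment[OF ang(3,2) assms]
  have c: "0 < cos (ang/2)" using ang by (intro cos_gt_zero_pi) auto
  have n: "R * cos (ang/2) \<le> cmod z" using norm_sector_segment[of R z ang] assms c by simp
  have "z = of_real (cmod z) * cis (Arg z)" using rcis_cmod_Arg[of z] by (simp add: rcis_def)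
  then have "z powr of_real \<beta> = of_real (cmod z powr \<beta>) * cis (\<beta> * Arg z)"
    using powr_ray[of "cmod z" "Arg z" \<beta>] A Arg_bounded[of z] by simp
  then have "Re (z powr of_real \<beta>) = cmod z powr \<beta> * cos (\<beta> * Arg z)" by simp
  moreover have "\<mu> \<le> cos (\<beta> * Arg z)" unfolding \<mu>_def
  proof -
    have "\<beta> * Arg z \<le> \<beta> * ang" using A \<beta> by (intro mult_left_mono) auto
    then show "cos (\<beta> * ang) \<le> cos (\<beta> * Arg z)" using A \<beta> ang by (intro cos_monotone_0_pi_le) auto
  qed
  moreover have "(R * cos (ang/2)) powr \<beta> \<le> cmod z powr \<beta>"
    using n \<beta> assms c by (intro powr_mono2) auto
  ultimately have "\<mu> * (R * cos (ang/2)) powr \<beta> \<le> Re (z powr of_real \<beta>)"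
    using kappa_mu(2) by (subst mult.commute) (auto intro: mult_mono)
  then show ?thesis by simp
qed

text \<open>On the positive half-line the integrand is real apart from its pole at l, and turning
  the contour past the pole leaves half a residue, whence the factor \<pi>. The rotation is
  available for functions continuous up to the boundary, so the pole is subtracted: the difference
  \<open>F\<close> has a removable singularity and is rotated, while the subtracted rational
  function is integrated along the ray by logarithms.\<close>

lemma resolvent_limit:
  assumes l: "0 < l"
  shows "((\<lambda>R. Im (integral {0..R} (\<lambda>r. exp (- (of_real (r powr \<beta>) * cis (\<beta> * ang))) * cis ang / (of_real l - of_real r * cis ang)))) \<longlongrightarrow> pi * exp (- (l powr \<beta>))) at_top"
proof -
  define b where "b = complex_of_real \<beta>"
  \<comment> \<open>The factor z + 1 is divided out again in \<open>F\<close>. It makes the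
    subtracted term of order |z|^-2 instead of |z|^-1; with the latter the chord would not vanish in
    the limit.\<close>
  define g where "g z = exp (- (z powr b)) * (z + 1)" for z :: complex
  define E where "E = exp (- (l powr \<beta>))"
  define L where "L = complex_of_real l"
  let ?D = "{z. Im z \<noteq> 0 \<or> 0 \<le> Re z}"
  have gL: "g L = of_real (E * (l + 1))"
    using l by (simp add: g_def L_def b_def E_def powr_of_real exp_of_real[symmetric])
  have gd: "\<exists>g'. (g has_field_derivative g') (at z)" if "Im z \<noteq> 0 \<or> 0 < Re z" for z
  proof -
    have "z \<notin> \<real>\<^sub>\<le>\<^sub>0" using that by (auto simp: complex_nonpos_Reals_iff)
    then show ?thesis unfolding g_def b_def by (intro exI) (auto intro!: derivative_eq_intros)
  qed
  from gd[of L] obtain g' where g': "(g has_field_derivative g') (at L)" using l by (auto simp: L_def)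
  have gcont: "continuous_on ?D g"
    unfolding g_def b_def using \<beta> by (intro continuous_intros) auto
  define h where "h z = (if z = L then - g' else (g z - g L) / (L - z))" for z
  define F where "F z = h z / (z + 1)" for z
  have hL: "isCont h L"
  proof -
    have "((\<lambda>y. - ((g y - g L) / (y - L))) \<longlongrightarrow> - g') (at L)"
      using g' unfolding has_field_derivative_iff by (rule tendsto_minus)
    then have "(h \<longlongrightarrow> - g') (at L)"
      by (rule Lim_transform_eventually) (auto simp: h_def eventually_at_filter field_simps divide_simps)
    then show ?thesis by (simp add: isCont_def h_def)
  qed
  have "continuous_on ?D h"
    unfolding continuous_on_eq_continuous_within
  proof
    fix z assume z: "z \<in> ?D"
    show "continuous (at z within ?D) h"
    proof (cases "z = L")
      case True then show ?thesis using hL continuous_at_imp_continuous_at_within by blast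
    next
      case False
      have "((\<lambda>z. (g z - g L) / (L - z)) \<longlongrightarrow> (g z - g L) / (L - z)) (at z within ?D)"
        using gcont z False by (intro tendsto_intros) (auto simp: continuous_on_def)
      then have "(h \<longlongrightarrow> (g z - g L) / (L - z)) (at z within ?D)"
        by (rule Lim_transform_within_open[where s="-{L}"]) (use False in \<open>auto simp: h_def\<close>)
      then show ?thesis using False by (simp add: continuous_within h_def)
    qed
  qed
  then have Fcont: "continuous_on ?D F"
    unfolding F_def by (intro continuous_intros) (auto simp: complex_eq_iff)
  have Fdiff: "F field_differentiable at z" if "Im z \<noteq> 0" for z
  proof -
    have zL: "z \<noteq> L" "z + 1 \<noteq> 0" using that by (auto simp: L_def complex_eq_iff)
    have "\<exists>d. (g has_field_derivative d) (at z)" using gd[of z] that by simp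
    then obtain d where "(g has_field_derivative d) (at z)" ..
    then have "(\<lambda>z. (g z - g L) / (L - z) / (z + 1)) field_differentiable at z"
      unfolding field_differentiable_def using zL by (intro exI) (rule derivative_eq_intros refl | simp)+
    then show ?thesis
      by (rule field_differentiable_transform_within[where d="cmod (z - L)", rotated 3])
         (use \<open>z \<noteq> L\<close> in \<open>auto simp: F_def h_def dist_norm norm_minus_commute\<close>)
  qed
  define c where "c = cos (ang/2)"
  have c: "0 < c" using ang unfolding c_def by (intro cos_gt_zero_pi) auto
  define B where "B R = exp (- (\<mu> * (R * c) powr \<beta>)) * 2 / (c * R) + 4 * E * (l + 1) / (c * R)\<^sup>2" for R
  have Feq: "F z = exp (- (z powr b)) / (L - z) - of_real (E * (l + 1)) / ((z + 1) * (L - z))"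
    if "z \<noteq> L" "z + 1 \<noteq> 0" for z
  proof -
    have "F z = (exp (- (z powr b)) * (z + 1) - of_real (E * (l + 1))) / ((L - z) * (z + 1))"
      using that by (simp add: F_def h_def gL) (simp add: g_def)
    also have "\<dots> = exp (- (z powr b)) / (L - z) - of_real (E * (l + 1)) / ((z + 1) * (L - z))"
      using that by (simp add: diff_divide_distrib mult.commute)
    finally show ?thesis .
  qed
  have rot: "((\<lambda>R. integral {0..R} (\<lambda>r. F (of_real r * cis ang) * cis ang) - integral {0..R} (\<lambda>r. F (of_real r))) \<longlongrightarrow> 0) at_top"
  proof (rule ray_rotation[OF ang(3,2) Fcont Fdiff])
    show "\<forall>\<^sub>F R in at_top. \<forall>z\<in>closed_segment (of_real R) (of_real R * cis ang). norm (F z) \<le> B R"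
      using eventually_ge_at_top[of "(2 * l + 2) / c"]
    proof eventually_elim
      case (elim R)
      then have cR: "2 * l + 2 \<le> c * R" using c by (simp add: field_simps)
      then have R: "0 < R" using c l by (smt (verit) zero_less_mult_pos)
      show ?case
      proof
        fix z assume z: "z \<in> closed_segment (of_real R) (of_real R * cis ang)"
        have n: "c * R \<le> cmod z" using norm_sector_segment[of R z ang] R z c by (simp add: c_def mult.commute)
        have n1: "c * R / 2 \<le> cmod (L - z)" using norm_triangle_ineq2[of z L] n cR l
          by (simp add: L_def norm_minus_commute)
        have n2: "c * R / 2 \<le> cmod (z + 1)" using norm_triangle_ineq2[of z "-1"] n cR l by simp
        have pos: "0 < c * R" using c R by simp
        have "z \<noteq> L" "z + 1 \<noteq> 0" using n1 n2 pos by auto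
        then have "cmod (F z) \<le> cmod (exp (- (z powr b))) / cmod (L - z) + E * (l + 1) / (cmod (z + 1) * cmod (L - z))"
          using l by (simp add: Feq order_trans[OF norm_triangle_ineq4] norm_divide norm_mult E_def)
        also have "\<dots> \<le> exp (- (\<mu> * (R * c) powr \<beta>)) / (c * R / 2) + E * (l + 1) / ((c * R / 2) * (c * R / 2))"
          using n1 n2 pos l norm_exp_minus_powr_segment[OF R z] unfolding c_def[symmetric] b_def
          by (intro add_mono frac_le mult_mono) (auto simp: E_def)
        also have "\<dots> = B R" by (simp add: B_def power2_eq_square)
        finally show "norm (F z) \<le> B R" .
      qed
    qed
    show "((\<lambda>R. R * B R) \<longlongrightarrow> 0) at_top"
      unfolding B_def power2_eq_square using c kappa_mu \<beta> l by (real_asymp simp: E_def)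
  qed
  \<comment> \<open>Partial fractions of the subtracted term: (l+1) / ((z+1)(l-z)) = 1/(z+1) +
    1/(l-z), multiplied by dz/dr = cis ang.\<close>
  define Q where "Q r = cis ang / (of_real r * cis ang + 1) + cis ang / (L - of_real r * cis ang)" for r
  let ?I = "\<lambda>r. exp (- (of_real (r powr \<beta>) * cis (\<beta> * ang))) * cis ang / (L - of_real r * cis ang)"
  have sang: "0 < sin ang" using ang by (intro sin_gt_zero) auto
  have nz: "of_real r * cis ang \<noteq> L" "of_real r * cis ang + 1 \<noteq> 0" if "0 \<le> r" for r
    using that sang l by (auto simp: L_def complex_eq_iff)
  have Fray: "F (of_real r * cis ang) * cis ang = ?I r - of_real E * Q r" if "0 \<le> r" for r
  proof -
    let ?X = "of_real r * cis ang + 1" and ?Y = "L - of_real r * cis ang"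
    have "?X \<noteq> 0" "?Y \<noteq> 0" using nz[OF that] by auto
    then have "1 / ?X + 1 / ?Y = (?X + ?Y) / (?X * ?Y)" by (simp add: divide_simps)
    also have "?X + ?Y = of_real (l + 1)" by (simp add: L_def)
    finally have pf: "of_real (l + 1) / (?X * ?Y) = 1 / ?X + 1 / ?Y" ..
    have "of_real (E * (l + 1)) / (?X * ?Y) * cis ang = of_real E * (of_real (l + 1) / (?X * ?Y)) * cis ang"
      by simp
    also have "\<dots> = of_real E * Q r"
      unfolding pf Q_def by (simp only: distrib_right distrib_left mult_1 times_divide_eq_left times_divide_eq_right mult.assoc)
    finally have "of_real (E * (l + 1)) / (?X * ?Y) * cis ang = of_real E * Q r" .
    then show ?thesis
      unfolding Feq[OF nz[OF that]] b_def using powr_ray[of r ang \<beta>] ang that by (simp add: left_diff_distrib)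
  qed
  have contI: "continuous_on {0..R} ?I" for R
  proof -
    have p: "continuous_on {0..R} (\<lambda>r. r powr \<beta>)" using \<beta> by (intro continuous_on_powr') (auto intro!: continuous_intros)
    show ?thesis
      by (intro continuous_on_divide continuous_on_mult continuous_on_exp continuous_on_minus continuous_on_of_real p
            continuous_on_diff continuous_on_const continuous_on_id) (use nz in \<open>auto simp: eq_commute[of L]\<close>)
  qed
  have Qint: "(Q has_integral (Ln (of_real R * cis ang + 1) - Ln (L - of_real R * cis ang)) - (Ln (of_real 0 * cis ang + 1) - Ln (L - of_real 0 * cis ang))) {0..R}" if "0 \<le> R" for R
  proof (rule fundamental_theorem_of_calculus[OF that])
    fix r assume r: "r \<in> {0..R}"
    have "of_real r * cis ang + 1 \<notin> \<real>\<^sub>\<le>\<^sub>0" "L - of_real r * cis ang \<notin> \<real>\<^sub>\<le>\<^sub>0"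
      using r sang l by (auto simp: complex_nonpos_Reals_iff L_def)
    then have "((\<lambda>z. Ln (z * cis ang + 1) - Ln (L - z * cis ang)) has_field_derivative Q r) (at (of_real r))"
      unfolding Q_def using nz r by (auto intro!: derivative_eq_intros simp: field_simps)
    then show "((\<lambda>r. Ln (of_real r * cis ang + 1) - Ln (L - of_real r * cis ang)) has_vector_derivative Q r) (at r within {0..R})"
      by (rule has_vector_derivative_real_field)
  qed
  \<comment> \<open>The terms ln R of the two logarithms cancel. What remains are the logarithms of
    cis ang and of -cis ang, with imaginary parts ang and ang - \<pi>; their difference is the \<pi>
    of the conclusion.\<close>
  have limQ: "((\<lambda>R. Im (integral {0..R} Q)) \<longlongrightarrow> pi) at_top"
  proof (rule Lim_transform_eventually)
    have e1: "cis ang + 0 \<notin> \<real>\<^sub>\<le>\<^sub>0" "0 - cis ang \<notin> \<real>\<^sub>\<le>\<^sub>0" using sang by (auto simp: complex_nonpos_Reals_iff)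
    have t: "((\<lambda>R. complex_of_real (k / R)) \<longlongrightarrow> of_real 0) at_top" for k
      by (intro tendsto_of_real) real_asymp
    have "((\<lambda>R. Im (Ln (cis ang + of_real (1/R)) - Ln (of_real (l/R) - cis ang))) \<longlongrightarrow> Im (Ln (cis ang + 0) - Ln (0 - cis ang))) at_top"
      using t[of 1] t[of l] e1 by (intro tendsto_intros) auto
    moreover have "Ln (cis ang) = \<i> * ang" using ang by (simp add: cis_conv_exp)
    moreover have "Ln (- cis ang) = \<i> * (ang - pi)"
    proof -
      have "- cis ang = cis (ang - pi)" by (simp add: complex_eq_iff)
      then show ?thesis using ang by (simp add: cis_conv_exp)
    qed
    ultimately show "((\<lambda>R. Im (Ln (cis ang + of_real (1/R)) - Ln (of_real (l/R) - cis ang))) \<longlongrightarrow> pi) at_top"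
      by simp
    show "\<forall>\<^sub>F R in at_top. Im (Ln (cis ang + of_real (1/R)) - Ln (of_real (l/R) - cis ang)) = Im (integral {0..R} Q)"
      using eventually_gt_at_top[of 0]
    proof eventually_elim
      case (elim R)
      have "of_real R * cis ang + 1 = of_real R * (cis ang + of_real (1/R))" "L - of_real R * cis ang = of_real R * (of_real (l/R) - cis ang)"
        using elim by (auto simp: L_def field_simps)
      moreover have "cis ang + of_real (1/R) \<noteq> 0" "of_real (l/R) - cis ang \<noteq> 0" using sang by (auto simp: complex_eq_iff)
      ultimately have "Ln (of_real R * cis ang + 1) = of_real (ln R) + Ln (cis ang + of_real (1/R))"
         "Ln (L - of_real R * cis ang) = of_real (ln R) + Ln (of_real (l/R) - cis ang)"
        using Ln_times_of_real elim Ln_of_real by metis+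
      then show ?case using Qint[of R] elim l by (simp add: integral_unique L_def Ln_of_real)
    qed
  qed
  have "((\<lambda>R. Im (integral {0..R} (\<lambda>r. F (of_real r * cis ang) * cis ang) - integral {0..R} (\<lambda>r. F (of_real r))) + E * Im (integral {0..R} Q)) \<longlongrightarrow> Im 0 + E * pi) at_top"
    by (intro tendsto_intros rot limQ)
  moreover have "\<forall>\<^sub>F R in at_top. Im (integral {0..R} (\<lambda>r. F (of_real r * cis ang) * cis ang) - integral {0..R} (\<lambda>r. F (of_real r))) + E * Im (integral {0..R} Q) = Im (integral {0..R} ?I)"
    using eventually_gt_at_top[of 0]
  proof eventually_elim
    case (elim R)
    \<comment> \<open>The half-line contributes nothing to the imaginary part. The point r = l,
      where \<open>h\<close> takes the value -g', is discarded as negligible.\<close>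
    have "F (of_real r) \<in> \<real>" if "0 \<le> r" "r \<noteq> l" for r
    proof -
      have "g (of_real r) \<in> \<real>" using that by (simp add: g_def b_def powr_of_real exp_in_Reals)
      then show ?thesis using that by (auto simp: F_def h_def gL) (auto simp: L_def intro!: Reals_divide Reals_diff Reals_add)
    qed
    then have re: "integral {0..R} (Im \<circ> (\<lambda>r. F (of_real r))) = integral {0..R} (\<lambda>r. 0)"
      by (intro integral_spike[of "{l}"]) (auto simp: complex_is_Real_iff)
    have "(\<lambda>r. F (of_real r)) integrable_on {0..R}"
      by (intro integrable_continuous_interval continuous_on_compose2[OF Fcont]) (auto intro!: continuous_intros)
    from integral_linear[OF this bounded_linear_Im] re have z: "Im (integral {0..R} (\<lambda>r. F (of_real r))) = 0" by simp
    have "integral {0..R} (\<lambda>r. F (of_real r * cis ang) * cis ang) = integral {0..R} (\<lambda>r. ?I r - of_real E * Q r)"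
      by (rule integral_cong) (use Fray in auto)
    also have "\<dots> = integral {0..R} ?I - integral {0..R} (\<lambda>r. of_real E * Q r)"
    proof -
      have "Q integrable_on {0..R}" using Qint[of R] elim unfolding integrable_on_def by auto
      then show ?thesis
        by (rule integral_diff[OF integrable_continuous_interval[OF contI] integrable_on_mult_right])
    qed
    also have "integral {0..R} (\<lambda>r. of_real E * Q r) = of_real E * integral {0..R} Q" by simp
    finally show ?case using z by simp
  qed
  ultimately have "((\<lambda>R. Im (integral {0..R} ?I)) \<longlongrightarrow> Im 0 + E * pi) at_top"
    by (rule Lim_transform_eventually)
  then show ?thesis by (simp add: E_def L_def mult.commute)
qed

end

section \<open>The one-sided stable density: bound, Laplace transform and tail\<close>

context subordinator_index
begin

lemma ray_measurable [measurable]: "(\<lambda>(s, r). ray s r) \<in> borel_measurable (borel \<Otimes>\<^sub>M borel)"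
  unfolding ray_def by measurable

lemma decay_integrable: "set_integrable lborel {0..} (\<lambda>r. exp (- (\<mu> * r powr \<beta>)))"
  using set_integrable_exp_minus_powr kappa_mu \<beta> by simp

lemma ray_integrable:
  assumes "0 \<le> s"
  shows "set_integrable lborel {0..} (ray s)"
proof -
  have [measurable]: "ray s \<in> borel_measurable borel"
    using measurable_Pair2[OF ray_measurable, of s] by simp
  have "AE r in lborel. norm (indicator {0..} r *\<^sub>R ray s r) \<le> norm (indicator {0..} r *\<^sub>R exp (- (\<mu> * r powr \<beta>)))"
    using assms kappa_mu by (intro AE_I2) (auto simp: norm_ray indicator_def mult_le_cancel_right1)
  then show ?thesis
    unfolding set_integrable_def
    by (rule Bochner_Integration.integrable_bound[OF decay_integrable[unfolded set_integrable_def], rotated]) simp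
qed

lemma eta_measurable [measurable]: "\<eta> \<in> borel_measurable borel"
  unfolding \<eta>_def set_lebesgue_integral_def by measurable

definition "\<eta>_sup = (LBINT r:{0..}. exp (- (\<mu> * r powr \<beta>))) / pi"

text \<open>Dropping the decay of e^(sz) leaves a bound uniform in s. It serves small s, where the
  tail expansion below is useless.\<close>

lemma eta_bounded:
  assumes "0 \<le> s"
  shows "\<bar>\<eta> s\<bar> \<le> \<eta>_sup"
proof -
  have "\<bar>Im (LBINT r:{0..}. ray s r)\<bar> \<le> norm (LBINT r:{0..}. ray s r)" by (rule abs_Im_le_cmod)
  also have "\<dots> \<le> (LBINT r:{0..}. exp (- (\<mu> * r powr \<beta>)))"
    unfolding set_lebesgue_integral_def
    by (rule Bochner_Integration.integral_norm_bound_integral[OF ray_integrable[OF assms, unfolded set_integrable_def] decay_integrable[unfolded set_integrable_def]])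
      (use assms kappa_mu in \<open>auto simp: norm_ray indicator_def mult_le_cancel_right1\<close>)
  finally show ?thesis by (simp add: \<eta>_def \<eta>_sup_def divide_right_mono)
qed

lemma resolvent_integral:
  assumes l: "0 < l"
  shows "Im (LBINT r:{0..}. exp (- (of_real (r powr \<beta>) * cis (\<beta> * ang))) * cis ang / (of_real l - of_real r * cis ang)) = pi * exp (- (l powr \<beta>))"
proof -
  let ?I = "\<lambda>r. exp (- (of_real (r powr \<beta>) * cis (\<beta> * ang))) * cis ang / (of_real l - of_real r * cis ang)"
  have "norm (?I r) \<le> 1 / l * exp (- (\<mu> * r powr \<beta>))" if "0 \<le> r" for r
  proof -
    have "l \<le> cmod (of_real l - of_real r * cis ang)" using Re_resolvent[OF that, of l] complex_Re_le_cmod order_trans by blast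
    then have "exp (- (\<mu> * r powr \<beta>)) / cmod (of_real l - of_real r * cis ang) \<le> exp (- (\<mu> * r powr \<beta>)) / l"
      using l by (intro divide_left_mono mult_pos_pos) auto
    then show ?thesis by (simp add: norm_mult norm_divide \<mu>_def mult.commute)
  qed
  then have b: "AE r in lborel. norm (indicator {0..} r *\<^sub>R ?I r) \<le> norm (1/l * (indicator {0..} r *\<^sub>R exp (- (\<mu> * r powr \<beta>))))"
    using l by (intro AE_I2) (auto simp: indicator_def)
  have si: "set_integrable lborel {0..} ?I"
    unfolding set_integrable_def
    by (rule Bochner_Integration.integrable_bound[OF integrable_mult_right[OF decay_integrable[unfolded set_integrable_def]] _ b]) simp
  have eq: "(LBINT r:{0..R}. ?I r) = integral {0..R} ?I" for R
    by (rule set_borel_integral_eq_integral(2)[OF set_integrable_subset[OF si]]) auto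
  have "((\<lambda>R. Im (LBINT r:{0..R}. ?I r)) \<longlongrightarrow> Im (LBINT r:{0..}. ?I r)) at_top"
    by (intro tendsto_Im tendsto_set_lebesgue_integral_at_top si) auto
  then show ?thesis
    unfolding eq by (rule tendsto_unique[OF trivial_limit_at_top_linorder _ resolvent_limit[OF l]])
qed

text \<open>Integrating over s first turns e^(sz) e^(-sl) into the resolvent 1/(l-z), which reduces
  the Laplace transform to \<open>resolvent_integral\<close>. Fubini applies since Re z \<le> 0 on
  the ray: the double integrand is dominated by exp(-sl) exp(-\<mu> r^\<beta>).\<close>

lemma laplace_eta:
  assumes l: "0 < l"
  shows "set_integrable lborel {0..} (\<lambda>s. \<eta> s * exp (- (s * l)))"
    and "(LBINT s:{0..}. \<eta> s * exp (- (s * l))) = exp (- (l powr \<beta>))"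
proof -
  have expi: "integrable lborel (\<lambda>s. indicator {0..} s * exp (- (s * l)))"
  proof -
    have "set_integrable lborel {0..} (\<lambda>s. Re (exp (- (of_real s * of_real l))))"
      using integrable_Re[OF laplace_one(1)[of "of_real l", unfolded set_integrable_def]] l
      by (simp add: set_integrable_def)
    then show ?thesis by (simp add: set_integrable_def Re_exp)
  qed
  have b: "AE s in lborel. norm (indicator {0..} s *\<^sub>R (\<eta> s * exp (- (s * l)))) \<le> norm (\<eta>_sup * (indicator {0..} s * exp (- (s * l))))"
    using eta_bounded eta_bounded[of 0] by (intro AE_I2) (auto simp: indicator_def abs_mult intro!: mult_right_mono order_trans[OF _ abs_ge_self])
  show "set_integrable lborel {0..} (\<lambda>s. \<eta> s * exp (- (s * l)))"
    unfolding set_integrable_def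
    by (rule Bochner_Integration.integrable_bound[OF integrable_mult_right[OF expi] _ b]) simp
  define f where "f = (\<lambda>s r. (indicator {0..} s * indicator {0..} r) *\<^sub>R (exp (- (of_real (s * l))) * ray s r))"
  have [measurable]: "case_prod f \<in> borel_measurable (borel \<Otimes>\<^sub>M borel)" unfolding f_def by measurable
  have fb: "norm (f s r) \<le> (indicator {0..} s * exp (- (s * l))) * (indicator {0..} r * exp (- (\<mu> * r powr \<beta>)))" for s r
    using kappa_mu by (auto simp: f_def indicator_def norm_mult norm_ray mult_le_cancel_right1)
  have fint: "integrable (lborel \<Otimes>\<^sub>M lborel) (case_prod f)"
    by (rule Bochner_Integration.integrable_bound[OF integrable_pair_mult[OF expi decay_integrable[unfolded set_integrable_def]]])
      (use fb in \<open>auto intro!: AE_I2 order_trans[OF fb] abs_ge_self\<close>)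
  have inner1: "(\<integral>r. f s r \<partial>lborel) = indicator {0..} s *\<^sub>R (exp (- (of_real (s * l))) * (LBINT r:{0..}. ray s r))" for s
    by (simp add: f_def set_lebesgue_integral_def mult.assoc flip: scaleR_scaleR mult_scaleR_right)
  have inner2: "(\<integral>s. f s r \<partial>lborel) = indicator {0..} r *\<^sub>R (exp (- (of_real (r powr \<beta>) * cis (\<beta> * ang))) * cis ang / (of_real l - of_real r * cis ang))" for r
  proof (cases "0 \<le> r")
    case True
    let ?w = "of_real l - of_real r * cis ang"
    have "0 < Re ?w" using Re_resolvent[OF True, of l] l by linarith
    note L = laplace_one(2)[OF this]
    have "f s r = (indicator {0..} s *\<^sub>R exp (- (of_real s * ?w))) * (exp (- (of_real (r powr \<beta>) * cis (\<beta> * ang))) * cis ang)" for s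
    proof -
      have "exp (- of_real (s * l)) * exp (of_real (s * r) * cis ang - of_real (r powr \<beta>) * cis (\<beta> * ang))
        = exp (- (of_real s * ?w)) * exp (- (of_real (r powr \<beta>) * cis (\<beta> * ang)))"
        unfolding exp_add[symmetric] by (rule arg_cong[where f=exp]) (simp add: algebra_simps)
      then show ?thesis using True by (simp add: f_def ray_def mult.assoc[symmetric])
    qed
    then have "(\<integral>s. f s r \<partial>lborel) = (\<integral>s. (indicator {0..} s *\<^sub>R exp (- (of_real s * ?w))) * (exp (- (of_real (r powr \<beta>) * cis (\<beta> * ang))) * cis ang) \<partial>lborel)"
      by (simp only:)
    also have "\<dots> = (LBINT s:{0..}. exp (- (of_real s * ?w))) * (exp (- (of_real (r powr \<beta>) * cis (\<beta> * ang))) * cis ang)"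
      unfolding set_lebesgue_integral_def by (rule integral_mult_left_zero)
    finally have "(\<integral>s. f s r \<partial>lborel) = (LBINT s:{0..}. exp (- (of_real s * ?w))) * (exp (- (of_real (r powr \<beta>) * cis (\<beta> * ang))) * cis ang)" .
    then show ?thesis using True unfolding L by simp
  qed (simp add: f_def)
  have "(\<integral>s. \<integral>r. f s r \<partial>lborel \<partial>lborel) = (\<integral>r. \<integral>s. f s r \<partial>lborel \<partial>lborel)"
    by (rule lborel_pair.Fubini_integral[symmetric, OF fint])
  also have "Im \<dots> = pi * exp (- (l powr \<beta>))"
    unfolding inner2 using resolvent_integral[OF l] by (simp add: set_lebesgue_integral_def)
  finally have "Im (\<integral>s. \<integral>r. f s r \<partial>lborel \<partial>lborel) = pi * exp (- (l powr \<beta>))" .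
  moreover have "integrable lborel (\<lambda>s. \<integral>r. f s r \<partial>lborel)"
    using lborel_pair.integrable_fst'[OF fint] by simp
  then have "Im (\<integral>s. \<integral>r. f s r \<partial>lborel \<partial>lborel) = (\<integral>s. Im (\<integral>r. f s r \<partial>lborel) \<partial>lborel)"
    by (rule integral_Im[symmetric])
  moreover have "Im (\<integral>r. f s r \<partial>lborel) = pi * (indicator {0..} s *\<^sub>R (\<eta> s * exp (- (s * l))))" for s
    unfolding inner1 \<eta>_def by (simp add: exp_of_real flip: of_real_minus of_real_mult)
  ultimately show "(LBINT s:{0..}. \<eta> s * exp (- (s * l))) = exp (- (l powr \<beta>))"
    by (simp add: set_lebesgue_integral_def)
qed

text \<open>This is Euler's integral of z^\<beta> e^(-sz), turned from the half-line to a ray inside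
  the right half-plane. It evaluates the leading coefficient of the tail of
  \<open>\<eta>\<close>.\<close>

lemma ray_Gamma:
  assumes s: "0 < s" and \<phi>: "0 < \<phi>" "\<phi> < pi/2"
  shows "(LBINT r:{0..}. of_real (r powr \<beta>) * exp (- (of_real (s * r) * cis \<phi>))) * cis ((\<beta> + 1) * \<phi>) = of_real (Gamma (\<beta> + 1) / s powr (\<beta> + 1))"
proof -
  define F where "F z = z powr of_real \<beta> * exp (- (of_real s * z))" for z :: complex
  have cphi: "0 < cos \<phi>" using \<phi> by (intro cos_gt_zero_pi) auto
  have Fcont: "continuous_on {z. Im z \<noteq> 0 \<or> 0 \<le> Re z} F"
    unfolding F_def using \<beta> by (intro continuous_intros) auto
  have Fdiff: "F field_differentiable at z" if "Im z \<noteq> 0" for z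
  proof -
    have "z \<notin> \<real>\<^sub>\<le>\<^sub>0" using that by (auto simp: complex_nonpos_Reals_iff)
    then show ?thesis unfolding F_def field_differentiable_def by (intro exI) (auto intro!: derivative_eq_intros)
  qed
  have rot: "((\<lambda>R. integral {0..R} (\<lambda>r. F (of_real r * cis \<phi>) * cis \<phi>) - integral {0..R} (\<lambda>r. F (of_real r))) \<longlongrightarrow> 0) at_top"
  proof (rule ray_rotation[OF \<phi>(1) _ Fcont Fdiff])
    show "\<phi> < pi" using \<phi> by simp
    show "\<forall>\<^sub>F R in at_top. \<forall>z\<in>closed_segment (of_real R) (of_real R * cis \<phi>). norm (F z) \<le> R powr \<beta> * exp (- (s * (R * cos \<phi>)))"
      using eventually_gt_at_top[of 0]
    proof eventually_elim
      case (elim R)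
      show ?case
      proof
        fix z :: complex assume z: "z \<in> closed_segment (of_real R) (of_real R * cis \<phi>)"
        then obtain u where u: "0 \<le> u" "u \<le> 1" "z = (1-u) *\<^sub>R of_real R + u *\<^sub>R (of_real R * cis \<phi>)"
          by (auto simp: closed_segment_def)
        have "cmod z \<le> (1-u) * R + u * R"
          unfolding u(3) using u elim by (intro order_trans[OF norm_triangle_ineq]) (simp add: norm_mult)
        then have n: "cmod z \<le> R" by (simp add: algebra_simps)
        have "(1-u) * (R * cos \<phi>) \<le> (1-u) * R" using u elim by (intro mult_left_mono) auto
        then have "R * cos \<phi> \<le> Re z" unfolding u(3) by (simp add: algebra_simps)
        then have "exp (- (s * Re z)) \<le> exp (- (s * (R * cos \<phi>)))" using s by simp
        moreover have "cmod z powr \<beta> \<le> R powr \<beta>" using n \<beta> by (intro powr_mono2) auto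
        ultimately show "norm (F z) \<le> R powr \<beta> * exp (- (s * (R * cos \<phi>)))"
          by (simp add: F_def norm_mult norm_powr_real_powr' mult_mono)
      qed
    qed
    show "((\<lambda>R. R * (R powr \<beta> * exp (- (s * (R * cos \<phi>))))) \<longlongrightarrow> 0) at_top"
      using s cphi \<beta> by real_asymp
  qed
  let ?f = "\<lambda>r. of_real (r powr \<beta>) * exp (- (of_real (s * r) * cis \<phi>))"
  have G: "has_bochner_integral lborel (\<lambda>r. indicator {0..} r * (r powr \<beta> * exp (- (a * r)))) (Gamma (\<beta> + 1) / a powr (\<beta> + 1))" if "0 < a" for a
    using has_bochner_integral_Gamma_scaled'[of "\<beta> + 1" a] \<beta> that by simp
  have b: "AE r in lborel. norm (indicator {0..} r *\<^sub>R ?f r) \<le> norm (indicator {0..} r * (r powr \<beta> * exp (- (s * cos \<phi> * r))))"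
    by (intro AE_I2) (auto simp: indicator_def norm_mult mult_ac)
  have fi: "set_integrable lborel {0..} ?f"
    unfolding set_integrable_def
    by (rule Bochner_Integration.integrable_bound[OF integrable.intros[OF G] _ b]) (use s cphi in auto)
  have hb: "has_bochner_integral lborel (\<lambda>r. complex_of_real (indicator {0..} r * (r powr \<beta> * exp (- (s * r))))) (of_real (Gamma (\<beta> + 1) / s powr (\<beta> + 1)))"
    by (rule has_bochner_integral_of_real[OF G[OF s]])
  have Gi: "set_integrable lborel {0..} (\<lambda>r. complex_of_real (r powr \<beta> * exp (- (s * r))))"
    using integrable.intros[OF hb]
    by (simp add: set_integrable_def scaleR_conv_of_real)
  have Gv: "(LBINT r:{0..}. complex_of_real (r powr \<beta> * exp (- (s * r)))) = of_real (Gamma (\<beta> + 1) / s powr (\<beta> + 1))"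
    using has_bochner_integral_integral_eq[OF hb]
    by (simp add: set_lebesgue_integral_def scaleR_conv_of_real)
  have "((\<lambda>R. LBINT r:{0..R}. ?f r) \<longlongrightarrow> (LBINT r:{0..}. ?f r)) at_top"
    by (intro tendsto_set_lebesgue_integral_at_top fi) auto
  moreover have "(LBINT r:{0..R}. ?f r) = integral {0..R} ?f" for R
    by (rule set_borel_integral_eq_integral(2)[OF set_integrable_subset[OF fi]]) auto
  ultimately have l1: "((\<lambda>R. integral {0..R} ?f) \<longlongrightarrow> (LBINT r:{0..}. ?f r)) at_top" by simp
  have "((\<lambda>R. LBINT r:{0..R}. complex_of_real (r powr \<beta> * exp (- (s * r)))) \<longlongrightarrow> (LBINT r:{0..}. complex_of_real (r powr \<beta> * exp (- (s * r))))) at_top"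
    by (intro tendsto_set_lebesgue_integral_at_top Gi) auto
  moreover have "(LBINT r:{0..R}. complex_of_real (r powr \<beta> * exp (- (s * r)))) = integral {0..R} (\<lambda>r. F (of_real r))" for R
  proof -
    have "(LBINT r:{0..R}. complex_of_real (r powr \<beta> * exp (- (s * r)))) = integral {0..R} (\<lambda>r. complex_of_real (r powr \<beta> * exp (- (s * r))))"
      by (rule set_borel_integral_eq_integral(2)[OF set_integrable_subset[OF Gi]]) auto
    also have "\<dots> = integral {0..R} (\<lambda>r. F (of_real r))"
      by (rule integral_cong) (simp add: F_def powr_of_real exp_of_real flip: of_real_mult of_real_minus)
    finally show ?thesis .
  qed
  ultimately have l2: "((\<lambda>R. integral {0..R} (\<lambda>r. F (of_real r))) \<longlongrightarrow> of_real (Gamma (\<beta> + 1) / s powr (\<beta> + 1))) at_top"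
    unfolding Gv by simp
  have "integral {0..R} (\<lambda>r. F (of_real r * cis \<phi>) * cis \<phi>) = integral {0..R} ?f * cis ((\<beta> + 1) * \<phi>)" for R
  proof -
    have "F (of_real r * cis \<phi>) * cis \<phi> = ?f r * cis ((\<beta> + 1) * \<phi>)" if "0 \<le> r" for r
    proof -
      have "cis ((\<beta> + 1) * \<phi>) = cis (\<beta> * \<phi>) * cis \<phi>" by (simp add: cis_mult algebra_simps)
      then show ?thesis using powr_ray[of r \<phi> \<beta>] that \<phi> by (simp add: F_def mult_ac)
    qed
    then have "integral {0..R} (\<lambda>r. F (of_real r * cis \<phi>) * cis \<phi>) = integral {0..R} (\<lambda>r. ?f r * cis ((\<beta> + 1) * \<phi>))"
      by (intro integral_cong) auto
    then show ?thesis by simp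
  qed
  then have "((\<lambda>R. (integral {0..R} ?f * cis ((\<beta> + 1) * \<phi>) - integral {0..R} (\<lambda>r. F (of_real r))) + integral {0..R} (\<lambda>r. F (of_real r))) \<longlongrightarrow> 0 + of_real (Gamma (\<beta> + 1) / s powr (\<beta> + 1))) at_top"
    using rot l2 by (intro tendsto_add) simp_all
  moreover have "((\<lambda>R. integral {0..R} ?f * cis ((\<beta> + 1) * \<phi>)) \<longlongrightarrow> (LBINT r:{0..}. ?f r) * cis ((\<beta> + 1) * \<phi>)) at_top"
    by (intro tendsto_intros l1)
  ultimately show ?thesis
    using tendsto_unique[OF trivial_limit_at_top_linorder, of "\<lambda>R. integral {0..R} ?f * cis ((\<beta> + 1) * \<phi>)"] by simp
qed

text \<open>By the reflection formula this equals \<beta> / Gamma(1-\<beta>), the classical tail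
  coefficient of the one-sided stable density.\<close>

definition "\<eta>_lead = Gamma (\<beta> + 1) * sin (pi * \<beta>) / pi"
definition "\<eta>_C1 = Gamma (\<beta> + 1) / \<kappa> powr (\<beta> + 1) / pi"
definition "\<eta>_C2 = Gamma (2 * \<beta> + 1) / \<kappa> powr (2 * \<beta> + 1) / pi"

text \<open>Only the factor exp(-z^\<beta>) is expanded, as 1 - z^\<beta> + O(|z|^(2\<beta>)), and
  e^(sz) is kept. Each power of r then integrates against exp(-\<kappa> s r) to a power of 1/s.
  Since Re (z^\<beta>) \<ge> 0 on the ray, the remainders need no restriction on s.\<close>

lemma eta_expansion:
  assumes s: "0 < s"
  shows "\<bar>\<eta> s\<bar> \<le> \<eta>_C1 * s powr (- \<beta> - 1)"
    and "\<bar>\<eta> s - \<eta>_lead * s powr (- \<beta> - 1)\<bar> \<le> \<eta>_C2 * s powr (- 2 * \<beta> - 1)"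
proof -
  define k where "k r = exp (- (of_real r * (of_real s * (- cis ang)))) * cis ang" for r
  define w where "w r = of_real (r powr \<beta>) * cis (\<beta> * ang)" for r
  have nk: "cmod (k r) = exp (- (s * \<kappa> * r))" for r by (simp add: k_def norm_mult \<kappa>_def)
  have rw: "0 \<le> Re (w r)" for r using kappa_mu by (simp add: w_def \<mu>_def)
  have nw: "cmod (w r) = r powr \<beta>" for r by (simp add: w_def norm_mult)
  have sk: "0 < s * \<kappa>" using s kappa_mu by simp
  have [measurable]: "k \<in> borel_measurable borel" "w \<in> borel_measurable borel" unfolding k_def w_def by measurable
  have ray: "ray s r = k r * exp (- w r)" for r
    by (simp add: ray_def k_def w_def exp_diff exp_minus mult_ac divide_inverse)
  have L: "0 < Re (of_real s * (- cis ang))" using sk by (simp add: \<kappa>_def)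
  \<comment> \<open>The term of order zero integrates to -1/s. Being real, it drops out of
    \<open>\<eta>\<close>, so the tail starts at s^(-\<beta>-1).\<close>
  have ki: "set_integrable lborel {0..} k" "(LBINT r:{0..}. k r) = of_real (- 1 / s)"
  proof -
    show "set_integrable lborel {0..} k" unfolding k_def by (intro set_integrable_mult_left) (rule laplace_one(1)[OF L])
    have "(LBINT r:{0..}. k r) = 1 / (of_real s * (- cis ang)) * cis ang"
      unfolding k_def set_integral_mult_left laplace_one(2)[OF L] ..
    then show "(LBINT r:{0..}. k r) = of_real (- 1 / s)" using s by simp
  qed
  have G: "has_bochner_integral lborel (\<lambda>r. indicator {0..} r * (r powr b * exp (- (s * \<kappa> * r)))) (Gamma (b + 1) / (s * \<kappa>) powr (b + 1))" if "0 < b" for b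
    using has_bochner_integral_Gamma_scaled'[of "b + 1" "s * \<kappa>"] sk that by simp
  have bnd: "\<bar>Im (LBINT r:{0..}. h r)\<bar> \<le> Gamma (b + 1) / (s * \<kappa>) powr (b + 1)"
    if h: "set_integrable lborel {0..} h" "\<And>r. 0 \<le> r \<Longrightarrow> cmod (h r) \<le> r powr b * exp (- (s * \<kappa> * r))" and b: "0 < b" for h :: "real \<Rightarrow> complex" and b
  proof -
    have "\<bar>Im (LBINT r:{0..}. h r)\<bar> \<le> norm (LBINT r:{0..}. h r)" by (rule abs_Im_le_cmod)
    also have "\<dots> \<le> (\<integral>r. indicator {0..} r * (r powr b * exp (- (s * \<kappa> * r))) \<partial>lborel)"
      unfolding set_lebesgue_integral_def
      by (rule Bochner_Integration.integral_norm_bound_integral[OF h(1)[unfolded set_integrable_def] integrable.intros[OF G[OF b]]])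
        (use h(2) in \<open>auto simp: indicator_def\<close>)
    also have "\<dots> = Gamma (b + 1) / (s * \<kappa>) powr (b + 1)" by (rule has_bochner_integral_integral_eq[OF G[OF b]])
    finally show ?thesis .
  qed
  have i1: "set_integrable lborel {0..} (\<lambda>r. k r * w r)"
    unfolding set_integrable_def
    by (rule Bochner_Integration.integrable_bound[OF integrable.intros[OF G[of \<beta>]]])
      (use \<beta> in \<open>auto simp: indicator_def norm_mult nk nw mult_ac\<close>)
  have ri: "set_integrable lborel {0..} (ray s)" using ray_integrable s by simp
  have d1: "set_integrable lborel {0..} (\<lambda>r. k r * (exp (- w r) - 1))"
    using set_integral_diff(1)[OF ri ki(1)] by (simp add: ray algebra_simps)
  have v1: "(LBINT r:{0..}. k r * (exp (- w r) - 1)) = (LBINT r:{0..}. ray s r) - of_real (- 1 / s)"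
    using set_integral_diff(2)[OF ri ki(1)] unfolding ki(2) by (simp add: ray algebra_simps)
  have "\<bar>Im (LBINT r:{0..}. k r * (exp (- w r) - 1))\<bar> \<le> Gamma (\<beta> + 1) / (s * \<kappa>) powr (\<beta> + 1)"
  proof (rule bnd[OF d1])
    fix r :: real
    show "cmod (k r * (exp (- w r) - 1)) \<le> r powr \<beta> * exp (- (s * \<kappa> * r))"
      using cmod_exp_minus_le(1)[OF rw[of r]] by (simp add: norm_mult nk nw)
  qed (use \<beta> in auto)
  then show "\<bar>\<eta> s\<bar> \<le> \<eta>_C1 * s powr (- \<beta> - 1)"
    unfolding v1 using s kappa_mu
    by (simp add: \<eta>_def \<eta>_C1_def powr_mult powr_minus powr_diff field_simps powr_add)
  have d2: "set_integrable lborel {0..} (\<lambda>r. k r * (exp (- w r) - 1 + w r))"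
    using set_integral_add(1)[OF d1 i1] by (simp add: algebra_simps)
  have v2: "(LBINT r:{0..}. k r * (exp (- w r) - 1 + w r)) = (LBINT r:{0..}. ray s r) - of_real (- 1 / s) + (LBINT r:{0..}. k r * w r)"
    using set_integral_add(2)[OF d1 i1] unfolding v1 by (simp add: algebra_simps)
  have est: "\<bar>Im (LBINT r:{0..}. k r * (exp (- w r) - 1 + w r))\<bar> \<le> Gamma (2 * \<beta> + 1) / (s * \<kappa>) powr (2 * \<beta> + 1)"
  proof (rule bnd[OF d2])
    fix r :: real assume "0 \<le> r"
    then show "cmod (k r * (exp (- w r) - 1 + w r)) \<le> r powr (2 * \<beta>) * exp (- (s * \<kappa> * r))"
      using cmod_exp_minus_le(2)[OF rw[of r]] by (simp add: norm_mult nk nw power2_eq_square powr_add[symmetric] mult_left_mono)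
  qed (use \<beta> in auto)
  \<comment> \<open>The ray lies in the left half-plane. Conjugation combined with the sign of
    e^(sz) carries it to the angle \<pi> - ang below \<pi>/2, where \<open>ray_Gamma\<close>
    applies; the phases add up to \<pi> + \<pi>\<beta>.\<close>
  have "Im (LBINT r:{0..}. k r * w r) = - (pi * \<eta>_lead * s powr (- \<beta> - 1))"
  proof -
    let ?f = "\<lambda>r. complex_of_real (r powr \<beta>) * exp (- (of_real (s * r) * cis (pi - ang)))"
    let ?g = "complex_of_real (Gamma (\<beta> + 1) / s powr (\<beta> + 1))"
    have "(LBINT r:{0..}. ?f r) * cis ((\<beta> + 1) * (pi - ang)) = ?g"
      by (rule ray_Gamma[OF s]) (use ang in auto)
    then have "(LBINT r:{0..}. ?f r) * (cis ((\<beta> + 1) * (pi - ang)) * cis (- ((\<beta> + 1) * (pi - ang)))) = ?g * cis (- ((\<beta> + 1) * (pi - ang)))"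
      by (simp only: mult.assoc[symmetric])
    then have "(LBINT r:{0..}. ?f r) = ?g * cis (- ((\<beta> + 1) * (pi - ang)))"
      by (simp add: cis_mult)
    then have "cnj (LBINT r:{0..}. ?f r) = ?g * cis ((\<beta> + 1) * (pi - ang))"
      by (simp add: cis_cnj)
    moreover have "cnj (LBINT r:{0..}. ?f r) = (LBINT r:{0..}. cnj (?f r))"
      unfolding set_lebesgue_integral_def by (subst Bochner_Integration.integral_cnj[symmetric]) simp
    moreover have "cnj (?f r) * (cis ang * cis (\<beta> * ang)) = k r * w r" for r
    proof -
      have "cis (- pi + ang) = - cis ang" by (simp add: complex_eq_iff cos_diff sin_diff)
      then show ?thesis by (simp add: k_def w_def exp_cnj cis_cnj mult_ac)
    qed
    then have "(LBINT r:{0..}. k r * w r) = (LBINT r:{0..}. cnj (?f r)) * (cis ang * cis (\<beta> * ang))"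
      by (simp flip: set_integral_mult_left)
    ultimately have "(LBINT r:{0..}. k r * w r) = ?g * (cis ((\<beta> + 1) * (pi - ang)) * cis ang * cis (\<beta> * ang))"
      by (simp add: mult_ac)
    also have "cis ((\<beta> + 1) * (pi - ang)) * cis ang * cis (\<beta> * ang) = cis (pi + pi * \<beta>)"
      by (simp add: cis_mult algebra_simps)
    finally have "Im (LBINT r:{0..}. k r * w r) = Gamma (\<beta> + 1) / s powr (\<beta> + 1) * sin (pi + pi * \<beta>)" by simp
    then show ?thesis using s by (simp add: \<eta>_lead_def powr_minus powr_diff powr_add sin_add field_simps)
  qed
  then have "Im (LBINT r:{0..}. k r * (exp (- w r) - 1 + w r)) = pi * (\<eta> s - \<eta>_lead * s powr (- \<beta> - 1))"
    unfolding v2 by (simp add: \<eta>_def algebra_simps)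
  with est have "pi * \<bar>\<eta> s - \<eta>_lead * s powr (- \<beta> - 1)\<bar> \<le> Gamma (2 * \<beta> + 1) / (s * \<kappa>) powr (2 * \<beta> + 1)"
    by (simp add: abs_mult)
  then show "\<bar>\<eta> s - \<eta>_lead * s powr (- \<beta> - 1)\<bar> \<le> \<eta>_C2 * s powr (- 2 * \<beta> - 1)"
    using s kappa_mu by (simp add: \<eta>_C2_def powr_mult powr_minus powr_diff field_simps powr_add)
qed

end

section \<open>Gaussians and polynomial weights\<close>

lemma borel_measurable_cis [measurable]: "cis \<in> borel_measurable borel"
  by (intro borel_measurable_continuous_onI continuous_intros)

lemma lborel_integral_affine:
  fixes f :: "'a::euclidean_space \<Rightarrow> 'b::{banach, second_countable_topology}"
  assumes c: "c \<noteq> 0" and f[measurable]: "f \<in> borel_measurable borel"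
  shows "integrable lborel (\<lambda>x. f (t + c *\<^sub>R x)) \<longleftrightarrow> integrable lborel f"
    and "(\<integral>x. f (t + c *\<^sub>R x) \<partial>lborel) = (\<integral>x. f x \<partial>lborel) /\<^sub>R \<bar>c\<bar> ^ DIM('a)"
proof -
  have l: "(lborel :: 'a measure) = density (distr lborel borel (\<lambda>x. t + c *\<^sub>R x)) (\<lambda>_. ennreal (\<bar>c\<bar> ^ DIM('a)))"
    using lborel_affine[OF c, of t] by (simp add: ennreal_power)
  have "integrable lborel f \<longleftrightarrow> integrable (density (distr lborel borel (\<lambda>x. t + c *\<^sub>R x)) (\<lambda>_. ennreal (\<bar>c\<bar> ^ DIM('a)))) f"
    using l by simp
  also have "\<dots> \<longleftrightarrow> integrable lborel (\<lambda>x. \<bar>c\<bar> ^ DIM('a) *\<^sub>R f (t + c *\<^sub>R x))"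
    by (subst integrable_density) (auto simp: integrable_distr_eq)
  also have "\<dots> \<longleftrightarrow> integrable lborel (\<lambda>x. f (t + c *\<^sub>R x))"
  proof
    assume "integrable lborel (\<lambda>x. \<bar>c\<bar> ^ DIM('a) *\<^sub>R f (t + c *\<^sub>R x))"
    then have "integrable lborel (\<lambda>x. (1 / \<bar>c\<bar> ^ DIM('a)) *\<^sub>R (\<bar>c\<bar> ^ DIM('a) *\<^sub>R f (t + c *\<^sub>R x)))"
      by (rule integrable_scaleR_right)
    then show "integrable lborel (\<lambda>x. f (t + c *\<^sub>R x))" using c by simp
  qed (rule integrable_scaleR_right)
  finally show "integrable lborel (\<lambda>x. f (t + c *\<^sub>R x)) \<longleftrightarrow> integrable lborel f" ..
  have "(\<integral>x. f x \<partial>lborel) = (\<integral>x. f x \<partial>density (distr lborel borel (\<lambda>x. t + c *\<^sub>R x)) (\<lambda>_. ennreal (\<bar>c\<bar> ^ DIM('a))))"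
    using l by simp
  also have "\<dots> = (\<integral>x. \<bar>c\<bar> ^ DIM('a) *\<^sub>R f (t + c *\<^sub>R x) \<partial>lborel)"
    by (subst integral_density) (auto simp: integral_distr)
  also have "\<dots> = \<bar>c\<bar> ^ DIM('a) *\<^sub>R (\<integral>x. f (t + c *\<^sub>R x) \<partial>lborel)" by simp
  finally show "(\<integral>x. f (t + c *\<^sub>R x) \<partial>lborel) = (\<integral>x. f x \<partial>lborel) /\<^sub>R \<bar>c\<bar> ^ DIM('a)"
    using c by simp
qed

lemma lborel_integral_reflect:
  fixes f :: "'a::euclidean_space \<Rightarrow> 'b::{banach, second_countable_topology}"
  assumes "f \<in> borel_measurable borel"
  shows "integrable lborel (\<lambda>y. f (x - y)) \<longleftrightarrow> integrable lborel f"
    and "(\<integral>y. f (x - y) \<partial>lborel) = (\<integral>y. f y \<partial>lborel)"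
  using lborel_integral_affine[OF _ assms, of "-1" x] by simp_all

text \<open>The dilation by c = sqrt(2s) reduces this to the characteristic function of the standard
  normal law at a/c.\<close>

lemma gaussian_fourier_1d:
  fixes a s :: real
  assumes s: "0 < s"
  shows "integrable lborel (\<lambda>y. cis (a * y) * of_real (exp (- (s * y\<^sup>2))))"
    and "(\<integral>y. cis (a * y) * of_real (exp (- (s * y\<^sup>2))) \<partial>lborel) = of_real (sqrt (pi / s) * exp (- (a\<^sup>2 / (4 * s))))"
proof -
  define c where "c = sqrt (2 * s)"
  have c: "0 < c" "c\<^sup>2 = 2 * s" using s by (auto simp: c_def)
  define t where "t = a / c"
  define f where "f x = (std_normal_density x *\<^sub>R cis (t * x))" for x
  have [measurable]: "f \<in> borel_measurable borel"
    unfolding f_def by (intro borel_measurable_scaleR borel_measurable_normal_density measurable_compose[OF _ borel_measurable_cis]) simp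
  have fi: "integrable lborel f"
    by (rule Bochner_Integration.integrable_bound[OF integrable_normal_density[of 1 0]]) (auto simp: f_def)
  have "(\<integral>x. f x \<partial>lborel) = char std_normal_distribution t"
    unfolding char_def f_def by (subst integral_density) (auto simp: cis_conv_exp)
  also have "\<dots> = of_real (exp (- (a\<^sup>2 / (4 * s))))"
    unfolding char_std_normal_distribution using c by (simp add: t_def power_divide)
  finally have fv: "(\<integral>x. f x \<partial>lborel) = of_real (exp (- (a\<^sup>2 / (4 * s))))" .
  have eq: "cis (a * y) * of_real (exp (- (s * y\<^sup>2))) = of_real (sqrt (2 * pi)) * f (0 + c *\<^sub>R y)" for y
  proof -
    have e: "t * (c * y) = a * y" using c by (simp add: t_def)
    show ?thesis using c by (simp add: e f_def std_normal_density_def power_mult_distrib scaleR_conv_of_real)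
  qed
  have "integrable lborel (\<lambda>y. f (0 + c *\<^sub>R y))" using lborel_integral_affine(1)[of c f 0] c fi by simp
  then show "integrable lborel (\<lambda>y. cis (a * y) * of_real (exp (- (s * y\<^sup>2))))"
    unfolding eq by (rule integrable_mult_right)
  have v: "(\<integral>y. f (0 + c *\<^sub>R y) \<partial>lborel) = of_real (exp (- (a\<^sup>2 / (4 * s))) / c)"
  proof -
    have "(\<integral>y. f (0 + c *\<^sub>R y) \<partial>lborel) = (\<integral>x. f x \<partial>lborel) /\<^sub>R \<bar>c\<bar> ^ DIM(real)"
      by (rule lborel_integral_affine(2)) (use c in auto)
    also have "\<dots> = of_real (inverse c * exp (- (a\<^sup>2 / (4 * s))))"
      unfolding fv scaleR_conv_of_real of_real_mult using c(1) by (simp only: DIM_real power_one_right abs_of_pos)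
    finally show ?thesis by (simp only: divide_inverse mult.commute)
  qed
  have "(\<integral>y. cis (a * y) * of_real (exp (- (s * y\<^sup>2))) \<partial>lborel) = of_real (sqrt (2 * pi)) * of_real (exp (- (a\<^sup>2 / (4 * s))) / c)"
    unfolding eq integral_mult_right_zero v ..
  also have "\<dots> = of_real (sqrt (pi / s) * exp (- (a\<^sup>2 / (4 * s))))"
    unfolding of_real_mult[symmetric] using s by (simp add: c_def real_sqrt_mult real_sqrt_divide)
  finally show "(\<integral>y. cis (a * y) * of_real (exp (- (s * y\<^sup>2))) \<partial>lborel) = of_real (sqrt (pi / s) * exp (- (a\<^sup>2 / (4 * s))))" .
qed

text \<open>Both the character and the Gaussian factor over the coordinates, so the integral is a
  product of one-dimensional ones.\<close>

lemma gaussian_fourier: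
  fixes x :: "'a::euclidean_space"
  assumes s: "0 < s"
  shows "integrable lborel (\<lambda>\<xi>. cis (x \<bullet> \<xi>) * of_real (exp (- (s * (norm \<xi>)\<^sup>2))))"
    and "(\<integral>\<xi>. cis (x \<bullet> \<xi>) * of_real (exp (- (s * (norm \<xi>)\<^sup>2))) \<partial>lborel)
      = of_real ((pi / s) powr (DIM('a) / 2) * exp (- ((norm x)\<^sup>2 / (4 * s))))"
proof -
  interpret P: product_sigma_finite "\<lambda>b::'a. lborel :: real measure" by standard
  define f where "f b y = cis ((x \<bullet> b) * y) * complex_of_real (exp (- (s * y\<^sup>2)))" for b :: 'a and y
  have fi: "integrable lborel (f b)" for b unfolding f_def by (rule gaussian_fourier_1d[OF s])
  have cis_sum: "cis (sum g I) = (\<Prod>i\<in>I. cis (g i))" if "finite I" for g :: "'a \<Rightarrow> real" and I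
    using that by (induction I) (auto simp: cis_mult[symmetric])
  define F where "F = (\<lambda>\<xi>. cis (x \<bullet> \<xi>) * complex_of_real (exp (- (s * (norm \<xi>)\<^sup>2))))"
  have [measurable]: "F \<in> borel_measurable borel" unfolding F_def by measurable
  have Feq: "F (\<Sum>b\<in>Basis. g b *\<^sub>R b) = (\<Prod>b\<in>Basis. f b (g b))" for g
  proof -
    have n: "(norm (\<Sum>b\<in>Basis. g b *\<^sub>R b :: 'a))\<^sup>2 = (\<Sum>b\<in>Basis. (g b)\<^sup>2)"
      unfolding power2_norm_eq_inner by (subst euclidean_inner) (simp add: power2_eq_square)
    have i: "x \<bullet> (\<Sum>b\<in>Basis. g b *\<^sub>R b) = (\<Sum>b\<in>Basis. (x \<bullet> b) * g b)"
      by (simp add: inner_sum_right mult.commute)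
    show ?thesis unfolding F_def n i f_def
      by (simp add: cis_sum sum_distrib_left sum_negf[symmetric] exp_sum prod.distrib)
  qed
  have m: "(\<lambda>g. \<Sum>b\<in>Basis. g b *\<^sub>R b :: 'a) \<in> measurable (\<Pi>\<^sub>M b\<in>Basis. lborel) borel" by measurable
  have "integrable lborel F \<longleftrightarrow> integrable (\<Pi>\<^sub>M b\<in>(Basis :: 'a set). lborel) (\<lambda>g. F (\<Sum>b\<in>Basis. g b *\<^sub>R b))"
    by (subst lborel_eq, rule integrable_distr_eq[OF m]) simp
  also have "\<dots>" unfolding Feq by (rule P.product_integrable_prod) (auto intro: fi)
  finally show "integrable lborel (\<lambda>\<xi>. cis (x \<bullet> \<xi>) * complex_of_real (exp (- (s * (norm \<xi>)\<^sup>2))))" by (simp add: F_def)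
  have "(\<integral>\<xi>. F \<xi> \<partial>lborel) = (\<integral>g. F (\<Sum>b\<in>Basis. g b *\<^sub>R b) \<partial>(\<Pi>\<^sub>M b\<in>(Basis :: 'a set). lborel))"
    by (subst lborel_eq, rule integral_distr[OF m]) simp
  also have "\<dots> = (\<Prod>b\<in>Basis. \<integral>y. f b y \<partial>lborel)"
    unfolding Feq by (rule P.product_integral_prod) (auto intro: fi)
  also have "\<dots> = (\<Prod>b\<in>(Basis :: 'a set). of_real (sqrt (pi / s) * exp (- ((x \<bullet> b)\<^sup>2 / (4 * s)))))"
    unfolding f_def gaussian_fourier_1d(2)[OF s] ..
  also have "\<dots> = of_real (sqrt (pi / s) ^ DIM('a) * exp (\<Sum>b\<in>(Basis :: 'a set). - ((x \<bullet> b)\<^sup>2 / (4 * s))))"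
    by (simp add: prod.distrib exp_sum)
  also have "(\<Sum>b\<in>(Basis :: 'a set). - ((x \<bullet> b)\<^sup>2 / (4 * s))) = - ((norm x)\<^sup>2 / (4 * s))"
  proof -
    have "(norm x)\<^sup>2 = (\<Sum>b\<in>Basis. (x \<bullet> b)\<^sup>2)"
      unfolding power2_norm_eq_inner by (subst euclidean_inner) (simp add: power2_eq_square)
    then show ?thesis by (simp add: sum_negf sum_divide_distrib)
  qed
  also have "sqrt (pi / s) ^ DIM('a) = (pi / s) powr (DIM('a) / 2)"
    using s by (simp add: powr_half_sqrt[symmetric] powr_realpow[symmetric] powr_powr)
  finally show "(\<integral>\<xi>. cis (x \<bullet> \<xi>) * of_real (exp (- (s * (norm \<xi>)\<^sup>2))) \<partial>lborel)
      = of_real ((pi / s) powr (DIM('a) / 2) * exp (- ((norm x)\<^sup>2 / (4 * s))))"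
    by (simp add: F_def)
qed

lemma gaussian_integral:
  assumes s: "0 < s"
  shows "integrable lborel (\<lambda>\<xi>::'a::euclidean_space. exp (- (s * (norm \<xi>)\<^sup>2)))"
    and "(\<integral>\<xi>. exp (- (s * (norm (\<xi>::'a))\<^sup>2)) \<partial>lborel) = (pi / s) powr (DIM('a) / 2)"
proof -
  note G = gaussian_fourier[OF s, of "0::'a"]
  show "integrable lborel (\<lambda>\<xi>::'a. exp (- (s * (norm \<xi>)\<^sup>2)))"
    using integrable_Re[OF G(1)] by simp
  have "complex_of_real (\<integral>\<xi>. exp (- (s * (norm (\<xi>::'a))\<^sup>2)) \<partial>lborel) = of_real ((pi / s) powr (DIM('a) / 2))"
    using G(2) by (simp flip: integral_complex_of_real)
  then show "(\<integral>\<xi>. exp (- (s * (norm (\<xi>::'a))\<^sup>2)) \<partial>lborel) = (pi / s) powr (DIM('a) / 2)"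
    by (simp only: of_real_eq_iff)
qed

text \<open>No polar coordinates are used. The comparable weight (1+|x|^2)^(-a/2) is, up to
  Gamma(a/2), the integral of s^(a/2-1) e^(-s) e^(-s|x|^2) over s > 0. Integrating over x first
  gives a Gamma integral of index (a-d)/2, which is positive exactly when a > d.\<close>

lemma integrable_weight:
  fixes a :: real
  assumes a: "DIM('a) < a"
  shows "integrable lborel (\<lambda>x::'a::euclidean_space. (1 + norm x) powr (- a))"
proof -
  define f where "f = (\<lambda>s (x::'a). indicator {0..} s * (s powr (a/2 - 1) * exp (- (1 * s))) * exp (- (s * (norm x)\<^sup>2)))"
  have a0: "0 < a" using a by linarith
  have [measurable]: "case_prod f \<in> borel_measurable (borel \<Otimes>\<^sub>M borel)" unfolding f_def by measurable
  have inner: "(\<integral>x. norm (f s x) \<partial>lborel) = pi powr (DIM('a)/2) * (indicator {0..} s * (s powr ((a - DIM('a))/2 - 1) * exp (- (1 * s))))" for s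
  proof (cases "0 < s")
    case True
    have "(\<integral>x. norm (f s x) \<partial>lborel) = s powr (a/2 - 1) * exp (- (1 * s)) * (\<integral>x. exp (- (s * (norm (x::'a))\<^sup>2)) \<partial>lborel)"
      using True by (simp add: f_def abs_mult)
    also have "\<dots> = s powr (a/2 - 1) * exp (- (1 * s)) * (pi / s) powr (DIM('a)/2)"
      unfolding gaussian_integral(2)[OF True] ..
    also have "\<dots> = pi powr (DIM('a)/2) * (s powr (a/2 - 1) * s powr (- (DIM('a)/2)) * exp (- (1 * s)))"
    proof -
      have "(pi / s) powr (DIM('a)/2) = pi powr (DIM('a)/2) * s powr (- (DIM('a)/2))"
        using True by (simp add: powr_divide powr_minus_divide)
      then show ?thesis by (simp only: mult_ac)
    qed
    also have "s powr (a/2 - 1) * s powr (- (DIM('a)/2)) = s powr ((a - DIM('a))/2 - 1)"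
      unfolding powr_add[symmetric] by (rule arg_cong[where f="(powr) s"]) (simp add: field_simps)
    finally show ?thesis using True by simp
  qed (auto simp: f_def indicator_def)
  have "integrable (lborel \<Otimes>\<^sub>M lborel) (case_prod f)"
  proof (rule lborel_pair.Fubini_integrable)
    have "integrable lborel (\<lambda>s. indicator {0..} s * (s powr ((a - DIM('a))/2 - 1) * exp (- (1 * s))))"
      by (rule integrable.intros[OF has_bochner_integral_Gamma_scaled']) (use a in auto)
    then show "integrable lborel (\<lambda>s. \<integral>x. norm (case (s, x) of (s, x) \<Rightarrow> f s x) \<partial>lborel)"
      unfolding prod.case inner by simp
    show "AE s in lborel. integrable lborel (\<lambda>x. case (s, x) of (s, x) \<Rightarrow> f s x)"
    proof (intro AE_I2)
      fix s :: real
      show "integrable lborel (\<lambda>x. case (s, x) of (s, x) \<Rightarrow> f s x)"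
        using gaussian_integral(1)[of s, where 'a='a] by (cases "0 < s") (auto simp: f_def indicator_def)
    qed
  qed auto
  then have "integrable lborel (\<lambda>x. \<integral>s. f s x \<partial>lborel)" by (rule lborel_pair.integrable_snd)
  moreover have "(\<integral>s. f s x \<partial>lborel) = Gamma (a/2) / (1 + (norm x)\<^sup>2) powr (a/2)" for x :: 'a
  proof -
    have "f s x = indicator {0..} s * (s powr (a/2 - 1) * exp (- ((1 + (norm x)\<^sup>2) * s)))" for s
      by (simp add: f_def mult.assoc exp_add[symmetric] algebra_simps)
    then show ?thesis
      using has_bochner_integral_integral_eq[OF has_bochner_integral_Gamma_scaled'[of "a/2" "1 + (norm x)\<^sup>2"]] a0
      by (simp add: add_pos_nonneg)
  qed
  ultimately have "integrable lborel (\<lambda>x::'a. Gamma (a/2) / (1 + (norm x)\<^sup>2) powr (a/2))" by simp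
  then have i: "integrable lborel (\<lambda>x::'a. 1 / Gamma (a/2) * (Gamma (a/2) / (1 + (norm x)\<^sup>2) powr (a/2)))" by (rule integrable_mult_right)
  have b: "norm ((1 + norm x) powr (- a)) \<le> norm (1 / Gamma (a/2) * (Gamma (a/2) / (1 + (norm x)\<^sup>2) powr (a/2)))" for x :: 'a
  proof -
    have "(1 + (norm x)\<^sup>2) powr (a/2) \<le> ((1 + norm x)\<^sup>2) powr (a/2)"
      using a0 by (intro powr_mono2) (auto simp: power2_eq_square algebra_simps)
    also have "\<dots> = (1 + norm x) powr a"
      by (simp add: powr_powr add_pos_nonneg flip: powr_numeral)
    finally have "1 / (1 + norm x) powr a \<le> 1 / (1 + (norm x)\<^sup>2) powr (a/2)"
      by (intro divide_left_mono) (auto intro!: mult_pos_pos add_pos_nonneg simp: add_nonneg_eq_0_iff)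
    moreover have "1 / Gamma (a/2) * (Gamma (a/2) / (1 + (norm x)\<^sup>2) powr (a/2)) = 1 / (1 + (norm x)\<^sup>2) powr (a/2)"
    proof -
      have "Gamma (a/2) \<noteq> 0" using Gamma_real_pos[of "a/2"] a0 by linarith
      then show ?thesis by simp
    qed
    moreover have "(1 + norm x) powr (- a) = 1 / (1 + norm x) powr a" by (rule powr_minus_divide)
    ultimately show ?thesis by (simp only: real_norm_def abs_of_nonneg powr_ge_zero divide_nonneg_nonneg zero_le_one)
  qed
  show ?thesis
    by (rule Bochner_Integration.integrable_bound[OF i]) (use b in auto)
qed

text \<open>This is the inequality z \<le> e^z at z = cy/p, raised to the power p.\<close>

lemma powr_mult_exp_bounded:
  fixes p c y :: real
  assumes "0 < p" "0 < c" "0 \<le> y"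
  shows "y powr p * exp (- (c * y)) \<le> (p / c) powr p"
proof -
  have "c * y / p \<le> exp (c * y / p)" using exp_ge_add_one_self[of "c * y / p"] by linarith
  then have "y \<le> p / c * exp (c * y / p)" using assms by (simp add: field_simps)
  then have "y powr p \<le> (p / c * exp (c * y / p)) powr p" using assms by (intro powr_mono2) auto
  also have "\<dots> = (p / c) powr p * exp (c * y)"
    using assms by (subst powr_mult) (auto simp: exp_powr_real)
  finally show ?thesis by (simp add: exp_minus field_simps)
qed

lemma exp_minus_powr_le_weight:
  fixes \<alpha> m :: real
  assumes "1 \<le> \<alpha>" "0 < m"
  obtains C where "0 < C" "\<And>r. 0 \<le> r \<Longrightarrow> exp (- (r powr \<alpha>)) \<le> C * (1 + r) powr (- m)"
proof
  show "0 < exp 2 * m powr m" using assms by simp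
  fix r :: real assume r: "0 \<le> r"
  have "r - 1 \<le> r powr \<alpha>"
    using ge_one_powr_ge_zero[of r] powr_mono[of 1 \<alpha> r] assms r by (cases "r \<le> 1") (auto intro: order_trans[of _ 0])
  then have "exp (- (r powr \<alpha>)) \<le> exp (2 - (1 + r))" by simp
  also have "\<dots> = exp 2 * exp (- (1 * (1 + r)))" by (simp add: exp_add[symmetric])
  finally have "(1 + r) powr m * exp (- (r powr \<alpha>)) \<le> exp 2 * ((1 + r) powr m * exp (- (1 * (1 + r))))"
    by (subst mult.left_commute) (rule mult_left_mono, simp_all)
  also have "\<dots> \<le> exp 2 * (m / 1) powr m"
    using assms r by (intro mult_left_mono powr_mult_exp_bounded) auto
  finally show "exp (- (r powr \<alpha>)) \<le> exp 2 * m powr m * (1 + r) powr (- m)"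
    using r by (simp add: powr_minus field_simps)
qed

section \<open>Quadratic Taylor bounds\<close>

text \<open>A two-point bound of this kind is inherited by integrals over parameters and by convolutions without
  differentiating under the integral sign, and it makes the gradient Lipschitz.\<close>

definition quadratic_gradient :: "real \<Rightarrow> (real^'n \<Rightarrow> real) \<Rightarrow> (real^'n \<Rightarrow> real^'n) \<Rightarrow> bool" where
  "quadratic_gradient K \<phi> G \<longleftrightarrow> (\<forall>x h. \<bar>\<phi> (x + h) - \<phi> x - G x \<bullet> h\<bar> \<le> K * (norm h)\<^sup>2)"

lemma quadratic_gradientD:
  "quadratic_gradient K \<phi> G \<Longrightarrow> \<bar>\<phi> (x + h) - \<phi> x - G x \<bullet> h\<bar> \<le> K * (norm h)\<^sup>2"
  unfolding quadratic_gradient_def by blast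

lemma quadratic_gradient_nonneg:
  assumes "quadratic_gradient K \<phi> (G :: real^'n \<Rightarrow> real^'n)"
  shows "0 \<le> K"
  using quadratic_gradientD[OF assms, of 0 "axis undefined 1"] by (simp add: norm_axis_1)

lemma quadratic_gradient_has_derivative:
  assumes "quadratic_gradient K \<phi> G"
  shows "(\<phi> has_derivative (\<lambda>h. G x \<bullet> h)) (at x)"
  unfolding has_derivative_at
proof
  show "bounded_linear ((\<bullet>) (G x))" by (rule bounded_linear_inner_right)
  have t: "((\<lambda>h::real^'a. K * norm h) \<longlongrightarrow> 0) (at 0)"
    by (intro tendsto_mult_right_zero tendsto_norm_zero tendsto_ident_at)
  show "(\<lambda>h. norm (\<phi> (x + h) - \<phi> x - G x \<bullet> h) / norm h) \<midarrow>0\<rightarrow> 0"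
  proof (rule Lim_null_comparison[OF _ t])
    show "\<forall>\<^sub>F h in at 0. norm (norm (\<phi> (x + h) - \<phi> x - G x \<bullet> h) / norm h) \<le> K * norm h"
    proof (rule eventually_at_filter[THEN iffD2], rule always_eventually, intro allI impI)
      fix h :: "real^'a" assume "h \<noteq> 0"
      then show "norm (norm (\<phi> (x + h) - \<phi> x - G x \<bullet> h) / norm h) \<le> K * norm h"
        using quadratic_gradientD[OF assms, of x h] by (simp add: field_simps power2_eq_square)
    qed
  qed
qed

lemma grad_eqI:
  assumes "(\<phi> has_derivative (\<lambda>h. G \<bullet> h)) (at x)"
  shows "grad \<phi> x = G"
  unfolding grad_def frechet_derivative_at[OF assms, symmetric] by (simp add: vec_eq_iff inner_axis)

lemma quadratic_gradient_grad: "quadratic_gradient K \<phi> G \<Longrightarrow> grad \<phi> = G"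
  by (intro ext grad_eqI quadratic_gradient_has_derivative)

text \<open>The increments x to y, y to y+h and x to y+h form a triangle, and subtracting the three
  Taylor bounds isolates (G y - G x) \<bullet> h. Taking h along G y - G x with length |y-x| makes
  the errors K, K and 4K times |y-x|^2, hence the 6.\<close>

lemma quadratic_gradient_lipschitz:
  assumes q: "quadratic_gradient K \<phi> G"
  shows "norm (G y - G x) \<le> 6 * K * norm (y - x)"
proof (cases "G y = G x")
  case False
  define \<delta> where "\<delta> = y - x"
  define h where "h = (norm \<delta> / norm (G y - G x)) *\<^sub>R (G y - G x)"
  have K: "0 \<le> K" by (rule quadratic_gradient_nonneg[OF q])
  have nh: "norm h = norm \<delta>" using False by (simp add: h_def)
  have "\<delta> \<noteq> 0" using False by (auto simp: \<delta>_def)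
  have y: "x + \<delta> = y" by (simp add: \<delta>_def)
  have a1: "\<bar>\<phi> (y + h) - \<phi> y - G y \<bullet> h\<bar> \<le> K * (norm \<delta>)\<^sup>2"
    using quadratic_gradientD[OF q, of y h] nh by simp
  have a2: "\<bar>\<phi> y - \<phi> x - G x \<bullet> \<delta>\<bar> \<le> K * (norm \<delta>)\<^sup>2"
    using quadratic_gradientD[OF q, of x \<delta>] y by simp
  have a3: "\<bar>\<phi> (y + h) - \<phi> x - G x \<bullet> (\<delta> + h)\<bar> \<le> K * (4 * (norm \<delta>)\<^sup>2)"
  proof -
    have "\<bar>\<phi> (y + h) - \<phi> x - G x \<bullet> (\<delta> + h)\<bar> \<le> K * (norm (\<delta> + h))\<^sup>2"
      using quadratic_gradientD[OF q, of x "\<delta> + h"] y by (simp add: add.assoc[symmetric])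
    also have "(norm (\<delta> + h))\<^sup>2 \<le> (2 * norm \<delta>)\<^sup>2"
      using norm_triangle_ineq[of \<delta> h] nh by (intro power_mono) auto
    finally show ?thesis using K by (simp add: power_mult_distrib mult_left_mono)
  qed
  have "(G y - G x) \<bullet> h = (\<phi> (y + h) - \<phi> x - G x \<bullet> (\<delta> + h)) - (\<phi> (y + h) - \<phi> y - G y \<bullet> h) - (\<phi> y - \<phi> x - G x \<bullet> \<delta>)"
    by (simp add: inner_diff_left inner_add_right)
  then have "(G y - G x) \<bullet> h \<le> 6 * K * (norm \<delta>)\<^sup>2"
    using a1 a2 a3 unfolding abs_le_iff by linarith
  moreover have "(G y - G x) \<bullet> h = norm \<delta> * norm (G y - G x)"
    using False by (simp add: h_def power2_norm_eq_inner[symmetric] power2_eq_square)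
  ultimately have "norm \<delta> * norm (G y - G x) \<le> norm \<delta> * (6 * K * norm \<delta>)" by (simp add: power2_eq_square mult_ac)
  then show ?thesis using \<open>\<delta> \<noteq> 0\<close> by (simp add: \<delta>_def)
qed (use quadratic_gradient_nonneg[OF q] in simp)

lemma quadratic_gradient_continuous:
  assumes q: "quadratic_gradient K \<phi> G"
  shows "continuous_on UNIV G" "continuous_on UNIV \<phi>"
proof -
  have "(6 * K)-lipschitz_on UNIV G"
    by (rule lipschitz_onI) (use quadratic_gradient_lipschitz[OF q] quadratic_gradient_nonneg[OF q] in \<open>auto simp: dist_norm\<close>)
  then show "continuous_on UNIV G" by (rule lipschitz_on_continuous_on)
  show "continuous_on UNIV \<phi>"
    using has_derivative_continuous[OF quadratic_gradient_has_derivative[OF q]] by (simp add: continuous_at_imp_continuous_on)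
qed

lemma quadratic_gradient_measurable:
  assumes q: "quadratic_gradient K \<phi> G"
  shows "G \<in> borel_measurable borel" "\<phi> \<in> borel_measurable borel"
  using quadratic_gradient_continuous[OF q] by (auto intro: borel_measurable_continuous_onI)

lemma quadratic_gradient_affine:
  assumes q: "quadratic_gradient K \<phi> G"
  shows "quadratic_gradient (K * c\<^sup>2) (\<lambda>y. \<phi> (a + c *\<^sub>R y)) (\<lambda>y. c *\<^sub>R G (a + c *\<^sub>R y))"
  unfolding quadratic_gradient_def
proof (intro allI)
  fix x h :: "real^'a"
  show "\<bar>\<phi> (a + c *\<^sub>R (x + h)) - \<phi> (a + c *\<^sub>R x) - (c *\<^sub>R G (a + c *\<^sub>R x)) \<bullet> h\<bar> \<le> K * c\<^sup>2 * (norm h)\<^sup>2"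
    using quadratic_gradientD[OF q, of "a + c *\<^sub>R x" "c *\<^sub>R h"] by (simp add: algebra_simps power_mult_distrib)
qed

lemma quadratic_gradient_cmult:
  assumes q: "quadratic_gradient K \<phi> G"
  shows "quadratic_gradient (\<bar>c\<bar> * K) (\<lambda>y. c * \<phi> y) (\<lambda>y. c *\<^sub>R G y)"
  unfolding quadratic_gradient_def
proof (intro allI)
  fix x h :: "real^'a"
  have "\<bar>c * \<phi> (x + h) - c * \<phi> x - (c *\<^sub>R G x) \<bullet> h\<bar> = \<bar>c\<bar> * \<bar>\<phi> (x + h) - \<phi> x - G x \<bullet> h\<bar>"
    by (simp add: abs_mult[symmetric] right_diff_distrib)
  then show "\<bar>c * \<phi> (x + h) - c * \<phi> x - (c *\<^sub>R G x) \<bullet> h\<bar> \<le> \<bar>c\<bar> * K * (norm h)\<^sup>2"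
    using mult_left_mono[OF quadratic_gradientD[OF q, of x h], of "\<bar>c\<bar>"] by (simp add: mult.assoc)
qed

lemma quadratic_gradient_integral:
  fixes \<phi> :: "'b::euclidean_space \<Rightarrow> real^'n \<Rightarrow> real" and G :: "'b \<Rightarrow> real^'n \<Rightarrow> real^'n"
  assumes q: "\<And>\<omega>. quadratic_gradient (k \<omega>) (\<phi> \<omega>) (G \<omega>)"
    and k: "integrable M k" and \<phi>: "\<And>x. integrable M (\<lambda>\<omega>. \<phi> \<omega> x)" and G: "\<And>x. integrable M (\<lambda>\<omega>. G \<omega> x)"
  shows "quadratic_gradient (\<integral>\<omega>. k \<omega> \<partial>M) (\<lambda>x. \<integral>\<omega>. \<phi> \<omega> x \<partial>M) (\<lambda>x. \<integral>\<omega>. G \<omega> x \<partial>M)"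
  unfolding quadratic_gradient_def
proof (intro allI)
  fix x h :: "real^'n"
  have Gh: "integrable M (\<lambda>\<omega>. G \<omega> x \<bullet> h)" by (intro integrable_inner_left G)
  have i1: "integrable M (\<lambda>\<omega>. \<phi> \<omega> (x + h) - \<phi> \<omega> x - G \<omega> x \<bullet> h)"
    by (intro Bochner_Integration.integrable_diff \<phi> Gh)
  have i2: "integrable M (\<lambda>\<omega>. k \<omega> * (norm h)\<^sup>2)" using k by (rule integrable_mult_left)
  have "(\<integral>\<omega>. \<phi> \<omega> (x + h) \<partial>M) - (\<integral>\<omega>. \<phi> \<omega> x \<partial>M) - (\<integral>\<omega>. G \<omega> x \<partial>M) \<bullet> h
    = (\<integral>\<omega>. \<phi> \<omega> (x + h) - \<phi> \<omega> x - G \<omega> x \<bullet> h \<partial>M)"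
    using \<phi> Gh by (subst integral_inner_left[symmetric]) (auto simp: G)
  moreover have "norm (\<integral>\<omega>. \<phi> \<omega> (x + h) - \<phi> \<omega> x - G \<omega> x \<bullet> h \<partial>M) \<le> (\<integral>\<omega>. k \<omega> * (norm h)\<^sup>2 \<partial>M)"
    by (rule Bochner_Integration.integral_norm_bound_integral[OF i1 i2])
      (use quadratic_gradientD[OF q] in simp)
  ultimately show "\<bar>(\<integral>\<omega>. \<phi> \<omega> (x + h) \<partial>M) - (\<integral>\<omega>. \<phi> \<omega> x \<partial>M) - (\<integral>\<omega>. G \<omega> x \<partial>M) \<bullet> h\<bar> \<le> (\<integral>\<omega>. k \<omega> \<partial>M) * (norm h)\<^sup>2"
    by simp
qed

lemma cos_taylor2:
  fixes a b :: real
  shows "\<bar>cos (a + b) - cos a + sin a * b\<bar> \<le> b\<^sup>2"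
proof -
  define f where "f = (\<lambda>i::nat. if i = 0 then cos else if i = 1 then (\<lambda>x. - sin x) else (\<lambda>x::real. - cos x))"
  have "norm (f 0 (a + b) - (\<Sum>i\<le>1. f i a * (a + b - a) ^ i / fact i)) \<le> 1 * norm (a + b - a) ^ Suc 1 / fact 1"
    by (rule field_Taylor[where S=UNIV]) (auto simp: f_def le_Suc_eq intro!: derivative_eq_intros)
  then show ?thesis by (simp add: f_def power2_eq_square algebra_simps)
qed

lemma exp_taylor2:
  fixes h :: real
  shows "\<bar>exp (- h) - 1 + h\<bar> \<le> h\<^sup>2 * exp \<bar>h\<bar>"
proof -
  have "norm ((-1)^0 * exp (- h) - (\<Sum>i\<le>1. (-1)^i * exp (- 0) * (h - 0) ^ i / fact i)) \<le> exp \<bar>h\<bar> * norm (h - 0) ^ Suc 1 / fact 1"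
    by (rule field_Taylor[where S="{-\<bar>h\<bar>..\<bar>h\<bar>}" and f="\<lambda>i x. (-1)^i * exp (- x)"])
      (auto intro!: derivative_eq_intros simp: abs_mult power_abs)
  then show ?thesis by (simp add: power2_eq_square algebra_simps)
qed

text \<open>Each frequency contributes a Taylor constant |\<xi>|^2 |g(\<xi>)|, so the integral of
  (1+|\<xi>|)^2 |g| bounds value, gradient and Taylor constant at once. This gives regularity of the
  kernel at the origin, where the subordinated formula does not reach.\<close>

lemma quadratic_gradient_cosine_transform:
  fixes g :: "real^'n \<Rightarrow> real"
  assumes g[measurable]: "g \<in> borel_measurable borel"
    and i: "integrable lborel (\<lambda>\<xi>. (1 + norm \<xi>)\<^sup>2 * g \<xi>)"
  obtains K G where "quadratic_gradient K (\<lambda>x. \<integral>\<xi>. cos (x \<bullet> \<xi>) * g \<xi> \<partial>lborel) G" "\<And>x. norm (G x) \<le> K"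
    "\<And>x. \<bar>\<integral>\<xi>. cos (x \<bullet> \<xi>) * g \<xi> \<partial>lborel\<bar> \<le> K"
proof -
  let ?w = "\<lambda>\<xi>. (1 + norm \<xi>)\<^sup>2 * g \<xi>"
  have w: "\<bar>g \<xi>\<bar> \<le> \<bar>?w \<xi>\<bar>" "norm \<xi> * \<bar>g \<xi>\<bar> \<le> \<bar>?w \<xi>\<bar>" "(norm \<xi>)\<^sup>2 * \<bar>g \<xi>\<bar> \<le> \<bar>?w \<xi>\<bar>" for \<xi>
  proof -
    have c: "1 \<le> (1 + norm \<xi>)\<^sup>2" "norm \<xi> \<le> (1 + norm \<xi>)\<^sup>2" "(norm \<xi>)\<^sup>2 \<le> (1 + norm \<xi>)\<^sup>2"
      by (auto simp: power2_eq_square algebra_simps)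
    show "\<bar>g \<xi>\<bar> \<le> \<bar>?w \<xi>\<bar>" "norm \<xi> * \<bar>g \<xi>\<bar> \<le> \<bar>?w \<xi>\<bar>" "(norm \<xi>)\<^sup>2 * \<bar>g \<xi>\<bar> \<le> \<bar>?w \<xi>\<bar>"
      using c[THEN mult_right_mono, of "\<bar>g \<xi>\<bar>"] by (simp_all add: abs_mult)
  qed
  have kq: "quadratic_gradient ((norm \<xi>)\<^sup>2 * \<bar>g \<xi>\<bar>) (\<lambda>x. cos (x \<bullet> \<xi>) * g \<xi>) (\<lambda>x. (- sin (x \<bullet> \<xi>) * g \<xi>) *\<^sub>R \<xi>)" for \<xi>
    unfolding quadratic_gradient_def
  proof (intro allI)
    fix x h :: "real^'n"
    have "cos ((x + h) \<bullet> \<xi>) * g \<xi> - cos (x \<bullet> \<xi>) * g \<xi> - ((- sin (x \<bullet> \<xi>) * g \<xi>) *\<^sub>R \<xi>) \<bullet> h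
      = (cos (x \<bullet> \<xi> + h \<bullet> \<xi>) - cos (x \<bullet> \<xi>) + sin (x \<bullet> \<xi>) * (h \<bullet> \<xi>)) * g \<xi>"
      by (simp add: inner_add_left algebra_simps inner_commute)
    also have "\<bar>\<dots>\<bar> \<le> (h \<bullet> \<xi>)\<^sup>2 * \<bar>g \<xi>\<bar>"
      unfolding abs_mult by (intro mult_right_mono cos_taylor2) simp
    also have "\<dots> \<le> (norm h * norm \<xi>)\<^sup>2 * \<bar>g \<xi>\<bar>"
      using power_mono[OF Cauchy_Schwarz_ineq2[of h \<xi>] abs_ge_zero, of 2] by (intro mult_right_mono) simp_all
    also have "\<dots> = (norm \<xi>)\<^sup>2 * \<bar>g \<xi>\<bar> * (norm h)\<^sup>2" by (simp add: power_mult_distrib)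
    finally show "\<bar>cos ((x + h) \<bullet> \<xi>) * g \<xi> - cos (x \<bullet> \<xi>) * g \<xi> - ((- sin (x \<bullet> \<xi>) * g \<xi>) *\<^sub>R \<xi>) \<bullet> h\<bar> \<le> (norm \<xi>)\<^sup>2 * \<bar>g \<xi>\<bar> * (norm h)\<^sup>2" .
  qed
  have k: "integrable lborel (\<lambda>\<xi>. (norm \<xi>)\<^sup>2 * \<bar>g \<xi>\<bar>)"
    by (rule Bochner_Integration.integrable_bound[OF i]) (use w in auto)
  have b1: "norm (cos (x \<bullet> \<xi>) * g \<xi>) \<le> norm (?w \<xi>)" for x \<xi>
    using mult_right_mono[OF abs_cos_le_one[of "x \<bullet> \<xi>"], of "\<bar>g \<xi>\<bar>"] w(1)[of \<xi>] by (simp add: abs_mult)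
  have p: "integrable lborel (\<lambda>\<xi>. cos (x \<bullet> \<xi>) * g \<xi>)" for x
    by (rule Bochner_Integration.integrable_bound[OF i]) (use b1 in auto)
  have b2: "norm ((- sin (x \<bullet> \<xi>) * g \<xi>) *\<^sub>R \<xi>) \<le> norm (?w \<xi>)" for x \<xi>
    using mult_right_mono[OF abs_sin_le_one[of "x \<bullet> \<xi>"], of "\<bar>g \<xi>\<bar> * norm \<xi>"] w(2)[of \<xi>] by (simp add: abs_mult mult.assoc mult.commute[of "norm \<xi>"])
  have G: "integrable lborel (\<lambda>\<xi>. (- sin (x \<bullet> \<xi>) * g \<xi>) *\<^sub>R \<xi>)" for x
    by (rule Bochner_Integration.integrable_bound[OF i]) (use b2 in auto)
  let ?K = "\<integral>\<xi>. norm (?w \<xi>) \<partial>lborel"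
  let ?G = "\<lambda>x. \<integral>\<xi>. (- sin (x \<bullet> \<xi>) * g \<xi>) *\<^sub>R \<xi> \<partial>lborel"
  have "(\<integral>\<xi>. (norm \<xi>)\<^sup>2 * \<bar>g \<xi>\<bar> \<partial>lborel) \<le> ?K"
    by (rule integral_mono[OF k integrable_norm[OF i]]) (use w(3) in auto)
  then have "quadratic_gradient ?K (\<lambda>x. \<integral>\<xi>. cos (x \<bullet> \<xi>) * g \<xi> \<partial>lborel) ?G"
    using quadratic_gradient_integral[OF kq k p G] unfolding quadratic_gradient_def
    by (meson mult_right_mono order_trans zero_le_power2)
  moreover have "norm (?G x) \<le> ?K" for x
    by (rule Bochner_Integration.integral_norm_bound_integral[OF G integrable_norm[OF i]]) (use b2 in auto)
  moreover have "norm (\<integral>\<xi>. cos (x \<bullet> \<xi>) * g \<xi> \<partial>lborel) \<le> ?K" for x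
    by (rule Bochner_Integration.integral_norm_bound_integral[OF p integrable_norm[OF i]]) (use b1 in auto)
  ultimately show ?thesis using that[of ?K ?G] by (simp only: real_norm_def)
qed

lemma quadratic_gradient_convolution:
  fixes \<phi> :: "real^'n \<Rightarrow> real"
  assumes q: "quadratic_gradient K \<phi> G" and b: "\<And>x. \<bar>\<phi> x\<bar> \<le> M" "\<And>x. norm (G x) \<le> M"
    and u: "integrable lborel u"
  shows "quadratic_gradient (K * (\<integral>y. \<bar>u y\<bar> \<partial>lborel)) (\<lambda>x. \<integral>y. \<phi> (x - y) * u y \<partial>lborel) (\<lambda>x. \<integral>y. u y *\<^sub>R G (x - y) \<partial>lborel)"
    and "\<And>x. integrable lborel (\<lambda>y. \<phi> (x - y) * u y)" and "\<And>x. integrable lborel (\<lambda>y. u y *\<^sub>R G (x - y))"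
proof -
  have [measurable]: "u \<in> borel_measurable borel" using u by simp
  note [measurable] = quadratic_gradient_measurable[OF q]
  have kq: "quadratic_gradient (K * \<bar>u y\<bar>) (\<lambda>x. \<phi> (x - y) * u y) (\<lambda>x. u y *\<^sub>R G (x - y))" for y
    using quadratic_gradient_cmult[OF quadratic_gradient_affine[OF q, of 1 "-y"], of "u y"] by (simp add: mult.commute)
  have M0: "0 \<le> M" using b(2)[of 0] norm_ge_zero order_trans by blast
  have k: "integrable lborel (\<lambda>y. K * \<bar>u y\<bar>)" using u by simp
  have i: "integrable lborel (\<lambda>y. M * u y)" using u by simp
  show p: "integrable lborel (\<lambda>y. \<phi> (x - y) * u y)" for x
    by (rule Bochner_Integration.integrable_bound[OF i]) (use b M0 in \<open>auto simp: abs_mult intro!: mult_right_mono\<close>)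
  show G: "integrable lborel (\<lambda>y. u y *\<^sub>R G (x - y))" for x
    by (rule Bochner_Integration.integrable_bound[OF i]) (use b M0 in \<open>auto simp: abs_mult mult.commute[of M] intro!: mult_left_mono\<close>)
  show "quadratic_gradient (K * (\<integral>y. \<bar>u y\<bar> \<partial>lborel)) (\<lambda>x. \<integral>y. \<phi> (x - y) * u y \<partial>lborel) (\<lambda>x. \<integral>y. u y *\<^sub>R G (x - y) \<partial>lborel)"
    using quadratic_gradient_integral[OF kq k p G] by simp
qed

section \<open>Weak gradients\<close>

text \<open>A function that is not integrable has integral 0 by convention, and g is nonnegative
  almost everywhere, so the bound holds in that case too. Measurability of f need not be checked at
  each use.\<close>

lemma norm_integral_le_AE:
  fixes f :: "'a \<Rightarrow> 'b::{banach, second_countable_topology}"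
  assumes g: "integrable M g" and le: "AE x in M. norm (f x) \<le> g x"
  shows "norm (\<integral>x. f x \<partial>M) \<le> (\<integral>x. g x \<partial>M)"
proof (cases "integrable M f")
  case True
  have "norm (\<integral>x. f x \<partial>M) \<le> (\<integral>x. norm (f x) \<partial>M)" by (rule integral_norm_bound)
  also have "\<dots> \<le> (\<integral>x. g x \<partial>M)" by (rule integral_mono_AE[OF integrable_norm[OF True] g le])
  finally show ?thesis .
next
  case False
  have "AE x in M. 0 \<le> g x" using le by eventually_elim (meson norm_ge_zero order_trans)
  then show ?thesis using False by (simp add: not_integrable_integral_eq integral_nonneg_AE)
qed

lemma test_functionI:
  fixes \<phi> :: "real^'n \<Rightarrow> real"
  assumes d: "\<And>x. (\<phi> has_derivative (\<lambda>h. D x \<bullet> h)) (at x)" and c: "continuous_on UNIV D"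
    and s: "\<And>x. r < norm x \<Longrightarrow> \<phi> x = 0"
  shows "test_function \<phi>" "grad \<phi> = D"
proof -
  show g: "grad \<phi> = D" by (intro ext grad_eqI d)
  show "test_function \<phi>" unfolding test_function_def g using d c s
    by (auto simp: differentiable_def)
qed

text \<open>The profile (1-|y|^2)_+^2 is once continuously differentiable with a global quadratic
  Taylor bound. Test functions here are C^1, so this elementary cut-off replaces a smooth
  mollifier.\<close>

definition bump :: "real^'n \<Rightarrow> real" where
  "bump y = (max 0 (1 - (norm y)\<^sup>2))\<^sup>2"

definition bump_grad :: "real^'n \<Rightarrow> real^'n" where
  "bump_grad y = (- 4 * max 0 (1 - (norm y)\<^sup>2)) *\<^sub>R y"

lemma bump_bounds: "0 \<le> bump y" "bump y \<le> 1" "1 \<le> norm y \<Longrightarrow> bump y = 0" "bump 0 = 1"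
proof -
  show "0 \<le> bump y" "bump y \<le> 1" by (auto simp: bump_def intro!: power_le_one)
  show "bump y = 0" if "1 \<le> norm y"
  proof -
    have "max 0 (1 - (norm y)\<^sup>2) = 0" using one_le_power[OF that, of 2] by (intro max_absorb1) simp
    then show ?thesis by (simp add: bump_def)
  qed
  show "bump 0 = 1" by (simp add: bump_def)
qed

lemma bump_grad_bound: "norm (bump_grad y) \<le> 4"
proof (cases "norm y \<le> 1")
  case True
  then have "max 0 (1 - (norm y)\<^sup>2) * norm y \<le> 1 * 1" by (intro mult_mono) auto
  then show ?thesis by (simp add: bump_grad_def abs_mult)
next
  case False
  then have "1 \<le> (norm y)\<^sup>2" by (simp add: one_le_power)
  then have "max 0 (1 - (norm y)\<^sup>2) = 0" by (intro max_absorb1) simp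
  then show ?thesis by (simp add: bump_grad_def)
qed

text \<open>The square of the positive part has derivative twice the positive part, which is
  Lipschitz with constant 2.\<close>

lemma square_pos_part_taylor:
  fixes t k :: real
  shows "\<bar>(max 0 (t + k))\<^sup>2 - (max 0 t)\<^sup>2 - 2 * max 0 t * k\<bar> \<le> k\<^sup>2"
proof -
  consider "0 \<le> t" "0 \<le> t + k" | "0 \<le> t" "t + k < 0" | "t < 0" "0 \<le> t + k" | "t < 0" "t + k < 0" by linarith
  then show ?thesis
  proof cases
    case 1 then show ?thesis by (simp add: power2_eq_square algebra_simps)
  next
    case 2
    have "0 \<le> t * (- t - 2 * k)" using 2 by (intro mult_nonneg_nonneg) auto
    moreover have "0 \<le> (t + k)\<^sup>2" by simp
    ultimately have "\<bar>- t\<^sup>2 - 2 * t * k\<bar> \<le> k\<^sup>2" unfolding abs_le_iff by (simp add: power2_eq_square algebra_simps)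
    then show ?thesis using 2 by simp
  next
    case 3
    then have "(t + k)\<^sup>2 \<le> k\<^sup>2" by (intro power_mono) auto
    then show ?thesis using 3 by simp
  next
    case 4 then show ?thesis by simp
  qed
qed

text \<open>The one-variable bound is composed with t = 1 - |y|^2. For |h| \<le> 1 and |y| \<le> 2
  the increment of t is at most 5|h|, giving 25|h|^2; another 2|h|^2 comes from the quadratic part
  of that increment. The other cases are cheaper.\<close>

lemma bump_quadratic_gradient: "quadratic_gradient 27 bump (bump_grad :: real^'n \<Rightarrow> _)"
  unfolding quadratic_gradient_def
proof (intro allI)
  fix y h :: "real^'n"
  define t where "t = 1 - (norm y)\<^sup>2"
  define k where "k = - (2 * (y \<bullet> h) + (norm h)\<^sup>2)"
  have tk: "1 - (norm (y + h))\<^sup>2 = t + k"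
    by (simp add: t_def k_def power2_norm_eq_inner inner_add_left inner_add_right inner_commute)
  show "\<bar>bump (y + h) - bump y - bump_grad y \<bullet> h\<bar> \<le> 27 * (norm h)\<^sup>2"
  proof (cases "norm h \<le> 1")
    case True
    show ?thesis
    proof (cases "norm y \<le> 2")
      case True
      have eq: "bump (y + h) - bump y - bump_grad y \<bullet> h = ((max 0 (t + k))\<^sup>2 - (max 0 t)\<^sup>2 - 2 * max 0 t * k) - 2 * max 0 t * (norm h)\<^sup>2"
        unfolding bump_def tk bump_grad_def t_def[symmetric] by (simp add: k_def algebra_simps)
      have "\<bar>y \<bullet> h\<bar> \<le> 2 * norm h"
        using Cauchy_Schwarz_ineq2[of y h] True mult_right_mono[OF True norm_ge_zero[of h]] by linarith
      moreover have "(norm h)\<^sup>2 \<le> norm h" using \<open>norm h \<le> 1\<close> by (simp add: power2_eq_square mult_left_le)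
      moreover have "\<bar>k\<bar> \<le> 2 * \<bar>y \<bullet> h\<bar> + (norm h)\<^sup>2" unfolding k_def using zero_le_power2[of "norm h"] by linarith
      ultimately have "\<bar>k\<bar> \<le> 5 * norm h" by linarith
      then have "\<bar>k\<bar>\<^sup>2 \<le> (5 * norm h)\<^sup>2" by (intro power_mono) auto
      then have k2: "k\<^sup>2 \<le> 25 * (norm h)\<^sup>2" by (simp add: power_mult_distrib)
      have "max 0 t * (norm h)\<^sup>2 \<le> 1 * (norm h)\<^sup>2" by (intro mult_right_mono) (auto simp: t_def)
      moreover have "0 \<le> max 0 t * (norm h)\<^sup>2" by (intro mult_nonneg_nonneg) auto
      moreover define m where "m = max 0 t"
      ultimately show ?thesis unfolding eq using square_pos_part_taylor[of t k] k2
        unfolding m_def[symmetric] abs_le_iff by linarith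
    next
      case False
      then have "1 < norm (y + h)" using norm_triangle_ineq4[of "y + h" h] \<open>norm h \<le> 1\<close> by simp
      then have "bump (y + h) = 0" by (intro bump_bounds) simp
      moreover have "bump y = 0" using False by (intro bump_bounds) simp
      moreover have "1 \<le> (norm y)\<^sup>2" using False by (simp add: one_le_power)
      then have "max 0 (1 - (norm y)\<^sup>2) = 0" by (intro max_absorb1) simp
      then have "bump_grad y = 0" by (simp add: bump_grad_def)
      ultimately show ?thesis by simp
    qed
  next
    case False
    have "\<bar>bump_grad y \<bullet> h\<bar> \<le> 4 * norm h"
      using Cauchy_Schwarz_ineq2[of "bump_grad y" h] mult_right_mono[OF bump_grad_bound norm_ge_zero[of h], of y] by linarith
    moreover have "norm h \<le> (norm h)\<^sup>2" using False mult_left_mono[of 1 "norm h" "norm h"] by (simp add: power2_eq_square)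
    ultimately show ?thesis using False bump_bounds(1,2)[of y] bump_bounds(1,2)[of "y + h"] unfolding abs_le_iff by linarith
  qed
qed

lemma bump_scaled:
  assumes "0 < r"
  shows "quadratic_gradient (27 / r\<^sup>2) (\<lambda>y. bump (y /\<^sub>R r)) (\<lambda>y. bump_grad (y /\<^sub>R r) /\<^sub>R r)"
  using quadratic_gradient_affine[OF bump_quadratic_gradient, of "inverse r" 0] by (simp add: power2_eq_square divide_inverse)

lemma is_weak_gradientD:
  "is_weak_gradient g G \<Longrightarrow> test_function \<phi> \<Longrightarrow> grad \<phi> = D \<Longrightarrow> (\<integral>x. g x *\<^sub>R D x \<partial>lborel) = - (\<integral>x. \<phi> x *\<^sub>R G x \<partial>lborel)"
  unfolding is_weak_gradient_def by auto

text \<open>Cut-offs at radius n have gradients of size 4/n, so the extra term of the product rule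
  vanishes by dominated convergence, u and G being integrable. Thus the heat kernel, which has no
  compact support, may serve as a test function.\<close>

lemma weak_gradient_bounded_test:
  fixes u :: "real^'n \<Rightarrow> real"
  assumes w: "is_weak_gradient u G" and u: "integrable lborel u" and G: "integrable lborel G"
    and d: "\<And>y. (\<psi> has_derivative (\<lambda>h. D y \<bullet> h)) (at y)" and c: "continuous_on UNIV D"
    and M: "\<And>y. \<bar>\<psi> y\<bar> \<le> M" "\<And>y. norm (D y) \<le> M"
  shows "(\<integral>y. u y *\<^sub>R D y \<partial>lborel) = - (\<integral>y. \<psi> y *\<^sub>R G y \<partial>lborel)"
proof -
  have M0: "0 \<le> M" using M(2)[of 0] norm_ge_zero order_trans by blast
  have [measurable]: "u \<in> borel_measurable borel" "G \<in> borel_measurable borel" using u G by auto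
  have [measurable]: "D \<in> borel_measurable borel" using c by (rule borel_measurable_continuous_onI)
  have cpsi: "continuous_on UNIV \<psi>"
    using has_derivative_continuous[OF d] by (simp add: continuous_at_imp_continuous_on)
  then have [measurable]: "\<psi> \<in> borel_measurable borel" by (rule borel_measurable_continuous_onI)
  define \<zeta> where "\<zeta> n y = bump (y /\<^sub>R real (Suc n))" for n and y :: "real^'n"
  define \<zeta>' where "\<zeta>' n y = bump_grad (y /\<^sub>R real (Suc n)) /\<^sub>R real (Suc n)" for n and y :: "real^'n"
  have q: "quadratic_gradient (27 / (real (Suc n))\<^sup>2) (\<zeta> n) (\<zeta>' n)" for n
    unfolding \<zeta>_def \<zeta>'_def by (rule bump_scaled) simp
  note [measurable] = quadratic_gradient_measurable[OF q]
  define E where "E n y = \<psi> y *\<^sub>R \<zeta>' n y + \<zeta> n y *\<^sub>R D y" for n y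
  have [measurable]: "E n \<in> borel_measurable borel" for n unfolding E_def by measurable
  have dE: "((\<lambda>y. \<psi> y * \<zeta> n y) has_derivative (\<lambda>h. E n x \<bullet> h)) (at x)" for n x
    by (rule has_derivative_eq_rhs[OF has_derivative_mult[OF d quadratic_gradient_has_derivative[OF q]]])
      (simp add: E_def inner_add_left fun_eq_iff mult.commute)
  have cE: "continuous_on UNIV (E n)" for n
    unfolding E_def by (intro continuous_intros cpsi c quadratic_gradient_continuous[OF q])
  have sE: "\<psi> x * \<zeta> n x = 0" if "real (Suc n) < norm x" for n x
  proof -
    have "1 \<le> norm (x /\<^sub>R real (Suc n))" using that by (simp add: field_simps)
    then have "\<zeta> n x = 0" unfolding \<zeta>_def by (rule bump_bounds(3))
    then show ?thesis by simp
  qed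
  note test = test_functionI[OF dE cE sE]
  have eq: "(\<integral>y. u y *\<^sub>R E n y \<partial>lborel) = - (\<integral>y. (\<psi> y * \<zeta> n y) *\<^sub>R G y \<partial>lborel)" for n
    by (rule is_weak_gradientD[OF w test])
  have \<zeta>_lim: "(\<lambda>n. \<zeta> n y) \<longlonglongrightarrow> 1" for y
  proof -
    have "(\<lambda>n. inverse (real (Suc n)) *\<^sub>R y) \<longlonglongrightarrow> 0 *\<^sub>R y"
      by (intro tendsto_scaleR LIMSEQ_inverse_real_of_nat tendsto_const)
    then have t: "(\<lambda>n. y /\<^sub>R real (Suc n)) \<longlonglongrightarrow> 0" by simp
    have "continuous_on UNIV (bump :: real^'n \<Rightarrow> real)"
      by (rule quadratic_gradient_continuous(2)[OF bump_quadratic_gradient])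
    then have "isCont bump (0 :: real^'n)" by (simp add: continuous_on_eq_continuous_at)
    from isCont_tendsto_compose[OF this t] have "(\<lambda>n. bump (y /\<^sub>R real (Suc n))) \<longlonglongrightarrow> bump (0 :: real^'n)" .
    then show ?thesis unfolding \<zeta>_def bump_bounds(4) .
  qed
  have \<zeta>'_bd: "norm (\<zeta>' n y) \<le> 4 * inverse (real (Suc n))" for n y
    unfolding \<zeta>'_def using bump_grad_bound[of "y /\<^sub>R real (Suc n)"] mult_right_mono[of _ 4 "inverse (real (Suc n))"]
    by (simp add: mult.commute)
  have \<zeta>'_lim: "(\<lambda>n. \<zeta>' n y) \<longlonglongrightarrow> 0" for y
  proof (rule Lim_null_comparison)
    show "\<forall>\<^sub>F n in sequentially. norm (\<zeta>' n y) \<le> 4 * inverse (real (Suc n))" using \<zeta>'_bd by simp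
    show "(\<lambda>n. 4 * inverse (real (Suc n))) \<longlonglongrightarrow> 0"
      by (intro tendsto_mult_right_zero LIMSEQ_inverse_real_of_nat)
  qed
  have \<zeta>'_bd4: "norm (\<zeta>' n y) \<le> 4" for n y
  proof -
    have "inverse (real (Suc n)) \<le> 1" by (simp add: field_simps)
    then show ?thesis using \<zeta>'_bd[of n y] by linarith
  qed
  have \<zeta>1: "\<bar>\<zeta> n y\<bar> \<le> 1" for n y
    unfolding \<zeta>_def using bump_bounds(1,2)[of "y /\<^sub>R real (Suc n)"] by linarith
  have E_bd: "norm (E n y) \<le> 5 * M" for n y
  proof -
    have "norm (E n y) \<le> \<bar>\<psi> y\<bar> * norm (\<zeta>' n y) + \<bar>\<zeta> n y\<bar> * norm (D y)"
      unfolding E_def by (rule order_trans[OF norm_triangle_ineq]) simp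
    also have "\<dots> \<le> M * 4 + 1 * M"
      using M M0 \<zeta>'_bd4 \<zeta>1 by (intro add_mono mult_mono) auto
    finally show ?thesis by simp
  qed
  have l1: "(\<lambda>n. \<integral>y. u y *\<^sub>R E n y \<partial>lborel) \<longlonglongrightarrow> (\<integral>y. u y *\<^sub>R D y \<partial>lborel)"
  proof (rule integral_dominated_convergence)
    show "integrable lborel (\<lambda>y. 5 * M * \<bar>u y\<bar>)" using u by simp
    show "AE y in lborel. (\<lambda>n. u y *\<^sub>R E n y) \<longlonglongrightarrow> u y *\<^sub>R D y"
    proof (intro AE_I2)
      fix y
      have "(\<lambda>n. u y *\<^sub>R E n y) \<longlonglongrightarrow> u y *\<^sub>R (\<psi> y *\<^sub>R 0 + 1 *\<^sub>R D y)"
        unfolding E_def by (intro tendsto_intros \<zeta>_lim \<zeta>'_lim)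
      then show "(\<lambda>n. u y *\<^sub>R E n y) \<longlonglongrightarrow> u y *\<^sub>R D y" by simp
    qed
    show "AE y in lborel. norm (u y *\<^sub>R E n y) \<le> 5 * M * \<bar>u y\<bar>" for n
      using E_bd[of n] mult_left_mono[OF E_bd[of n] abs_ge_zero] by (intro AE_I2) (simp add: mult.commute)
  qed measurable
  have l2: "(\<lambda>n. \<integral>y. (\<psi> y * \<zeta> n y) *\<^sub>R G y \<partial>lborel) \<longlonglongrightarrow> (\<integral>y. \<psi> y *\<^sub>R G y \<partial>lborel)"
  proof (rule integral_dominated_convergence)
    show "integrable lborel (\<lambda>y. M * norm (G y))" using G by simp
    show "AE y in lborel. (\<lambda>n. (\<psi> y * \<zeta> n y) *\<^sub>R G y) \<longlonglongrightarrow> \<psi> y *\<^sub>R G y"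
    proof (intro AE_I2)
      fix y
      have "(\<lambda>n. (\<psi> y * \<zeta> n y) *\<^sub>R G y) \<longlonglongrightarrow> (\<psi> y * 1) *\<^sub>R G y" by (intro tendsto_intros \<zeta>_lim)
      then show "(\<lambda>n. (\<psi> y * \<zeta> n y) *\<^sub>R G y) \<longlonglongrightarrow> \<psi> y *\<^sub>R G y" by simp
    qed
    show "AE y in lborel. norm ((\<psi> y * \<zeta> n y) *\<^sub>R G y) \<le> M * norm (G y)" for n
    proof (intro AE_I2)
      fix y
      have "\<bar>\<psi> y\<bar> * \<bar>\<zeta> n y\<bar> \<le> M * 1" using M M0 \<zeta>1 by (intro mult_mono) auto
      then show "norm ((\<psi> y * \<zeta> n y) *\<^sub>R G y) \<le> M * norm (G y)" by (simp add: abs_mult mult_right_mono)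
    qed
  qed measurable
  have "(\<lambda>n. \<integral>y. u y *\<^sub>R E n y \<partial>lborel) \<longlonglongrightarrow> - (\<integral>y. \<psi> y *\<^sub>R G y \<partial>lborel)"
    unfolding eq by (intro tendsto_minus l2)
  with l1 show ?thesis by (rule LIMSEQ_unique)
qed

text \<open>The gradient of a mollification of u is the mollification of G, hence bounded by L times
  the mass of the mollifier on a ball around x0. The mean value inequality applies to the
  mollification, and continuity of u at the two points removes it.\<close>

lemma weak_gradient_lipschitz:
  fixes u :: "real^'n \<Rightarrow> real"
  assumes w: "is_weak_gradient u G" and u: "integrable lborel u" and cu: "continuous_on UNIV u"
    and L: "0 \<le> L" and G: "AE y in lborel. dist y x0 < r \<longrightarrow> norm (G y) \<le> L" and x: "dist x x0 < r"
  shows "\<bar>u x - u x0\<bar> \<le> L * dist x x0"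
proof (rule field_le_epsilon)
  fix e :: real assume e: "0 < e"
  have [measurable]: "u \<in> borel_measurable borel" using u by simp
  have "isCont u x" "isCont u x0" using cu by (auto simp: continuous_on_eq_continuous_at)
  then obtain \<epsilon>1 \<epsilon>2 where \<epsilon>12: "0 < \<epsilon>1" "\<And>y. dist y x < \<epsilon>1 \<Longrightarrow> dist (u y) (u x) < e/2"
     "0 < \<epsilon>2" "\<And>y. dist y x0 < \<epsilon>2 \<Longrightarrow> dist (u y) (u x0) < e/2"
    unfolding continuous_at_eps_delta using e by (metis half_gt_zero)
  \<comment> \<open>The third term keeps every ball of radius \<epsilon> around a point of the
    segment's ball inside the region where |G| \<le> L.\<close>
  define \<epsilon> where "\<epsilon> = min (min \<epsilon>1 \<epsilon>2) (r - dist x x0)"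
  have \<epsilon>: "0 < \<epsilon>" "\<epsilon> \<le> \<epsilon>1" "\<epsilon> \<le> \<epsilon>2" "\<epsilon> \<le> r - dist x x0" using \<epsilon>12 x by (auto simp: \<epsilon>_def)
  define \<phi> where "\<phi> y = bump (y /\<^sub>R \<epsilon>)" for y :: "real^'n"
  define D where "D y = bump_grad (y /\<^sub>R \<epsilon>) /\<^sub>R \<epsilon>" for y :: "real^'n"
  have q: "quadratic_gradient (27 / \<epsilon>\<^sup>2) \<phi> D" unfolding \<phi>_def D_def by (rule bump_scaled) fact
  note [measurable] = quadratic_gradient_measurable[OF q]
  have \<phi>0: "0 \<le> \<phi> y" "\<phi> y \<le> 1" for y unfolding \<phi>_def by (rule bump_bounds)+
  have \<phi>s: "\<phi> y = 0" if "\<epsilon> \<le> norm y" for y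
    unfolding \<phi>_def by (rule bump_bounds(3)) (use that \<epsilon>(1) in \<open>simp add: field_simps\<close>)
  define M where "M = max 1 (4 / \<epsilon>)"
  have M: "\<bar>\<phi> y\<bar> \<le> M" "norm (D y) \<le> M" for y
  proof -
    show "\<bar>\<phi> y\<bar> \<le> M" using \<phi>0[of y] by (simp add: M_def)
    have "norm (D y) \<le> 4 / \<epsilon>" unfolding D_def using bump_grad_bound[of "y /\<^sub>R \<epsilon>"] \<epsilon>(1) by (simp add: field_simps)
    then show "norm (D y) \<le> M" by (simp add: M_def)
  qed
  have \<phi>i: "integrable lborel \<phi>"
  proof (rule Bochner_Integration.integrable_bound)
    show "integrable lborel (indicator (cball 0 \<epsilon>) :: real^'n \<Rightarrow> real)"
      by (rule integrable_real_indicator[OF _ emeasure_bounded_finite]) auto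
    show "AE y in lborel. norm (\<phi> y) \<le> norm (indicat_real (cball 0 \<epsilon>) y)"
      using \<phi>0 \<phi>s by (intro AE_I2) (auto simp: indicator_def)
  qed simp
  \<comment> \<open>The mollifier is left unnormalised; its mass Z is divided out at the end, which
    only needs Z > 0.\<close>
  define Z where "Z = (\<integral>y. \<phi> y \<partial>lborel)"
  have Z: "0 < Z"
  proof -
    have fin: "emeasure lborel (cball (0::real^'n) (\<epsilon>/2)) < \<infinity>" by (rule emeasure_bounded_finite) simp
    have "0 < 1/2 * measure lborel (cball (0::real^'n) (\<epsilon>/2))" using \<epsilon>(1) by (simp add: content_cball_pos)
    also have "\<dots> = (\<integral>y. 1/2 * indicator (cball (0::real^'n) (\<epsilon>/2)) y \<partial>lborel)" by simp
    also have "\<dots> \<le> Z" unfolding Z_def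
    proof (rule integral_mono[OF integrable_mult_right[OF integrable_real_indicator[OF _ fin]] \<phi>i])
      fix y :: "real^'n"
      show "1/2 * indicator (cball 0 (\<epsilon>/2)) y \<le> \<phi> y"
      proof (cases "norm y \<le> \<epsilon>/2")
        case True
        then have "norm (y /\<^sub>R \<epsilon>) \<le> 1/2" using \<epsilon>(1) by (simp add: field_simps)
        then have "(norm (y /\<^sub>R \<epsilon>))\<^sup>2 \<le> (1/2)\<^sup>2" by (intro power_mono) auto
        moreover have "(1/2::real)\<^sup>2 = 1/4" by (simp add: power2_eq_square)
        ultimately have "3/4 \<le> max 0 (1 - (norm (y /\<^sub>R \<epsilon>))\<^sup>2)" by linarith
        from power_mono[OF this, of 2] have "(3/4)\<^sup>2 \<le> \<phi> y" unfolding \<phi>_def bump_def by (simp only: zero_le_divide_iff zero_le_numeral simp_thms)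
        then show ?thesis using True by (simp add: indicator_def power2_eq_square)
      qed (simp add: indicator_def \<phi>0)
    qed simp
    finally show ?thesis .
  qed
  have \<phi>ri: "integrable lborel (\<lambda>y. \<phi> (p - y))" "(\<integral>y. \<phi> (p - y) \<partial>lborel) = Z" for p
    using lborel_integral_reflect[of \<phi> p] \<phi>i by (auto simp: Z_def)
  define U where "U p = (\<integral>y. \<phi> (p - y) * u y \<partial>lborel)" for p
  define U' where "U' p = (\<integral>y. u y *\<^sub>R D (p - y) \<partial>lborel)" for p
  note conv = quadratic_gradient_convolution[OF q M u]
  have U: "(U has_derivative (\<lambda>h. U' p \<bullet> h)) (at p)" for p
    unfolding U_def U'_def by (rule quadratic_gradient_has_derivative[OF conv(1)])
  have U'_eq: "U' p = (\<integral>y. \<phi> (p - y) *\<^sub>R G y \<partial>lborel)" for p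
  proof -
    have q': "quadratic_gradient (27 / \<epsilon>\<^sup>2) (\<lambda>y. \<phi> (p - y)) (\<lambda>y. - D (p - y))"
      using quadratic_gradient_affine[OF q, of "-1" p] by simp
    have s': "\<phi> (p - y) = 0" if "norm p + \<epsilon> < norm y" for y
      using that norm_triangle_ineq2[of y p] by (intro \<phi>s) (simp add: norm_minus_commute)
    note test = test_functionI[OF quadratic_gradient_has_derivative[OF q'] quadratic_gradient_continuous(1)[OF q'] s']
    have "(\<integral>y. u y *\<^sub>R (- D (p - y)) \<partial>lborel) = - (\<integral>y. \<phi> (p - y) *\<^sub>R G y \<partial>lborel)"
      by (rule is_weak_gradientD[OF w test])
    then show ?thesis by (simp add: U'_def)
  qed
  have U'_le: "norm (U' p) \<le> L * Z" if "dist p x0 \<le> dist x x0" for p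
  proof -
    have "AE y in lborel. norm (\<phi> (p - y) *\<^sub>R G y) \<le> L * \<phi> (p - y)"
      using G
    proof eventually_elim
      case (elim y)
      show ?case
      proof (cases "norm (p - y) < \<epsilon>")
        case True
        then have "dist y x0 < r" using that \<epsilon>(4) dist_triangle[of y x0 p] by (simp add: dist_norm norm_minus_commute)
        then show ?thesis using elim \<phi>0[of "p - y"] by (simp add: mult.commute[of "\<phi> (p - y)"] mult_right_mono)
      qed (simp add: \<phi>s)
    qed
    then have "norm (U' p) \<le> (\<integral>y. L * \<phi> (p - y) \<partial>lborel)"
      unfolding U'_eq by (intro norm_integral_le_AE) (simp_all add: \<phi>ri)
    then show ?thesis by (simp add: \<phi>ri)
  qed
  have UL: "norm (U x - U x0) \<le> L * Z * norm (x - x0)"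
  proof (rule differentiable_bound[of "cball x0 (dist x x0)" U "\<lambda>p h. U' p \<bullet> h"])
    show "onorm ((\<bullet>) (U' p)) \<le> L * Z" if "p \<in> cball x0 (dist x x0)" for p
    proof (rule onorm_le)
      fix h
      have "norm (U' p \<bullet> h) \<le> norm (U' p) * norm h" using Cauchy_Schwarz_ineq2[of "U' p" h] by simp
      also have "\<dots> \<le> L * Z * norm h" using U'_le[of p] that by (intro mult_right_mono) (simp_all add: dist_commute)
      finally show "norm (U' p \<bullet> h) \<le> L * Z * norm h" .
    qed
  qed (auto intro: has_derivative_at_withinI U simp: dist_commute)
  have close: "\<bar>U p - u p * Z\<bar> \<le> e / 2 * Z" if "\<And>y. dist y p < \<epsilon> \<Longrightarrow> dist (u y) (u p) < e/2" for p
  proof -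
    have "U p - u p * Z = (\<integral>y. \<phi> (p - y) * u y - \<phi> (p - y) * u p \<partial>lborel)"
      unfolding U_def using conv(2)[of p] \<phi>ri[of p] by simp
    also have "norm \<dots> \<le> (\<integral>y. e / 2 * \<phi> (p - y) \<partial>lborel)"
    proof (rule norm_integral_le_AE)
      show "AE y in lborel. norm (\<phi> (p - y) * u y - \<phi> (p - y) * u p) \<le> e / 2 * \<phi> (p - y)"
      proof (intro AE_I2)
        fix y
        show "norm (\<phi> (p - y) * u y - \<phi> (p - y) * u p) \<le> e / 2 * \<phi> (p - y)"
        proof (cases "norm (p - y) < \<epsilon>")
          case True
          then have "\<bar>u y - u p\<bar> \<le> e/2" using that[of y] by (simp add: dist_norm norm_minus_commute)
          then have "\<phi> (p - y) * \<bar>u y - u p\<bar> \<le> \<phi> (p - y) * (e/2)" using \<phi>0 by (intro mult_left_mono) auto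
          then show ?thesis using \<phi>0[of "p - y"] by (simp add: right_diff_distrib[symmetric] abs_mult mult.commute[of e])
        qed (simp add: \<phi>s)
      qed
    qed (simp add: \<phi>ri)
    also have "\<dots> = e / 2 * Z" by (simp add: \<phi>ri)
    finally show ?thesis by simp
  qed
  have "\<bar>U x - u x * Z\<bar> \<le> e / 2 * Z"
    by (rule close, rule \<epsilon>12(2)) (use \<epsilon>(2) in linarith)
  moreover have "\<bar>U x0 - u x0 * Z\<bar> \<le> e / 2 * Z"
    by (rule close, rule \<epsilon>12(4)) (use \<epsilon>(3) in linarith)
  ultimately have "\<bar>u x * Z - u x0 * Z\<bar> \<le> L * Z * norm (x - x0) + e * Z"
    using UL unfolding real_norm_def by linarith
  also have "\<bar>u x * Z - u x0 * Z\<bar> = \<bar>u x - u x0\<bar> * Z" using Z by (simp add: left_diff_distrib[symmetric] abs_mult)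
  finally have "\<bar>u x - u x0\<bar> * Z \<le> (L * dist x x0 + e) * Z" by (simp add: algebra_simps dist_norm)
  then show "\<bar>u x - u x0\<bar> \<le> L * dist x x0 + e" using Z by simp
qed

section \<open>Radial profiles obtained by subordination\<close>

context subordinator_index
begin

text \<open>Boundedness serves s \<le> 1 and the tail s^(-\<beta>-1) serves s > 1. The cut at 1 is
  made by the factors e^(-s) and e^(-1/s), each paid for with a constant e, so that the majorant
  consists of integrals already computed.\<close>

lemma eta_integrable: "set_integrable lborel {0..} \<eta>"
proof -
  have i1: "integrable lborel (\<lambda>s::real. indicator {0..} s * (s powr (1 - 1) * exp (- (1 * s))))"
    by (rule integrable.intros[OF has_bochner_integral_Gamma_scaled']) auto
  have i2: "integrable lborel (\<lambda>s::real. indicator {0..} s * (s powr (- \<beta> - 1) * exp (- (1 / s))))"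
    by (rule integrable.intros[OF has_bochner_integral_inverse_Gamma]) (use \<beta> in auto)
  let ?g = "\<lambda>s. exp 1 * \<eta>_sup * (indicator {0..} s * (s powr (1 - 1) * exp (- (1 * s))))
     + exp 1 * \<eta>_C1 * (indicator {0..} s * (s powr (- \<beta> - 1) * exp (- (1 / s))))"
  have g: "integrable lborel ?g" by (intro Bochner_Integration.integrable_add integrable_mult_right i1 i2)
  have sup0: "0 \<le> \<eta>_sup" using eta_bounded[of 0] by simp
  have C0: "0 \<le> \<eta>_C1" using eta_expansion(1)[of 1] by simp
  have "AE s in lborel. norm (indicator {0..} s *\<^sub>R \<eta> s) \<le> norm (?g s)"
    using AE_lborel_singleton[of 0]
  proof eventually_elim
    case (elim s)
    show ?case
    proof (cases "0 < s")
      case True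
      have p1: "0 \<le> exp 1 * \<eta>_sup * exp (- s)" using sup0 by simp
      have p2: "0 \<le> exp 1 * \<eta>_C1 * (s powr (- \<beta> - 1) * exp (- (1 / s)))" using C0 by simp
      have "\<bar>\<eta> s\<bar> \<le> exp 1 * \<eta>_sup * exp (- s) + exp 1 * \<eta>_C1 * (s powr (- \<beta> - 1) * exp (- (1 / s)))"
      proof (cases "s \<le> 1")
        case True
        then have "1 \<le> exp (1 - s)" by simp
        then have "\<eta>_sup * 1 \<le> \<eta>_sup * exp (1 - s)" using sup0 by (rule mult_left_mono)
        also have "\<dots> = exp 1 * \<eta>_sup * exp (- s)" by (simp add: exp_diff exp_minus divide_inverse)
        finally show ?thesis using p2 eta_bounded[of s] \<open>0 < s\<close> by linarith
      next
        case False
        then have "1 \<le> exp (1 - 1/s)" by simp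
        then have "\<eta>_C1 * s powr (- \<beta> - 1) * 1 \<le> \<eta>_C1 * s powr (- \<beta> - 1) * exp (1 - 1/s)" using C0 by (intro mult_left_mono) auto
        also have "\<dots> = exp 1 * \<eta>_C1 * (s powr (- \<beta> - 1) * exp (- (1 / s)))" by (simp add: exp_diff exp_minus divide_inverse)
        finally show ?thesis using p1 eta_expansion(1)[of s] \<open>0 < s\<close> by linarith
      qed
      then show ?thesis using True by simp
    qed (use elim in \<open>simp add: indicator_def\<close>)
  qed
  then show ?thesis unfolding set_integrable_def
    by (rule Bochner_Integration.integrable_bound[OF g, rotated]) simp
qed

text \<open>Up to the factor \<open>(4\<pi>)\<^sup>-\<^sup>k\<close>, \<open>gk k (|x|\<^sup>2)\<close> is the kernel in dimension \<open>2k\<close>, so that its derivative in \<open>\<rho>\<close> is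
  \<open>- gk (k + 1) / 4\<close>: differentiating raises the dimension by two.\<close>

definition gk :: "real \<Rightarrow> real \<Rightarrow> real" where
  "gk k \<rho> = (\<integral>s. indicator {0..} s * (\<eta> s * (s powr (- k) * exp (- (\<rho> / (4 * s))))) \<partial>lborel)"

lemma gk_majorant:
  fixes k \<rho> :: real
  assumes "0 < k" "0 < \<rho>"
  shows "has_bochner_integral lborel (\<lambda>s. indicator {0..} s * (s powr (- k - 1) * exp (- (\<rho> / (4 * s))))) (Gamma k / (\<rho> / 4) powr k)"
  using has_bochner_integral_inverse_Gamma[of k "\<rho> / 4"] assms by simp

text \<open>The expansion of \<open>\<eta>\<close> is inserted under the integral. Each power
  s^(-b-1) against exp(-\<rho>/(4s)) gives Gamma(b) (\<rho>/4)^(-b), so the leading coefficient in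
  \<rho> is exact and the error gains a further factor \<rho>^(-\<beta>).\<close>

lemma gk_integrable:
  assumes "0 \<le> k" "0 < \<rho>"
  shows "integrable lborel (\<lambda>s. indicator {0..} s * (\<eta> s * (s powr (- k) * exp (- (\<rho> / (4 * s))))))"
    and "\<bar>gk k \<rho>\<bar> \<le> \<eta>_C1 * (Gamma (k + \<beta>) / (\<rho> / 4) powr (k + \<beta>))"
    and "\<bar>gk k \<rho> - \<eta>_lead * (Gamma (k + \<beta>) / (\<rho> / 4) powr (k + \<beta>))\<bar> \<le> \<eta>_C2 * (Gamma (k + 2 * \<beta>) / (\<rho> / 4) powr (k + 2 * \<beta>))"
proof -
  let ?e = "\<lambda>s. exp (- (\<rho> / (4 * s)))"
  let ?f = "\<lambda>s. indicator {0..} s * (\<eta> s * (s powr (- k) * ?e s))"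
  have h1: "has_bochner_integral lborel (\<lambda>s. indicator {0..} s * (s powr (- (k + \<beta>) - 1) * ?e s)) (Gamma (k + \<beta>) / (\<rho> / 4) powr (k + \<beta>))"
    by (rule gk_majorant) (use assms \<beta> in auto)
  have h2: "has_bochner_integral lborel (\<lambda>s. indicator {0..} s * (s powr (- (k + 2 * \<beta>) - 1) * ?e s)) (Gamma (k + 2 * \<beta>) / (\<rho> / 4) powr (k + 2 * \<beta>))"
    by (rule gk_majorant) (use assms \<beta> in auto)
  note i1 = integrable.intros[OF h1] and v1 = has_bochner_integral_integral_eq[OF h1]
  note i2 = integrable.intros[OF h2] and v2 = has_bochner_integral_integral_eq[OF h2]
  have p1: "s powr (- \<beta> - 1) * s powr (- k) = s powr (- (k + \<beta>) - 1)" for s :: real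
    by (simp add: powr_add[symmetric] algebra_simps)
  have p2: "s powr (- 2 * \<beta> - 1) * s powr (- k) = s powr (- (k + 2 * \<beta>) - 1)" for s :: real
    by (simp add: powr_add[symmetric] algebra_simps)
  have b1: "norm (?f s) \<le> \<eta>_C1 * (indicator {0..} s * (s powr (- (k + \<beta>) - 1) * ?e s))" for s
  proof (cases "0 < s")
    case True
    have "\<bar>\<eta> s\<bar> * (s powr (- k) * ?e s) \<le> \<eta>_C1 * s powr (- \<beta> - 1) * (s powr (- k) * ?e s)"
      by (intro mult_right_mono eta_expansion(1) True) simp
    also have "\<dots> = \<eta>_C1 * (s powr (- \<beta> - 1) * s powr (- k) * ?e s)" by (simp only: mult.assoc)
    finally show ?thesis using True unfolding p1 by (simp add: abs_mult)
  qed (auto simp: indicator_def)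
  have b2: "norm (?f s - \<eta>_lead * (indicator {0..} s * (s powr (- (k + \<beta>) - 1) * ?e s))) \<le> \<eta>_C2 * (indicator {0..} s * (s powr (- (k + 2 * \<beta>) - 1) * ?e s))" for s
  proof (cases "0 < s")
    case True
    have "\<eta> s * (s powr (- k) * ?e s) - \<eta>_lead * (s powr (- \<beta> - 1) * s powr (- k) * ?e s) = (\<eta> s - \<eta>_lead * s powr (- \<beta> - 1)) * (s powr (- k) * ?e s)"
      by (simp add: left_diff_distrib mult.assoc)
    moreover have "\<bar>\<eta> s - \<eta>_lead * s powr (- \<beta> - 1)\<bar> * (s powr (- k) * ?e s) \<le> \<eta>_C2 * s powr (- 2 * \<beta> - 1) * (s powr (- k) * ?e s)"
      by (intro mult_right_mono eta_expansion(2) True) simp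
    moreover have "\<eta>_C2 * s powr (- 2 * \<beta> - 1) * (s powr (- k) * ?e s) = \<eta>_C2 * (s powr (- 2 * \<beta> - 1) * s powr (- k) * ?e s)" by (simp only: mult.assoc)
    ultimately have "\<bar>\<eta> s * (s powr (- k) * ?e s) - \<eta>_lead * (s powr (- \<beta> - 1) * s powr (- k) * ?e s)\<bar> \<le> \<eta>_C2 * (s powr (- 2 * \<beta> - 1) * s powr (- k) * ?e s)"
      by (simp add: abs_mult)
    then show ?thesis using True unfolding p1 p2 by simp
  qed (auto simp: indicator_def)
  show i: "integrable lborel ?f"
    by (rule Bochner_Integration.integrable_bound[OF integrable_mult_right[OF i1, of \<eta>_C1]])
      (use b1 in \<open>auto intro: order_trans[OF _ abs_ge_self]\<close>)
  have "norm (gk k \<rho>) \<le> (\<integral>s. \<eta>_C1 * (indicator {0..} s * (s powr (- (k + \<beta>) - 1) * ?e s)) \<partial>lborel)"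
    unfolding gk_def by (rule Bochner_Integration.integral_norm_bound_integral[OF i integrable_mult_right[OF i1]]) (rule b1)
  then show "\<bar>gk k \<rho>\<bar> \<le> \<eta>_C1 * (Gamma (k + \<beta>) / (\<rho> / 4) powr (k + \<beta>))"
    by (simp only: integral_mult_right_zero v1 real_norm_def)
  let ?d = "\<lambda>s. ?f s - \<eta>_lead * (indicator {0..} s * (s powr (- (k + \<beta>) - 1) * ?e s))"
  have "gk k \<rho> - \<eta>_lead * (Gamma (k + \<beta>) / (\<rho> / 4) powr (k + \<beta>)) = (\<integral>s. ?d s \<partial>lborel)"
    unfolding gk_def v1[symmetric] integral_mult_right_zero[symmetric] by (rule Bochner_Integration.integral_diff[symmetric, OF i integrable_mult_right[OF i1]])
  moreover have "norm (\<integral>s. ?d s \<partial>lborel) \<le> (\<integral>s. \<eta>_C2 * (indicator {0..} s * (s powr (- (k + 2 * \<beta>) - 1) * ?e s)) \<partial>lborel)"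
    by (rule Bochner_Integration.integral_norm_bound_integral[OF Bochner_Integration.integrable_diff[OF i integrable_mult_right[OF i1]] integrable_mult_right[OF i2]]) (rule b2)
  moreover have "(\<integral>s. \<eta>_C2 * (indicator {0..} s * (s powr (- (k + 2 * \<beta>) - 1) * ?e s)) \<partial>lborel) = \<eta>_C2 * (Gamma (k + 2 * \<beta>) / (\<rho> / 4) powr (k + 2 * \<beta>))"
    unfolding integral_mult_right_zero v2 ..
  ultimately show "\<bar>gk k \<rho> - \<eta>_lead * (Gamma (k + \<beta>) / (\<rho> / 4) powr (k + \<beta>))\<bar> \<le> \<eta>_C2 * (Gamma (k + 2 * \<beta>) / (\<rho> / 4) powr (k + 2 * \<beta>))"
    by (simp only: real_norm_def)
qed

text \<open>Differentiating exp(-\<rho>/(4s)) brings down -1/(4s), which raises k by one. The Taylor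
  remainder is integrated directly: for |h| \<le> \<rho>/2 the factor exp(|h|/(4s)) uses up at most
  half of the exponential decay, which accounts for \<rho>/8 in the constant.\<close>

lemma gk_has_derivative:
  assumes k: "0 \<le> k" and \<rho>: "0 < \<rho>"
  shows "(gk k has_real_derivative - (gk (k + 1) \<rho> / 4)) (at \<rho>)"
proof -
  define C where "C = \<eta>_C1 / 16 * (Gamma (k + 2 + \<beta>) / (\<rho> / 8) powr (k + 2 + \<beta>))"
  have est: "\<bar>gk k (\<rho> + h) - gk k \<rho> + h * (gk (k + 1) \<rho> / 4)\<bar> \<le> C * h\<^sup>2" if h: "\<bar>h\<bar> \<le> \<rho> / 2" for h
  proof -
    have \<rho>h: "0 < \<rho> + h" using h \<rho> by linarith
    let ?f = "\<lambda>k \<rho> s. indicator {0..} s * (\<eta> s * (s powr (- k) * exp (- (\<rho> / (4 * s)))))"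
    let ?g = "\<lambda>s. indicator {0..} s * (s powr (- (k + 2 + \<beta>) - 1) * exp (- (\<rho> / 2 / (4 * s))))"
    have m: "has_bochner_integral lborel ?g (Gamma (k + 2 + \<beta>) / (\<rho> / 2 / 4) powr (k + 2 + \<beta>))"
      by (rule gk_majorant) (use assms \<beta> in auto)
    note fi = gk_integrable(1)[OF k \<rho>] gk_integrable(1)[OF k \<rho>h] gk_integrable(1)[of "k + 1", OF _ \<rho>]
    have b: "norm (?f k (\<rho> + h) s - ?f k \<rho> s + h / 4 * ?f (k + 1) \<rho> s) \<le> \<eta>_C1 / 16 * h\<^sup>2 * ?g s" for s
    proof (cases "0 < s")
      case True
      define y where "y = h / (4 * s)"
      have e1: "exp (- ((\<rho> + h) / (4 * s))) = exp (- (\<rho> / (4 * s))) * exp (- y)"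
        unfolding y_def exp_add[symmetric] by (simp add: add_divide_distrib)
      have e2: "s powr (- (k + 1)) = s powr (- k) / s"
        using True by (simp add: powr_diff)
      have "?f k (\<rho> + h) s - ?f k \<rho> s + h / 4 * ?f (k + 1) \<rho> s = \<eta> s * (s powr (- k) * (exp (- (\<rho> / (4 * s))) * (exp (- y) - 1 + y)))"
        using True unfolding e1 e2 by (simp add: y_def algebra_simps)
      also have "norm \<dots> \<le> \<eta>_C1 * s powr (- \<beta> - 1) * (s powr (- k) * (exp (- (\<rho> / (4 * s))) * (y\<^sup>2 * exp \<bar>y\<bar>)))"
        unfolding real_norm_def abs_mult using eta_expansion(1)[OF True]
        by (intro mult_mono exp_taylor2) auto
      also have "\<dots> \<le> \<eta>_C1 * s powr (- \<beta> - 1) * (s powr (- k) * (y\<^sup>2 * exp (- (\<rho> / 2 / (4 * s)))))"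
      proof -
        have "\<bar>h\<bar> / (4 * s) \<le> \<rho> / 2 / (4 * s)" using True by (intro divide_right_mono h) auto
        then have "\<bar>y\<bar> \<le> \<rho> / 2 / (4 * s)" using True by (simp add: y_def abs_divide)
        then have "exp (- (\<rho> / (4 * s))) * exp \<bar>y\<bar> \<le> exp (- (\<rho> / 2 / (4 * s)))"
          unfolding exp_add[symmetric] by simp
        then have "y\<^sup>2 * (exp (- (\<rho> / (4 * s))) * exp \<bar>y\<bar>) \<le> y\<^sup>2 * exp (- (\<rho> / 2 / (4 * s)))" by (intro mult_left_mono) auto
        moreover have "0 \<le> \<eta>_C1" using eta_expansion(1)[of 1] by simp
        ultimately show ?thesis by (intro mult_left_mono) (auto simp: mult.left_commute)
      qed
      also have "\<dots> = \<eta>_C1 / 16 * h\<^sup>2 * ?g s"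
      proof -
        have "s powr (- \<beta> - 1) * (s powr (- k) * (1 / s\<^sup>2)) = s powr (- (k + 2 + \<beta>) - 1)"
        proof -
          have "1 / s\<^sup>2 = s powr (- 2)" using True by (simp add: powr_minus_divide powr_realpow[of s 2, simplified])
          then show ?thesis by (simp add: powr_add[symmetric] algebra_simps)
        qed
        moreover have y2: "y\<^sup>2 = h\<^sup>2 / 16 * (1 / s\<^sup>2)" by (simp add: y_def power_divide power_mult_distrib)
        have "\<eta>_C1 * s powr (- \<beta> - 1) * (s powr (- k) * (y\<^sup>2 * exp (- (\<rho> / 2 / (4 * s)))))
          = \<eta>_C1 / 16 * h\<^sup>2 * (s powr (- \<beta> - 1) * (s powr (- k) * (1 / s\<^sup>2)) * exp (- (\<rho> / 2 / (4 * s))))"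
          unfolding y2 by (simp only: divide_inverse mult_ac)
        ultimately show ?thesis using True by simp
      qed
      finally show ?thesis .
    qed (auto simp: indicator_def)
    have k1: "0 \<le> k + 1" using k by simp
    have I: "integrable lborel (\<lambda>s. ?f k (\<rho> + h) s - ?f k \<rho> s + h / 4 * ?f (k + 1) \<rho> s)"
      by (intro Bochner_Integration.integrable_add Bochner_Integration.integrable_diff integrable_mult_right gk_integrable(1) k k1 \<rho> \<rho>h)
    have "gk k (\<rho> + h) - gk k \<rho> + h / 4 * gk (k + 1) \<rho> = (\<integral>s. ?f k (\<rho> + h) s - ?f k \<rho> s + h / 4 * ?f (k + 1) \<rho> s \<partial>lborel)"
      unfolding gk_def using fi k by simp
    moreover have "norm (\<integral>s. ?f k (\<rho> + h) s - ?f k \<rho> s + h / 4 * ?f (k + 1) \<rho> s \<partial>lborel) \<le> (\<integral>s. \<eta>_C1 / 16 * h\<^sup>2 * ?g s \<partial>lborel)"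
      by (rule Bochner_Integration.integral_norm_bound_integral[OF I integrable_mult_right[OF integrable.intros[OF m]]]) (rule b)
    moreover have "(\<integral>s. \<eta>_C1 / 16 * h\<^sup>2 * ?g s \<partial>lborel) = \<eta>_C1 / 16 * h\<^sup>2 * (Gamma (k + 2 + \<beta>) / (\<rho> / 2 / 4) powr (k + 2 + \<beta>))"
      unfolding integral_mult_right_zero has_bochner_integral_integral_eq[OF m] ..
    moreover have "\<eta>_C1 / 16 * h\<^sup>2 * (Gamma (k + 2 + \<beta>) / (\<rho> / 2 / 4) powr (k + 2 + \<beta>)) = C * h\<^sup>2"
    proof -
      have "\<rho> / 2 / 4 = \<rho> / 8" by simp
      then show ?thesis unfolding C_def by (simp only: mult_ac)
    qed
    moreover have "h * (gk (k + 1) \<rho> / 4) = h / 4 * gk (k + 1) \<rho>" by simp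
    ultimately show ?thesis by (simp only: real_norm_def)
  qed
  have "(\<lambda>h. (gk k (\<rho> + h) - gk k \<rho>) / h - (- (gk (k + 1) \<rho> / 4))) \<midarrow>0\<rightarrow> 0"
  proof (rule Lim_null_comparison)
    show "((\<lambda>h. C * \<bar>h\<bar>) \<longlongrightarrow> 0) (at 0)" by (intro tendsto_mult_right_zero tendsto_rabs_zero tendsto_ident_at)
    show "\<forall>\<^sub>F h in at 0. norm ((gk k (\<rho> + h) - gk k \<rho>) / h - (- (gk (k + 1) \<rho> / 4))) \<le> C * \<bar>h\<bar>"
      unfolding eventually_at
    proof (intro exI[of _ "\<rho> / 2"] conjI ballI impI)
      fix h :: real assume h: "h \<noteq> 0 \<and> dist h 0 < \<rho> / 2"
      then have "\<bar>gk k (\<rho> + h) - gk k \<rho> + h * (gk (k + 1) \<rho> / 4)\<bar> \<le> C * \<bar>h\<bar> * \<bar>h\<bar>"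
        using est[of h] by (simp add: power2_eq_square mult.assoc)
      then have "\<bar>(gk k (\<rho> + h) - gk k \<rho> + h * (gk (k + 1) \<rho> / 4)) / h\<bar> \<le> C * \<bar>h\<bar>"
        using h by (simp add: abs_divide pos_divide_le_eq)
      moreover have "(gk k (\<rho> + h) - gk k \<rho>) / h - (- (gk (k + 1) \<rho> / 4)) = (gk k (\<rho> + h) - gk k \<rho> + h * (gk (k + 1) \<rho> / 4)) / h"
        using h by (simp add: add_divide_distrib)
      ultimately show "norm ((gk k (\<rho> + h) - gk k \<rho>) / h - (- (gk (k + 1) \<rho> / 4))) \<le> C * \<bar>h\<bar>" by simp
    qed (use \<rho> in simp)
  qed
  then show ?thesis unfolding DERIV_def by (rule LIM_zero_cancel)
qed

end

section \<open>The subordination formula for the kernel at time one\<close>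

context subordinator_index
begin

lemma exp_weight_integrable:
  "integrable lborel (\<lambda>\<xi>::real^'n. (1 + norm \<xi>)\<^sup>2 * exp (- (norm \<xi> powr (2 * \<beta>))))"
proof -
  have "1 \<le> 2 * \<beta>" "0 < real CARD('n) + 3" using \<beta> by auto
  then obtain C where C: "0 < C" "\<And>r. 0 \<le> r \<Longrightarrow> exp (- (r powr (2 * \<beta>))) \<le> C * (1 + r) powr (- (real CARD('n) + 3))"
    using exp_minus_powr_le_weight by metis
  have i: "integrable lborel (\<lambda>\<xi>::real^'n. C * (1 + norm \<xi>) powr (- (real CARD('n) + 1)))"
    by (intro integrable_mult_right integrable_weight) simp
  have b: "norm ((1 + norm \<xi>)\<^sup>2 * exp (- (norm \<xi> powr (2 * \<beta>)))) \<le> norm (C * (1 + norm \<xi>) powr (- (real CARD('n) + 1)))" for \<xi> :: "real^'n"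
  proof -
    have n: "0 < 1 + norm \<xi>" by (simp add: add_pos_nonneg)
    have "(1 + norm \<xi>)\<^sup>2 * exp (- (norm \<xi> powr (2 * \<beta>))) \<le> (1 + norm \<xi>)\<^sup>2 * (C * (1 + norm \<xi>) powr (- (real CARD('n) + 3)))"
      by (intro mult_left_mono C) auto
    also have "\<dots> = C * ((1 + norm \<xi>) powr 2 * (1 + norm \<xi>) powr (- (real CARD('n) + 3)))"
      using n by simp
    also have "(1 + norm \<xi>) powr 2 * (1 + norm \<xi>) powr (- (real CARD('n) + 3)) = (1 + norm \<xi>) powr (- (real CARD('n) + 1))"
      unfolding powr_add[symmetric] by (rule arg_cong[where f="\<lambda>a. (1 + norm \<xi>) powr a"]) simp
    finally show ?thesis using C(1) by simp
  qed
  show ?thesis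
    by (rule Bochner_Integration.integrable_bound[OF i]) (use b in auto)
qed

lemma exp_integrable: "integrable lborel (\<lambda>\<xi>::real^'n. exp (- (norm \<xi> powr (2 * \<beta>))))"
proof (rule Bochner_Integration.integrable_bound[OF exp_weight_integrable])
  show "AE \<xi>::real^'n in lborel. norm (exp (- (norm \<xi> powr (2 * \<beta>)))) \<le> norm ((1 + norm \<xi>)\<^sup>2 * exp (- (norm \<xi> powr (2 * \<beta>))))"
  proof (intro AE_I2)
    fix \<xi> :: "real^'n"
    have "1 \<le> (1 + norm \<xi>)\<^sup>2" by (simp add: one_le_power)
    from mult_right_mono[OF this, of "exp (- (norm \<xi> powr (2 * \<beta>)))"]
    show "norm (exp (- (norm \<xi> powr (2 * \<beta>)))) \<le> norm ((1 + norm \<xi>)\<^sup>2 * exp (- (norm \<xi> powr (2 * \<beta>))))"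
      by (simp add: abs_mult)
  qed
qed simp

lemma cis_exp_integrable:
  "integrable lborel (\<lambda>\<xi>::real^'n. cis (x \<bullet> \<xi>) * complex_of_real (exp (- (norm \<xi> powr (2 * \<beta>)))))"
  by (rule Bochner_Integration.integrable_bound[OF exp_integrable]) (auto simp: norm_mult)

lemma p_kernel_one_cos:
  "p_kernel (2 * \<beta>) (x :: real^'n) 1 = (\<integral>\<xi>. cos (x \<bullet> \<xi>) * exp (- (norm \<xi> powr (2 * \<beta>))) \<partial>lborel) / (2 * pi) ^ CARD('n)"
  unfolding p_kernel_def using integral_Re[OF cis_exp_integrable[of x]] by simp

text \<open>The extra Gaussian makes the double integral absolutely convergent. Without it the inner
  integral is of order s^(-d/2), which the boundedness of \<open>\<eta>\<close> does not control
  near s = 0 when d \<ge> 2.\<close>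

lemma subordination_regularised:
  fixes x :: "real^'n"
  assumes d: "0 < \<delta>"
  shows "(\<integral>\<xi>. cis (x \<bullet> \<xi>) * complex_of_real (exp (- (norm \<xi> powr (2 * \<beta>)))) * of_real (exp (- (\<delta> * (norm \<xi>)\<^sup>2))) \<partial>lborel)
    = of_real (\<integral>s. indicator {0..} s * (\<eta> s * ((pi / (s + \<delta>)) powr (CARD('n) / 2) * exp (- ((norm x)\<^sup>2 / (4 * (s + \<delta>)))))) \<partial>lborel)"
proof -
  define f where "f = (\<lambda>s (\<xi>::real^'n). of_real (indicator {0..} s * (\<eta> s * exp (- (s * (norm \<xi>)\<^sup>2)))) * (cis (x \<bullet> \<xi>) * complex_of_real (exp (- (\<delta> * (norm \<xi>)\<^sup>2)))))"
  have [measurable]: "case_prod f \<in> borel_measurable (borel \<Otimes>\<^sub>M borel)" unfolding f_def by measurable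
  have gi: "integrable lborel (\<lambda>\<xi>::real^'n. exp (- (\<delta> * (norm \<xi>)\<^sup>2)))" by (rule gaussian_integral(1)[OF d])
  have ei: "integrable lborel (\<lambda>s. indicator {0..} s * \<eta> s)"
    using eta_integrable by (simp add: set_integrable_def)
  have fb: "norm (f s \<xi>) \<le> norm ((indicator {0..} s * \<eta> s) * exp (- (\<delta> * (norm \<xi>)\<^sup>2)))" for s \<xi>
    by (auto simp: f_def norm_mult indicator_def abs_mult intro!: mult_right_mono mult_left_le)
  have fi: "integrable (lborel \<Otimes>\<^sub>M lborel) (case_prod f)"
    by (rule Bochner_Integration.integrable_bound[OF integrable_pair_mult[OF ei gi]]) (use fb in auto)
  have s1: "(\<integral>\<xi>. f s \<xi> \<partial>lborel) = of_real (indicator {0..} s * (\<eta> s * ((pi / (s + \<delta>)) powr (CARD('n) / 2) * exp (- ((norm x)\<^sup>2 / (4 * (s + \<delta>)))))))" for s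
  proof (cases "0 \<le> s")
    case True
    then have sd: "0 < s + \<delta>" using d by simp
    have "f s \<xi> = of_real (\<eta> s) * (cis (x \<bullet> \<xi>) * of_real (exp (- ((s + \<delta>) * (norm \<xi>)\<^sup>2))))" for \<xi>
    proof -
      have "exp (- ((s + \<delta>) * (norm \<xi>)\<^sup>2)) = exp (- (s * (norm \<xi>)\<^sup>2)) * exp (- (\<delta> * (norm \<xi>)\<^sup>2))"
        unfolding exp_add[symmetric] by (simp add: algebra_simps)
      then show ?thesis using True by (simp add: f_def)
    qed
    then have "(\<integral>\<xi>. f s \<xi> \<partial>lborel) = of_real (\<eta> s) * (\<integral>\<xi>. cis (x \<bullet> \<xi>) * of_real (exp (- ((s + \<delta>) * (norm \<xi>)\<^sup>2))) \<partial>lborel)"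
      by (simp only: integral_mult_right_zero)
    then show ?thesis unfolding gaussian_fourier(2)[OF sd] using True by simp
  qed (simp add: f_def)
  have s2: "(\<integral>s. f s \<xi> \<partial>lborel) = cis (x \<bullet> \<xi>) * complex_of_real (exp (- (norm \<xi> powr (2 * \<beta>)))) * of_real (exp (- (\<delta> * (norm \<xi>)\<^sup>2)))" if "\<xi> \<noteq> 0" for \<xi>
  proof -
    have "0 < (norm \<xi>)\<^sup>2" using that by simp
    note L = laplace_eta(2)[OF this]
    have "(\<integral>s. f s \<xi> \<partial>lborel) = (\<integral>s. complex_of_real (indicator {0..} s * (\<eta> s * exp (- (s * (norm \<xi>)\<^sup>2)))) \<partial>lborel) * (cis (x \<bullet> \<xi>) * complex_of_real (exp (- (\<delta> * (norm \<xi>)\<^sup>2))))"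
      unfolding f_def by (rule integral_mult_left_zero)
    also have "(\<integral>s. complex_of_real (indicator {0..} s * (\<eta> s * exp (- (s * (norm \<xi>)\<^sup>2)))) \<partial>lborel) = of_real (exp (- (((norm \<xi>)\<^sup>2) powr \<beta>)))"
      using L by (simp only: integral_complex_of_real set_lebesgue_integral_def real_scaleR_def)
    also have "((norm \<xi>)\<^sup>2) powr \<beta> = norm \<xi> powr (2 * \<beta>)"
      using that by (simp add: powr_powr flip: powr_numeral)
    finally show ?thesis by (simp add: mult_ac)
  qed
  have "(\<integral>\<xi>. \<integral>s. f s \<xi> \<partial>lborel \<partial>lborel) = (\<integral>s. \<integral>\<xi>. f s \<xi> \<partial>lborel \<partial>lborel)"
    by (rule lborel_pair.Fubini_integral[OF fi])
  also have "\<dots> = of_real (\<integral>s. indicator {0..} s * (\<eta> s * ((pi / (s + \<delta>)) powr (CARD('n) / 2) * exp (- ((norm x)\<^sup>2 / (4 * (s + \<delta>)))))) \<partial>lborel)"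
    unfolding s1 by (rule integral_complex_of_real)
  finally have eq: "(\<integral>\<xi>. \<integral>s. f s \<xi> \<partial>lborel \<partial>lborel) = of_real (\<integral>s. indicator {0..} s * (\<eta> s * ((pi / (s + \<delta>)) powr (CARD('n) / 2) * exp (- ((norm x)\<^sup>2 / (4 * (s + \<delta>)))))) \<partial>lborel)" .
  have "(\<integral>\<xi>. cis (x \<bullet> \<xi>) * complex_of_real (exp (- (norm \<xi> powr (2 * \<beta>)))) * of_real (exp (- (\<delta> * (norm \<xi>)\<^sup>2))) \<partial>lborel) = (\<integral>\<xi>. \<integral>s. f s \<xi> \<partial>lborel \<partial>lborel)"
  proof (rule integral_cong_AE)
    show "AE \<xi> in lborel. cis (x \<bullet> \<xi>) * complex_of_real (exp (- (norm \<xi> powr (2 * \<beta>)))) * of_real (exp (- (\<delta> * (norm \<xi>)\<^sup>2))) = (\<integral>s. f s \<xi> \<partial>lborel)"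
      using AE_lborel_singleton[of "0::real^'n"] by eventually_elim (simp add: s2)
  qed measurable
  then show ?thesis using eq by simp
qed

text \<open>Letting the regularisation \<delta> tend to 0 is where x \<noteq> 0 matters:
  exp(-|x|^2/(4(s+\<delta>))) compensates the singularity (s+\<delta>)^(-d/2) uniformly in \<delta>,
  so an integrable majorant exists on the subordinated side as well.\<close>

lemma p_kernel_one_gk:
  fixes x :: "real^'n"
  assumes x: "x \<noteq> 0"
  shows "p_kernel (2 * \<beta>) x 1 = (4 * pi) powr (- (CARD('n) / 2)) * gk (CARD('n) / 2) ((norm x)\<^sup>2)"
proof -
  define N where "N = (norm x)\<^sup>2"
  define n where "n = real CARD('n) / 2"
  have N: "0 < N" using x by (simp add: N_def)
  have n: "0 < n" by (simp add: n_def)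
  define \<delta> where "\<delta> m = inverse (real (Suc m))" for m
  have \<delta>: "0 < \<delta> m" for m by (simp add: \<delta>_def)
  have \<delta>lim: "\<delta> \<longlonglongrightarrow> 0" unfolding \<delta>_def by (rule LIMSEQ_inverse_real_of_nat)
  define c where "c = (\<lambda>\<xi>. cis (x \<bullet> \<xi>) * complex_of_real (exp (- (norm \<xi> powr (2 * \<beta>)))))"
  have ci: "integrable lborel c" unfolding c_def by (rule cis_exp_integrable)
  have [measurable]: "c \<in> borel_measurable borel" unfolding c_def by measurable
  have l1: "(\<lambda>m. \<integral>\<xi>. c \<xi> * of_real (exp (- (\<delta> m * (norm \<xi>)\<^sup>2))) \<partial>lborel) \<longlonglongrightarrow> (\<integral>\<xi>. c \<xi> \<partial>lborel)"
  proof (rule integral_dominated_convergence)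
    show "integrable lborel (\<lambda>\<xi>. norm (c \<xi>))" using ci by simp
    show "AE \<xi> in lborel. (\<lambda>m. c \<xi> * of_real (exp (- (\<delta> m * (norm \<xi>)\<^sup>2)))) \<longlonglongrightarrow> c \<xi>"
    proof (intro AE_I2)
      fix \<xi>
      have "(\<lambda>m. c \<xi> * of_real (exp (- (\<delta> m * (norm \<xi>)\<^sup>2)))) \<longlonglongrightarrow> c \<xi> * of_real (exp (- (0 * (norm \<xi>)\<^sup>2)))"
        by (intro tendsto_intros \<delta>lim)
      then show "(\<lambda>m. c \<xi> * of_real (exp (- (\<delta> m * (norm \<xi>)\<^sup>2)))) \<longlonglongrightarrow> c \<xi>" by simp
    qed
    show "AE \<xi> in lborel. norm (c \<xi> * of_real (exp (- (\<delta> m * (norm \<xi>)\<^sup>2)))) \<le> norm (c \<xi>)" for m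
      using \<delta>[of m] by (intro AE_I2) (auto simp: norm_mult intro!: mult_left_le)
  qed measurable
  define g where "g d s = indicator {0..} s * (\<eta> s * ((pi / (s + d)) powr n * exp (- (N / (4 * (s + d))))))" for d s :: real
  have l2: "(\<lambda>m. \<integral>s. g (\<delta> m) s \<partial>lborel) \<longlonglongrightarrow> (\<integral>s. g 0 s \<partial>lborel)"
  proof (rule integral_dominated_convergence)
    \<comment> \<open>This is pi^n times the bound of y^n exp(-N y/4) over all y > 0, with y =
      1/(s+\<delta>); hence it does not depend on \<delta>.\<close>
    define K where "K = pi powr n * (n / (N / 4)) powr n"
    show "integrable lborel (\<lambda>s. K * norm (indicator {0..} s * \<eta> s))"
      using eta_integrable by (intro integrable_mult_right integrable_norm) (simp add: set_integrable_def)
    show "AE s in lborel. norm (g (\<delta> m) s) \<le> K * norm (indicator {0..} s * \<eta> s)" for m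
    proof (intro AE_I2)
      fix s
      show "norm (g (\<delta> m) s) \<le> K * norm (indicator {0..} s * \<eta> s)"
      proof (cases "0 \<le> s")
        case True
        define y where "y = 1 / (s + \<delta> m)"
        have y: "0 < y" using True \<delta>[of m] by (simp add: y_def)
        have "(pi / (s + \<delta> m)) powr n * exp (- (N / (4 * (s + \<delta> m)))) = pi powr n * (y powr n * exp (- (N / 4 * y)))"
          using y by (simp add: y_def powr_mult[symmetric])
        also have "\<dots> \<le> K" unfolding K_def using powr_mult_exp_bounded[of n "N/4" y] n N y by (intro mult_left_mono) auto
        finally have "\<bar>\<eta> s\<bar> * ((pi / (s + \<delta> m)) powr n * exp (- (N / (4 * (s + \<delta> m))))) \<le> \<bar>\<eta> s\<bar> * K"
          by (intro mult_left_mono) auto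
        then show ?thesis using True by (simp add: g_def abs_mult mult.commute)
      qed (simp add: g_def)
    qed
    show "AE s in lborel. (\<lambda>m. g (\<delta> m) s) \<longlonglongrightarrow> g 0 s"
      using AE_lborel_singleton[of 0]
    proof eventually_elim
      case (elim s)
      show ?case
      proof (cases "0 < s")
        case True
        then show ?thesis unfolding g_def by (intro tendsto_intros \<delta>lim) auto
      qed (use elim in \<open>simp add: g_def\<close>)
    qed
  qed (unfold g_def, measurable)
  have "(\<lambda>m. \<integral>\<xi>. c \<xi> * of_real (exp (- (\<delta> m * (norm \<xi>)\<^sup>2))) \<partial>lborel) = (\<lambda>m. complex_of_real (\<integral>s. g (\<delta> m) s \<partial>lborel))"
    using subordination_regularised[OF \<delta>, of x] by (simp add: c_def g_def n_def N_def)
  then have "(\<lambda>m. complex_of_real (\<integral>s. g (\<delta> m) s \<partial>lborel)) \<longlonglongrightarrow> (\<integral>\<xi>. c \<xi> \<partial>lborel)" using l1 by simp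
  then have "(\<integral>\<xi>. c \<xi> \<partial>lborel) = of_real (\<integral>s. g 0 s \<partial>lborel)"
    using tendsto_of_real[OF l2] LIMSEQ_unique by blast
  moreover have "g 0 s = pi powr n * (indicator {0..} s * (\<eta> s * (s powr (- n) * exp (- (N / (4 * s))))))" for s
  proof (cases "0 < s")
    case True
    then have "(pi / s) powr n = pi powr n * s powr (- n)" by (simp add: powr_divide powr_minus_divide)
    then show ?thesis using True by (simp add: g_def)
  qed (auto simp: g_def indicator_def)
  ultimately have "(\<integral>\<xi>. c \<xi> \<partial>lborel) = of_real (pi powr n * gk n N)"
    by (simp add: gk_def)
  then have "p_kernel (2 * \<beta>) x 1 = pi powr n * gk n N / (2 * pi) ^ CARD('n)"
    unfolding p_kernel_def c_def by simp
  moreover have "(2 * pi) ^ CARD('n) = (4 * pi) powr n * pi powr n"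
  proof -
    have "(2 * pi) ^ CARD('n) = (2 * pi) powr (2 * n)" by (simp add: n_def powr_realpow)
    also have "\<dots> = ((2 * pi) powr 2) powr n" by (simp only: powr_powr)
    also have "(2 * pi) powr 2 = 4 * pi * pi" by (simp add: power2_eq_square)
    also have "(4 * pi * pi) powr n = (4 * pi) powr n * pi powr n" by (simp add: powr_mult)
    finally show ?thesis .
  qed
  ultimately show ?thesis by (simp add: n_def N_def powr_minus_divide)
qed

end

section \<open>Asymptotics of the kernel at time one\<close>

context subordinator_index
begin

lemma norm_square_powr:
  fixes x :: "real^'n"
  shows "((norm x)\<^sup>2 / 4) powr k = norm x powr (2 * k) / 4 powr k"
proof (cases "x = 0")
  case False
  have e: "(norm x)\<^sup>2 = norm x powr 2" using False by simp
  have "((norm x)\<^sup>2) powr k = norm x powr (2 * k)" unfolding e by (rule powr_powr)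
  then show ?thesis by (simp add: powr_divide)
qed simp

lemma gk_norm_bounds:
  fixes x :: "real^'n"
  assumes k: "0 \<le> k" and x: "x \<noteq> 0"
  shows "\<bar>gk k ((norm x)\<^sup>2)\<bar> \<le> \<eta>_C1 * Gamma (k + \<beta>) * 4 powr (k + \<beta>) * norm x powr (- (2 * k + 2 * \<beta>))"
    and "\<bar>gk k ((norm x)\<^sup>2) - \<eta>_lead * Gamma (k + \<beta>) * 4 powr (k + \<beta>) * norm x powr (- (2 * k + 2 * \<beta>))\<bar>
      \<le> \<eta>_C2 * Gamma (k + 2 * \<beta>) * 4 powr (k + 2 * \<beta>) * norm x powr (- (2 * k + 4 * \<beta>))"
proof -
  have N: "0 < (norm x)\<^sup>2" using x by simp
  have e: "Gamma j / ((norm x)\<^sup>2 / 4) powr j = Gamma j * 4 powr j * norm x powr (- (2 * j))" for j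
    unfolding norm_square_powr by (simp add: powr_minus_divide)
  have e1: "2 * (k + \<beta>) = 2 * k + 2 * \<beta>" "2 * (k + 2 * \<beta>) = 2 * k + 4 * \<beta>" by simp_all
  note B = gk_integrable[OF k N, unfolded e, unfolded e1]
  show "\<bar>gk k ((norm x)\<^sup>2)\<bar> \<le> \<eta>_C1 * Gamma (k + \<beta>) * 4 powr (k + \<beta>) * norm x powr (- (2 * k + 2 * \<beta>))"
    using B(2) by (simp only: mult.assoc)
  show "\<bar>gk k ((norm x)\<^sup>2) - \<eta>_lead * Gamma (k + \<beta>) * 4 powr (k + \<beta>) * norm x powr (- (2 * k + 2 * \<beta>))\<bar>
      \<le> \<eta>_C2 * Gamma (k + 2 * \<beta>) * 4 powr (k + 2 * \<beta>) * norm x powr (- (2 * k + 4 * \<beta>))"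
    using B(3) by (simp only: mult.assoc)
qed

lemma gk_norm_has_derivative:
  fixes x :: "real^'n"
  assumes k: "0 \<le> k" and x: "x \<noteq> 0"
  shows "((\<lambda>x. gk k ((norm x)\<^sup>2)) has_derivative (\<lambda>h. - (gk (k + 1) ((norm x)\<^sup>2) / 2) * (x \<bullet> h))) (at x)"
proof -
  have N: "0 < (norm x)\<^sup>2" using x by simp
  have "((\<lambda>x::real^'n. (norm x)\<^sup>2) has_derivative (\<lambda>h. 2 * (x \<bullet> h))) (at x)"
    unfolding power2_norm_eq_inner by (auto intro!: derivative_eq_intros simp: inner_commute)
  from DERIV_compose_FDERIV[OF gk_has_derivative[OF k N] this]
  show ?thesis by (rule has_derivative_eq_rhs) (simp add: fun_eq_iff)
qed

definition p_one_grad :: "real^'n \<Rightarrow> real^'n" where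
  "p_one_grad x = (- ((4 * pi) powr (- (CARD('n) / 2)) / 2) * gk (CARD('n) / 2 + 1) ((norm x)\<^sup>2)) *\<^sub>R x"

lemma p_one_has_derivative:
  fixes x :: "real^'n"
  assumes x: "x \<noteq> 0"
  shows "((\<lambda>x. p_kernel (2 * \<beta>) x 1) has_derivative (\<lambda>h. p_one_grad x \<bullet> h)) (at x)"
proof -
  let ?A = "(4 * pi) powr (- (CARD('n) / 2))"
  have "((\<lambda>x::real^'n. ?A * gk (CARD('n) / 2) ((norm x)\<^sup>2)) has_derivative (\<lambda>h. ?A * (- (gk (CARD('n) / 2 + 1) ((norm x)\<^sup>2) / 2) * (x \<bullet> h)))) (at x)"
    by (rule has_derivative_mult_right[OF gk_norm_has_derivative[OF _ x]]) simp
  then have "((\<lambda>x::real^'n. ?A * gk (CARD('n) / 2) ((norm x)\<^sup>2)) has_derivative (\<lambda>h. p_one_grad x \<bullet> h)) (at x)"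
    by (rule has_derivative_eq_rhs) (simp add: fun_eq_iff p_one_grad_def)
  then show ?thesis
    by (rule has_derivative_transform_within_open[of _ _ _ _ "-{0}"]) (use x in \<open>auto simp: p_kernel_one_gk\<close>)
qed

text \<open>The ball of radius |y| \<le> |x|/2 about x stays at distance |x|/2 from the origin.
  There the field z gk(|z|^2) has derivative of size |z|^-(2k+2\<beta>), both from
  \<open>gk k\<close> and from |z|^2 \<open>gk (k + 1)\<close>, and the mean value inequality
  applies.\<close>

lemma gk_vector_difference:
  assumes k: "0 \<le> k"
  obtains C where "0 \<le> C" "\<And>x y :: real^'n. x \<noteq> 0 \<Longrightarrow> norm y \<le> norm x / 2 \<Longrightarrow>
    norm (gk k ((norm (x - y))\<^sup>2) *\<^sub>R (x - y) - gk k ((norm x)\<^sup>2) *\<^sub>R x) \<le> C * norm y * norm x powr (- (2 * k + 2 * \<beta>))"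
proof -
  define e where "e = 2 * k + 2 * \<beta>"
  define C0 where "C0 = \<eta>_C1 * Gamma (k + \<beta>) * 4 powr (k + \<beta>)"
  define C1 where "C1 = \<eta>_C1 * Gamma (k + 1 + \<beta>) * 4 powr (k + 1 + \<beta>)"
  have e0: "0 \<le> e" using k \<beta> by (simp add: e_def)
  have "0 \<le> \<eta>_C1" using eta_expansion(1)[of 1] by simp
  moreover have "0 \<le> Gamma (k + \<beta>)" "0 \<le> Gamma (k + 1 + \<beta>)" using k \<beta> by (auto intro!: Gamma_real_nonneg)
  ultimately have C01: "0 \<le> C0" "0 \<le> C1" by (simp_all add: C0_def C1_def)
  let ?\<Phi> = "\<lambda>x::real^'n. gk k ((norm x)\<^sup>2) *\<^sub>R x"
  define C where "C = (C0 + C1) * 2 powr e"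
  show ?thesis
  proof (rule that[of C])
    show "0 \<le> C" using C01 by (simp add: C_def)
    fix x y :: "real^'n" assume x: "x \<noteq> 0" and y: "norm y \<le> norm x / 2"
    define B where "B = C * norm x powr (- e)"
    have "norm (?\<Phi> (x - y) - ?\<Phi> x) \<le> B * norm ((x - y) - x)"
    proof (rule differentiable_bound[of "cball x (norm y)" ?\<Phi> "\<lambda>z h. gk k ((norm z)\<^sup>2) *\<^sub>R h + (- (gk (k + 1) ((norm z)\<^sup>2) / 2) * (z \<bullet> h)) *\<^sub>R z"])
      fix z assume "z \<in> cball x (norm y)"
      then have "norm x - norm z \<le> norm y" using norm_triangle_ineq2[of x z] by (simp add: dist_norm)
      then have nz: "norm x / 2 \<le> norm z" using y by simp
      then have z: "z \<noteq> 0" using x by auto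
      show "(?\<Phi> has_derivative (\<lambda>h. gk k ((norm z)\<^sup>2) *\<^sub>R h + (- (gk (k + 1) ((norm z)\<^sup>2) / 2) * (z \<bullet> h)) *\<^sub>R z)) (at z within cball x (norm y))"
        by (rule has_derivative_at_withinI, rule has_derivative_eq_rhs[OF has_derivative_scaleR[OF gk_norm_has_derivative[OF k z] has_derivative_ident]]) simp
      show "onorm (\<lambda>h. gk k ((norm z)\<^sup>2) *\<^sub>R h + (- (gk (k + 1) ((norm z)\<^sup>2) / 2) * (z \<bullet> h)) *\<^sub>R z) \<le> B"
      proof (rule onorm_le)
        fix h
        have zp: "norm z powr (- e) \<le> 2 powr e * norm x powr (- e)"
        proof -
          have "norm z powr (- e) \<le> (norm x / 2) powr (- e)"
            using nz x e0 by (intro powr_mono2') auto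
          also have "\<dots> = 2 powr e * norm x powr (- e)" by (simp add: powr_divide powr_minus_divide)
          finally show ?thesis .
        qed
        have g0: "\<bar>gk k ((norm z)\<^sup>2)\<bar> \<le> C0 * norm z powr (- e)"
          using gk_norm_bounds(1)[OF k z] by (simp add: C0_def e_def)
        have "\<bar>gk (k + 1) ((norm z)\<^sup>2)\<bar> \<le> C1 * norm z powr (- (2 * (k + 1) + 2 * \<beta>))"
          using gk_norm_bounds(1)[of "k + 1", OF _ z] k by (simp add: C1_def)
        also have "norm z powr (- (2 * (k + 1) + 2 * \<beta>)) = norm z powr (- e) / (norm z)\<^sup>2"
        proof -
          have "- (2 * (k + 1) + 2 * \<beta>) = - e - 2" by (simp add: e_def)
          moreover have "norm z powr 2 = (norm z)\<^sup>2" using z by simp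
          ultimately show ?thesis by (simp only: powr_diff)
        qed
        finally have g1: "\<bar>gk (k + 1) ((norm z)\<^sup>2)\<bar> * (norm z)\<^sup>2 \<le> C1 * norm z powr (- e)"
          using z by (simp add: field_simps)
        have "\<bar>z \<bullet> h\<bar> * norm z \<le> (norm z)\<^sup>2 * norm h"
          using mult_right_mono[OF Cauchy_Schwarz_ineq2[of z h] norm_ge_zero[of z]] by (simp add: power2_eq_square mult_ac)
        then have t2: "\<bar>gk (k + 1) ((norm z)\<^sup>2)\<bar> * (\<bar>z \<bullet> h\<bar> * norm z) \<le> \<bar>gk (k + 1) ((norm z)\<^sup>2)\<bar> * ((norm z)\<^sup>2 * norm h)"
          by (intro mult_left_mono) auto
        have t3: "\<bar>gk (k + 1) ((norm z)\<^sup>2)\<bar> * ((norm z)\<^sup>2 * norm h) \<le> C1 * norm z powr (- e) * norm h"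
          using mult_right_mono[OF g1 norm_ge_zero[of h]] by (simp only: mult.assoc)
        have "norm (gk k ((norm z)\<^sup>2) *\<^sub>R h + (- (gk (k + 1) ((norm z)\<^sup>2) / 2) * (z \<bullet> h)) *\<^sub>R z)
            \<le> \<bar>gk k ((norm z)\<^sup>2)\<bar> * norm h + \<bar>gk (k + 1) ((norm z)\<^sup>2)\<bar> / 2 * (\<bar>z \<bullet> h\<bar> * norm z)"
          by (rule order_trans[OF norm_triangle_ineq]) (simp add: abs_mult)
        also have "\<dots> \<le> C0 * norm z powr (- e) * norm h + C1 * norm z powr (- e) * norm h"
        proof -
          have "0 \<le> \<bar>gk (k + 1) ((norm z)\<^sup>2)\<bar> * (\<bar>z \<bullet> h\<bar> * norm z)" by (intro mult_nonneg_nonneg) auto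
          then show ?thesis using mult_right_mono[OF g0 norm_ge_zero[of h]] t2 t3 by linarith
        qed
        also have "\<dots> = (C0 + C1) * norm h * norm z powr (- e)" by (simp add: algebra_simps)
        also have "\<dots> \<le> (C0 + C1) * norm h * (2 powr e * norm x powr (- e))" using zp C01 by (intro mult_left_mono) auto
        also have "\<dots> = B * norm h" by (simp add: B_def C_def mult_ac)
        finally show "norm (gk k ((norm z)\<^sup>2) *\<^sub>R h + (- (gk (k + 1) ((norm z)\<^sup>2) / 2) * (z \<bullet> h)) *\<^sub>R z) \<le> B * norm h" .
      qed
    qed (auto simp: dist_norm)
    then show "norm (gk k ((norm (x - y))\<^sup>2) *\<^sub>R (x - y) - gk k ((norm x)\<^sup>2) *\<^sub>R x) \<le> C * norm y * norm x powr (- (2 * k + 2 * \<beta>))"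
      by (simp add: B_def e_def mult_ac)
  qed
qed

text \<open>The right-hand side is the constant delivered by the expansion: the prefactor of
  \<open>p_one_grad\<close> times the leading coefficient of \<open>gk\<close> at index d/2 + 1. The
  identity rests on Gamma(\<beta>+1) = \<beta> Gamma(\<beta>), the rest being powers of 2 and
  pi.\<close>

lemma c1_eq:
  "c1 (2 * \<beta>) d = (4 * pi) powr (- (d / 2)) / 2 * (\<eta>_lead * Gamma (d / 2 + 1 + \<beta>) * 4 powr (d / 2 + 1 + \<beta>))"
proof -
  have G: "Gamma (\<beta> + 1) = \<beta> * Gamma \<beta>"
  proof -
    have "\<beta> \<notin> \<int>\<^sub>\<le>\<^sub>0" using nonpos_Ints_nonpos[of \<beta>] \<beta> by auto
    then show ?thesis by (rule Gamma_plus1)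
  qed
  have p4: "4 powr (d / 2 + 1 + \<beta>) = 4 powr (d / 2) * 4 * 2 powr (2 * \<beta>)"
  proof -
    have "2 powr (2 * \<beta>) = (2 powr 2) powr \<beta>" by (simp only: powr_powr)
    also have "\<dots> = 4 powr \<beta>" by simp
    finally show ?thesis by (simp add: powr_add)
  qed
  have p2: "2 powr (2 * \<beta> - 1) = 2 powr (2 * \<beta>) / 2" by (simp add: powr_diff)
  have pp: "pi powr (- (d + 4) / 2) = pi powr (- (d / 2)) / (pi * pi)"
  proof -
    have "- (d + 4) / 2 = - (d / 2) - 2" by simp
    moreover have "pi powr 2 = pi * pi" by (simp add: power2_eq_square)
    ultimately show ?thesis by (simp only: powr_diff)
  qed
  have p4pi: "(4 * pi) powr (- (d / 2)) * 4 powr (d / 2) = pi powr (- (d / 2))"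
    by (simp add: powr_mult powr_minus_divide)
  have arg: "(2 * \<beta> + d + 2) / 2 = d / 2 + 1 + \<beta>" "2 * \<beta> * pi / 2 = pi * \<beta>" "2 * \<beta> / 2 = \<beta>" by simp_all
  have "c1 (2 * \<beta>) d = pi powr (- (d / 2)) * (2 * \<beta> * 2 powr (2 * \<beta>) * sin (pi * \<beta>) * Gamma (d / 2 + 1 + \<beta>) * Gamma \<beta> / pi)"
    unfolding c1_def arg p2 pp by simp
  also have "\<dots> = (4 * pi) powr (- (d / 2)) / 2 * (\<eta>_lead * Gamma (d / 2 + 1 + \<beta>) * 4 powr (d / 2 + 1 + \<beta>))"
    unfolding p4pi[symmetric] p4 \<eta>_lead_def G by (simp add: field_simps)
  finally show ?thesis .
qed

text \<open>Global bounds and regularity come from the Fourier side, decay and asymptotics from the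
  subordinated formula away from the origin. The two gradients coincide there because the derivative
  is unique.\<close>

theorem p_one_facts:
  obtains C :: real and G :: "real^'n \<Rightarrow> real^'n" where "0 < C"
    "quadratic_gradient C (\<lambda>x. p_kernel (2 * \<beta>) x 1) G"
    "\<And>x::real^'n. \<bar>p_kernel (2 * \<beta>) x 1\<bar> \<le> C" "\<And>x. norm (G x) \<le> C"
    "\<And>x::real^'n. x \<noteq> 0 \<Longrightarrow> \<bar>p_kernel (2 * \<beta>) x 1\<bar> \<le> C * norm x powr (- (2 * \<beta> + CARD('n)))"
    "\<And>x. x \<noteq> 0 \<Longrightarrow> norm (G x) \<le> C * norm x powr (- (2 * \<beta> + CARD('n) + 1))"
    "\<And>x. x \<noteq> 0 \<Longrightarrow> norm (G x + (c1 (2 * \<beta>) CARD('n) * norm x powr (- (2 * \<beta> + CARD('n) + 2))) *\<^sub>R x) \<le> C * norm x powr (- (4 * \<beta> + CARD('n) + 1))"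
    "\<And>x y. x \<noteq> 0 \<Longrightarrow> norm y \<le> norm x / 2 \<Longrightarrow> norm (G (x - y) - G x) \<le> C * norm y * norm x powr (- (2 * \<beta> + CARD('n) + 2))"
proof -
  define n where "n = real CARD('n)"
  let ?P = "\<lambda>x::real^'n. p_kernel (2 * \<beta>) x 1"
  have m: "(\<lambda>\<xi>::real^'n. exp (- (norm \<xi> powr (2 * \<beta>)))) \<in> borel_measurable borel" by measurable
  obtain K0 G0 where K0: "quadratic_gradient K0 (\<lambda>x::real^'n. \<integral>\<xi>. cos (x \<bullet> \<xi>) * exp (- (norm \<xi> powr (2 * \<beta>))) \<partial>lborel) G0"
      "\<And>x. norm (G0 x) \<le> K0" "\<And>x::real^'n. \<bar>\<integral>\<xi>. cos (x \<bullet> \<xi>) * exp (- (norm \<xi> powr (2 * \<beta>))) \<partial>lborel\<bar> \<le> K0"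
    by (rule quadratic_gradient_cosine_transform[OF m exp_weight_integrable]) (rule that)
  define a where "a = 1 / (2 * pi) ^ CARD('n)"
  have a: "0 < a" by (simp add: a_def)
  define G where "G x = a *\<^sub>R G0 x" for x
  have P: "?P = (\<lambda>x. a * (\<integral>\<xi>. cos (x \<bullet> \<xi>) * exp (- (norm \<xi> powr (2 * \<beta>))) \<partial>lborel))"
    by (simp add: fun_eq_iff p_kernel_one_cos a_def)
  have q: "quadratic_gradient (a * K0) ?P G"
    unfolding P G_def using quadratic_gradient_cmult[OF K0(1), of a] a by simp
  have b1: "\<bar>?P x\<bar> \<le> a * K0" for x
    using mult_left_mono[OF K0(3)[of x], of a] a fun_cong[OF P, of x] by (simp add: abs_mult)
  have b2: "norm (G x) \<le> a * K0" for x
    unfolding G_def using a K0(2)[of x] by (simp add: mult_left_mono)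
  have Geq: "G x = p_one_grad x" if "x \<noteq> 0" for x
    using grad_eqI[OF p_one_has_derivative[OF that]] quadratic_gradient_grad[OF q] by simp
  define A where "A = (4 * pi) powr (- (n / 2))"
  have A: "0 < A" by (simp add: A_def)
  have n0: "0 \<le> n / 2" "0 \<le> n / 2 + 1" by (simp_all add: n_def)
  obtain Cd where Cd: "0 \<le> Cd" "\<And>x y :: real^'n. x \<noteq> 0 \<Longrightarrow> norm y \<le> norm x / 2 \<Longrightarrow>
    norm (gk (n / 2 + 1) ((norm (x - y))\<^sup>2) *\<^sub>R (x - y) - gk (n / 2 + 1) ((norm x)\<^sup>2) *\<^sub>R x) \<le> Cd * norm y * norm x powr (- (2 * (n / 2 + 1) + 2 * \<beta>))"
    using gk_vector_difference[OF n0(2)] by blast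
  define C0 where "C0 = A * (\<eta>_C1 * Gamma (n / 2 + \<beta>) * 4 powr (n / 2 + \<beta>))"
  define C1 where "C1 = A / 2 * (\<eta>_C1 * Gamma (n / 2 + 1 + \<beta>) * 4 powr (n / 2 + 1 + \<beta>))"
  define C2 where "C2 = A / 2 * (\<eta>_C2 * Gamma (n / 2 + 1 + 2 * \<beta>) * 4 powr (n / 2 + 1 + 2 * \<beta>))"
  define C where "C = Max {1, a * K0, C0, C1, C2, A / 2 * Cd}"
  have C: "1 \<le> C" "a * K0 \<le> C" "C0 \<le> C" "C1 \<le> C" "C2 \<le> C" "A / 2 * Cd \<le> C"
    unfolding C_def by (rule Max_ge; simp)+
  have ex: "2 * (n / 2) + 2 * \<beta> = 2 * \<beta> + n" "2 * (n / 2 + 1) + 2 * \<beta> = 2 * \<beta> + n + 2" "2 * (n / 2 + 1) + 4 * \<beta> = 4 * \<beta> + n + 2"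
    by simp_all
  have pn: "norm x powr (- (b + 1)) * norm x = norm x powr (- b)" for x :: "real^'n" and b
  proof (cases "x = 0")
    case False
    have "norm x powr (- b) = norm x powr (- (b + 1) + 1)" by simp
    also have "\<dots> = norm x powr (- (b + 1)) * norm x" unfolding powr_add using False by simp
    finally show ?thesis by simp
  qed simp
  have G': "G x = (- (A / 2) * gk (n / 2 + 1) ((norm x)\<^sup>2)) *\<^sub>R x" if "x \<noteq> 0" for x
    using Geq[OF that] by (simp add: p_one_grad_def A_def n_def)
  show ?thesis
  proof (rule that[of C G])
    show "0 < C" using C by linarith
    show "quadratic_gradient C ?P G"
      unfolding quadratic_gradient_def using quadratic_gradientD[OF q] C(2) by (meson mult_right_mono order_trans zero_le_power2)
    show "\<bar>?P x\<bar> \<le> C" "norm (G x) \<le> C" for x using b1[of x] b2[of x] C(2) by linarith+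
    show "\<bar>?P x\<bar> \<le> C * norm x powr (- (2 * \<beta> + CARD('n)))" if "x \<noteq> 0" for x
    proof -
      have "\<bar>?P x\<bar> = A * \<bar>gk (n / 2) ((norm x)\<^sup>2)\<bar>"
        using p_kernel_one_gk[OF that] A by (simp add: A_def n_def abs_mult)
      also have "\<dots> \<le> A * (\<eta>_C1 * Gamma (n / 2 + \<beta>) * 4 powr (n / 2 + \<beta>) * norm x powr (- (2 * (n / 2) + 2 * \<beta>)))"
        using A gk_norm_bounds(1)[OF n0(1) that] by (intro mult_left_mono) auto
      also have "\<dots> = C0 * norm x powr (- (2 * \<beta> + n))" unfolding ex by (simp add: C0_def)
      also have "\<dots> \<le> C * norm x powr (- (2 * \<beta> + n))" using C(3) by (intro mult_right_mono) auto
      finally show ?thesis by (simp add: n_def)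
    qed
    show "norm (G x) \<le> C * norm x powr (- (2 * \<beta> + CARD('n) + 1))" if "x \<noteq> 0" for x
    proof -
      have "norm (G x) = A / 2 * \<bar>gk (n / 2 + 1) ((norm x)\<^sup>2)\<bar> * norm x"
        unfolding G'[OF that] using A by (simp add: abs_mult)
      also have "\<dots> \<le> A / 2 * (\<eta>_C1 * Gamma (n / 2 + 1 + \<beta>) * 4 powr (n / 2 + 1 + \<beta>) * norm x powr (- (2 * (n / 2 + 1) + 2 * \<beta>))) * norm x"
        using A gk_norm_bounds(1)[OF n0(2) that] by (intro mult_left_mono mult_right_mono) auto
      also have "\<dots> = C1 * (norm x powr (- (2 * \<beta> + n + 1 + 1)) * norm x)" unfolding ex by (simp add: C1_def)
      also have "\<dots> \<le> C * norm x powr (- (2 * \<beta> + n + 1))" unfolding pn using C(4) by (intro mult_right_mono) auto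
      finally show ?thesis by (simp add: n_def)
    qed
    show "norm (G x + (c1 (2 * \<beta>) CARD('n) * norm x powr (- (2 * \<beta> + CARD('n) + 2))) *\<^sub>R x) \<le> C * norm x powr (- (4 * \<beta> + CARD('n) + 1))" if "x \<noteq> 0" for x
    proof -
      let ?L = "\<eta>_lead * Gamma (n / 2 + 1 + \<beta>) * 4 powr (n / 2 + 1 + \<beta>)"
      have "G x + (c1 (2 * \<beta>) n * norm x powr (- (2 * \<beta> + n + 2))) *\<^sub>R x
        = (- (A / 2) * (gk (n / 2 + 1) ((norm x)\<^sup>2) - ?L * norm x powr (- (2 * (n / 2 + 1) + 2 * \<beta>)))) *\<^sub>R x"
        unfolding G'[OF that] ex c1_eq A_def[symmetric] scaleR_add_left[symmetric] by (simp add: algebra_simps)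
      then have "norm (G x + (c1 (2 * \<beta>) n * norm x powr (- (2 * \<beta> + n + 2))) *\<^sub>R x)
        = A / 2 * \<bar>gk (n / 2 + 1) ((norm x)\<^sup>2) - ?L * norm x powr (- (2 * (n / 2 + 1) + 2 * \<beta>))\<bar> * norm x"
        using A by (simp add: abs_mult)
      also have "\<dots> \<le> A / 2 * (\<eta>_C2 * Gamma (n / 2 + 1 + 2 * \<beta>) * 4 powr (n / 2 + 1 + 2 * \<beta>) * norm x powr (- (2 * (n / 2 + 1) + 4 * \<beta>))) * norm x"
        using A gk_norm_bounds(2)[OF n0(2) that] by (intro mult_left_mono mult_right_mono) auto
      also have "\<dots> = C2 * (norm x powr (- (4 * \<beta> + n + 1 + 1)) * norm x)" unfolding ex by (simp add: C2_def)
      also have "\<dots> \<le> C * norm x powr (- (4 * \<beta> + n + 1))" unfolding pn using C(5) by (intro mult_right_mono) auto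
      finally show ?thesis by (simp add: n_def)
    qed
    show "norm (G (x - y) - G x) \<le> C * norm y * norm x powr (- (2 * \<beta> + CARD('n) + 2))" if x: "x \<noteq> 0" and y: "norm y \<le> norm x / 2" for x y
    proof -
      have "norm x \<le> norm y" if "x - y = 0" using that by simp
      then have xy: "x - y \<noteq> 0" using x y by auto
      have "G (x - y) - G x = (- (A / 2)) *\<^sub>R (gk (n / 2 + 1) ((norm (x - y))\<^sup>2) *\<^sub>R (x - y) - gk (n / 2 + 1) ((norm x)\<^sup>2) *\<^sub>R x)"
        unfolding G'[OF x] G'[OF xy] by (simp add: scaleR_diff_right)
      then have "norm (G (x - y) - G x) = A / 2 * norm (gk (n / 2 + 1) ((norm (x - y))\<^sup>2) *\<^sub>R (x - y) - gk (n / 2 + 1) ((norm x)\<^sup>2) *\<^sub>R x)"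
        using A by simp
      also have "\<dots> \<le> A / 2 * (Cd * norm y * norm x powr (- (2 * (n / 2 + 1) + 2 * \<beta>)))"
        using A by (intro mult_left_mono Cd(2) x y) auto
      also have "\<dots> = A / 2 * Cd * (norm y * norm x powr (- (2 * \<beta> + n + 2)))" unfolding ex by simp
      also have "\<dots> \<le> C * (norm y * norm x powr (- (2 * \<beta> + n + 2)))" using C(6) by (intro mult_right_mono) auto
      finally show ?thesis by (simp add: n_def)
    qed
  qed
qed

end

lemma p_kernel_scaling:
  fixes x :: "real^'n"
  assumes \<alpha>: "0 < \<alpha>" and t: "0 < t"
  shows "p_kernel \<alpha> x t = (t powr (- (1 / \<alpha>))) powr CARD('n) * p_kernel \<alpha> (t powr (- (1 / \<alpha>)) *\<^sub>R x) 1"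
proof -
  define \<sigma> where "\<sigma> = t powr (- (1 / \<alpha>))"
  have \<sigma>: "0 < \<sigma>" using t by (simp add: \<sigma>_def)
  define F where "F = (\<lambda>\<xi>::real^'n. cis (x \<bullet> \<xi>) * complex_of_real (exp (- t * norm \<xi> powr \<alpha>)))"
  have [measurable]: "F \<in> borel_measurable borel" unfolding F_def by measurable
  have "t * \<sigma> powr \<alpha> = 1"
  proof -
    have "\<sigma> powr \<alpha> = t powr (- 1)" unfolding \<sigma>_def powr_powr using \<alpha> by simp
    then show ?thesis using t by (simp add: powr_minus_divide)
  qed
  then have e: "t * (\<sigma> powr \<alpha> * r) = r" for r by (simp only: mult.assoc[symmetric] mult_1)
  have F: "F (0 + \<sigma> *\<^sub>R \<xi>) = cis ((\<sigma> *\<^sub>R x) \<bullet> \<xi>) * complex_of_real (exp (- 1 * norm \<xi> powr \<alpha>))" for \<xi>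
    using \<sigma> by (simp add: F_def powr_mult e)
  have "(\<integral>\<xi>. F (0 + \<sigma> *\<^sub>R \<xi>) \<partial>lborel) = (\<integral>\<xi>. F \<xi> \<partial>lborel) /\<^sub>R \<bar>\<sigma>\<bar> ^ DIM(real^'n)"
    by (rule lborel_integral_affine(2)) (use \<sigma> in auto)
  then have "Re (\<integral>\<xi>. F \<xi> \<partial>lborel) = \<sigma> ^ CARD('n) * Re (\<integral>\<xi>. F (0 + \<sigma> *\<^sub>R \<xi>) \<partial>lborel)"
    using \<sigma> by simp
  then show ?thesis using \<sigma> unfolding F unfolding p_kernel_def F_def \<sigma>_def[symmetric] by (simp add: powr_realpow)
qed

text \<open>The decay bound is used for |x| \<ge> 1, where |x| \<ge> (1+|x|)/2, and the uniform
  bound for |x| < 1, where 1+|x| < 2; both cost the factor 2^b.\<close>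

lemma decay_imp_weight_bound:
  fixes f :: "real^'n \<Rightarrow> real"
  assumes b: "0 \<le> b" and 1: "f x \<le> C" and 2: "x \<noteq> 0 \<Longrightarrow> f x \<le> C * norm x powr (- b)" and C: "0 \<le> C"
  shows "f x \<le> C * 2 powr b * (1 + norm x) powr (- b)"
proof (cases "1 \<le> norm x")
  case True
  then have "norm x powr (- b) \<le> ((1 + norm x) / 2) powr (- b)" using b by (intro powr_mono2') auto
  also have "\<dots> = 2 powr b * (1 + norm x) powr (- b)" by (simp add: powr_divide powr_minus_divide)
  finally have "C * norm x powr (- b) \<le> C * (2 powr b * (1 + norm x) powr (- b))" using C by (intro mult_left_mono)
  moreover have "x \<noteq> 0" using True by auto
  ultimately show ?thesis using 2 by simp
next
  case False
  then have "2 powr (- b) \<le> (1 + norm x) powr (- b)" using b by (intro powr_mono2') (auto simp: add_pos_nonneg)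
  then have "C * 2 powr b * 2 powr (- b) \<le> C * 2 powr b * (1 + norm x) powr (- b)" using C by (intro mult_left_mono) auto
  moreover have "C * 2 powr b * 2 powr (- b) = C" by (simp add: powr_minus_divide)
  ultimately show ?thesis using 1 by simp
qed

section \<open>The fractional heat kernel\<close>

text \<open>The parameter \<open>D\<close> is the gradient of the kernel, tied to it by
  \<open>kernel_quadratic\<close>; everything later rests on these bounds and not on how they were
  obtained. By scaling, the first moment of |D \<tau>| is bounded uniformly in \<tau>, whereas its
  mass grows like \<tau>^(-1/\<alpha>).\<close>

locale stable_kernel =
  fixes \<alpha> C :: real and D :: "real \<Rightarrow> real^'n \<Rightarrow> real^'n"
  assumes \<alpha>: "1 < \<alpha>" "\<alpha> < 2" and C: "0 < C"
    and kernel_quadratic: "0 < \<tau> \<Longrightarrow> \<exists>K. quadratic_gradient K (\<lambda>z. p_kernel \<alpha> z \<tau>) (D \<tau>)"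
    and kernel_bound: "0 < \<tau> \<Longrightarrow> \<bar>p_kernel \<alpha> (z :: real^'n) \<tau>\<bar> \<le> C * \<tau> powr (- (CARD('n) / \<alpha>))"
    and grad_bound: "0 < \<tau> \<Longrightarrow> norm (D \<tau> z) \<le> C * \<tau> powr (- ((CARD('n) + 1) / \<alpha>))"
    and kernel_decay: "0 < \<tau> \<Longrightarrow> z \<noteq> 0 \<Longrightarrow> \<bar>p_kernel \<alpha> z \<tau>\<bar> \<le> C * \<tau> * norm z powr (- (\<alpha> + CARD('n)))"
    and grad_decay: "0 < \<tau> \<Longrightarrow> z \<noteq> 0 \<Longrightarrow> norm (D \<tau> z) \<le> C * \<tau> * norm z powr (- (\<alpha> + CARD('n) + 1))"
    and grad_asymptotics: "0 < \<tau> \<Longrightarrow> z \<noteq> 0 \<Longrightarrow> norm (D \<tau> z + (c1 \<alpha> CARD('n) * \<tau> * norm z powr (- (\<alpha> + CARD('n) + 2))) *\<^sub>R z)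
        \<le> C * \<tau>\<^sup>2 * norm z powr (- (2 * \<alpha> + CARD('n) + 1))"
    and grad_difference: "0 < \<tau> \<Longrightarrow> z \<noteq> 0 \<Longrightarrow> norm y \<le> norm z / 2 \<Longrightarrow>
        norm (D \<tau> (z - y) - D \<tau> z) \<le> C * \<tau> * norm y * norm z powr (- (\<alpha> + CARD('n) + 2))"
    and kernel_integral: "0 < \<tau> \<Longrightarrow> integrable lborel (\<lambda>z::real^'n. p_kernel \<alpha> z \<tau>)" "0 < \<tau> \<Longrightarrow> (\<integral>z. \<bar>p_kernel \<alpha> (z :: real^'n) \<tau>\<bar> \<partial>lborel) \<le> C"
    and grad_integral: "0 < \<tau> \<Longrightarrow> integrable lborel (D \<tau>)" "0 < \<tau> \<Longrightarrow> (\<integral>z. norm (D \<tau> z) \<partial>lborel) \<le> C * \<tau> powr (- (1 / \<alpha>))"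
    and grad_moment: "0 < \<tau> \<Longrightarrow> integrable lborel (\<lambda>z. norm z * norm (D \<tau> z))" "0 < \<tau> \<Longrightarrow> (\<integral>z. norm z * norm (D \<tau> z) \<partial>lborel) \<le> C"
    and grad_odd: "0 < \<tau> \<Longrightarrow> D \<tau> (- z) = - D \<tau> z"
    and grad_continuous: "continuous_on {0<..} (\<lambda>\<tau>. D \<tau> z)"

text \<open>All bounds are transported from time 1 by the dilation with s(t) = t^(-1/\<alpha>). The
  powers of s(t) then collapse to t or t^2 through s(t)^(-\<alpha>) = t, so every kernel estimate at
  infinity carries a power of the elapsed time.\<close>

theorem stable_kernel_exists:
  assumes \<alpha>: "1 < \<alpha>" "\<alpha> < 2"
  shows "\<exists>C (D :: real \<Rightarrow> real^'n \<Rightarrow> real^'n). stable_kernel \<alpha> C D"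
proof -
  interpret subordinator_index "\<alpha> / 2" by standard (use \<alpha> in auto)
  define n where "n = real CARD('n)"
  have ex: "2 * (\<alpha> / 2) = \<alpha>" "4 * (\<alpha> / 2) = 2 * \<alpha>" by simp_all
  obtain C0 and G :: "real^'n \<Rightarrow> real^'n" where C0: "0 < C0"
    and q: "quadratic_gradient C0 (\<lambda>x. p_kernel \<alpha> x 1) G"
    and b: "\<And>x::real^'n. \<bar>p_kernel \<alpha> x 1\<bar> \<le> C0" "\<And>x. norm (G x) \<le> C0"
    and dec: "\<And>x::real^'n. x \<noteq> 0 \<Longrightarrow> \<bar>p_kernel \<alpha> x 1\<bar> \<le> C0 * norm x powr (- (\<alpha> + n))"
    "\<And>x. x \<noteq> 0 \<Longrightarrow> norm (G x) \<le> C0 * norm x powr (- (\<alpha> + n + 1))"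
    and asy: "\<And>x. x \<noteq> 0 \<Longrightarrow> norm (G x + (c1 \<alpha> n * norm x powr (- (\<alpha> + n + 2))) *\<^sub>R x) \<le> C0 * norm x powr (- (2 * \<alpha> + n + 1))"
    and dif: "\<And>x y. x \<noteq> 0 \<Longrightarrow> norm y \<le> norm x / 2 \<Longrightarrow> norm (G (x - y) - G x) \<le> C0 * norm y * norm x powr (- (\<alpha> + n + 2))"
    by (rule p_one_facts[where 'n='n, unfolded ex, folded n_def]) (rule that)
  define P where "P = (\<lambda>x::real^'n. p_kernel \<alpha> x 1)"
  note [measurable] = quadratic_gradient_measurable[OF q, folded P_def]
  have n: "0 < n" by (simp add: n_def)
  have a0: "0 < \<alpha>" using \<alpha> by simp
  let ?w = "\<lambda>x::real^'n. (1 + norm x) powr (- (\<alpha> + n))"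
  have wi: "integrable lborel ?w" by (rule integrable_weight) (use \<alpha> in \<open>simp add: n_def\<close>)
  define K1 where "K1 = C0 * 2 powr (\<alpha> + n)"
  define K2 where "K2 = C0 * 2 powr (\<alpha> + n + 1)"
  have K: "0 < K1" "0 < K2" using C0 by (simp_all add: K1_def K2_def)
  have Pw: "\<bar>P x\<bar> \<le> K1 * ?w x" for x
    unfolding K1_def P_def by (rule decay_imp_weight_bound) (use b dec C0 \<alpha> n in auto)
  have Gw: "norm (G x) \<le> K2 * (1 + norm x) powr (- (\<alpha> + n + 1))" for x
    unfolding K2_def by (rule decay_imp_weight_bound) (use b dec C0 \<alpha> n in auto)
  have w1: "(1 + norm x) powr (- (\<alpha> + n + 1)) \<le> ?w x" for x :: "real^'n" by (intro powr_mono) auto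
  have w2: "norm x * (1 + norm x) powr (- (\<alpha> + n + 1)) \<le> ?w x" for x :: "real^'n"
  proof -
    have "?w x = (1 + norm x) powr (- (\<alpha> + n + 1) + 1)" by simp
    also have "\<dots> = (1 + norm x) powr (- (\<alpha> + n + 1)) * (1 + norm x)" unfolding powr_add by (simp add: add_nonneg_eq_0_iff)
    finally show ?thesis
      using mult_right_mono[of "norm x" "1 + norm x" "(1 + norm x) powr (- (\<alpha> + n + 1))"] by (simp add: mult.commute)
  qed
  have Gw1: "norm (G x) \<le> K2 * ?w x" for x
    using Gw[of x] mult_left_mono[OF w1[of x], of K2] K by linarith
  have Gw2: "norm x * norm (G x) \<le> K2 * ?w x" for x
  proof -
    have "norm x * norm (G x) \<le> norm x * (K2 * (1 + norm x) powr (- (\<alpha> + n + 1)))" by (intro mult_left_mono Gw) auto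
    also have "\<dots> = K2 * (norm x * (1 + norm x) powr (- (\<alpha> + n + 1)))" by simp
    also have "\<dots> \<le> K2 * ?w x" using K w2[of x] by (intro mult_left_mono) auto
    finally show ?thesis .
  qed
  have Pi: "integrable lborel P"
    by (rule Bochner_Integration.integrable_bound[OF integrable_mult_right[OF wi, of K1]]) (use Pw K in auto)
  have Gi: "integrable lborel G"
    by (rule Bochner_Integration.integrable_bound[OF integrable_mult_right[OF wi, of K2]]) (use Gw1 K in auto)
  have GMi: "integrable lborel (\<lambda>x. norm x * norm (G x))"
    by (rule Bochner_Integration.integrable_bound[OF integrable_mult_right[OF wi, of K2]]) (use Gw2 K in auto)
  define C where "C = Max {C0, (\<integral>x. \<bar>P x\<bar> \<partial>lborel), (\<integral>x. norm (G x) \<partial>lborel), (\<integral>x. norm x * norm (G x) \<partial>lborel)}"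
  have CM: "C0 \<le> C" "(\<integral>x. \<bar>P x\<bar> \<partial>lborel) \<le> C" "(\<integral>x. norm (G x) \<partial>lborel) \<le> C" "(\<integral>x. norm x * norm (G x) \<partial>lborel) \<le> C"
    unfolding C_def by (rule Max_ge; simp)+
  define s where "s t = t powr (- (1 / \<alpha>))" for t
  define D where "D t x = s t powr (n + 1) *\<^sub>R G (s t *\<^sub>R x)" for t x
  have s0: "0 < s t" if "0 < t" for t using that by (simp add: s_def)
  have sp: "s t powr a = t powr (- (a / \<alpha>))" for t a by (simp add: s_def powr_powr)
  have sa: "s t powr (- \<alpha>) = t" "s t powr (- (2 * \<alpha>)) = t\<^sup>2" if "0 < t" for t
  proof -
    show "s t powr (- \<alpha>) = t" unfolding sp using a0 that by simp
    have "s t powr (- (2 * \<alpha>)) = t powr 2" unfolding sp using a0 by simp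
    then show "s t powr (- (2 * \<alpha>)) = t\<^sup>2" using that by simp
  qed
  have Pt: "p_kernel \<alpha> x t = s t powr n * P (s t *\<^sub>R x)" if "0 < t" for t and x :: "real^'n"
    unfolding P_def s_def n_def using p_kernel_scaling[OF a0 that, of x] .
  have nz: "s t *\<^sub>R x \<noteq> 0" if "0 < t" "x \<noteq> 0" for t and x :: "real^'n" using s0[OF that(1)] that by simp
  have np: "norm (s t *\<^sub>R x) powr b = s t powr b * norm x powr b" if "0 < t" for t b and x :: "real^'n"
    using s0[OF that] by (simp add: powr_mult)
  have aff: "integrable lborel (\<lambda>x. f (s t *\<^sub>R x)) \<longleftrightarrow> integrable lborel f"
      "(\<integral>x. f (s t *\<^sub>R x) \<partial>lborel) = (\<integral>x. f x \<partial>lborel) /\<^sub>R s t powr n"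
    if "0 < t" and [measurable]: "f \<in> borel_measurable borel" for t and f :: "real^'n \<Rightarrow> 'b::{banach, second_countable_topology}"
    using lborel_integral_affine[of "s t" f 0] s0[OF that(1)] by (simp_all add: n_def powr_realpow)
  have qt: "quadratic_gradient (s t powr n * (C0 * (s t)\<^sup>2)) (\<lambda>x. p_kernel \<alpha> x t) (D t)" if "0 < t" for t
  proof -
    have "quadratic_gradient (\<bar>s t powr n\<bar> * (C0 * (s t)\<^sup>2)) (\<lambda>x. s t powr n * P (0 + s t *\<^sub>R x)) (\<lambda>x. s t powr n *\<^sub>R (s t *\<^sub>R G (0 + s t *\<^sub>R x)))"
      by (intro quadratic_gradient_cmult quadratic_gradient_affine q[folded P_def])
    moreover have "s t powr (n + 1) = s t powr n * s t" using s0[OF that] by (simp add: powr_add)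
    ultimately show ?thesis by (simp add: Pt[OF that] D_def[abs_def])
  qed
  have "stable_kernel \<alpha> C D"
  proof
    fix t :: real assume t: "0 < t"
    note st = s0[OF t]
    show "\<exists>K. quadratic_gradient K (\<lambda>z. p_kernel \<alpha> z t) (D t)" using qt[OF t] by blast
    show "\<bar>p_kernel \<alpha> (z :: real^'n) t\<bar> \<le> C * t powr (- (CARD('n) / \<alpha>))" for z
    proof -
      have "\<bar>p_kernel \<alpha> z t\<bar> \<le> s t powr n * C"
        unfolding Pt[OF t] abs_mult using b(1)[of "s t *\<^sub>R z"] CM(1) by (simp add: P_def mult_left_mono)
      then show ?thesis by (simp add: sp n_def mult.commute)
    qed
    show "norm (D t z) \<le> C * t powr (- ((CARD('n) + 1) / \<alpha>))" for z
    proof -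
      have "norm (D t z) \<le> s t powr (n + 1) * C"
        unfolding D_def norm_scaleR using b(2)[of "s t *\<^sub>R z"] CM(1) by (simp add: mult_left_mono)
      then show ?thesis by (simp add: sp n_def mult.commute add.commute)
    qed
    show "\<bar>p_kernel \<alpha> z t\<bar> \<le> C * t * norm z powr (- (\<alpha> + CARD('n)))" if z: "z \<noteq> 0" for z :: "real^'n"
    proof -
      have "\<bar>p_kernel \<alpha> z t\<bar> \<le> s t powr n * (C0 * norm (s t *\<^sub>R z) powr (- (\<alpha> + n)))"
        unfolding Pt[OF t] abs_mult using dec(1)[OF nz[OF t z]] by (simp add: P_def mult_left_mono)
      also have "\<dots> = C0 * (s t powr n * s t powr (- (\<alpha> + n))) * norm z powr (- (\<alpha> + n))" unfolding np[OF t] by simp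
      also have "s t powr n * s t powr (- (\<alpha> + n)) = t" unfolding powr_add[symmetric] using sa(1)[OF t] by simp
      also have "C0 * t * norm z powr (- (\<alpha> + n)) \<le> C * t * norm z powr (- (\<alpha> + n))" using CM(1) t by (intro mult_right_mono) auto
      finally show ?thesis by (simp add: n_def)
    qed
    show "norm (D t z) \<le> C * t * norm z powr (- (\<alpha> + CARD('n) + 1))" if z: "z \<noteq> 0" for z
    proof -
      have "norm (D t z) \<le> s t powr (n + 1) * (C0 * norm (s t *\<^sub>R z) powr (- (\<alpha> + n + 1)))"
        unfolding D_def norm_scaleR using dec(2)[OF nz[OF t z]] by (simp add: mult_left_mono)
      also have "\<dots> = C0 * (s t powr (n + 1) * s t powr (- (\<alpha> + n + 1))) * norm z powr (- (\<alpha> + n + 1))" unfolding np[OF t] by simp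
      also have "s t powr (n + 1) * s t powr (- (\<alpha> + n + 1)) = t" unfolding powr_add[symmetric] using sa(1)[OF t] by simp
      also have "C0 * t * norm z powr (- (\<alpha> + n + 1)) \<le> C * t * norm z powr (- (\<alpha> + n + 1))" using CM(1) t by (intro mult_right_mono) auto
      finally show ?thesis by (simp add: n_def)
    qed
    show "norm (D t z + (c1 \<alpha> CARD('n) * t * norm z powr (- (\<alpha> + CARD('n) + 2))) *\<^sub>R z) \<le> C * t\<^sup>2 * norm z powr (- (2 * \<alpha> + CARD('n) + 1))" if z: "z \<noteq> 0" for z
    proof -
      have "s t powr (n + 1) * (s t powr (- (\<alpha> + n + 2)) * s t) = s t powr (n + 1) * (s t powr (- (\<alpha> + n + 2)) * s t powr 1)" using st by simp
      also have "\<dots> = t" unfolding powr_add[symmetric] using sa(1)[OF t] by simp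
      finally have se: "s t powr (n + 1) * (s t powr (- (\<alpha> + n + 2)) * s t) = t" .
      have "s t powr (n + 1) *\<^sub>R (G (s t *\<^sub>R z) + (c1 \<alpha> n * norm (s t *\<^sub>R z) powr (- (\<alpha> + n + 2))) *\<^sub>R (s t *\<^sub>R z))
        = D t z + (c1 \<alpha> n * (s t powr (n + 1) * (s t powr (- (\<alpha> + n + 2)) * s t)) * norm z powr (- (\<alpha> + n + 2))) *\<^sub>R z"
        unfolding np[OF t] D_def by (simp add: scaleR_add_right mult_ac)
      then have "norm (D t z + (c1 \<alpha> n * t * norm z powr (- (\<alpha> + n + 2))) *\<^sub>R z)
        = s t powr (n + 1) * norm (G (s t *\<^sub>R z) + (c1 \<alpha> n * norm (s t *\<^sub>R z) powr (- (\<alpha> + n + 2))) *\<^sub>R (s t *\<^sub>R z))"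
        unfolding se by (metis abs_of_nonneg norm_scaleR powr_ge_zero)
      also have "\<dots> \<le> s t powr (n + 1) * (C0 * norm (s t *\<^sub>R z) powr (- (2 * \<alpha> + n + 1)))"
        by (intro mult_left_mono asy nz t z) auto
      also have "\<dots> = C0 * (s t powr (n + 1) * s t powr (- (2 * \<alpha> + n + 1))) * norm z powr (- (2 * \<alpha> + n + 1))" unfolding np[OF t] by simp
      also have "s t powr (n + 1) * s t powr (- (2 * \<alpha> + n + 1)) = t\<^sup>2" unfolding powr_add[symmetric] using sa(2)[OF t] by simp
      also have "C0 * t\<^sup>2 * norm z powr (- (2 * \<alpha> + n + 1)) \<le> C * t\<^sup>2 * norm z powr (- (2 * \<alpha> + n + 1))" using CM(1) t by (intro mult_right_mono) auto
      finally show ?thesis by (simp add: n_def)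
    qed
    show "norm (D t (z - y) - D t z) \<le> C * t * norm y * norm z powr (- (\<alpha> + CARD('n) + 2))" if z: "z \<noteq> 0" and y: "norm y \<le> norm z / 2" for z y
    proof -
      have se: "s t powr (n + 1) * (s t * s t powr (- (\<alpha> + n + 2))) = t"
      proof -
        have "s t powr (n + 1) * (s t * s t powr (- (\<alpha> + n + 2))) = s t powr (n + 1) * (s t powr 1 * s t powr (- (\<alpha> + n + 2)))" using st by simp
        also have "\<dots> = t" unfolding powr_add[symmetric] using sa(1)[OF t] by simp
        finally show ?thesis .
      qed
      have sy: "norm (s t *\<^sub>R y) \<le> norm (s t *\<^sub>R z) / 2" using y st by simp
      have "norm (D t (z - y) - D t z) = s t powr (n + 1) * norm (G (s t *\<^sub>R z - s t *\<^sub>R y) - G (s t *\<^sub>R z))"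
        unfolding D_def by (simp add: scaleR_diff_right[symmetric])
      also have "\<dots> \<le> s t powr (n + 1) * (C0 * norm (s t *\<^sub>R y) * norm (s t *\<^sub>R z) powr (- (\<alpha> + n + 2)))"
        by (intro mult_left_mono dif nz t z sy) auto
      also have "\<dots> = C0 * (s t powr (n + 1) * (s t * s t powr (- (\<alpha> + n + 2)))) * norm y * norm z powr (- (\<alpha> + n + 2))"
        unfolding np[OF t] using st by simp
      also have "\<dots> \<le> C * t * norm y * norm z powr (- (\<alpha> + n + 2))" unfolding se using CM(1) t by (intro mult_right_mono) auto
      finally show ?thesis by (simp add: n_def)
    qed
    have pe: "(\<lambda>z. p_kernel \<alpha> z t) = (\<lambda>z. s t powr n * P (s t *\<^sub>R z))" using Pt[OF t] by (simp add: fun_eq_iff)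
    show "integrable lborel (\<lambda>z::real^'n. p_kernel \<alpha> z t)"
      unfolding pe using aff(1)[OF t, of P] Pi by simp
    have "(\<integral>z. \<bar>p_kernel \<alpha> (z :: real^'n) t\<bar> \<partial>lborel) = s t powr n * (\<integral>z. \<bar>P (s t *\<^sub>R z)\<bar> \<partial>lborel)"
      unfolding Pt[OF t] abs_mult by simp
    also have "\<dots> = (\<integral>z. \<bar>P z\<bar> \<partial>lborel)" using aff(2)[OF t, of "\<lambda>z. \<bar>P z\<bar>"] st by simp
    finally show "(\<integral>z. \<bar>p_kernel \<alpha> (z :: real^'n) t\<bar> \<partial>lborel) \<le> C" using CM(2) by simp
    show "integrable lborel (D t)"
      unfolding D_def[abs_def] using aff(1)[OF t, of G] Gi by (intro integrable_scaleR_right) simp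
    have s1: "s t powr (n + 1) = s t * s t powr n" using st by (simp add: powr_add)
    have "(\<integral>z. norm (D t z) \<partial>lborel) = s t powr (n + 1) * (\<integral>z. norm (G (s t *\<^sub>R z)) \<partial>lborel)"
      unfolding D_def by simp
    also have "\<dots> = s t * (\<integral>z. norm (G z) \<partial>lborel)" using aff(2)[OF t, of "\<lambda>z. norm (G z)"] st by (simp add: s1)
    also have "\<dots> \<le> s t * C" using CM(3) st by (intro mult_left_mono) auto
    finally show "(\<integral>z. norm (D t z) \<partial>lborel) \<le> C * t powr (- (1 / \<alpha>))" by (simp add: s_def mult.commute)
    have De: "norm z * norm (D t z) = s t powr n * (norm (s t *\<^sub>R z) * norm (G (s t *\<^sub>R z)))" for z
      unfolding D_def using st by (simp add: s1)
    show "integrable lborel (\<lambda>z. norm z * norm (D t z))"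
      unfolding De using aff(1)[OF t, of "\<lambda>z. norm z * norm (G z)"] GMi by (intro integrable_mult_right) simp
    have "(\<integral>z. norm z * norm (D t z) \<partial>lborel) = s t powr n * (\<integral>z. norm (s t *\<^sub>R z) * norm (G (s t *\<^sub>R z)) \<partial>lborel)"
      unfolding De by (rule integral_mult_right_zero)
    also have "(\<integral>z. norm (s t *\<^sub>R z) * norm (G (s t *\<^sub>R z)) \<partial>lborel) = (\<integral>z. norm z * norm (G z) \<partial>lborel) / s t powr n"
      using aff(2)[OF t, of "\<lambda>z. norm z * norm (G z)"] by (simp add: divide_inverse mult.commute)
    finally show "(\<integral>z. norm z * norm (D t z) \<partial>lborel) \<le> C" using CM(4) st by simp
    show "D t (- z) = - D t z" for z
    proof -
      \<comment> \<open>Evenness is the invariance of Lebesgue measure under \<xi> to -\<xi>; the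
        gradient is then odd because it is determined by the kernel.\<close>
      have even: "p_kernel \<alpha> (- x) t = p_kernel \<alpha> x t" for x :: "real^'n"
      proof -
        have "p_kernel \<alpha> x t = Re (\<integral>\<xi>. cis (x \<bullet> (0 + (-1) *\<^sub>R \<xi>)) * complex_of_real (exp (- t * norm (0 + (-1) *\<^sub>R \<xi>) powr \<alpha>)) \<partial>lborel) / (2 * pi) ^ CARD('n)"
          unfolding p_kernel_def by (subst lborel_integral_affine(2)) auto
        then show ?thesis unfolding p_kernel_def by simp
      qed
      have "quadratic_gradient (s t powr n * (C0 * (s t)\<^sup>2) * (-1)\<^sup>2) (\<lambda>x. p_kernel \<alpha> (0 + (-1) *\<^sub>R x) t) (\<lambda>x. (-1) *\<^sub>R D t (0 + (-1) *\<^sub>R x))"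
        by (rule quadratic_gradient_affine[OF qt[OF t]])
      then have "quadratic_gradient (s t powr n * (C0 * (s t)\<^sup>2)) (\<lambda>x. p_kernel \<alpha> x t) (\<lambda>x. - D t (- x))"
        by (simp add: even)
      then have "D t = (\<lambda>x. - D t (- x))"
        using quadratic_gradient_grad qt[OF t] by metis
      then have "D t z = - D t (- z)" by (rule fun_cong)
      then show ?thesis by simp
    qed
  next
    show "continuous_on {0<..} (\<lambda>t. D t z)" for z
    proof -
      have sc: "continuous_on {0<..} s" unfolding s_def by (intro continuous_intros) auto
      have "continuous_on {0<..} (\<lambda>t. G (s t *\<^sub>R z))"
        by (rule continuous_on_compose2[OF quadratic_gradient_continuous(1)[OF q]]) (auto intro!: continuous_intros sc)
      moreover have "continuous_on {0<..} (\<lambda>t. s t powr (n + 1))"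
        using s0 by (intro continuous_on_powr sc continuous_on_const) (auto simp: less_imp_neq[symmetric])
      ultimately show ?thesis unfolding D_def by (intro continuous_on_scaleR)
    qed
  qed (use \<alpha> C0 CM in auto)
  then show ?thesis by blast
qed

section \<open>The far field of a convolution with the gradient kernel\<close>

text \<open>If 1+|y| is at least half of 1+|x|, the weight at y is already comparable to the weight
  at x and only the mass of k is needed. Otherwise |x| > 1 and |x-y| \<ge> |x|/2, so k supplies the
  decay and the weight is merely integrated.\<close>

lemma convolution_weight_bound:
  fixes k :: "real^'n \<Rightarrow> real" and a b \<kappa> :: real
  assumes k: "integrable lborel k" "\<And>z. 0 \<le> k z" and dec: "\<And>z. z \<noteq> 0 \<Longrightarrow> k z \<le> \<kappa> * norm z powr (- b)"
    and \<kappa>: "0 \<le> \<kappa>" and ab: "CARD('n) < a" "a \<le> b"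
  shows "integrable lborel (\<lambda>y. k (x - y) * (1 + norm y) powr (- a))"
    and "(\<integral>y. k (x - y) * (1 + norm y) powr (- a) \<partial>lborel)
      \<le> (2 powr a * (\<integral>z. k z \<partial>lborel) + \<kappa> * 2 powr (a + b) * (\<integral>y. (1 + norm (y::real^'n)) powr (- a) \<partial>lborel)) * (1 + norm x) powr (- a)"
proof -
  have [measurable]: "k \<in> borel_measurable borel" using k by auto
  let ?w = "\<lambda>y::real^'n. (1 + norm y) powr (- a)"
  have a0: "0 < a" "0 < b" using ab by linarith+
  have wi: "integrable lborel ?w" by (rule integrable_weight) (use ab in simp)
  have w1: "?w y \<le> 1" for y
    using powr_mono2'[of "- a" 1 "1 + norm y"] a0 by simp
  have kr: "integrable lborel (\<lambda>y. k (x - y))" "(\<integral>y. k (x - y) \<partial>lborel) = (\<integral>z. k z \<partial>lborel)"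
    using lborel_integral_reflect[of k x] k by auto
  have half: "(1 + norm y) powr (- a) \<le> 2 powr a * ?w x" if "(1 + norm x) / 2 \<le> 1 + norm y" for y
  proof -
    have "(1 + norm y) powr (- a) \<le> ((1 + norm x) / 2) powr (- a)"
      using that a0 by (intro powr_mono2') (auto simp: add_pos_nonneg)
    also have "\<dots> = 2 powr a * ?w x" by (simp add: powr_divide powr_minus_divide)
    finally show ?thesis .
  qed
  have pw: "k (x - y) * ?w y \<le> 2 powr a * ?w x * k (x - y) + \<kappa> * 2 powr (a + b) * ?w x * ?w y" for y
  proof (cases "(1 + norm x) / 2 \<le> 1 + norm y")
    case True
    have "k (x - y) * ?w y \<le> k (x - y) * (2 powr a * ?w x)" by (intro mult_left_mono half True k)
    moreover have "0 \<le> \<kappa> * 2 powr (a + b) * ?w x * ?w y" using \<kappa> by simp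
    ultimately show ?thesis by (simp add: mult.commute)
  next
    case False
    then have "2 * (1 + norm y) < 1 + norm x" by (simp add: field_simps)
    moreover have "0 \<le> norm y" by simp
    ultimately have "1 < norm x \<and> norm y < norm x / 2" by argo
    then have x1: "1 < norm x" "norm y < norm x / 2" by auto
    have "norm x - norm y \<le> norm (x - y)" by (rule norm_triangle_ineq2)
    then have xy: "norm x / 2 \<le> norm (x - y)" using x1 by linarith
    have "x - y \<noteq> 0"
    proof
      assume "x - y = 0"
      then show False using xy x1 by simp
    qed
    then have "k (x - y) \<le> \<kappa> * norm (x - y) powr (- b)" by (rule dec)
    also have "\<dots> \<le> \<kappa> * (norm x / 2) powr (- b)" using xy x1 a0 \<kappa> by (intro mult_left_mono powr_mono2') auto
    also have "(norm x / 2) powr (- b) = 2 powr b * norm x powr (- b)" by (simp add: powr_divide powr_minus_divide)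
    also have "\<kappa> * (2 powr b * norm x powr (- b)) \<le> \<kappa> * (2 powr b * (2 powr a * ?w x))"
    proof (intro mult_left_mono \<kappa>)
      have "norm x powr (- b) \<le> norm x powr (- a)" using x1 ab by (intro powr_mono) auto
      also have "\<dots> \<le> ((1 + norm x) / 2) powr (- a)" using x1 a0 by (intro powr_mono2') auto
      also have "\<dots> = 2 powr a * ?w x" by (simp add: powr_divide powr_minus_divide)
      finally show "norm x powr (- b) \<le> 2 powr a * ?w x" .
    qed simp
    also have "\<dots> = \<kappa> * 2 powr (a + b) * ?w x" by (simp add: powr_add)
    finally have "k (x - y) * ?w y \<le> \<kappa> * 2 powr (a + b) * ?w x * ?w y" by (intro mult_right_mono) auto
    moreover have "0 \<le> 2 powr a * ?w x * k (x - y)" using k by simp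
    ultimately show ?thesis by linarith
  qed
  have gi: "integrable lborel (\<lambda>y. 2 powr a * ?w x * k (x - y) + \<kappa> * 2 powr (a + b) * ?w x * ?w y)"
    by (intro Bochner_Integration.integrable_add integrable_mult_right kr wi)
  show "integrable lborel (\<lambda>y. k (x - y) * ?w y)"
  proof (rule Bochner_Integration.integrable_bound[OF gi])
    show "AE y in lborel. norm (k (x - y) * ?w y) \<le> norm (2 powr a * ?w x * k (x - y) + \<kappa> * 2 powr (a + b) * ?w x * ?w y)"
    proof (intro AE_I2)
      fix y
      have "norm (k (x - y) * ?w y) = k (x - y) * ?w y" using k(2)[of "x - y"] by simp
      then show "norm (k (x - y) * ?w y) \<le> norm (2 powr a * ?w x * k (x - y) + \<kappa> * 2 powr (a + b) * ?w x * ?w y)"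
        using pw[of y] by simp
    qed
  qed measurable
  then have "(\<integral>y. k (x - y) * ?w y \<partial>lborel) \<le> (\<integral>y. 2 powr a * ?w x * k (x - y) + \<kappa> * 2 powr (a + b) * ?w x * ?w y \<partial>lborel)"
    by (rule integral_mono[OF _ gi pw])
  also have "\<dots> = 2 powr a * ?w x * (\<integral>z. k z \<partial>lborel) + \<kappa> * 2 powr (a + b) * ?w x * (\<integral>y. ?w y \<partial>lborel)"
    by (subst Bochner_Integration.integral_add[OF integrable_mult_right[OF kr(1)] integrable_mult_right[OF wi]])
      (simp only: integral_mult_right_zero kr(2))
  finally show "(\<integral>y. k (x - y) * ?w y \<partial>lborel) \<le> (2 powr a * (\<integral>z. k z \<partial>lborel) + \<kappa> * 2 powr (a + b) * (\<integral>y. ?w y \<partial>lborel)) * ?w x"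
    by (simp add: algebra_simps)
qed

context stable_kernel
begin

lemma grad_eq: "0 < \<tau> \<Longrightarrow> grad (\<lambda>z. p_kernel \<alpha> z \<tau>) = D \<tau>"
  using kernel_quadratic quadratic_gradient_grad by blast

lemma D_continuous_space: "0 < \<tau> \<Longrightarrow> continuous_on UNIV (D \<tau>)"
  using kernel_quadratic quadratic_gradient_continuous(1) by blast

lemma D_measurable: "0 < \<tau> \<Longrightarrow> D \<tau> \<in> borel_measurable borel"
  using D_continuous_space borel_measurable_continuous_onI by blast

lemma grad_semigroup_eq: "0 < \<tau> \<Longrightarrow> grad_semigroup \<alpha> \<tau> w x = (\<integral>y. D \<tau> (x - y) \<bullet> w y \<partial>lborel)"
  unfolding grad_semigroup_def grad_eq ..

lemma grad_convolution_integrable: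
  assumes \<tau>: "0 < \<tau>" and g: "integrable lborel g"
  shows "integrable lborel (\<lambda>y. D \<tau> (x - y) \<bullet> g y)"
proof -
  note [measurable] = D_measurable[OF \<tau>]
  have [measurable]: "cball c r \<in> sets borel" for c :: "real^'n" and r by simp
  have [measurable]: "g \<in> borel_measurable borel" using g by auto
  define B where "B = C * \<tau> powr (- ((CARD('n) + 1) / \<alpha>))"
  have B: "norm (D \<tau> z) \<le> B" for z unfolding B_def by (rule grad_bound[OF \<tau>])
  have B0: "0 \<le> B" using B[of 0] norm_ge_zero order_trans by blast
  have i: "integrable lborel (\<lambda>y. B * norm (g y))" using g by simp
  show ?thesis
  proof (rule Bochner_Integration.integrable_bound[OF i])
    show "AE y in lborel. norm (D \<tau> (x - y) \<bullet> g y) \<le> norm (B * norm (g y))"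
    proof (intro AE_I2)
      fix y
      have "norm (D \<tau> (x - y) \<bullet> g y) \<le> norm (D \<tau> (x - y)) * norm (g y)" using Cauchy_Schwarz_ineq2 by simp
      also have "\<dots> \<le> B * norm (g y)" by (intro mult_right_mono B) simp
      finally show "norm (D \<tau> (x - y) \<bullet> g y) \<le> norm (B * norm (g y))" using B0 by simp
    qed
  qed measurable
qed

text \<open>This is the region where the kernel concentrates for small \<tau> and its decay is of no
  help, so that decay or regularity of g has to be used.\<close>

definition near :: "real \<Rightarrow> (real^'n \<Rightarrow> real^'n) \<Rightarrow> real^'n \<Rightarrow> real" where
  "near \<tau> g x = (\<integral>y. indicator (cball x (norm x / 2)) y * (D \<tau> (x - y) \<bullet> g y) \<partial>lborel)"

text \<open>The sum 2^(\<alpha>+d+1) + 1 bounds |D(x-y)| + |D(x)| for |x-y| \<ge> |x|/2 in units of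
  C \<tau> |x|^-(\<alpha>+d+1); the factor 2 comes from trading |x| for 2|y|.\<close>

definition "split_const = 2 * C * (2 powr (\<alpha> + CARD('n) + 1) + 1)"

text \<open>The value D(x) is integrated against all of g, not only outside the ball, so that the
  total integral of g appears. The surplus inside the ball is charged to the first moment as well,
  because |y| \<ge> |x|/2 there; the same exchange covers points outside the ball with |y| >
  |x|/2.\<close>

lemma far_field_split:
  assumes \<tau>: "0 < \<tau>" and x: "x \<noteq> 0" and g: "integrable lborel g" and g1: "integrable lborel (\<lambda>y. norm y * norm (g y))"
  shows "\<bar>(\<integral>y. D \<tau> (x - y) \<bullet> g y \<partial>lborel) + (c1 \<alpha> CARD('n) * \<tau> * norm x powr (- (\<alpha> + CARD('n) + 2))) * (x \<bullet> (\<integral>y. g y \<partial>lborel)) - near \<tau> g x\<bar>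
    \<le> split_const * \<tau> * norm x powr (- (\<alpha> + CARD('n) + 2)) * (\<integral>y. norm y * norm (g y) \<partial>lborel)
      + C * \<tau>\<^sup>2 * norm x powr (- (2 * \<alpha> + CARD('n) + 1)) * (\<integral>y. norm (g y) \<partial>lborel)"
proof -
  note [measurable] = D_measurable[OF \<tau>]
  have [measurable]: "cball c r \<in> sets borel" for c :: "real^'n" and r by simp
  have [measurable]: "g \<in> borel_measurable borel" using g by auto
  define e where "e = \<alpha> + CARD('n) + 1"
  have e0: "0 < e" using \<alpha> by (simp add: e_def)
  have ee: "norm x powr (- (\<alpha> + CARD('n) + 2)) = norm x powr (- e) / norm x"
  proof -
    have "- (\<alpha> + CARD('n) + 2) = - e - 1" by (simp add: e_def)
    then show ?thesis using x by (simp only: powr_diff) simp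
  qed
  define k where "k = c1 \<alpha> CARD('n) * \<tau> * norm x powr (- (\<alpha> + CARD('n) + 2))"
  let ?A = "cball x (norm x / 2)"
  let ?h = "\<lambda>y. indicator (- ?A) y * ((D \<tau> (x - y) - D \<tau> x) \<bullet> g y) - indicator ?A y * (D \<tau> x \<bullet> g y)"
  note i1 = grad_convolution_integrable[OF \<tau> g, of x]
  have i2: "integrable lborel (\<lambda>y. indicator ?A y * (D \<tau> (x - y) \<bullet> g y))"
    by (rule Bochner_Integration.integrable_bound[OF i1], measurable) (auto simp: indicator_def)
  have i3: "integrable lborel (\<lambda>y. D \<tau> x \<bullet> g y)" using g by (rule integrable_inner_right)
  have hb: "\<bar>?h y\<bar> \<le> split_const * \<tau> * norm x powr (- (\<alpha> + CARD('n) + 2)) * (norm y * norm (g y))" for y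
  proof -
    have key: "\<bar>v \<bullet> g y\<bar> \<le> split_const * \<tau> * norm x powr (- (\<alpha> + CARD('n) + 2)) * (norm y * norm (g y))"
      if "norm v \<le> split_const * \<tau> * norm x powr (- (\<alpha> + CARD('n) + 2)) * norm y" for v
    proof -
      have "\<bar>v \<bullet> g y\<bar> \<le> norm v * norm (g y)" by (rule Cauchy_Schwarz_ineq2)
      also have "\<dots> \<le> split_const * \<tau> * norm x powr (- (\<alpha> + CARD('n) + 2)) * norm y * norm (g y)"
        using that by (intro mult_right_mono) auto
      finally show ?thesis by (simp only: mult.assoc)
    qed
    have far: "C * (2 powr e + 1) * \<tau> * norm x powr (- e) \<le> split_const * \<tau> * norm x powr (- (\<alpha> + CARD('n) + 2)) * norm y"
      if "norm x / 2 \<le> norm y"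
    proof -
      have "1 \<le> 2 * norm y / norm x" using that x by (simp add: field_simps)
      then have "C * (2 powr e + 1) * \<tau> * norm x powr (- e) * 1 \<le> C * (2 powr e + 1) * \<tau> * norm x powr (- e) * (2 * norm y / norm x)"
        using C \<tau> by (intro mult_left_mono) (auto intro!: mult_nonneg_nonneg add_nonneg_nonneg)
      also have "\<dots> = split_const * \<tau> * norm x powr (- (\<alpha> + CARD('n) + 2)) * norm y"
        unfolding ee split_const_def e_def by simp
      finally show ?thesis by simp
    qed
    have Dx: "norm (D \<tau> x) \<le> C * \<tau> * norm x powr (- e)" using grad_decay[OF \<tau> x] by (simp add: e_def)
    show ?thesis
    proof (cases "y \<in> ?A")
      case True
      have "norm x - norm y \<le> norm (x - y)" by (rule norm_triangle_ineq2)
      then have "norm x / 2 \<le> norm y" using True by (simp add: dist_norm)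
      note far[OF this]
      moreover have "C * \<tau> * norm x powr (- e) \<le> C * (2 powr e + 1) * \<tau> * norm x powr (- e)"
        using C \<tau> by (intro mult_right_mono) auto
      ultimately show ?thesis using key[of "D \<tau> x"] Dx True by simp
    next
      case False
      then have nA: "norm x / 2 < norm (x - y)" by (simp add: dist_norm)
      have "norm (D \<tau> (x - y) - D \<tau> x) \<le> split_const * \<tau> * norm x powr (- (\<alpha> + CARD('n) + 2)) * norm y"
      proof (cases "norm y \<le> norm x / 2")
        case True
        have "norm (D \<tau> (x - y) - D \<tau> x) \<le> C * \<tau> * norm y * norm x powr (- (\<alpha> + CARD('n) + 2))"
          by (rule grad_difference[OF \<tau> x True])
        also have "\<dots> = C * (\<tau> * norm x powr (- (\<alpha> + CARD('n) + 2)) * norm y)" by simp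
        also have "\<dots> \<le> split_const * (\<tau> * norm x powr (- (\<alpha> + CARD('n) + 2)) * norm y)"
          using C \<tau> by (intro mult_right_mono) (auto simp: split_const_def algebra_simps)
        finally show ?thesis by (simp only: mult.assoc)
      next
        case False
        have "x - y \<noteq> 0" using nA by auto
        then have "norm (D \<tau> (x - y)) \<le> C * \<tau> * norm (x - y) powr (- e)" using grad_decay[OF \<tau>] by (simp add: e_def)
        also have "\<dots> \<le> C * \<tau> * (norm x / 2) powr (- e)" using nA x C \<tau> e0 by (intro mult_left_mono powr_mono2') auto
        also have "(norm x / 2) powr (- e) = 2 powr e * norm x powr (- e)" by (simp add: powr_divide powr_minus_divide)
        finally have "norm (D \<tau> (x - y)) + norm (D \<tau> x) \<le> C * (2 powr e + 1) * \<tau> * norm x powr (- e)" using Dx by (simp add: algebra_simps)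
        also have "\<dots> \<le> split_const * \<tau> * norm x powr (- (\<alpha> + CARD('n) + 2)) * norm y" by (rule far) (use False in simp)
        finally show ?thesis using norm_triangle_ineq4[of "D \<tau> (x - y)" "D \<tau> x"] by linarith
      qed
      then show ?thesis using key[of "D \<tau> (x - y) - D \<tau> x"] False by simp
    qed
  qed
  have hi: "integrable lborel ?h"
    by (rule Bochner_Integration.integrable_bound[OF integrable_mult_right[OF g1, of "split_const * \<tau> * norm x powr (- (\<alpha> + CARD('n) + 2))"]], measurable)
      (intro AE_I2, unfold real_norm_def, rule order_trans[OF hb abs_ge_self])
  have "(\<integral>y. D \<tau> (x - y) \<bullet> g y \<partial>lborel) = (\<integral>y. indicator ?A y * (D \<tau> (x - y) \<bullet> g y) + (?h y + D \<tau> x \<bullet> g y) \<partial>lborel)"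
    by (rule Bochner_Integration.integral_cong) (auto simp: indicator_def inner_diff_left)
  also have "\<dots> = near \<tau> g x + ((\<integral>y. ?h y \<partial>lborel) + D \<tau> x \<bullet> (\<integral>y. g y \<partial>lborel))"
    unfolding near_def using i2 hi i3 integral_inner_right[of "D \<tau> x" lborel g] g by simp
  finally have "(\<integral>y. D \<tau> (x - y) \<bullet> g y \<partial>lborel) + k * (x \<bullet> (\<integral>y. g y \<partial>lborel)) - near \<tau> g x
    = (\<integral>y. ?h y \<partial>lborel) + (D \<tau> x + k *\<^sub>R x) \<bullet> (\<integral>y. g y \<partial>lborel)"
    by (simp add: inner_add_left)
  moreover have "norm (\<integral>y. ?h y \<partial>lborel) \<le> (\<integral>y. split_const * \<tau> * norm x powr (- (\<alpha> + CARD('n) + 2)) * (norm y * norm (g y)) \<partial>lborel)"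
    by (rule norm_integral_le_AE[OF integrable_mult_right[OF g1]]) (use hb in auto)
  then have "\<bar>\<integral>y. ?h y \<partial>lborel\<bar> \<le> split_const * \<tau> * norm x powr (- (\<alpha> + CARD('n) + 2)) * (\<integral>y. norm y * norm (g y) \<partial>lborel)"
    by (simp only: integral_mult_right_zero real_norm_def)
  moreover have "\<bar>(D \<tau> x + k *\<^sub>R x) \<bullet> (\<integral>y. g y \<partial>lborel)\<bar> \<le> C * \<tau>\<^sup>2 * norm x powr (- (2 * \<alpha> + CARD('n) + 1)) * (\<integral>y. norm (g y) \<partial>lborel)"
  proof -
    have "\<bar>(D \<tau> x + k *\<^sub>R x) \<bullet> (\<integral>y. g y \<partial>lborel)\<bar> \<le> norm (D \<tau> x + k *\<^sub>R x) * norm (\<integral>y. g y \<partial>lborel)"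
      by (rule Cauchy_Schwarz_ineq2)
    also have "\<dots> \<le> C * \<tau>\<^sup>2 * norm x powr (- (2 * \<alpha> + CARD('n) + 1)) * (\<integral>y. norm (g y) \<partial>lborel)"
      using grad_asymptotics[OF \<tau> x] C unfolding k_def by (intro mult_mono integral_norm_bound) auto
    finally show ?thesis .
  qed
  ultimately show ?thesis unfolding k_def[symmetric] by linarith
qed

lemma near_bound_sup:
  assumes \<tau>: "0 < \<tau>" and E: "\<And>y. norm (x - y) \<le> norm x / 2 \<Longrightarrow> norm (g y) \<le> E" and E0: "0 \<le> E"
  shows "\<bar>near \<tau> g x\<bar> \<le> E * (C * \<tau> powr (- (1 / \<alpha>)))"
proof -
  note [measurable] = D_measurable[OF \<tau>]
  have [measurable]: "cball c r \<in> sets borel" for c :: "real^'n" and r by simp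
  have ni: "integrable lborel (\<lambda>z. norm (D \<tau> z))" using grad_integral(1)[OF \<tau>] by simp
  have r: "integrable lborel (\<lambda>y. norm (D \<tau> (x - y)))" "(\<integral>y. norm (D \<tau> (x - y)) \<partial>lborel) = (\<integral>z. norm (D \<tau> z) \<partial>lborel)"
    using lborel_integral_reflect[of "\<lambda>z. norm (D \<tau> z)" x] ni by auto
  have "norm (near \<tau> g x) \<le> (\<integral>y. E * norm (D \<tau> (x - y)) \<partial>lborel)"
    unfolding near_def
  proof (rule norm_integral_le_AE[OF integrable_mult_right[OF r(1)]], intro AE_I2)
    fix y
    show "norm (indicator (cball x (norm x / 2)) y * (D \<tau> (x - y) \<bullet> g y)) \<le> E * norm (D \<tau> (x - y))"
    proof (cases "norm (x - y) \<le> norm x / 2")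
      case True
      have "\<bar>D \<tau> (x - y) \<bullet> g y\<bar> \<le> norm (D \<tau> (x - y)) * norm (g y)" by (rule Cauchy_Schwarz_ineq2)
      also have "\<dots> \<le> norm (D \<tau> (x - y)) * E" by (intro mult_left_mono E True) simp
      finally show ?thesis using True E0 by (simp add: indicator_def mult.commute)
    qed (use E0 in \<open>simp add: indicator_def dist_norm\<close>)
  qed
  also have "\<dots> = E * (\<integral>z. norm (D \<tau> z) \<partial>lborel)" by (simp add: r(2))
  also have "\<dots> \<le> E * (C * \<tau> powr (- (1 / \<alpha>)))" by (intro mult_left_mono grad_integral(2) \<tau> E0)
  finally show ?thesis by simp
qed

text \<open>The ball is symmetric about x, so the odd kernel integrates to 0 over it and g(x) may be
  subtracted for free. The Lipschitz bound then leaves the first moment of the kernel, which has no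
  singularity in \<tau>, unlike the mass in \<open>near_bound_sup\<close>.\<close>

lemma near_bound_lipschitz:
  assumes \<tau>: "0 < \<tau>" and g: "integrable lborel g"
    and L: "\<And>y. norm (x - y) \<le> norm x / 2 \<Longrightarrow> norm (g y - g x) \<le> L * norm (x - y)" and L0: "0 \<le> L"
  shows "\<bar>near \<tau> g x\<bar> \<le> L * C"
proof -
  note [measurable] = D_measurable[OF \<tau>]
  have [measurable]: "cball c r \<in> sets borel" for c :: "real^'n" and r by simp
  have [measurable]: "g \<in> borel_measurable borel" using g by auto
  let ?A = "cball x (norm x / 2)"
  have i2: "integrable lborel (\<lambda>y. indicator ?A y * (D \<tau> (x - y) \<bullet> g y))"
    by (rule Bochner_Integration.integrable_bound[OF grad_convolution_integrable[OF \<tau> g, of x]], measurable) (auto simp: indicator_def)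
  let ?k = "\<lambda>z. indicator (cball 0 (norm x / 2)) z *\<^sub>R D \<tau> z"
  have ki: "integrable lborel ?k"
    by (rule Bochner_Integration.integrable_bound[OF grad_integral(1)[OF \<tau>]], measurable) (auto simp: indicator_def)
  have "(\<integral>z. ?k (0 - z) \<partial>lborel) = (\<integral>z. ?k z \<partial>lborel)" by (rule lborel_integral_reflect(2)) measurable
  moreover have "?k (0 - z) = - ?k z" for z using grad_odd[OF \<tau>, of z] by (simp add: indicator_def)
  ultimately have "(\<integral>z. ?k z \<partial>lborel) = - (\<integral>z. ?k z \<partial>lborel)" by simp
  then have "(\<integral>z. ?k z \<partial>lborel) + (\<integral>z. ?k z \<partial>lborel) = 0" by (simp only: eq_neg_iff_add_eq_0)
  then have k0: "(\<integral>z. ?k z \<partial>lborel) = 0" unfolding scaleR_2[symmetric] by simp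
  have kr: "integrable lborel (\<lambda>y. ?k (x - y))" "(\<integral>y. ?k (x - y) \<partial>lborel) = 0"
    using lborel_integral_reflect[of ?k x] ki k0 by auto
  have "(\<integral>y. ?k (x - y) \<bullet> g x \<partial>lborel) = 0" using integral_inner_left[of "g x" lborel "\<lambda>y. ?k (x - y)"] kr by simp
  moreover have i3: "integrable lborel (\<lambda>y. ?k (x - y) \<bullet> g x)" using kr(1) by (rule integrable_inner_left)
  ultimately have "near \<tau> g x = (\<integral>y. indicator ?A y * (D \<tau> (x - y) \<bullet> g y) - ?k (x - y) \<bullet> g x \<partial>lborel)"
    unfolding near_def using i2 by simp
  also have "\<dots> = (\<integral>y. indicator ?A y * (D \<tau> (x - y) \<bullet> (g y - g x)) \<partial>lborel)"
    by (rule Bochner_Integration.integral_cong) (auto simp: indicator_def inner_diff_right dist_norm norm_minus_commute[of x])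
  finally have eq: "near \<tau> g x = (\<integral>y. indicator ?A y * (D \<tau> (x - y) \<bullet> (g y - g x)) \<partial>lborel)" .
  have mr: "integrable lborel (\<lambda>y. norm (x - y) * norm (D \<tau> (x - y)))"
     "(\<integral>y. norm (x - y) * norm (D \<tau> (x - y)) \<partial>lborel) = (\<integral>z. norm z * norm (D \<tau> z) \<partial>lborel)"
    using lborel_integral_reflect[of "\<lambda>z. norm z * norm (D \<tau> z)" x] grad_moment(1)[OF \<tau>] by auto
  have "norm (near \<tau> g x) \<le> (\<integral>y. L * (norm (x - y) * norm (D \<tau> (x - y))) \<partial>lborel)"
    unfolding eq
  proof (rule norm_integral_le_AE[OF integrable_mult_right[OF mr(1)]], intro AE_I2)
    fix y
    show "norm (indicator ?A y * (D \<tau> (x - y) \<bullet> (g y - g x))) \<le> L * (norm (x - y) * norm (D \<tau> (x - y)))"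
    proof (cases "norm (x - y) \<le> norm x / 2")
      case True
      have "\<bar>D \<tau> (x - y) \<bullet> (g y - g x)\<bar> \<le> norm (D \<tau> (x - y)) * norm (g y - g x)" by (rule Cauchy_Schwarz_ineq2)
      also have "\<dots> \<le> norm (D \<tau> (x - y)) * (L * norm (x - y))" by (intro mult_left_mono L True) simp
      finally show ?thesis using True by (simp add: indicator_def dist_norm mult_ac)
    qed (use L0 in \<open>simp add: indicator_def dist_norm\<close>)
  qed
  also have "\<dots> = L * (\<integral>z. norm z * norm (D \<tau> z) \<partial>lborel)" by (simp add: mr(2))
  also have "\<dots> \<le> L * C" by (intro mult_left_mono grad_moment(2) \<tau> L0)
  finally show ?thesis by simp
qed

end

section \<open>Volterra estimates in weighted spaces\<close>

text \<open>At the endpoints the integrands below are uncontrolled, as the kernel has time 0 at s =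
  t and bounds on u are for positive times. Measurability comes from continuity on the open interval
  and a correction at two points.\<close>

lemma set_integrable_open_interval:
  fixes \<phi> :: "real \<Rightarrow> 'b::euclidean_space"
  assumes c: "continuous_on {0<..<t} \<phi>" and b: "\<And>s. 0 < s \<Longrightarrow> s < t \<Longrightarrow> norm (\<phi> s) \<le> h s" and h: "integrable lborel h"
  shows "set_integrable lborel {0..t} \<phi>"
proof -
  have [measurable]: "(\<lambda>s. indicator {0<..<t} s *\<^sub>R \<phi> s) \<in> borel_measurable borel"
    by (rule borel_measurable_continuous_on_indicator[OF _ c]) simp
  have eq: "(\<lambda>s. indicator {0..t} s *\<^sub>R \<phi> s) = (\<lambda>s. indicator {0<..<t} s *\<^sub>R \<phi> s + (if s = 0 \<and> 0 \<le> t then \<phi> 0 else if s = t \<and> 0 \<le> t then \<phi> t else 0))"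
    by (auto simp: fun_eq_iff indicator_def)
  have m: "(\<lambda>s. indicator {0..t} s *\<^sub>R \<phi> s) \<in> borel_measurable borel"
    unfolding eq by measurable
  show ?thesis unfolding set_integrable_def
  proof (rule Bochner_Integration.integrable_bound[OF h])
    show "AE s in lborel. norm (indicator {0..t} s *\<^sub>R \<phi> s) \<le> norm (h s)"
      using AE_lborel_singleton[of 0] AE_lborel_singleton[of t]
    proof eventually_elim
      case (elim s)
      show ?case
      proof (cases "0 < s \<and> s < t")
        case True
        then show ?thesis using b[of s] by simp
      qed (use elim in \<open>auto simp: indicator_def\<close>)
    qed
  qed (use m in simp)
qed

context stable_kernel
begin

text \<open>The tail of the kernel contributes a factor \<tau> and its mass a factor
  \<tau>^(-1/\<alpha>). For \<tau> \<le> T the former is at most T^(1+1/\<alpha>) times the latter,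
  so a single singular factor remains.\<close>

lemma grad_weight_convolution:
  fixes T a :: real
  assumes T: "0 < T" and a: "CARD('n) < a" "a \<le> \<alpha> + CARD('n) + 1"
  obtains K where "0 < K"
    "\<And>\<tau> x. 0 < \<tau> \<Longrightarrow> \<tau> \<le> T \<Longrightarrow> integrable lborel (\<lambda>y. norm (D \<tau> (x - y)) * (1 + norm y) powr (- a))"
    "\<And>\<tau> x. 0 < \<tau> \<Longrightarrow> \<tau> \<le> T \<Longrightarrow> (\<integral>y. norm (D \<tau> (x - y)) * (1 + norm y) powr (- a) \<partial>lborel) \<le> K * \<tau> powr (- (1 / \<alpha>)) * (1 + norm x) powr (- a)"
proof -
  define b where "b = \<alpha> + CARD('n) + 1"
  define W where "W = (\<integral>y. (1 + norm (y::real^'n)) powr (- a) \<partial>lborel)"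
  have W: "0 \<le> W" unfolding W_def by (rule Bochner_Integration.integral_nonneg) simp
  define K where "K = 2 powr a * C + C * T powr (1 + 1 / \<alpha>) * 2 powr (a + b) * W"
  have K: "0 < K" unfolding K_def using C W by (intro add_pos_nonneg mult_nonneg_nonneg) auto
  show ?thesis
  proof (rule that[OF K])
    fix \<tau> :: real and x :: "real^'n" assume \<tau>: "0 < \<tau>" "\<tau> \<le> T"
    let ?k = "\<lambda>z. norm (D \<tau> z)"
    have ki: "integrable lborel ?k" using grad_integral(1)[OF \<tau>(1)] by simp
    have dec: "?k z \<le> C * \<tau> * norm z powr (- b)" if "z \<noteq> 0" for z
      unfolding b_def by (rule grad_decay[OF \<tau>(1) that])
    have k0: "0 \<le> C * \<tau>" using C \<tau> by simp
    have ab: "a \<le> b" using a by (simp add: b_def)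
    note conv = convolution_weight_bound[OF ki norm_ge_zero dec k0 a(1) ab, of x]
    show "integrable lborel (\<lambda>y. ?k (x - y) * (1 + norm y) powr (- a))" by (rule conv(1))
    have "\<tau> = \<tau> powr (1 + 1 / \<alpha>) * \<tau> powr (- (1 / \<alpha>))" unfolding powr_add[symmetric] using \<tau> by simp
    also have "\<dots> \<le> T powr (1 + 1 / \<alpha>) * \<tau> powr (- (1 / \<alpha>))"
      using \<tau> \<alpha> by (intro mult_right_mono powr_mono2) auto
    finally have tau: "\<tau> \<le> T powr (1 + 1 / \<alpha>) * \<tau> powr (- (1 / \<alpha>))" .
    have "2 powr a * (\<integral>z. ?k z \<partial>lborel) + C * \<tau> * 2 powr (a + b) * W \<le> 2 powr a * (C * \<tau> powr (- (1 / \<alpha>))) + C * (T powr (1 + 1 / \<alpha>) * \<tau> powr (- (1 / \<alpha>))) * 2 powr (a + b) * W"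
      using C W tau grad_integral(2)[OF \<tau>(1)] by (intro add_mono mult_left_mono mult_right_mono) auto
    also have "\<dots> = K * \<tau> powr (- (1 / \<alpha>))" by (simp add: K_def algebra_simps)
    finally have "(2 powr a * (\<integral>z. ?k z \<partial>lborel) + C * \<tau> * 2 powr (a + b) * W) * (1 + norm x) powr (- a) \<le> K * \<tau> powr (- (1 / \<alpha>)) * (1 + norm x) powr (- a)"
      by (intro mult_right_mono) auto
    with conv(2) show "(\<integral>y. ?k (x - y) * (1 + norm y) powr (- a) \<partial>lborel) \<le> K * \<tau> powr (- (1 / \<alpha>)) * (1 + norm x) powr (- a)"
      unfolding W_def by linarith
  qed
qed

lemma kernel_weight_convolution:
  fixes T a :: real
  assumes T: "0 < T" and a: "CARD('n) < a" "a \<le> \<alpha> + CARD('n)"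
  obtains K where "0 < K"
    "\<And>\<tau> x::real^'n. 0 < \<tau> \<Longrightarrow> \<tau> \<le> T \<Longrightarrow> integrable lborel (\<lambda>y. \<bar>p_kernel \<alpha> (x - y) \<tau>\<bar> * (1 + norm y) powr (- a))"
    "\<And>\<tau> x::real^'n. 0 < \<tau> \<Longrightarrow> \<tau> \<le> T \<Longrightarrow> (\<integral>y. \<bar>p_kernel \<alpha> (x - y) \<tau>\<bar> * (1 + norm y) powr (- a) \<partial>lborel) \<le> K * (1 + norm x) powr (- a)"
proof -
  define b where "b = \<alpha> + CARD('n)"
  define W where "W = (\<integral>y. (1 + norm (y::real^'n)) powr (- a) \<partial>lborel)"
  have W: "0 \<le> W" unfolding W_def by (rule Bochner_Integration.integral_nonneg) simp
  define K where "K = 2 powr a * C + C * T * 2 powr (a + b) * W"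
  have K: "0 < K" unfolding K_def using C W T by (intro add_pos_nonneg mult_nonneg_nonneg) auto
  show ?thesis
  proof (rule that[OF K])
    fix \<tau> :: real and x :: "real^'n" assume \<tau>: "0 < \<tau>" "\<tau> \<le> T"
    let ?k = "\<lambda>z::real^'n. \<bar>p_kernel \<alpha> z \<tau>\<bar>"
    have ki: "integrable lborel ?k" using kernel_integral(1)[OF \<tau>(1)] by simp
    have dec: "?k z \<le> C * \<tau> * norm z powr (- b)" if "z \<noteq> 0" for z
      unfolding b_def by (rule kernel_decay[OF \<tau>(1) that])
    have k0: "0 \<le> C * \<tau>" using C \<tau> by simp
    have ab: "a \<le> b" using a by (simp add: b_def)
    note conv = convolution_weight_bound[OF ki abs_ge_zero dec k0 a(1) ab, of x]
    show "integrable lborel (\<lambda>y. ?k (x - y) * (1 + norm y) powr (- a))" by (rule conv(1))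
    have "2 powr a * (\<integral>z. ?k z \<partial>lborel) + C * \<tau> * 2 powr (a + b) * W \<le> K"
      unfolding K_def using C W \<tau> kernel_integral(2)[OF \<tau>(1)] by (intro add_mono mult_left_mono mult_right_mono) auto
    then have "(2 powr a * (\<integral>z. ?k z \<partial>lborel) + C * \<tau> * 2 powr (a + b) * W) * (1 + norm x) powr (- a) \<le> K * (1 + norm x) powr (- a)"
      by (intro mult_right_mono) auto
    with conv(2) show "(\<integral>y. ?k (x - y) * (1 + norm y) powr (- a) \<partial>lborel) \<le> K * (1 + norm x) powr (- a)"
      unfolding W_def by linarith
  qed
qed

text \<open>This is the integral of r^(-1/\<alpha>) exp(-\<mu> r) over r > 0. It tends to 0 as \<mu>
  grows, which is what makes the Volterra term small.\<close>

definition "sing_mass \<mu> = Gamma (1 - 1 / \<alpha>) / \<mu> powr (1 - 1 / \<alpha>)"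

lemma exponent_pos: "0 < 1 - 1 / \<alpha>"
  using \<alpha> by simp

lemma has_bochner_integral_sing:
  assumes "0 < \<mu>"
  shows "has_bochner_integral lborel (\<lambda>s. indicator {0<..} (t - s) * ((t - s) powr (- (1 / \<alpha>)) * exp (- (\<mu> * (t - s))))) (sing_mass \<mu>)"
proof -
  let ?f = "\<lambda>r::real. indicator {0<..} r * (r powr (- (1 / \<alpha>)) * exp (- (\<mu> * r)))"
  have "has_bochner_integral lborel ?f (sing_mass \<mu>)"
    using has_bochner_integral_Gamma_scaled[OF exponent_pos assms] by (simp add: sing_mass_def)
  then show ?thesis
    using lborel_integral_reflect[of ?f t] by (simp add: has_bochner_integral_iff)
qed

text \<open>Writing exp(\<mu> s) = exp(\<mu> t) exp(-\<mu>(t-s)) and extending the integration to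
  all s < t replaces the incomplete integral by an exact Gamma value independent of t.\<close>

lemma duhamel_bound:
  fixes a :: "real \<Rightarrow> real"
  assumes l: "0 < \<mu>" and H: "0 \<le> H" and b: "\<And>s. 0 < s \<Longrightarrow> s < t \<Longrightarrow> \<bar>a s\<bar> \<le> H * ((t - s) powr (- (1 / \<alpha>)) * exp (\<mu> * s))"
  shows "\<bar>LINT s:{0..t}|lborel. a s\<bar> \<le> H * (exp (\<mu> * t) * sing_mass \<mu>)"
proof -
  let ?\<psi> = "\<lambda>s. indicator {0<..} (t - s) * ((t - s) powr (- (1 / \<alpha>)) * exp (- (\<mu> * (t - s))))"
  have i: "integrable lborel ?\<psi>" "(\<integral>s. ?\<psi> s \<partial>lborel) = sing_mass \<mu>"
    using has_bochner_integral_sing[OF l] by (auto simp: has_bochner_integral_iff)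
  have "norm (\<integral>s. indicator {0..t} s *\<^sub>R a s \<partial>lborel) \<le> (\<integral>s. H * exp (\<mu> * t) * ?\<psi> s \<partial>lborel)"
  proof (rule norm_integral_le_AE[OF integrable_mult_right[OF i(1)]])
    show "AE s in lborel. norm (indicator {0..t} s *\<^sub>R a s) \<le> H * exp (\<mu> * t) * ?\<psi> s"
      using AE_lborel_singleton[of 0] AE_lborel_singleton[of t]
    proof eventually_elim
      case (elim s)
      show ?case
      proof (cases "0 < s \<and> s < t")
        case True
        have "exp (\<mu> * s) = exp (\<mu> * t) * exp (- (\<mu> * (t - s)))" unfolding exp_add[symmetric] by (simp add: algebra_simps)
        then show ?thesis using b[of s] True by (simp add: mult_ac)
      next
        case False
        then have "indicator {0..t} s *\<^sub>R a s = 0" using elim by (auto simp: indicator_def)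
        moreover have "0 \<le> H * exp (\<mu> * t) * ?\<psi> s" using H by simp
        ultimately show ?thesis by (simp only: norm_zero)
      qed
    qed
  qed
  also have "\<dots> = H * exp (\<mu> * t) * sing_mass \<mu>" unfolding integral_mult_right_zero i(2) ..
  finally show ?thesis unfolding set_lebesgue_integral_def by (simp add: mult.assoc)
qed

lemma grad_convolution_le:
  assumes \<tau>: "0 < \<tau>" and i: "integrable lborel (\<lambda>y. norm (D \<tau> (x - y)) * W y)" and le: "(\<integral>y. norm (D \<tau> (x - y)) * W y \<partial>lborel) \<le> R"
    and g: "\<And>y. norm (g y) \<le> c * W y" and c: "0 \<le> c"
  shows "\<bar>grad_semigroup \<alpha> \<tau> g x\<bar> \<le> c * R"
proof -
  have "norm (\<integral>y. D \<tau> (x - y) \<bullet> g y \<partial>lborel) \<le> (\<integral>y. c * (norm (D \<tau> (x - y)) * W y) \<partial>lborel)"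
  proof (rule norm_integral_le_AE[OF integrable_mult_right[OF i]], intro AE_I2)
    fix y
    have "norm (D \<tau> (x - y) \<bullet> g y) \<le> norm (D \<tau> (x - y)) * norm (g y)" using Cauchy_Schwarz_ineq2 by simp
    also have "\<dots> \<le> norm (D \<tau> (x - y)) * (c * W y)" by (intro mult_left_mono g) simp
    finally show "norm (D \<tau> (x - y) \<bullet> g y) \<le> c * (norm (D \<tau> (x - y)) * W y)" by (simp add: mult_ac)
  qed
  also have "\<dots> = c * (\<integral>y. norm (D \<tau> (x - y)) * W y \<partial>lborel)" by (rule integral_mult_right_zero)
  also have "\<dots> \<le> c * R" by (intro mult_left_mono le c)
  finally show ?thesis unfolding grad_semigroup_eq[OF \<tau>] by simp
qed

lemma duhamel_weight_bound:
  assumes l: "0 < \<mu>" and t: "t \<le> T" and K: "0 \<le> K" and c: "0 \<le> c" and Wx: "0 \<le> W x"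
    and i: "\<And>\<tau>. 0 < \<tau> \<Longrightarrow> \<tau> \<le> T \<Longrightarrow> integrable lborel (\<lambda>y. norm (D \<tau> (x - y)) * W y)"
    and le: "\<And>\<tau>. 0 < \<tau> \<Longrightarrow> \<tau> \<le> T \<Longrightarrow> (\<integral>y. norm (D \<tau> (x - y)) * W y \<partial>lborel) \<le> K * \<tau> powr (- (1 / \<alpha>)) * W x"
    and g: "\<And>s y. 0 < s \<Longrightarrow> s < t \<Longrightarrow> norm (g s y) \<le> c * exp (\<mu> * s) * W y"
  shows "\<bar>LINT s:{0..t}|lborel. grad_semigroup \<alpha> (t - s) (g s) x\<bar> \<le> c * K * W x * (exp (\<mu> * t) * sing_mass \<mu>)"
proof (rule duhamel_bound[OF l])
  show "0 \<le> c * K * W x" using c K Wx by simp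
  fix s assume s: "0 < s" "s < t"
  have "\<bar>grad_semigroup \<alpha> (t - s) (g s) x\<bar> \<le> c * exp (\<mu> * s) * (K * (t - s) powr (- (1 / \<alpha>)) * W x)"
    by (rule grad_convolution_le[OF _ i le g]) (use s t c in auto)
  then show "\<bar>grad_semigroup \<alpha> (t - s) (g s) x\<bar> \<le> c * K * W x * ((t - s) powr (- (1 / \<alpha>)) * exp (\<mu> * s))"
    by (simp add: mult_ac)
qed

text \<open>The supremum carries the exponential weight \<open>e\<^sup>-\<^sup>\<mu>\<^sup>t\<close>, so that the singular Volterra term is
  absorbed for large \<open>\<mu>\<close> and no measurability in time is needed.\<close>

lemma weighted_gronwall:
  fixes v :: "real \<Rightarrow> 'a \<Rightarrow> real"
  assumes T: "0 < T" and B: "\<And>t x. 0 < t \<Longrightarrow> t \<le> T \<Longrightarrow> \<bar>v t x\<bar> \<le> B" and W: "0 < \<epsilon>" "\<And>x. \<epsilon> \<le> W x"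
    and A: "0 \<le> A" and l: "0 < \<mu>" and H: "0 \<le> H" "H * sing_mass \<mu> \<le> 1/2"
    and step: "\<And>m t x. 0 \<le> m \<Longrightarrow> 0 < t \<Longrightarrow> t \<le> T \<Longrightarrow> (\<And>s y. 0 < s \<Longrightarrow> s < t \<Longrightarrow> \<bar>v s y\<bar> \<le> m * exp (\<mu> * s) * W y)
      \<Longrightarrow> \<bar>v t x\<bar> \<le> A * W x + m * H * W x * (exp (\<mu> * t) * sing_mass \<mu>)"
    and t: "0 < t" "t \<le> T"
  shows "\<bar>v t x\<bar> \<le> 2 * A * exp (\<mu> * T) * W x"
proof -
  define Q where "Q = (\<lambda>(t, x). exp (- (\<mu> * t)) * \<bar>v t x\<bar> / W x)"
  define S where "S = Q ` ({0<..T} \<times> UNIV)"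
  have Wp: "0 < W x" for x using W(1) W(2)[of x] by linarith
  have B0: "0 \<le> B" using B[OF t, of x] by simp
  \<comment> \<open>A finite supremum is what allows the term m/2 to be absorbed at the end. It is
    finite because v is bounded and W is bounded below by \<epsilon>; neither bound enters the final
    constant.\<close>
  have bdd: "bdd_above S"
  proof (rule bdd_aboveI[of _ "B / \<epsilon>"])
    fix z assume "z \<in> S"
    then obtain t' y where z: "z = exp (- (\<mu> * t')) * \<bar>v t' y\<bar> / W y" "0 < t'" "t' \<le> T" by (auto simp: S_def Q_def)
    have "exp (- (\<mu> * t')) * \<bar>v t' y\<bar> \<le> 1 * B" using B[OF z(2,3)] l z by (intro mult_mono) auto
    then show "z \<le> B / \<epsilon>" unfolding z(1) using W B0 by (intro frac_le) auto
  qed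
  define m where "m = Sup S"
  have mem: "Q (t', y) \<le> m" if "0 < t'" "t' \<le> T" for t' y
    unfolding m_def by (rule cSup_upper[OF _ bdd]) (use that in \<open>auto simp: S_def\<close>)
  have "0 \<le> Q (t, x)" using Wp[of x] by (simp add: Q_def)
  then have m0: "0 \<le> m" using mem[OF t, of x] by linarith
  have vb: "\<bar>v s y\<bar> \<le> m * exp (\<mu> * s) * W y" if "0 < s" "s \<le> T" for s y
  proof -
    have "exp (- (\<mu> * s)) * \<bar>v s y\<bar> \<le> m * W y" using mem[OF that, of y] Wp[of y] by (simp add: Q_def pos_divide_le_eq)
    then have "exp (\<mu> * s) * (exp (- (\<mu> * s)) * \<bar>v s y\<bar>) \<le> exp (\<mu> * s) * (m * W y)" by (intro mult_left_mono) auto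
    then show ?thesis by (simp add: exp_minus mult_ac)
  qed
  have "z \<le> A + m / 2" if "z \<in> S" for z
  proof -
    from that obtain t' y where z: "z = exp (- (\<mu> * t')) * \<bar>v t' y\<bar> / W y" "0 < t'" "t' \<le> T" by (auto simp: S_def Q_def)
    have "\<bar>v t' y\<bar> \<le> A * W y + m * H * W y * (exp (\<mu> * t') * sing_mass \<mu>)"
      by (rule step[OF m0 z(2,3)]) (use z in \<open>auto intro!: vb\<close>)
    also have "m * H * W y * (exp (\<mu> * t') * sing_mass \<mu>) = m * W y * exp (\<mu> * t') * (H * sing_mass \<mu>)" by (simp add: mult_ac)
    also have "A * W y + m * W y * exp (\<mu> * t') * (H * sing_mass \<mu>) \<le> A * W y * exp (\<mu> * t') + m * W y * exp (\<mu> * t') * (1/2)"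
    proof (rule add_mono)
      have "1 \<le> exp (\<mu> * t')" using l z(2) by simp
      from mult_left_mono[OF this, of "A * W y"] show "A * W y \<le> A * W y * exp (\<mu> * t')" using A Wp[of y] by simp
      show "m * W y * exp (\<mu> * t') * (H * sing_mass \<mu>) \<le> m * W y * exp (\<mu> * t') * (1/2)"
        using m0 Wp[of y] by (intro mult_left_mono H(2)) simp
    qed
    finally have "\<bar>v t' y\<bar> \<le> (A + m / 2) * W y * exp (\<mu> * t')" by (simp add: algebra_simps)
    then have "exp (- (\<mu> * t')) * \<bar>v t' y\<bar> \<le> exp (- (\<mu> * t')) * ((A + m / 2) * W y * exp (\<mu> * t'))" by (intro mult_left_mono) auto
    also have "\<dots> = (A + m / 2) * W y" by (simp add: exp_minus)
    finally show ?thesis unfolding z(1) using Wp[of y] by (simp add: pos_divide_le_eq)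
  qed
  moreover have "S \<noteq> {}" using T by (auto simp: S_def)
  ultimately have "m \<le> A + m / 2" unfolding m_def[symmetric] by (metis cSup_least m_def)
  then have "m \<le> 2 * A" by simp
  then have "m * exp (\<mu> * t) * W x \<le> 2 * A * exp (\<mu> * T) * W x"
    using Wp[of x] A l t by (intro mult_right_mono mult_mono) auto
  then show ?thesis using vb[OF t, of x] by linarith
qed

lemma sing_mass_small:
  assumes H: "0 \<le> H"
  obtains \<mu> where "0 < \<mu>" "H * sing_mass \<mu> \<le> 1/2"
proof -
  let ?b = "1 - 1 / \<alpha>"
  define G where "G = H * Gamma ?b"
  have G: "0 \<le> G" unfolding G_def using H exponent_pos by (simp add: Gamma_real_nonneg)
  define \<mu> where "\<mu> = (2 * G + 1) powr (1 / ?b)"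
  have bb: "1 / ?b * ?b = 1" by (rule nonzero_eq_divide_eq[THEN iffD1, OF _ refl]) (use exponent_pos in linarith)
  have l: "0 < \<mu>" using G by (simp add: \<mu>_def)
  have "\<mu> powr ?b = 2 * G + 1" unfolding \<mu>_def powr_powr using bb G by simp
  then have "H * sing_mass \<mu> = G / (2 * G + 1)" by (simp add: sing_mass_def G_def)
  also have "\<dots> \<le> 1/2" using G by (simp add: field_simps)
  finally show ?thesis using that[OF l] by blast
qed

text \<open>A set integral that does not converge is 0 by convention, so genuine integrability must
  be known before Duhamel terms are added or subtracted. Continuity in s separates the change of g,
  controlled in L^1, from the change of the kernel, handled by dominated convergence for fixed
  g.\<close>

lemma duhamel_integrable:
  fixes g :: "real \<Rightarrow> real^'n \<Rightarrow> real^'n"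
  assumes gi: "\<And>s. 0 < s \<Longrightarrow> s < t \<Longrightarrow> integrable lborel (g s)"
    and gc: "\<And>r s. (\<And>k. 0 < r k \<and> r k < t) \<Longrightarrow> 0 < s \<Longrightarrow> s < t \<Longrightarrow> r \<longlonglongrightarrow> s \<Longrightarrow> (\<lambda>k. \<integral>y. norm (g (r k) y - g s y) \<partial>lborel) \<longlonglongrightarrow> 0"
    and gb: "\<And>s y. 0 < s \<Longrightarrow> s < t \<Longrightarrow> norm (g s y) \<le> E" "\<And>s. 0 < s \<Longrightarrow> s < t \<Longrightarrow> (\<integral>y. norm (g s y) \<partial>lborel) \<le> B"
  shows "set_integrable lborel {0..t} (\<lambda>s. grad_semigroup \<alpha> (t - s) (g s) x)"
    and "set_integrable lborel {0..t} (\<lambda>s. (t - s) *\<^sub>R (\<integral>y. g s y \<partial>lborel))"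
proof -
  have lim_int: "(\<lambda>k. \<integral>y. g (r k) y \<partial>lborel) \<longlonglongrightarrow> (\<integral>y. g s y \<partial>lborel)"
    if r: "\<And>k. 0 < r k \<and> r k < t" and s: "0 < s" "s < t" and lim: "r \<longlonglongrightarrow> s" for r s
  proof (rule LIM_zero_cancel, rule Lim_null_comparison[OF _ gc[OF r s lim]], rule always_eventually, rule allI)
    fix k
    have "(\<integral>y. g (r k) y \<partial>lborel) - (\<integral>y. g s y \<partial>lborel) = (\<integral>y. g (r k) y - g s y \<partial>lborel)"
      using gi r s by (intro Bochner_Integration.integral_diff[symmetric]) auto
    then show "norm ((\<integral>y. g (r k) y \<partial>lborel) - (\<integral>y. g s y \<partial>lborel)) \<le> (\<integral>y. norm (g (r k) y - g s y) \<partial>lborel)"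
      using integral_norm_bound by metis
  qed
  show "set_integrable lborel {0..t} (\<lambda>s. (t - s) *\<^sub>R (\<integral>y. g s y \<partial>lborel))"
  proof (rule set_integrable_open_interval)
    show "continuous_on {0<..<t} (\<lambda>s. (t - s) *\<^sub>R (\<integral>y. g s y \<partial>lborel))"
      unfolding continuous_on_sequentially o_def
    proof (intro allI ballI impI, elim conjE)
      fix r s assume "s \<in> {0<..<t}" "\<forall>k. r k \<in> {0<..<t}" "r \<longlonglongrightarrow> s"
      then show "(\<lambda>k. (t - r k) *\<^sub>R (\<integral>y. g (r k) y \<partial>lborel)) \<longlonglongrightarrow> (t - s) *\<^sub>R (\<integral>y. g s y \<partial>lborel)"
        by (intro tendsto_intros lim_int) auto
    qed
    show "norm ((t - s) *\<^sub>R (\<integral>y. g s y \<partial>lborel)) \<le> indicator {0..t} s * (t * B)" if s: "0 < s" "s < t" for s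
    proof -
      have "norm (\<integral>y. g s y \<partial>lborel) \<le> B" using integral_norm_bound[of lborel "g s"] gb(2)[OF s] by linarith
      then have "(t - s) * norm (\<integral>y. g s y \<partial>lborel) \<le> t * B" using s by (intro mult_mono) auto
      then show ?thesis using s by simp
    qed
    have "integrable lborel (indicat_real {0..t})" by (simp add: emeasure_lborel_Icc_eq)
    then show "integrable lborel (\<lambda>s. indicator {0..t} s * (t * B))" by simp
  qed
  let ?a = "\<lambda>s. grad_semigroup \<alpha> (t - s) (g s) x"
  define N where "N \<tau> = C * \<tau> powr (- ((CARD('n) + 1) / \<alpha>))" for \<tau>
  have N: "norm (D \<tau> z) \<le> N \<tau>" if "0 < \<tau>" for \<tau> z unfolding N_def by (rule grad_bound[OF that])
  show "set_integrable lborel {0..t} ?a"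
  proof (rule set_integrable_open_interval)
    show "continuous_on {0<..<t} ?a"
      unfolding continuous_on_sequentially o_def
    proof (intro allI ballI impI, elim conjE)
      fix r s assume s: "s \<in> {0<..<t}" and r: "\<forall>k. r k \<in> {0<..<t}" and lim: "r \<longlonglongrightarrow> s"
      have r': "0 < r k \<and> r k < t" for k using r by simp
      have s': "0 < s" "s < t" using s by auto
      have \<tau>: "0 < t - r k" "0 < t - s" for k using r'[of k] s' by auto
      note [measurable] = D_measurable[OF \<tau>(1)] D_measurable[OF \<tau>(2)]
      have [measurable]: "g s \<in> borel_measurable borel" "g (r k) \<in> borel_measurable borel" for k
        using gi[OF s'] gi[of "r k"] r'[of k] by auto
      have tlim: "(\<lambda>k. t - r k) \<longlonglongrightarrow> t - s" by (intro tendsto_intros lim)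
      have Nlim: "(\<lambda>k. N (t - r k)) \<longlonglongrightarrow> N (t - s)"
        unfolding N_def using \<tau>(2) by (intro tendsto_intros tlim) auto
      obtain N0 where N0: "\<And>k. \<bar>N (t - r k)\<bar> \<le> N0"
        using convergent_imp_Bseq[OF convergentI[OF Nlim]] unfolding Bseq_def by auto
      have DN: "norm (D (t - r k) z) \<le> N0" for k z using N[OF \<tau>(1)[of k], of z] N0[of k] by linarith
      have first: "(\<lambda>k. \<integral>y. D (t - r k) (x - y) \<bullet> (g (r k) y - g s y) \<partial>lborel) \<longlonglongrightarrow> 0"
      proof (rule Lim_null_comparison)
        show "(\<lambda>k. N0 * (\<integral>y. norm (g (r k) y - g s y) \<partial>lborel)) \<longlonglongrightarrow> 0"
          by (intro tendsto_mult_right_zero gc[OF r' s' lim])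
        show "\<forall>\<^sub>F k in sequentially. norm (\<integral>y. D (t - r k) (x - y) \<bullet> (g (r k) y - g s y) \<partial>lborel) \<le> N0 * (\<integral>y. norm (g (r k) y - g s y) \<partial>lborel)"
        proof (rule always_eventually, rule allI)
          fix k
          have i: "integrable lborel (\<lambda>y. norm (g (r k) y - g s y))"
            using gi[OF s'] gi[of "r k"] r'[of k] by (intro integrable_norm Bochner_Integration.integrable_diff) auto
          have "norm (\<integral>y. D (t - r k) (x - y) \<bullet> (g (r k) y - g s y) \<partial>lborel) \<le> (\<integral>y. N0 * norm (g (r k) y - g s y) \<partial>lborel)"
          proof (rule norm_integral_le_AE[OF integrable_mult_right[OF i]], intro AE_I2)
            fix y
            have "norm (D (t - r k) (x - y) \<bullet> (g (r k) y - g s y)) \<le> norm (D (t - r k) (x - y)) * norm (g (r k) y - g s y)"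
              using Cauchy_Schwarz_ineq2 by simp
            also have "\<dots> \<le> N0 * norm (g (r k) y - g s y)" by (intro mult_right_mono DN) simp
            finally show "norm (D (t - r k) (x - y) \<bullet> (g (r k) y - g s y)) \<le> N0 * norm (g (r k) y - g s y)" .
          qed
          then show "norm (\<integral>y. D (t - r k) (x - y) \<bullet> (g (r k) y - g s y) \<partial>lborel) \<le> N0 * (\<integral>y. norm (g (r k) y - g s y) \<partial>lborel)"
            by (simp only: integral_mult_right_zero)
        qed
      qed
      have second: "(\<lambda>k. \<integral>y. D (t - r k) (x - y) \<bullet> g s y \<partial>lborel) \<longlonglongrightarrow> (\<integral>y. D (t - s) (x - y) \<bullet> g s y \<partial>lborel)"
      proof (rule integral_dominated_convergence)
        show "integrable lborel (\<lambda>y. N0 * norm (g s y))" using gi[OF s'] by simp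
        show "AE y in lborel. (\<lambda>k. D (t - r k) (x - y) \<bullet> g s y) \<longlonglongrightarrow> D (t - s) (x - y) \<bullet> g s y"
        proof (intro AE_I2)
          fix y
          have "(\<lambda>k. D (t - r k) (x - y)) \<longlonglongrightarrow> D (t - s) (x - y)"
            by (rule continuous_on_tendsto_compose[OF grad_continuous tlim]) (use \<tau> in auto)
          then show "(\<lambda>k. D (t - r k) (x - y) \<bullet> g s y) \<longlonglongrightarrow> D (t - s) (x - y) \<bullet> g s y" by (intro tendsto_intros)
        qed
        show "AE y in lborel. norm (D (t - r k) (x - y) \<bullet> g s y) \<le> N0 * norm (g s y)" for k
        proof (intro AE_I2)
          fix y
          have "norm (D (t - r k) (x - y) \<bullet> g s y) \<le> norm (D (t - r k) (x - y)) * norm (g s y)"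
            using Cauchy_Schwarz_ineq2 by simp
          also have "\<dots> \<le> N0 * norm (g s y)" by (intro mult_right_mono DN) simp
          finally show "norm (D (t - r k) (x - y) \<bullet> g s y) \<le> N0 * norm (g s y)" .
        qed
      qed measurable
      have "?a (r k) = (\<integral>y. D (t - r k) (x - y) \<bullet> (g (r k) y - g s y) \<partial>lborel) + (\<integral>y. D (t - r k) (x - y) \<bullet> g s y \<partial>lborel)" for k
        unfolding grad_semigroup_eq[OF \<tau>(1)] inner_diff_right
        using grad_convolution_integrable[OF \<tau>(1)[of k] gi[OF s'], of x] grad_convolution_integrable[OF \<tau>(1)[of k] gi[of "r k"], of x] r'[of k]
        by simp
      moreover have "?a s = (\<integral>y. D (t - s) (x - y) \<bullet> g s y \<partial>lborel)" by (rule grad_semigroup_eq[OF \<tau>(2)])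
      ultimately show "(\<lambda>k. ?a (r k)) \<longlonglongrightarrow> ?a s" using tendsto_add[OF first second] by simp
    qed
    \<comment> \<open>The factor exp(t) exp(-(t-s)) is at least 1; it only casts the majorant into
      the form of \<open>has_bochner_integral_sing\<close> with rate 1.\<close>
    show "norm (?a s) \<le> max 0 E * C * exp t * (indicator {0<..} (t - s) * ((t - s) powr (- (1 / \<alpha>)) * exp (- (1 * (t - s)))))" if s: "0 < s" "s < t" for s
    proof -
      have \<tau>: "0 < t - s" using s by simp
      note [measurable] = D_measurable[OF \<tau>]
      have ni: "integrable lborel (\<lambda>z. norm (D (t - s) z))" using grad_integral(1)[OF \<tau>] by simp
      have rr: "integrable lborel (\<lambda>y. norm (D (t - s) (x - y)) * 1)" "(\<integral>y. norm (D (t - s) (x - y)) * 1 \<partial>lborel) = (\<integral>z. norm (D (t - s) z) \<partial>lborel)"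
        using lborel_integral_reflect[of "\<lambda>z. norm (D (t - s) z)" x] ni by auto
      have "norm (g s y) \<le> max 0 E * 1" for y using gb(1)[OF s, of y] by simp
      then have "\<bar>?a s\<bar> \<le> max 0 E * (C * (t - s) powr (- (1 / \<alpha>)))"
        using grad_integral(2)[OF \<tau>] by (intro grad_convolution_le[where W="\<lambda>_. 1", OF \<tau> rr(1)]) (simp_all only: rr(2) max.cobounded1)
      moreover have "1 \<le> exp t * exp (- (1 * (t - s)))" unfolding exp_add[symmetric] using s by simp
      then have "max 0 E * (C * (t - s) powr (- (1 / \<alpha>))) * 1 \<le> max 0 E * (C * (t - s) powr (- (1 / \<alpha>))) * (exp t * exp (- (1 * (t - s))))"
        using C by (intro mult_left_mono) auto
      moreover have "max 0 E * C * exp t * (indicator {0<..} (t - s) * ((t - s) powr (- (1 / \<alpha>)) * exp (- (1 * (t - s)))))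
        = max 0 E * (C * (t - s) powr (- (1 / \<alpha>))) * (exp t * exp (- (1 * (t - s))))"
        using s by simp
      ultimately show ?thesis unfolding real_norm_def by linarith
    qed
    show "integrable lborel (\<lambda>s. max 0 E * C * exp t * (indicator {0<..} (t - s) * ((t - s) powr (- (1 / \<alpha>)) * exp (- (1 * (t - s))))))"
      by (intro integrable_mult_right integrable.intros[OF has_bochner_integral_sing]) simp
  qed
qed

end

text \<open>Of the p powers, p - p' are spent on the uniform bound M and p' are kept for the
  decaying bound V.\<close>

lemma powr_split_le:
  fixes a M V p p' :: real
  assumes "0 \<le> a" "a \<le> M" "a \<le> V" "0 \<le> p'" "p' \<le> p"
  shows "a powr p \<le> M powr (p - p') * V powr p'"
proof -
  have "a powr p = a powr (p - p') * a powr p'" by (simp flip: powr_add)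
  also have "\<dots> \<le> M powr (p - p') * V powr p'" using assms by (intro mult_mono powr_mono2) auto
  finally show ?thesis .
qed

section \<open>The Duhamel term integrated in time\<close>

context stable_kernel
begin

text \<open>It is the factor exp(\<mu> t) \<open>sing_mass \<mu>\<close> of
  \<open>duhamel_bound\<close> at the rate \<mu> = 1/t, without the power t^(1-1/\<alpha>).\<close>

definition "sing_const = exp 1 * Gamma (1 - 1 / \<alpha>)"

lemma sing_const_nonneg: "0 \<le> sing_const"
  using exponent_pos by (simp add: sing_const_def Gamma_real_nonneg)

text \<open>The rate \<mu> = 1/t makes exp(\<mu> s) harmless on [0,t]. The constant part of the
  bound is first made singular through 1 \<le> t^(1/\<alpha>) (t-s)^(-1/\<alpha>); the result t +
  t^(1-1/\<alpha>) is at most 2(1+t).\<close>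

lemma duhamel_time_bound:
  fixes a :: "real \<Rightarrow> real"
  assumes t: "0 < t" and P: "0 \<le> P" and b: "\<And>s. 0 < s \<Longrightarrow> s < t \<Longrightarrow> \<bar>a s\<bar> \<le> P * (1 + (t - s) powr (- (1 / \<alpha>)))"
  shows "\<bar>LINT s:{0..t}|lborel. a s\<bar> \<le> 2 * sing_const * P * (1 + t)"
proof -
  define r where "r = 1 / \<alpha>"
  have r: "0 < r" "r < 1" using \<alpha> by (simp_all add: r_def)
  have "\<bar>LINT s:{0..t}|lborel. a s\<bar> \<le> P * (t powr r + 1) * (exp (1 / t * t) * sing_mass (1 / t))"
  proof (rule duhamel_bound)
    fix s assume s: "0 < s" "s < t"
    define \<sigma> where "\<sigma> = (t - s) powr (- r)"
    have "1 \<le> exp (1 / t * s)" using s by simp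
    then have e: "\<sigma> * 1 \<le> \<sigma> * exp (1 / t * s)" by (intro mult_left_mono) (auto simp: \<sigma>_def)
    have "1 = t powr r * t powr (- r)" using t by (simp flip: powr_add)
    also have "\<dots> \<le> t powr r * \<sigma>" unfolding \<sigma>_def using s r by (intro mult_left_mono powr_mono2') auto
    finally have "1 + \<sigma> \<le> (t powr r + 1) * \<sigma>" by (simp add: algebra_simps)
    also have "\<dots> \<le> (t powr r + 1) * (\<sigma> * exp (1 / t * s))" using e by (intro mult_left_mono) auto
    finally have "P * (1 + \<sigma>) \<le> P * ((t powr r + 1) * (\<sigma> * exp (1 / t * s)))" using P by (rule mult_left_mono)
    then show "\<bar>a s\<bar> \<le> P * (t powr r + 1) * ((t - s) powr (- (1 / \<alpha>)) * exp (1 / t * s))"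
      using b[OF s] unfolding \<sigma>_def r_def by (simp only: mult.assoc)
  qed (use t P in auto)
  also have "exp (1 / t * t) * sing_mass (1 / t) = sing_const * t powr (1 - r)"
    using t by (simp add: sing_mass_def sing_const_def r_def powr_divide)
  also have "P * (t powr r + 1) * (sing_const * t powr (1 - r)) \<le> P * sing_const * (2 * (1 + t))"
  proof -
    have "t powr r * t powr (1 - r) = t" using t by (simp flip: powr_add)
    moreover have "t powr (1 - r) \<le> (1 + t) powr (1 - r)" using t r by (intro powr_mono2) auto
    moreover have "(1 + t) powr (1 - r) \<le> (1 + t) powr 1" using t r by (intro powr_mono) auto
    ultimately have "(t powr r + 1) * t powr (1 - r) \<le> 2 * (1 + t)" using t by (simp add: distrib_right)
    then have "(P * sing_const) * ((t powr r + 1) * t powr (1 - r)) \<le> (P * sing_const) * (2 * (1 + t))"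
      using P sing_const_nonneg by (intro mult_left_mono) auto
    then show ?thesis by (simp only: mult_ac)
  qed
  finally show ?thesis by (simp only: mult_ac)
qed

definition "far_const = 2 * sing_const * (split_const + C + 1)"

text \<open>At each s the far-field error is of order (1+t)^2: in one term the elapsed time meets a
  first moment of size 1+t, in the other the elapsed time is squared. Integration in s costs the
  third factor. The weight t-s in the second integral is the time factor of the kernel
  asymptotics.\<close>

lemma duhamel_far_field:
  fixes g :: "real \<Rightarrow> real^'n \<Rightarrow> real^'n"
  assumes t: "0 < t" and x: "1 \<le> norm x"
    and g: "\<And>s. 0 < s \<Longrightarrow> s < t \<Longrightarrow> integrable lborel (g s)" "\<And>s. 0 < s \<Longrightarrow> s < t \<Longrightarrow> integrable lborel (\<lambda>y. norm y * norm (g s y))"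
    and B: "\<And>s. 0 < s \<Longrightarrow> s < t \<Longrightarrow> (\<integral>y. norm (g s y) \<partial>lborel) \<le> B" "\<And>s. 0 < s \<Longrightarrow> s < t \<Longrightarrow> (\<integral>y. norm y * norm (g s y) \<partial>lborel) \<le> B * (1 + t)"
    and near: "\<And>s. 0 < s \<Longrightarrow> s < t \<Longrightarrow> \<bar>near (t - s) (g s) x\<bar> \<le> (1 + t)\<^sup>2 * E * (1 + (t - s) powr (- (1 / \<alpha>)))"
    and si: "set_integrable lborel {0..t} (\<lambda>s. grad_semigroup \<alpha> (t - s) (g s) x)" "set_integrable lborel {0..t} (\<lambda>s. (t - s) *\<^sub>R (\<integral>y. g s y \<partial>lborel))"
    and B0: "0 \<le> B" and E0: "0 \<le> E"
  shows "\<bar>(LINT s:{0..t}|lborel. grad_semigroup \<alpha> (t - s) (g s) x)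
      + ((c1 \<alpha> CARD('n) / norm x powr (\<alpha> + CARD('n) + 2)) *\<^sub>R x) \<bullet> (LINT s:{0..t}|lborel. (t - s) *\<^sub>R (\<integral>y. g s y \<partial>lborel))\<bar>
    \<le> far_const * (1 + t) ^ 3 * (B * norm x powr (- (\<alpha> + CARD('n) + 2)) + E)"
proof -
  define X where "X = norm x powr (- (\<alpha> + CARD('n) + 2))"
  define k where "k = (c1 \<alpha> CARD('n) / norm x powr (\<alpha> + CARD('n) + 2)) *\<^sub>R x"
  have kX: "k = (c1 \<alpha> CARD('n) * X) *\<^sub>R x" unfolding k_def X_def powr_minus_divide by simp
  have X: "0 \<le> X" by (simp add: X_def)
  have S: "0 \<le> split_const" using C by (simp add: split_const_def)
  have si2: "set_integrable lborel {0..t} (\<lambda>s. k \<bullet> ((t - s) *\<^sub>R (\<integral>y. g s y \<partial>lborel)))"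
    "(LINT s:{0..t}|lborel. k \<bullet> ((t - s) *\<^sub>R (\<integral>y. g s y \<partial>lborel))) = k \<bullet> (LINT s:{0..t}|lborel. (t - s) *\<^sub>R (\<integral>y. g s y \<partial>lborel))"
  proof -
    define v where "v s = indicat_real {0..t} s *\<^sub>R ((t - s) *\<^sub>R (\<integral>y. g s y \<partial>lborel))" for s
    have i: "integrable lborel v" using si(2) unfolding set_integrable_def v_def .
    have eq: "indicat_real {0..t} s *\<^sub>R (k \<bullet> ((t - s) *\<^sub>R (\<integral>y. g s y \<partial>lborel))) = k \<bullet> v s" for s by (simp add: v_def)
    show "set_integrable lborel {0..t} (\<lambda>s. k \<bullet> ((t - s) *\<^sub>R (\<integral>y. g s y \<partial>lborel)))"
      unfolding set_integrable_def eq using i by (rule integrable_inner_right)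
    show "(LINT s:{0..t}|lborel. k \<bullet> ((t - s) *\<^sub>R (\<integral>y. g s y \<partial>lborel))) = k \<bullet> (LINT s:{0..t}|lborel. (t - s) *\<^sub>R (\<integral>y. g s y \<partial>lborel))"
      unfolding set_lebesgue_integral_def eq v_def[symmetric] using i by (rule integral_inner_right)
  qed
  have "\<bar>LINT s:{0..t}|lborel. grad_semigroup \<alpha> (t - s) (g s) x + k \<bullet> ((t - s) *\<^sub>R (\<integral>y. g s y \<partial>lborel))\<bar>
    \<le> 2 * sing_const * ((1 + t)\<^sup>2 * ((split_const + C + 1) * (B * X + E))) * (1 + t)"
  proof (rule duhamel_time_bound[OF t])
    show "0 \<le> (1 + t)\<^sup>2 * ((split_const + C + 1) * (B * X + E))" using S C B0 E0 X by simp
    fix s assume s: "0 < s" "s < t"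
    define \<sigma> where "\<sigma> = (t - s) powr (- (1 / \<alpha>))"
    have s0: "0 \<le> \<sigma>" by (simp add: \<sigma>_def)
    have \<tau>: "0 < t - s" using s by simp
    have x0: "x \<noteq> 0" using x by auto
    have "\<bar>grad_semigroup \<alpha> (t - s) (g s) x + k \<bullet> ((t - s) *\<^sub>R (\<integral>y. g s y \<partial>lborel)) - near (t - s) (g s) x\<bar>
      \<le> split_const * (t - s) * X * (\<integral>y. norm y * norm (g s y) \<partial>lborel)
      + C * (t - s)\<^sup>2 * norm x powr (- (2 * \<alpha> + CARD('n) + 1)) * (\<integral>y. norm (g s y) \<partial>lborel)"
      using far_field_split[OF \<tau> x0 g(1)[OF s] g(2)[OF s]] unfolding grad_semigroup_eq[OF \<tau>] kX X_def by (simp add: mult_ac)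
    also have "\<dots> \<le> split_const * (1 + t) * X * (B * (1 + t)) + C * (1 + t)\<^sup>2 * X * B"
    proof (intro add_mono mult_mono B s)
      show "norm x powr (- (2 * \<alpha> + CARD('n) + 1)) \<le> X" unfolding X_def using x \<alpha> by (intro powr_mono) auto
      show "(t - s)\<^sup>2 \<le> (1 + t)\<^sup>2" using s by (intro power_mono) auto
    qed (use s S C X B0 in auto)
    also have "\<dots> = (1 + t)\<^sup>2 * ((split_const + C) * (B * X))" by (simp add: power2_eq_square algebra_simps)
    finally have "\<bar>grad_semigroup \<alpha> (t - s) (g s) x + k \<bullet> ((t - s) *\<^sub>R (\<integral>y. g s y \<partial>lborel))\<bar>
      \<le> (1 + t)\<^sup>2 * ((split_const + C) * (B * X)) * 1 + (1 + t)\<^sup>2 * E * (1 + \<sigma>)" using near[OF s] unfolding \<sigma>_def by linarith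
    also have "\<dots> \<le> (1 + t)\<^sup>2 * ((split_const + C) * (B * X)) * (1 + \<sigma>) + (1 + t)\<^sup>2 * E * (1 + \<sigma>)"
      using s0 S C B0 X by (intro add_right_mono mult_left_mono) auto
    also have "\<dots> = (1 + t)\<^sup>2 * ((split_const + C) * (B * X) + E) * (1 + \<sigma>)" by (simp add: algebra_simps)
    also have "\<dots> \<le> (1 + t)\<^sup>2 * ((split_const + C + 1) * (B * X + E)) * (1 + \<sigma>)"
    proof -
      have "0 \<le> B * X" "0 \<le> (split_const + C) * E" using B0 X S C E0 by auto
      then have "(split_const + C) * (B * X) + E \<le> (split_const + C + 1) * (B * X + E)" by (simp add: algebra_simps)
      then show ?thesis using s0 by (intro mult_right_mono mult_left_mono) auto
    qed
    finally show "\<bar>grad_semigroup \<alpha> (t - s) (g s) x + k \<bullet> ((t - s) *\<^sub>R (\<integral>y. g s y \<partial>lborel))\<bar>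
      \<le> (1 + t)\<^sup>2 * ((split_const + C + 1) * (B * X + E)) * (1 + (t - s) powr (- (1 / \<alpha>)))" unfolding \<sigma>_def .
  qed
  moreover have "2 * sing_const * ((1 + t)\<^sup>2 * ((split_const + C + 1) * (B * X + E))) * (1 + t) = far_const * (1 + t) ^ 3 * (B * X + E)"
    by (simp only: far_const_def power2_eq_square power3_eq_cube mult_ac)
  moreover have "(LINT s:{0..t}|lborel. grad_semigroup \<alpha> (t - s) (g s) x + k \<bullet> ((t - s) *\<^sub>R (\<integral>y. g s y \<partial>lborel)))
    = (LINT s:{0..t}|lborel. grad_semigroup \<alpha> (t - s) (g s) x) + k \<bullet> (LINT s:{0..t}|lborel. (t - s) *\<^sub>R (\<integral>y. g s y \<partial>lborel))"
    unfolding set_integral_add(2)[OF si(1) si2(1)] si2(2) ..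
  ultimately show ?thesis unfolding k_def[symmetric] X_def[symmetric] by linarith
qed

lemma far_const_nonneg: "0 \<le> far_const"
  using C sing_const_nonneg by (simp add: far_const_def split_const_def)

end

section \<open>The remainder for decaying solutions\<close>

text \<open>These are the data for the decay estimates. The same M bounds u(t) pointwise and in L^1
  for all t > 0, whereas \<open>M0\<close> bounds the weighted norm of the datum.\<close>

locale duhamel_solution = stable_kernel \<alpha> C D for \<alpha> C and D :: "real \<Rightarrow> real^'n \<Rightarrow> real^'n" +
  fixes q Cf M M0 :: real and f :: "real \<Rightarrow> real^'n" and u\<^sub>0 :: "real^'n \<Rightarrow> real" and u :: "real \<Rightarrow> real^'n \<Rightarrow> real"
  assumes q: "1 < q" and Cf: "0 < Cf" and M: "0 < M" and M0: "0 \<le> M0"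
    and flux: "norm (f a) \<le> Cf * \<bar>a\<bar> powr q"
    and flux_diff: "norm (f a - f b) \<le> Cf * \<bar>a - b\<bar> * (\<bar>a\<bar> powr (q - 1) + \<bar>b\<bar> powr (q - 1))"
    and f_cont: "continuous_on UNIV f"
    and u_bound: "0 < t \<Longrightarrow> \<bar>u t x\<bar> \<le> M"
    and u_int: "0 < t \<Longrightarrow> integrable lborel (u t)" "0 < t \<Longrightarrow> (\<integral>x. \<bar>u t x\<bar> \<partial>lborel) \<le> M"
    and u_time: "(\<And>k::nat. 0 < r k) \<Longrightarrow> 0 < s \<Longrightarrow> r \<longlonglongrightarrow> s \<Longrightarrow> (\<lambda>k. \<integral>y. \<bar>u (r k) y - u s y\<bar> \<partial>lborel) \<longlonglongrightarrow> 0"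
    and init_meas: "u\<^sub>0 \<in> borel_measurable borel"
    and init_bound: "AE y in lborel. \<bar>u\<^sub>0 y\<bar> \<le> M0 * (1 + norm y) powr (- (\<alpha> + CARD('n)))"
    and duhamel: "0 < t \<Longrightarrow> u t x = semigroup \<alpha> t u\<^sub>0 x - (LINT s:{0..t}|lborel. grad_semigroup \<alpha> (t - s) (\<lambda>y. f (u s y)) x)"
begin

text \<open>Boundedness of u turns the superlinear flux into a linear one. The same is done for
  differences in \<open>flux_lipschitz\<close>, so that all Volterra inequalities below are
  linear.\<close>

lemma flux_linear: "0 < t \<Longrightarrow> norm (f (u t y)) \<le> Cf * M powr (q - 1) * \<bar>u t y\<bar>"
proof -
  assume t: "0 < t"
  have "\<bar>u t y\<bar> powr q \<le> M powr (q - 1) * \<bar>u t y\<bar> powr 1" using u_bound[OF t] q by (intro powr_split_le) auto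
  then have "Cf * \<bar>u t y\<bar> powr q \<le> Cf * (M powr (q - 1) * \<bar>u t y\<bar>)" using Cf by (intro mult_left_mono) auto
  then show ?thesis using flux[of "u t y"] by (simp only: mult.assoc)
qed

lemma flux_lipschitz: "\<bar>a\<bar> \<le> M \<Longrightarrow> \<bar>b\<bar> \<le> M \<Longrightarrow> norm (f a - f b) \<le> 2 * Cf * M powr (q - 1) * \<bar>a - b\<bar>"
proof -
  assume ab: "\<bar>a\<bar> \<le> M" "\<bar>b\<bar> \<le> M"
  have "\<bar>a\<bar> powr (q - 1) + \<bar>b\<bar> powr (q - 1) \<le> M powr (q - 1) + M powr (q - 1)" using ab q by (intro add_mono powr_mono2) auto
  then have "Cf * \<bar>a - b\<bar> * (\<bar>a\<bar> powr (q - 1) + \<bar>b\<bar> powr (q - 1)) \<le> Cf * \<bar>a - b\<bar> * (2 * M powr (q - 1))"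
    using Cf by (intro mult_left_mono) auto
  then show ?thesis using flux_diff[of a b] by (simp add: mult_ac)
qed

lemma flux_measurable: "0 < t \<Longrightarrow> (\<lambda>y. f (u t y)) \<in> borel_measurable borel"
proof -
  assume "0 < t"
  then have [measurable]: "u t \<in> borel_measurable borel" using u_int by auto
  have [measurable]: "f \<in> borel_measurable borel" using f_cont by (rule borel_measurable_continuous_onI)
  show ?thesis by measurable
qed

lemma flux_integrable: "0 < t \<Longrightarrow> integrable lborel (\<lambda>y. f (u t y))"
proof -
  assume t: "0 < t"
  have i: "integrable lborel (\<lambda>y. Cf * M powr (q - 1) * \<bar>u t y\<bar>)" using u_int(1)[OF t] by (intro integrable_mult_right integrable_abs)
  show ?thesis
    by (rule Bochner_Integration.integrable_bound[OF i]) (use flux_measurable[OF t] flux_linear[OF t] Cf in \<open>auto simp: abs_mult\<close>)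
qed

lemma flux_integral: "0 < t \<Longrightarrow> (\<integral>y. norm (f (u t y)) \<partial>lborel) \<le> Cf * M powr (q - 1) * M"
proof -
  assume t: "0 < t"
  have "(\<integral>y. norm (f (u t y)) \<partial>lborel) \<le> (\<integral>y. Cf * M powr (q - 1) * \<bar>u t y\<bar> \<partial>lborel)"
    using flux_integrable[OF t] u_int(1)[OF t] by (intro integral_mono flux_linear[OF t]) auto
  also have "\<dots> = Cf * M powr (q - 1) * (\<integral>y. \<bar>u t y\<bar> \<partial>lborel)" by (rule integral_mult_right_zero)
  also have "\<dots> \<le> Cf * M powr (q - 1) * M" using Cf by (intro mult_left_mono u_int(2)[OF t]) auto
  finally show ?thesis .
qed

lemma flux_time:
  fixes r :: "nat \<Rightarrow> real"
  assumes r: "\<And>k. 0 < r k" and s: "0 < s" and lim: "r \<longlonglongrightarrow> s"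
  shows "(\<lambda>k. \<integral>y. norm (f (u (r k) y) - f (u s y)) \<partial>lborel) \<longlonglongrightarrow> 0"
proof (rule Lim_null_comparison)
  show "(\<lambda>k. 2 * Cf * M powr (q - 1) * (\<integral>y. \<bar>u (r k) y - u s y\<bar> \<partial>lborel)) \<longlonglongrightarrow> 0"
    by (intro tendsto_mult_right_zero u_time r s lim)
  show "\<forall>\<^sub>F k in sequentially. norm (\<integral>y. norm (f (u (r k) y) - f (u s y)) \<partial>lborel) \<le> 2 * Cf * M powr (q - 1) * (\<integral>y. \<bar>u (r k) y - u s y\<bar> \<partial>lborel)"
  proof (rule always_eventually, rule allI)
    fix k
    have i: "integrable lborel (\<lambda>y. 2 * Cf * M powr (q - 1) * \<bar>u (r k) y - u s y\<bar>)"
      using u_int(1)[OF s] u_int(1)[OF r] by (intro integrable_mult_right integrable_abs Bochner_Integration.integrable_diff)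
    have "norm (\<integral>y. norm (f (u (r k) y) - f (u s y)) \<partial>lborel) \<le> (\<integral>y. 2 * Cf * M powr (q - 1) * \<bar>u (r k) y - u s y\<bar> \<partial>lborel)"
      by (rule norm_integral_le_AE[OF i], intro AE_I2) (use flux_lipschitz u_bound[OF s] u_bound[OF r] in simp)
    then show "norm (\<integral>y. norm (f (u (r k) y) - f (u s y)) \<partial>lborel) \<le> 2 * Cf * M powr (q - 1) * (\<integral>y. \<bar>u (r k) y - u s y\<bar> \<partial>lborel)"
      by (simp only: integral_mult_right_zero)
  qed
qed

lemma flux_sup: "0 < t \<Longrightarrow> norm (f (u t y)) \<le> Cf * M powr (q - 1) * M"
proof -
  assume t: "0 < t"
  have "Cf * M powr (q - 1) * \<bar>u t y\<bar> \<le> Cf * M powr (q - 1) * M" using Cf by (intro mult_left_mono u_bound t) auto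
  then show ?thesis using flux_linear[OF t, of y] by linarith
qed

lemma duhamel_terms_integrable:
  "set_integrable lborel {0..t} (\<lambda>s. grad_semigroup \<alpha> (t - s) (\<lambda>y. f (u s y)) x)"
  "set_integrable lborel {0..t} (\<lambda>s. (t - s) *\<^sub>R (\<integral>y. f (u s y) \<partial>lborel))"
  by (rule duhamel_integrable[where g="\<lambda>s y. f (u s y)", OF flux_integrable flux_time flux_sup flux_integral]; simp)+

text \<open>Mass and first moment of f(u) are estimated with the linear bound on the flux; the
  factor |y| lowers the weight exponent to \<alpha>+d-1, still above d. The superlinearity is left
  to the hypothesis on \<open>near\<close>.\<close>

lemma remainder_le:
  assumes t: "0 < t" and x: "1 \<le> norm x" and M1: "0 \<le> M1" and E: "0 \<le> E"
    and w: "\<And>s y. 0 < s \<Longrightarrow> s < t \<Longrightarrow> \<bar>u s y\<bar> \<le> M1 * (1 + s) * (1 + norm y) powr (- (\<alpha> + CARD('n)))"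
    and near: "\<And>s. 0 < s \<Longrightarrow> s < t \<Longrightarrow> \<bar>near (t - s) (\<lambda>y. f (u s y)) x\<bar> \<le> (1 + t)\<^sup>2 * E * (1 + (t - s) powr (- (1 / \<alpha>)))"
    and B: "B = Cf * M powr (q - 1) * (M + M1 * (\<integral>y. (1 + norm (y::real^'n)) powr (- (\<alpha> + CARD('n) - 1)) \<partial>lborel))"
  shows "\<bar>remainder \<alpha> f u\<^sub>0 u x t\<bar> \<le> far_const * (1 + t) ^ 3 * (B * norm x powr (- (\<alpha> + CARD('n) + 2)) + E)"
proof -
  define W where "W = (\<integral>y. (1 + norm (y::real^'n)) powr (- (\<alpha> + CARD('n) - 1)) \<partial>lborel)"
  define c where "c = Cf * M powr (q - 1)"
  have c: "0 \<le> c" using Cf by (simp add: c_def)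
  have wi: "integrable lborel (\<lambda>y::real^'n. (1 + norm y) powr (- (\<alpha> + CARD('n) - 1)))"
    by (rule integrable_weight) (use \<alpha> in simp)
  have W: "0 \<le> W" unfolding W_def by (rule Bochner_Integration.integral_nonneg) simp
  have Bc: "B = c * M + c * M1 * W" unfolding B W_def c_def by (simp add: algebra_simps)
  have moment: "norm y * norm (f (u s y)) \<le> c * M1 * (1 + t) * (1 + norm y) powr (- (\<alpha> + CARD('n) - 1))" if s: "0 < s" "s < t" for s y
  proof -
    have "norm y * norm (f (u s y)) \<le> (1 + norm y) * (c * (M1 * (1 + t) * (1 + norm y) powr (- (\<alpha> + CARD('n)))))"
    proof (intro mult_mono)
      have "c * \<bar>u s y\<bar> \<le> c * (M1 * (1 + s) * (1 + norm y) powr (- (\<alpha> + CARD('n))))" by (intro mult_left_mono w s c)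
      also have "\<dots> \<le> c * (M1 * (1 + t) * (1 + norm y) powr (- (\<alpha> + CARD('n))))"
        using s M1 c by (intro mult_left_mono mult_right_mono) auto
      finally show "norm (f (u s y)) \<le> c * (M1 * (1 + t) * (1 + norm y) powr (- (\<alpha> + CARD('n))))"
        using flux_linear[OF s(1), of y] unfolding c_def by linarith
    qed auto
    moreover have "(1 + norm y) * (1 + norm y) powr (- (\<alpha> + CARD('n))) = (1 + norm y) powr (- (\<alpha> + CARD('n) - 1))"
    proof -
      have "(1 + norm y) powr 1 * (1 + norm y) powr (- (\<alpha> + CARD('n))) = (1 + norm y) powr (1 + - (\<alpha> + CARD('n)))"
        by (rule powr_add[symmetric])
      then show ?thesis by (simp add: add_pos_nonneg algebra_simps)
    qed
    then have "(1 + norm y) * (c * (M1 * (1 + t) * (1 + norm y) powr (- (\<alpha> + CARD('n))))) = c * M1 * (1 + t) * (1 + norm y) powr (- (\<alpha> + CARD('n) - 1))"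
      by (metis mult.assoc mult.left_commute)
    ultimately show ?thesis by linarith
  qed
  have ri: "integrable lborel (\<lambda>y::real^'n. c * M1 * (1 + t) * (1 + norm y) powr (- (\<alpha> + CARD('n) - 1)))"
    by (rule integrable_mult_right[OF wi])
  have mi: "integrable lborel (\<lambda>y. norm y * norm (f (u s y)))" if s: "0 < s" "s < t" for s
    by (rule Bochner_Integration.integrable_bound[OF ri])
      (use flux_measurable[OF s(1)] order_trans[OF moment[OF s] abs_ge_self] in auto)
  have "\<bar>(LINT s:{0..t}|lborel. grad_semigroup \<alpha> (t - s) (\<lambda>y. f (u s y)) x)
      + ((c1 \<alpha> CARD('n) / norm x powr (\<alpha> + CARD('n) + 2)) *\<^sub>R x) \<bullet> (LINT s:{0..t}|lborel. (t - s) *\<^sub>R (\<integral>y. f (u s y) \<partial>lborel))\<bar>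
    \<le> far_const * (1 + t) ^ 3 * (B * norm x powr (- (\<alpha> + CARD('n) + 2)) + E)"
  proof (rule duhamel_far_field[OF t x flux_integrable mi _ _ near duhamel_terms_integrable _ E])
    show "0 \<le> B" unfolding Bc using c M M1 W by auto
    show "(\<integral>y. norm (f (u s y)) \<partial>lborel) \<le> B" if "0 < s" "s < t" for s
    proof -
      have "(\<integral>y. norm (f (u s y)) \<partial>lborel) \<le> c * M" unfolding c_def by (rule flux_integral[OF that(1)])
      moreover have "0 \<le> c * M1 * W" using c M1 W by auto
      ultimately show ?thesis unfolding Bc by linarith
    qed
    show "(\<integral>y. norm y * norm (f (u s y)) \<partial>lborel) \<le> B * (1 + t)" if s: "0 < s" "s < t" for s
    proof -
      have "(\<integral>y. norm y * norm (f (u s y)) \<partial>lborel) \<le> (\<integral>y. c * M1 * (1 + t) * (1 + norm (y::real^'n)) powr (- (\<alpha> + CARD('n) - 1)) \<partial>lborel)"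
        by (rule integral_mono[OF mi[OF s] ri moment[OF s]])
      also have "\<dots> = c * M1 * W * (1 + t)" unfolding W_def by (simp only: integral_mult_right_zero mult_ac)
      also have "\<dots> \<le> B * (1 + t)" unfolding Bc using c M t by (intro mult_right_mono) auto
      finally show ?thesis .
    qed
  qed auto
  then show ?thesis unfolding remainder_def duhamel[OF t] integral_scaleR_right by linarith
qed

lemma far_weight_half:
  assumes "norm x / 2 \<le> norm y" "1 \<le> norm x" "0 \<le> a"
  shows "(1 + norm y) powr (- a) \<le> 2 powr a * norm x powr (- a)"
proof -
  have "(1 + norm y) powr (- a) \<le> (norm x / 2) powr (- a)" using assms by (intro powr_mono2') auto
  also have "\<dots> = 2 powr a * norm x powr (- a)" by (simp add: powr_divide powr_minus_divide)
  finally show ?thesis .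
qed

text \<open>Lowering the exponent \<open>q\<close> to \<open>min q (1 + 2/(\<alpha>+d)) \<le> 2\<close> keeps the growth in time below \<open>(1+t)\<^sup>3\<close>
  and costs no decay, since the error \<open>|x|\<^sup>-\<^sup>(\<^sup>\<alpha>\<^sup>+\<^sup>d\<^sup>+\<^sup>2\<^sup>)\<close> is present anyway.\<close>

theorem remainder_far_field:
  assumes M1: "0 \<le> M1"
  obtains K where "0 < K" "\<And>t x. 0 < t \<Longrightarrow> 1 \<le> norm x \<Longrightarrow>
      (\<And>s y. 0 < s \<Longrightarrow> s < t \<Longrightarrow> \<bar>u s y\<bar> \<le> M1 * (1 + s) * (1 + norm y) powr (- (\<alpha> + CARD('n)))) \<Longrightarrow>
      \<bar>remainder \<alpha> f u\<^sub>0 u x t\<bar> \<le> K * (1 + t) ^ 3 * max (norm x powr (- (q * (\<alpha> + CARD('n))))) (norm x powr (- (\<alpha> + CARD('n) + 2)))"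
proof -
  define \<gamma> where "\<gamma> = \<alpha> + CARD('n)"
  have "1 \<le> CARD('n)" by (simp add: Suc_leI)
  then have g: "2 < \<gamma>" using \<alpha> unfolding \<gamma>_def by linarith
  define p where "p = min q (1 + 2 / \<gamma>)"
  have "2 / \<gamma> \<le> 1" using g by simp
  then have p: "1 < p" "p \<le> q" "p \<le> 2" "p * \<gamma> = min (q * \<gamma>) (\<gamma> + 2)"
    using q g by (simp_all add: p_def min_mult_distrib_right distrib_right min_le_iff_disj)
  define B where "B = Cf * M powr (q - 1) * (M + M1 * (\<integral>y. (1 + norm (y::real^'n)) powr (- (\<alpha> + CARD('n) - 1)) \<partial>lborel))"
  define V where "V = Cf * (M powr (q - p) * (M1 * 2 powr \<gamma>) powr p)"
  define E where "E = V * C"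
  have V: "0 \<le> V" using Cf by (simp add: V_def)
  have E: "0 \<le> E" using V C by (simp add: E_def)
  have B: "0 \<le> B" unfolding B_def using Cf M M1 by (intro mult_nonneg_nonneg add_nonneg_nonneg Bochner_Integration.integral_nonneg) auto
  define K where "K = far_const * (B + E) + 1"
  have K: "0 < K" unfolding K_def using far_const_nonneg B E by (intro add_nonneg_pos mult_nonneg_nonneg) auto
  show ?thesis
  proof (rule that[OF K])
    fix t :: real and x :: "real^'n"
    assume t: "0 < t" and x: "1 \<le> norm x" and w: "\<And>s y. 0 < s \<Longrightarrow> s < t \<Longrightarrow> \<bar>u s y\<bar> \<le> M1 * (1 + s) * (1 + norm y) powr (- (\<alpha> + CARD('n)))"
    define X where "X = max (norm x powr (- (q * \<gamma>))) (norm x powr (- (\<gamma> + 2)))"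
    have Xp: "norm x powr (- (p * \<gamma>)) \<le> X" unfolding p(4) X_def by (auto simp: min_def)
    have X0: "0 \<le> X" unfolding X_def by (simp add: max_def)
    have near: "\<bar>near (t - s) (\<lambda>y. f (u s y)) x\<bar> \<le> (1 + t)\<^sup>2 * (E * X) * (1 + (t - s) powr (- (1 / \<alpha>)))" if s: "0 < s" "s < t" for s
    proof -
      have "\<bar>near (t - s) (\<lambda>y. f (u s y)) x\<bar> \<le> V * ((1 + t)\<^sup>2 * X) * (C * (t - s) powr (- (1 / \<alpha>)))"
      proof (rule near_bound_sup)
        fix y assume y: "norm (x - y) \<le> norm x / 2"
        have "norm x - norm y \<le> norm (x - y)" by (rule norm_triangle_ineq2)
        then have y2: "norm x / 2 \<le> norm y" using y by linarith
        have "\<bar>u s y\<bar> \<le> M1 * (1 + s) * (2 powr \<gamma> * norm x powr (- \<gamma>))"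
          using w[OF s, of y] mult_left_mono[OF far_weight_half[OF y2 x, of \<gamma>], of "M1 * (1 + s)"] M1 s g unfolding \<gamma>_def[symmetric] by simp
        then have "\<bar>u s y\<bar> powr q \<le> M powr (q - p) * (M1 * (1 + s) * (2 powr \<gamma> * norm x powr (- \<gamma>))) powr p"
          using u_bound[OF s(1), of y] p by (intro powr_split_le) auto
        also have "(M1 * (1 + s) * (2 powr \<gamma> * norm x powr (- \<gamma>))) powr p = (M1 * 2 powr \<gamma>) powr p * ((1 + s) powr p * norm x powr (- (p * \<gamma>)))"
          using M1 s by (simp add: powr_mult powr_powr mult_ac)
        also have "M powr (q - p) * \<dots> \<le> M powr (q - p) * ((M1 * 2 powr \<gamma>) powr p * ((1 + t)\<^sup>2 * X))"
        proof (intro mult_left_mono mult_mono Xp)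
          have "(1 + s) powr p \<le> (1 + s) powr 2" using s p by (intro powr_mono) auto
          also have "\<dots> = (1 + s)\<^sup>2" using s by (simp add: powr_numeral)
          also have "\<dots> \<le> (1 + t)\<^sup>2" using s by (intro power_mono) auto
          finally show "(1 + s) powr p \<le> (1 + t)\<^sup>2" .
        qed auto
        finally have "Cf * \<bar>u s y\<bar> powr q \<le> Cf * (M powr (q - p) * ((M1 * 2 powr \<gamma>) powr p * ((1 + t)\<^sup>2 * X)))"
          using Cf by (intro mult_left_mono) auto
        then show "norm (f (u s y)) \<le> V * ((1 + t)\<^sup>2 * X)" using flux[of "u s y"] unfolding V_def by (simp only: mult.assoc)
      qed (use s V X0 in auto)
      also have "\<dots> = (1 + t)\<^sup>2 * (E * X) * (t - s) powr (- (1 / \<alpha>))" by (simp only: E_def mult_ac)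
      also have "\<dots> \<le> (1 + t)\<^sup>2 * (E * X) * (1 + (t - s) powr (- (1 / \<alpha>)))" using E X0 by (intro mult_left_mono) auto
      finally show ?thesis .
    qed
    have "\<bar>remainder \<alpha> f u\<^sub>0 u x t\<bar> \<le> far_const * (1 + t) ^ 3 * (B * norm x powr (- (\<alpha> + CARD('n) + 2)) + E * X)"
      by (rule remainder_le[OF t x M1 _ w near B_def]) (use E X0 in auto)
    also have "\<dots> \<le> far_const * (1 + t) ^ 3 * (B * X + E * X)"
      using far_const_nonneg B t unfolding X_def \<gamma>_def by (intro mult_left_mono add_right_mono) auto
    also have "\<dots> = (K - 1) * (1 + t) ^ 3 * X" by (simp add: K_def algebra_simps)
    also have "\<dots> \<le> K * (1 + t) ^ 3 * X" using t X0 by (intro mult_right_mono) auto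
    finally show "\<bar>remainder \<alpha> f u\<^sub>0 u x t\<bar> \<le> K * (1 + t) ^ 3 * max (norm x powr (- (q * (\<alpha> + CARD('n))))) (norm x powr (- (\<alpha> + CARD('n) + 2)))"
      unfolding X_def \<gamma>_def .
  qed
qed

text \<open>The flux difference splits into |u(y)-u(x)|, of order (1+s) |x-y| |x|^-(\<alpha>+d+1),
  and the (q-1)-th powers of u, of order |x|^-(\<alpha>+d)(q-1). Together they decay like
  |x|^(-q(\<alpha>+d)-1) after the factor |x-y| has gone into the moment of the kernel.\<close>

theorem remainder_far_field_lipschitz:
  assumes M1: "0 \<le> M1"
  obtains K where "0 < K" "\<And>t x. 0 < t \<Longrightarrow> 1 \<le> norm x \<Longrightarrow>
      (\<And>s y. 0 < s \<Longrightarrow> s < t \<Longrightarrow> \<bar>u s y\<bar> \<le> M1 * (1 + s) * (1 + norm y) powr (- (\<alpha> + CARD('n)))) \<Longrightarrow>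
      (\<And>s y. 0 < s \<Longrightarrow> s < t \<Longrightarrow> norm (x - y) \<le> norm x / 2 \<Longrightarrow> \<bar>u s y - u s x\<bar> \<le> M1 * (1 + s) * norm (x - y) * norm x powr (- (\<alpha> + CARD('n) + 1))) \<Longrightarrow>
      \<bar>remainder \<alpha> f u\<^sub>0 u x t\<bar> \<le> K * (1 + t) ^ 3 * max (norm x powr (- (q * (\<alpha> + CARD('n))) - 1)) (norm x powr (- (\<alpha> + CARD('n) + 2)))"
proof -
  define \<gamma> where "\<gamma> = \<alpha> + CARD('n)"
  have "1 \<le> CARD('n)" by (simp add: Suc_leI)
  then have g: "2 < \<gamma>" using \<alpha> unfolding \<gamma>_def by linarith
  \<comment> \<open>The exponent is lowered as before, but only to 1 + 1/\<gamma>: one power of |x|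
    comes from the Lipschitz bound, and p \<gamma> + 1 then stops at \<gamma> + 2. As p \<le> 2, the
    factors 1+s and (1+s)^(p-1) together stay below (1+t)^2.\<close>
  define p where "p = min q (1 + 1 / \<gamma>)"
  have "1 / \<gamma> \<le> 1" using g by simp
  then have p: "1 < p" "p \<le> q" "p \<le> 2" "p * \<gamma> = min (q * \<gamma>) (\<gamma> + 1)"
    using q g by (simp_all add: p_def min_mult_distrib_right distrib_right min_le_iff_disj)
  define B where "B = Cf * M powr (q - 1) * (M + M1 * (\<integral>y. (1 + norm (y::real^'n)) powr (- (\<alpha> + CARD('n) - 1)) \<partial>lborel))"
  define V where "V = M powr (q - p) * (M1 * 2 powr \<gamma>) powr (p - 1)"
  define E where "E = Cf * M1 * (2 * V) * C"
  have V: "0 \<le> V" by (simp add: V_def)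
  have E: "0 \<le> E" using V C Cf M1 by (simp add: E_def)
  have B: "0 \<le> B" unfolding B_def using Cf M M1 by (intro mult_nonneg_nonneg add_nonneg_nonneg Bochner_Integration.integral_nonneg) auto
  define K where "K = far_const * (B + E) + 1"
  have K: "0 < K" unfolding K_def using far_const_nonneg B E by (intro add_nonneg_pos mult_nonneg_nonneg) auto
  show ?thesis
  proof (rule that[OF K])
    fix t :: real and x :: "real^'n"
    assume t: "0 < t" and x: "1 \<le> norm x" and w: "\<And>s y. 0 < s \<Longrightarrow> s < t \<Longrightarrow> \<bar>u s y\<bar> \<le> M1 * (1 + s) * (1 + norm y) powr (- (\<alpha> + CARD('n)))"
      and lip: "\<And>s y. 0 < s \<Longrightarrow> s < t \<Longrightarrow> norm (x - y) \<le> norm x / 2 \<Longrightarrow> \<bar>u s y - u s x\<bar> \<le> M1 * (1 + s) * norm (x - y) * norm x powr (- (\<alpha> + CARD('n) + 1))"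
    define X where "X = max (norm x powr (- (q * \<gamma>) - 1)) (norm x powr (- (\<gamma> + 2)))"
    have Xp: "norm x powr (- (p * \<gamma>) - 1) \<le> X"
    proof (cases "q * \<gamma> \<le> \<gamma> + 1")
      case True
      then have "p * \<gamma> = q * \<gamma>" using p(4) by simp
      then show ?thesis unfolding X_def by (simp only: max.cobounded1)
    next
      case False
      then have "- (p * \<gamma>) - 1 = - (\<gamma> + 2)" using p(4) by simp
      then show ?thesis unfolding X_def by (simp only: max.cobounded2)
    qed
    have X0: "0 \<le> X" unfolding X_def by (simp add: max_def)
    have near: "\<bar>near (t - s) (\<lambda>y. f (u s y)) x\<bar> \<le> (1 + t)\<^sup>2 * (E * X) * (1 + (t - s) powr (- (1 / \<alpha>)))" if s: "0 < s" "s < t" for s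
    proof -
      define L where "L = Cf * M1 * (2 * V) * ((1 + t)\<^sup>2 * X)"
      have small: "\<bar>u s y\<bar> powr (q - 1) \<le> V * ((1 + s) powr (p - 1) * norm x powr (- (\<gamma> * (p - 1))))" if y: "norm (x - y) \<le> norm x / 2" for y
      proof -
        have "norm x - norm y \<le> norm (x - y)" by (rule norm_triangle_ineq2)
        then have y2: "norm x / 2 \<le> norm y" using y by linarith
        have "\<bar>u s y\<bar> \<le> M1 * (1 + s) * (2 powr \<gamma> * norm x powr (- \<gamma>))"
          using w[OF s, of y] mult_left_mono[OF far_weight_half[OF y2 x, of \<gamma>], of "M1 * (1 + s)"] M1 s g unfolding \<gamma>_def[symmetric] by simp
        then have "\<bar>u s y\<bar> powr (q - 1) \<le> M powr (q - 1 - (p - 1)) * (M1 * (1 + s) * (2 powr \<gamma> * norm x powr (- \<gamma>))) powr (p - 1)"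
          using u_bound[OF s(1), of y] p by (intro powr_split_le) auto
        also have "(M1 * (1 + s) * (2 powr \<gamma> * norm x powr (- \<gamma>))) powr (p - 1) = (M1 * 2 powr \<gamma>) powr (p - 1) * ((1 + s) powr (p - 1) * norm x powr (- (\<gamma> * (p - 1))))"
          using M1 s by (simp add: powr_mult powr_powr mult_ac)
        finally show ?thesis by (simp add: V_def mult.assoc)
      qed
      have "\<bar>near (t - s) (\<lambda>y. f (u s y)) x\<bar> \<le> L * C"
      proof (rule near_bound_lipschitz[OF _ flux_integrable[OF s(1)]])
        fix y assume y: "norm (x - y) \<le> norm x / 2"
        let ?R = "V * ((1 + s) powr (p - 1) * norm x powr (- (\<gamma> * (p - 1))))"
        have "norm (f (u s y) - f (u s x)) \<le> Cf * \<bar>u s y - u s x\<bar> * (\<bar>u s y\<bar> powr (q - 1) + \<bar>u s x\<bar> powr (q - 1))" by (rule flux_diff)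
        also have "\<dots> \<le> Cf * (M1 * (1 + s) * norm (x - y) * norm x powr (- (\<alpha> + CARD('n) + 1))) * (?R + ?R)"
          using Cf M1 s by (intro mult_mono mult_left_mono add_mono lip s y small mult_nonneg_nonneg add_nonneg_nonneg) auto
        also have "\<dots> = Cf * M1 * (2 * V) * (((1 + s) * (1 + s) powr (p - 1)) * (norm x powr (- (\<gamma> + 1)) * norm x powr (- (\<gamma> * (p - 1))))) * norm (x - y)"
          unfolding \<gamma>_def by (simp only: mult_2[symmetric] mult_ac)
        also have "norm x powr (- (\<gamma> + 1)) * norm x powr (- (\<gamma> * (p - 1))) = norm x powr (- (p * \<gamma>) - 1)"
          unfolding powr_add[symmetric] by (rule arg_cong[where f="\<lambda>e. norm x powr e"]) (simp add: algebra_simps)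
        also have "Cf * M1 * (2 * V) * (((1 + s) * (1 + s) powr (p - 1)) * norm x powr (- (p * \<gamma>) - 1)) * norm (x - y) \<le> L * norm (x - y)"
          unfolding L_def
        proof (intro mult_right_mono mult_left_mono mult_mono Xp)
          have "(1 + s) powr (p - 1) \<le> (1 + s) powr 1" using s p by (intro powr_mono) auto
          then have "(1 + s) * (1 + s) powr (p - 1) \<le> (1 + s) * (1 + s)" using s by (intro mult_left_mono) auto
          also have "\<dots> \<le> (1 + t)\<^sup>2" unfolding power2_eq_square using s by (intro mult_mono) auto
          finally show "(1 + s) * (1 + s) powr (p - 1) \<le> (1 + t)\<^sup>2" .
        qed (use Cf M1 V in auto)
        finally show "norm (f (u s y) - f (u s x)) \<le> L * norm (x - y)" .
      qed (use s V X0 Cf M1 in \<open>auto simp: L_def\<close>)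
      also have "\<dots> = (1 + t)\<^sup>2 * (E * X) * 1" by (simp only: E_def L_def mult_ac)
      also have "\<dots> \<le> (1 + t)\<^sup>2 * (E * X) * (1 + (t - s) powr (- (1 / \<alpha>)))" using E X0 by (intro mult_left_mono) auto
      finally show ?thesis .
    qed
    have "\<bar>remainder \<alpha> f u\<^sub>0 u x t\<bar> \<le> far_const * (1 + t) ^ 3 * (B * norm x powr (- (\<alpha> + CARD('n) + 2)) + E * X)"
      by (rule remainder_le[OF t x M1 _ w near B_def]) (use E X0 in auto)
    also have "\<dots> \<le> far_const * (1 + t) ^ 3 * (B * X + E * X)"
      using far_const_nonneg B t unfolding X_def \<gamma>_def by (intro mult_left_mono add_right_mono) auto
    also have "\<dots> = (K - 1) * (1 + t) ^ 3 * X" by (simp add: K_def algebra_simps)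
    also have "\<dots> \<le> K * (1 + t) ^ 3 * X" using t X0 by (intro mult_right_mono) auto
    finally show "\<bar>remainder \<alpha> f u\<^sub>0 u x t\<bar> \<le> K * (1 + t) ^ 3 * max (norm x powr (- (q * (\<alpha> + CARD('n))) - 1)) (norm x powr (- (\<alpha> + CARD('n) + 2)))"
      unfolding X_def \<gamma>_def .
  qed
qed

end

section \<open>Linear Volterra inequalities with two-point weights\<close>

context stable_kernel
begin

text \<open>The weight at y+h is reduced to the weight at y by translation, and the constant
  \<epsilon> is reproduced through the mass of the kernel. One K serves all c, \<epsilon> and h, so
  \<epsilon> can be sent to 0 afterwards.\<close>

lemma shifted_weight_convolution:
  fixes T a :: real
  assumes T: "0 < T" and a: "CARD('n) < a" "a \<le> \<alpha> + CARD('n) + 1"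
  obtains K where "0 < K"
    "\<And>\<tau> c \<epsilon> x h. 0 < \<tau> \<Longrightarrow> \<tau> \<le> T \<Longrightarrow>
      integrable lborel (\<lambda>y. norm (D \<tau> (x - y)) * (c * ((1 + norm y) powr (- a) + (1 + norm (y + h)) powr (- a)) + \<epsilon>))"
    "\<And>\<tau> c \<epsilon> x h. 0 < \<tau> \<Longrightarrow> \<tau> \<le> T \<Longrightarrow> 0 \<le> c \<Longrightarrow> 0 \<le> \<epsilon> \<Longrightarrow>
      (\<integral>y. norm (D \<tau> (x - y)) * (c * ((1 + norm y) powr (- a) + (1 + norm (y + h)) powr (- a)) + \<epsilon>) \<partial>lborel)
      \<le> K * \<tau> powr (- (1 / \<alpha>)) * (c * ((1 + norm x) powr (- a) + (1 + norm (x + h)) powr (- a)) + \<epsilon>)"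
proof -
  obtain K where K: "0 < K"
    "\<And>\<tau> x. 0 < \<tau> \<Longrightarrow> \<tau> \<le> T \<Longrightarrow> integrable lborel (\<lambda>y. norm (D \<tau> (x - y)) * (1 + norm y) powr (- a))"
    "\<And>\<tau> x. 0 < \<tau> \<Longrightarrow> \<tau> \<le> T \<Longrightarrow> (\<integral>y. norm (D \<tau> (x - y)) * (1 + norm y) powr (- a) \<partial>lborel) \<le> K * \<tau> powr (- (1 / \<alpha>)) * (1 + norm x) powr (- a)"
    by (rule grad_weight_convolution[OF T a]) (rule that)
  let ?w = "\<lambda>x::real^'n. (1 + norm x) powr (- a)"
  define K' where "K' = K + C"
  have K': "0 < K'" using K(1) C by (simp add: K'_def)
  { fix \<tau> c \<epsilon> :: real and x h :: "real^'n" assume \<tau>: "0 < \<tau>" "\<tau> \<le> T"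
    note [measurable] = D_measurable[OF \<tau>(1)]
    let ?k = "\<lambda>z. norm (D \<tau> z)"
    let ?F = "\<lambda>y. ?k (x + h - y) * ?w y"
    have "integrable lborel (\<lambda>y. ?F (h + 1 *\<^sub>R y))" "(\<integral>y. ?F (h + 1 *\<^sub>R y) \<partial>lborel) = (\<integral>y. ?F y \<partial>lborel)"
      using lborel_integral_affine[of 1 ?F h] K(2)[OF \<tau>, of "x + h"] by simp_all
    then have i2: "integrable lborel (\<lambda>y. ?k (x - y) * ?w (y + h))" "(\<integral>y. ?k (x - y) * ?w (y + h) \<partial>lborel) = (\<integral>y. ?F y \<partial>lborel)"
      by (simp_all add: add.commute)
    have ki: "integrable lborel ?k" using grad_integral(1)[OF \<tau>(1)] by simp
    have i3: "integrable lborel (\<lambda>y. ?k (x - y))" "(\<integral>y. ?k (x - y) \<partial>lborel) = (\<integral>z. ?k z \<partial>lborel)"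
      using lborel_integral_reflect[of ?k x] ki by auto
    have eq: "(\<lambda>y. ?k (x - y) * (c * (?w y + ?w (y + h)) + \<epsilon>)) = (\<lambda>y. c * (?k (x - y) * ?w y) + c * (?k (x - y) * ?w (y + h)) + \<epsilon> * ?k (x - y))"
      by (auto simp: algebra_simps)
    have i: "integrable lborel (\<lambda>y. c * (?k (x - y) * ?w y) + c * (?k (x - y) * ?w (y + h)))"
      by (intro Bochner_Integration.integrable_add integrable_mult_right K(2) \<tau> i2(1))
    have "integrable lborel (\<lambda>y. ?k (x - y) * (c * (?w y + ?w (y + h)) + \<epsilon>))"
      unfolding eq by (intro Bochner_Integration.integrable_add[OF i] integrable_mult_right i3(1))
    moreover have "(\<integral>y. ?k (x - y) * (c * (?w y + ?w (y + h)) + \<epsilon>) \<partial>lborel) \<le> K' * \<tau> powr (- (1 / \<alpha>)) * (c * (?w x + ?w (x + h)) + \<epsilon>)"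
      if c: "0 \<le> c" "0 \<le> \<epsilon>"
    proof -
      define \<sigma> where "\<sigma> = \<tau> powr (- (1 / \<alpha>))"
      have s: "0 \<le> \<sigma>" by (simp add: \<sigma>_def)
      have "(\<integral>y. ?k (x - y) * (c * (?w y + ?w (y + h)) + \<epsilon>) \<partial>lborel)
        = c * (\<integral>y. ?k (x - y) * ?w y \<partial>lborel) + c * (\<integral>y. ?F y \<partial>lborel) + \<epsilon> * (\<integral>z. ?k z \<partial>lborel)"
        unfolding eq Bochner_Integration.integral_add[OF i integrable_mult_right[OF i3(1)]]
          Bochner_Integration.integral_add[OF integrable_mult_right[OF K(2)[OF \<tau>]] integrable_mult_right[OF i2(1)]]
          integral_mult_right_zero i2(2) i3(2) ..
      also have "\<dots> \<le> c * (K * \<sigma> * ?w x) + c * (K * \<sigma> * ?w (x + h)) + \<epsilon> * (C * \<sigma>)"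
        unfolding \<sigma>_def by (intro add_mono mult_left_mono K(3) \<tau> grad_integral(2) c)
      also have "\<dots> \<le> K' * \<sigma> * (c * (?w x + ?w (x + h)) + \<epsilon>)"
      proof -
        have "0 \<le> C * \<sigma> * (c * (?w x + ?w (x + h)))" "0 \<le> K * \<sigma> * \<epsilon>" using c s C K(1) by auto
        then show ?thesis unfolding K'_def by (simp add: algebra_simps)
      qed
      finally show ?thesis unfolding \<sigma>_def .
    qed
    ultimately have "integrable lborel (\<lambda>y. ?k (x - y) * (c * (?w y + ?w (y + h)) + \<epsilon>)) \<and>
      (0 \<le> c \<longrightarrow> 0 \<le> \<epsilon> \<longrightarrow> (\<integral>y. ?k (x - y) * (c * (?w y + ?w (y + h)) + \<epsilon>) \<partial>lborel) \<le> K' * \<tau> powr (- (1 / \<alpha>)) * (c * (?w x + ?w (x + h)) + \<epsilon>))"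
      by (intro conjI impI) }
  note main = this
  show ?thesis
    by (rule that[OF K']) (use main in \<open>blast intro: main\<close>)+
qed

text \<open>The predicate fixes what K may depend on: T, a, A and c0, but not the shift h, the
  factor c or the a priori bound B. With c = |h| this makes the later bounds linear in |h|.\<close>

definition volterra_const :: "real \<Rightarrow> real \<Rightarrow> real \<Rightarrow> real \<Rightarrow> real \<Rightarrow> bool" where
  "volterra_const T a A c0 K \<longleftrightarrow> (\<forall>v g h c B t (x :: real^'n). 0 \<le> c \<longrightarrow> (\<forall>t x. 0 < t \<longrightarrow> t \<le> T \<longrightarrow> \<bar>v t x\<bar> \<le> B) \<longrightarrow>
      (\<forall>s y. 0 < s \<longrightarrow> s \<le> T \<longrightarrow> norm (g s y) \<le> c0 * \<bar>v s y\<bar>) \<longrightarrow>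
      (\<forall>t x. 0 < t \<longrightarrow> t \<le> T \<longrightarrow> \<bar>v t x\<bar> \<le> A * (c * ((1 + norm x) powr (- a) + (1 + norm (x + h)) powr (- a)))
        + \<bar>LINT s:{0..t}|lborel. grad_semigroup \<alpha> (t - s) (g s) x\<bar>) \<longrightarrow>
      0 < t \<longrightarrow> t \<le> T \<longrightarrow> \<bar>v t x\<bar> \<le> K * (c * ((1 + norm x) powr (- a) + (1 + norm (x + h)) powr (- a))))"

lemmas volterra_constD = volterra_const_def[THEN iffD1, rule_format]

text \<open>The weight w tends to 0 at infinity, while \<open>weighted_gronwall\<close> wants a
  positive lower bound. It is therefore applied to w + \<epsilon>, with constants free of
  \<epsilon>, and \<epsilon> is removed at the end.\<close>

lemma volterra_weight_bound:
  fixes T a A c0 :: real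
  assumes T: "0 < T" and a: "CARD('n) < a" "a \<le> \<alpha> + CARD('n) + 1" and A: "0 \<le> A" and c0: "0 \<le> c0"
  shows "\<exists>K>0. volterra_const T a A c0 K"
proof -
  obtain K1 where K1: "0 < K1"
    "\<And>\<tau> c \<epsilon> x h. 0 < \<tau> \<Longrightarrow> \<tau> \<le> T \<Longrightarrow>
      integrable lborel (\<lambda>y. norm (D \<tau> (x - y)) * (c * ((1 + norm y) powr (- a) + (1 + norm (y + h)) powr (- a)) + \<epsilon>))"
    "\<And>\<tau> c \<epsilon> x h. 0 < \<tau> \<Longrightarrow> \<tau> \<le> T \<Longrightarrow> 0 \<le> c \<Longrightarrow> 0 \<le> \<epsilon> \<Longrightarrow>
      (\<integral>y. norm (D \<tau> (x - y)) * (c * ((1 + norm y) powr (- a) + (1 + norm (y + h)) powr (- a)) + \<epsilon>) \<partial>lborel)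
      \<le> K1 * \<tau> powr (- (1 / \<alpha>)) * (c * ((1 + norm x) powr (- a) + (1 + norm (x + h)) powr (- a)) + \<epsilon>)"
    by (rule shifted_weight_convolution[OF T a]) (rule that)
  define H where "H = c0 * K1"
  have H: "0 \<le> H" using c0 K1(1) by (simp add: H_def)
  obtain \<mu> where \<mu>: "0 < \<mu>" "H * sing_mass \<mu> \<le> 1/2" using sing_mass_small[OF H] .
  define K where "K = 2 * A * exp (\<mu> * T) + 1"
  have K: "0 < K" using A by (simp add: K_def add_nonneg_pos)
  show ?thesis unfolding volterra_const_def
  proof (intro exI[of _ K] conjI K allI impI)
    fix v :: "real \<Rightarrow> real^'n \<Rightarrow> real" and g :: "real \<Rightarrow> real^'n \<Rightarrow> real^'n" and h x :: "real^'n" and c B t :: real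
    assume c: "0 \<le> c" and "\<forall>t x. 0 < t \<longrightarrow> t \<le> T \<longrightarrow> \<bar>v t x\<bar> \<le> B"
      and "\<forall>s y. 0 < s \<longrightarrow> s \<le> T \<longrightarrow> norm (g s y) \<le> c0 * \<bar>v s y\<bar>"
      and "\<forall>t x. 0 < t \<longrightarrow> t \<le> T \<longrightarrow> \<bar>v t x\<bar> \<le> A * (c * ((1 + norm x) powr (- a) + (1 + norm (x + h)) powr (- a)))
        + \<bar>LINT s:{0..t}|lborel. grad_semigroup \<alpha> (t - s) (g s) x\<bar>"
      and t: "0 < t" "t \<le> T"
    then have B: "\<And>t x. 0 < t \<Longrightarrow> t \<le> T \<Longrightarrow> \<bar>v t x\<bar> \<le> B"
      and g: "\<And>s y. 0 < s \<Longrightarrow> s \<le> T \<Longrightarrow> norm (g s y) \<le> c0 * \<bar>v s y\<bar>"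
      and vb: "\<And>t x. 0 < t \<Longrightarrow> t \<le> T \<Longrightarrow> \<bar>v t x\<bar> \<le> A * (c * ((1 + norm x) powr (- a) + (1 + norm (x + h)) powr (- a)))
        + \<bar>LINT s:{0..t}|lborel. grad_semigroup \<alpha> (t - s) (g s) x\<bar>" by blast+
    define w where "w y = c * ((1 + norm y) powr (- a) + (1 + norm (y + h)) powr (- a))" for y
    have w0: "0 \<le> w y" for y using c by (simp add: w_def)
    have eps: "\<bar>v t x\<bar> \<le> 2 * A * exp (\<mu> * T) * (w x + \<epsilon>)" if e: "0 < \<epsilon>" for \<epsilon>
    proof (rule weighted_gronwall[where v=v and W="\<lambda>y. w y + \<epsilon>", OF T B e _ A \<mu>(1) H \<mu>(2) _ t])
      show "\<epsilon> \<le> w y + \<epsilon>" for y using w0 by simp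
      fix m t x assume m: "0 \<le> m" and t: "0 < t" "t \<le> T" and vm: "\<And>s y. 0 < s \<Longrightarrow> s < t \<Longrightarrow> \<bar>v s y\<bar> \<le> m * exp (\<mu> * s) * (w y + \<epsilon>)"
      have "\<bar>LINT s:{0..t}|lborel. grad_semigroup \<alpha> (t - s) (g s) x\<bar> \<le> (c0 * m) * K1 * (w x + \<epsilon>) * (exp (\<mu> * t) * sing_mass \<mu>)"
      proof (rule duhamel_weight_bound[where W="\<lambda>y. w y + \<epsilon>", OF \<mu>(1) t(2)])
        show "0 \<le> K1" "0 \<le> c0 * m" "0 \<le> w x + \<epsilon>" using K1(1) c0 m w0[of x] e by auto
        show "integrable lborel (\<lambda>y. norm (D \<tau> (x - y)) * (w y + \<epsilon>))" if "0 < \<tau>" "\<tau> \<le> T" for \<tau>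
          unfolding w_def by (rule K1(2)[OF that])
        show "(\<integral>y. norm (D \<tau> (x - y)) * (w y + \<epsilon>) \<partial>lborel) \<le> K1 * \<tau> powr (- (1 / \<alpha>)) * (w x + \<epsilon>)" if "0 < \<tau>" "\<tau> \<le> T" for \<tau>
          unfolding w_def using e by (intro K1(3)[OF that c]) simp
        show "norm (g s y) \<le> c0 * m * exp (\<mu> * s) * (w y + \<epsilon>)" if s: "0 < s" "s < t" for s y
        proof -
          have "c0 * \<bar>v s y\<bar> \<le> c0 * (m * exp (\<mu> * s) * (w y + \<epsilon>))" by (intro mult_left_mono vm s c0)
          moreover have "norm (g s y) \<le> c0 * \<bar>v s y\<bar>" using s t by (intro g) auto
          ultimately show ?thesis by (simp only: mult.assoc)
        qed
      qed
      also have "\<dots> = m * H * (w x + \<epsilon>) * (exp (\<mu> * t) * sing_mass \<mu>)" by (simp only: H_def mult_ac)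
      finally have "\<bar>LINT s:{0..t}|lborel. grad_semigroup \<alpha> (t - s) (g s) x\<bar> \<le> m * H * (w x + \<epsilon>) * (exp (\<mu> * t) * sing_mass \<mu>)" .
      moreover have "A * w x \<le> A * (w x + \<epsilon>)" using A e by (intro mult_left_mono) auto
      ultimately show "\<bar>v t x\<bar> \<le> A * (w x + \<epsilon>) + m * H * (w x + \<epsilon>) * (exp (\<mu> * t) * sing_mass \<mu>)"
        using vb[OF t, of x] unfolding w_def[symmetric] by linarith
    qed
    have "\<bar>v t x\<bar> \<le> K * w x"
    proof (rule field_le_epsilon)
      fix e :: real assume e: "0 < e"
      have "\<bar>v t x\<bar> \<le> 2 * A * exp (\<mu> * T) * (w x + e / K)" using e K by (intro eps) simp
      also have "\<dots> \<le> K * (w x + e / K)" using w0[of x] e K by (intro mult_right_mono) (auto simp: K_def)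
      also have "\<dots> = K * w x + e" using K by (simp add: distrib_left)
      finally show "\<bar>v t x\<bar> \<le> K * w x + e" .
    qed
    then show "\<bar>v t x\<bar> \<le> K * (c * ((1 + norm x) powr (- a) + (1 + norm (x + h)) powr (- a)))" unfolding w_def .
  qed
qed

lemma grad_semigroup_shift:
  fixes g :: "real^'n \<Rightarrow> real^'n"
  assumes \<tau>: "0 < \<tau>" and g: "integrable lborel g"
  shows "grad_semigroup \<alpha> \<tau> g (x + h) - grad_semigroup \<alpha> \<tau> g x = grad_semigroup \<alpha> \<tau> (\<lambda>y. g (y + h) - g y) x"
proof -
  note [measurable] = D_measurable[OF \<tau>]
  have [measurable]: "g \<in> borel_measurable borel" using g by auto
  let ?F = "\<lambda>y. D \<tau> (x + h - y) \<bullet> g y"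
  have "integrable lborel (\<lambda>y. ?F (h + 1 *\<^sub>R y))" "(\<integral>y. ?F (h + 1 *\<^sub>R y) \<partial>lborel) = (\<integral>y. ?F y \<partial>lborel)"
    using lborel_integral_affine[of 1 ?F h] grad_convolution_integrable[OF \<tau> g, of "x + h"] by simp_all
  then have "integrable lborel (\<lambda>y. D \<tau> (x - y) \<bullet> g (y + h))" "(\<integral>y. D \<tau> (x - y) \<bullet> g (y + h) \<partial>lborel) = (\<integral>y. ?F y \<partial>lborel)"
    by (simp_all add: add.commute)
  then show ?thesis
    unfolding grad_semigroup_eq[OF \<tau>] inner_diff_right using grad_convolution_integrable[OF \<tau> g, of x] by simp
qed

end

section \<open>Weighted decay of the solution and of its differences\<close>

context duhamel_solution
begin

lemma init_integrable: "integrable lborel u\<^sub>0"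
proof -
  have i: "integrable lborel (\<lambda>y::real^'n. M0 * (1 + norm y) powr (- (\<alpha> + CARD('n))))"
    by (rule integrable_mult_right[OF integrable_weight]) (use \<alpha> in simp)
  show ?thesis
    by (rule Bochner_Integration.integrable_bound[OF i]) (use init_meas init_bound M0 in auto)
qed

lemma semigroup_weight_bound:
  assumes T: "0 < T"
  obtains A where "0 < A" "\<And>t x. 0 < t \<Longrightarrow> t \<le> T \<Longrightarrow> \<bar>semigroup \<alpha> t u\<^sub>0 x\<bar> \<le> A * (1 + norm x) powr (- (\<alpha> + CARD('n)))"
proof -
  let ?a = "\<alpha> + CARD('n)"
  obtain K where K: "0 < K"
    "\<And>\<tau> x::real^'n. 0 < \<tau> \<Longrightarrow> \<tau> \<le> T \<Longrightarrow> integrable lborel (\<lambda>y. \<bar>p_kernel \<alpha> (x - y) \<tau>\<bar> * (1 + norm y) powr (- ?a))"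
    "\<And>\<tau> x::real^'n. 0 < \<tau> \<Longrightarrow> \<tau> \<le> T \<Longrightarrow> (\<integral>y. \<bar>p_kernel \<alpha> (x - y) \<tau>\<bar> * (1 + norm y) powr (- ?a) \<partial>lborel) \<le> K * (1 + norm x) powr (- ?a)"
    by (rule kernel_weight_convolution[OF T, of ?a]) (use \<alpha> in auto)
  define A where "A = M0 * K + 1"
  have A: "0 < A" using M0 K(1) by (simp add: A_def add_nonneg_pos)
  show ?thesis
  proof (rule that[OF A])
    fix t :: real and x :: "real^'n" assume t: "0 < t" "t \<le> T"
    have "norm (\<integral>y. p_kernel \<alpha> (x - y) t * u\<^sub>0 y \<partial>lborel) \<le> (\<integral>y. M0 * (\<bar>p_kernel \<alpha> (x - y) t\<bar> * (1 + norm y) powr (- ?a)) \<partial>lborel)"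
    proof (rule norm_integral_le_AE[OF integrable_mult_right[OF K(2)[OF t]]])
      show "AE y in lborel. norm (p_kernel \<alpha> (x - y) t * u\<^sub>0 y) \<le> M0 * (\<bar>p_kernel \<alpha> (x - y) t\<bar> * (1 + norm y) powr (- ?a))"
        using init_bound
      proof eventually_elim
        case (elim y)
        have "\<bar>p_kernel \<alpha> (x - y) t\<bar> * \<bar>u\<^sub>0 y\<bar> \<le> \<bar>p_kernel \<alpha> (x - y) t\<bar> * (M0 * (1 + norm y) powr (- ?a))"
          by (intro mult_left_mono elim) simp
        then show ?case by (simp add: abs_mult mult_ac)
      qed
    qed
    also have "\<dots> = M0 * (\<integral>y. \<bar>p_kernel \<alpha> (x - y) t\<bar> * (1 + norm y) powr (- ?a) \<partial>lborel)" by (rule integral_mult_right_zero)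
    also have "\<dots> \<le> M0 * (K * (1 + norm x) powr (- ?a))" by (intro mult_left_mono K(3) t M0)
    also have "\<dots> \<le> A * (1 + norm x) powr (- ?a)" by (simp add: A_def distrib_right)
    finally show "\<bar>semigroup \<alpha> t u\<^sub>0 x\<bar> \<le> A * (1 + norm x) powr (- ?a)" unfolding semigroup_def by simp
  qed
qed

lemma solution_weight_bound:
  assumes T: "0 < T"
  obtains K where "0 < K" "\<And>t x. 0 < t \<Longrightarrow> t \<le> T \<Longrightarrow> \<bar>u t x\<bar> \<le> K * (1 + norm x) powr (- (\<alpha> + CARD('n)))"
proof -
  let ?a = "\<alpha> + CARD('n)"
  obtain A where A: "0 < A" "\<And>t x. 0 < t \<Longrightarrow> t \<le> T \<Longrightarrow> \<bar>semigroup \<alpha> t u\<^sub>0 x\<bar> \<le> A * (1 + norm x) powr (- ?a)"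
    by (rule semigroup_weight_bound[OF T]) (rule that)
  have a: "CARD('n) < ?a" "?a \<le> \<alpha> + CARD('n) + 1" using \<alpha> by auto
  have A0: "0 \<le> A" and c0: "0 \<le> Cf * M powr (q - 1)" using A Cf by auto
  obtain K where K: "0 < K" "volterra_const T ?a A (Cf * M powr (q - 1)) K" using volterra_weight_bound[OF T a A0 c0] by blast
  show ?thesis
  proof (rule that[OF K(1)])
    fix t :: real and x :: "real^'n" assume t: "0 < t" "t \<le> T"
    \<comment> \<open>With h = 0 and c = 1/2 the two-point weight collapses to the single
      one.\<close>
    have "\<bar>u t x\<bar> \<le> K * (1/2 * ((1 + norm x) powr (- ?a) + (1 + norm (x + 0)) powr (- ?a)))"
    proof (rule volterra_constD[OF K(2), where g="\<lambda>s y. f (u s y)" and B=M and c="1/2", OF _ u_bound flux_linear _ t])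
      fix t x assume t: "0 < t" "t \<le> T"
      show "\<bar>u t x\<bar> \<le> A * (1/2 * ((1 + norm x) powr (- ?a) + (1 + norm (x + 0)) powr (- ?a)))
        + \<bar>LINT s:{0..t}|lborel. grad_semigroup \<alpha> (t - s) (\<lambda>y. f (u s y)) x\<bar>"
        using duhamel[OF t(1), of x] A(2)[OF t, of x] by simp
    qed simp
    then show "\<bar>u t x\<bar> \<le> K * (1 + norm x) powr (- ?a)" by simp
  qed
qed

text \<open>The nonlinearity is not differentiated: for a fixed shift \<open>h\<close> the difference \<open>u(x+h) - u(x)\<close> satisfies a linear
  Volterra inequality, with the symmetric weight at both points.\<close>

lemma solution_difference_bound:
  assumes T: "0 < T" and A: "0 \<le> A"
    and S: "\<And>t x h. 0 < t \<Longrightarrow> t \<le> T \<Longrightarrow> \<bar>semigroup \<alpha> t u\<^sub>0 (x + h) - semigroup \<alpha> t u\<^sub>0 x\<bar>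
      \<le> A * (norm h * ((1 + norm x) powr (- (\<alpha> + CARD('n) + 1)) + (1 + norm (x + h)) powr (- (\<alpha> + CARD('n) + 1))))"
  obtains K where "0 < K" "\<And>t x h. 0 < t \<Longrightarrow> t \<le> T \<Longrightarrow> \<bar>u t (x + h) - u t x\<bar>
      \<le> K * (norm h * ((1 + norm x) powr (- (\<alpha> + CARD('n) + 1)) + (1 + norm (x + h)) powr (- (\<alpha> + CARD('n) + 1))))"
proof -
  let ?a = "\<alpha> + CARD('n) + 1"
  have a: "CARD('n) < ?a" "?a \<le> \<alpha> + CARD('n) + 1" using \<alpha> by auto
  have c0: "0 \<le> 2 * Cf * M powr (q - 1)" using Cf by auto
  obtain K where K: "0 < K" "volterra_const T ?a A (2 * Cf * M powr (q - 1)) K" using volterra_weight_bound[OF T a A c0] by blast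
  show ?thesis
  proof (rule that[OF K(1)])
    fix t :: real and x h :: "real^'n" assume t: "0 < t" "t \<le> T"
    let ?g = "\<lambda>s y. f (u s (y + h)) - f (u s y)"
    show "\<bar>u t (x + h) - u t x\<bar> \<le> K * (norm h * ((1 + norm x) powr (- ?a) + (1 + norm (x + h)) powr (- ?a)))"
    proof (rule volterra_constD[OF K(2), where v="\<lambda>t x. u t (x + h) - u t x" and g="?g" and B="2 * M", OF norm_ge_zero _ _ _ t])
      show "\<bar>u t (x + h) - u t x\<bar> \<le> 2 * M" if "0 < t" "t \<le> T" for t x
        using u_bound[OF that(1), of "x + h"] u_bound[OF that(1), of x] by linarith
      show "norm (?g s y) \<le> 2 * Cf * M powr (q - 1) * \<bar>u s (y + h) - u s y\<bar>" if "0 < s" "s \<le> T" for s y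
        by (rule flux_lipschitz) (rule u_bound[OF that(1)])+
      fix t x assume t: "0 < t" "t \<le> T"
      let ?G = "\<lambda>x s. grad_semigroup \<alpha> (t - s) (\<lambda>y. f (u s y)) x"
      have "(LINT s:{0..t}|lborel. ?G (x + h) s) - (LINT s:{0..t}|lborel. ?G x s) = (LINT s:{0..t}|lborel. ?G (x + h) s - ?G x s)"
        by (rule set_integral_diff(2)[symmetric]) (rule duhamel_terms_integrable(1))+
      also have "\<dots> = (LINT s:{0..t}|lborel. grad_semigroup \<alpha> (t - s) (?g s) x)"
        unfolding set_lebesgue_integral_def
      proof (rule integral_cong_AE)
        show "AE s in lborel. indicator {0..t} s *\<^sub>R (?G (x + h) s - ?G x s) = indicator {0..t} s *\<^sub>R grad_semigroup \<alpha> (t - s) (?g s) x"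
          using AE_lborel_singleton[of 0] AE_lborel_singleton[of t]
        proof eventually_elim
          case (elim s)
          show ?case
          proof (cases "0 < s \<and> s < t")
            case True
            then show ?thesis using grad_semigroup_shift[of "t - s" "\<lambda>y. f (u s y)" x h] flux_integrable[of s] by simp
          qed (use elim in \<open>auto simp: indicator_def\<close>)
        qed
        have m: "(\<lambda>s. indicator {0..t} s *\<^sub>R (?G (x + h) s - ?G x s)) \<in> borel_measurable lborel"
          using set_integral_diff(1)[OF duhamel_terms_integrable(1)[of t "x + h"] duhamel_terms_integrable(1)[of t x]]
          unfolding set_integrable_def by auto
        then show "(\<lambda>s. indicator {0..t} s *\<^sub>R (?G (x + h) s - ?G x s)) \<in> borel_measurable lborel" .
        \<comment> \<open>The shift identity holds only for positive elapsed time and for s > 0, so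
          the two integrands may differ at s = 0 and s = t; measurability is carried over by
          correcting these two values.\<close>
        have "(\<lambda>s. indicator {0..t} s *\<^sub>R grad_semigroup \<alpha> (t - s) (?g s) x)
          = (\<lambda>s. indicator {0..t} s *\<^sub>R (?G (x + h) s - ?G x s) + (if s = 0 then grad_semigroup \<alpha> (t - 0) (?g 0) x - (?G (x + h) 0 - ?G x 0)
             else if s = t then grad_semigroup \<alpha> (t - t) (?g t) x - (?G (x + h) t - ?G x t) else 0))"
          (is "_ = ?R")
        proof
          fix s
          consider "0 < s \<and> s < t" | "s = 0" | "s = t" | "s \<notin> {0..t}" by fastforce
          then show "indicator {0..t} s *\<^sub>R grad_semigroup \<alpha> (t - s) (?g s) x = ?R s"
          proof cases
            case 1
            then show ?thesis using grad_semigroup_shift[of "t - s" "\<lambda>y. f (u s y)" x h] flux_integrable[of s] by simp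
          qed (use t in auto)
        qed
        moreover have "?R \<in> borel_measurable lborel" using m by measurable
        ultimately show "(\<lambda>s. indicator {0..t} s *\<^sub>R grad_semigroup \<alpha> (t - s) (?g s) x) \<in> borel_measurable lborel" by (simp only:)
      qed
      finally have "u t (x + h) - u t x = semigroup \<alpha> t u\<^sub>0 (x + h) - semigroup \<alpha> t u\<^sub>0 x - (LINT s:{0..t}|lborel. grad_semigroup \<alpha> (t - s) (?g s) x)"
        unfolding duhamel[OF t(1)] by linarith
      then show "\<bar>u t (x + h) - u t x\<bar> \<le> A * (norm h * ((1 + norm x) powr (- ?a) + (1 + norm (x + h)) powr (- ?a)))
        + \<bar>LINT s:{0..t}|lborel. grad_semigroup \<alpha> (t - s) (?g s) x\<bar>"
        using S[OF t, of x h] by linarith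
    qed
  qed
qed

end

text \<open>Linear vanishing of 1 - \<open>bump\<close> at the origin supplies a factor |z|, which
  turns the singular mass of the gradient kernel into its bounded first moment.\<close>

lemma bump_ge: "1 - bump y \<le> 2 * norm y"
proof (cases "norm y \<le> 1")
  case True
  then have "(norm y)\<^sup>2 \<le> norm y" by (simp add: power2_eq_square mult_left_le)
  moreover have "0 \<le> ((norm y)\<^sup>2)\<^sup>2" by simp
  moreover have "bump y = (1 - (norm y)\<^sup>2)\<^sup>2" using True by (simp add: bump_def abs_square_le_1 max_absorb2)
  then have "1 - bump y = 2 * (norm y)\<^sup>2 - ((norm y)\<^sup>2)\<^sup>2" by (simp add: power2_diff)
  ultimately show ?thesis by linarith
next
  case False
  then show ?thesis using bump_bounds(1)[of y] by linarith
qed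

lemma bump_grad_outside: "1 \<le> norm y \<Longrightarrow> bump_grad y = 0"
  by (simp add: bump_grad_def max_absorb1 one_le_power)

lemma weak_gradient_reflected_test:
  fixes u :: "real^'n \<Rightarrow> real"
  assumes w: "is_weak_gradient u G" and u: "integrable lborel u" and G: "integrable lborel G"
    and d: "\<And>z. (\<phi> has_derivative (\<lambda>h. E z \<bullet> h)) (at z)" and c: "continuous_on UNIV E"
    and B: "\<And>z. \<bar>\<phi> z\<bar> \<le> B" "\<And>z. norm (E z) \<le> B"
  shows "(\<integral>y. u y *\<^sub>R E (x - y) \<partial>lborel) = (\<integral>y. \<phi> (x - y) *\<^sub>R G y \<partial>lborel)"
proof -
  have "((\<lambda>y. \<phi> (x - y)) has_derivative (\<lambda>h. - E (x - y) \<bullet> h)) (at y)" for y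
  proof -
    have "((\<lambda>y. x - y) has_derivative (\<lambda>h. - h)) (at y)" by (auto intro!: derivative_eq_intros)
    from diff_chain_at[OF this d] show ?thesis by (simp add: o_def)
  qed
  moreover have "continuous_on UNIV (\<lambda>y. - E (x - y))"
    by (intro continuous_intros continuous_on_compose2[OF c]) auto
  ultimately have "(\<integral>y. u y *\<^sub>R - E (x - y) \<partial>lborel) = - (\<integral>y. \<phi> (x - y) *\<^sub>R G y \<partial>lborel)"
    by (rule weak_gradient_bounded_test[OF w u G]) (use B in auto)
  then show ?thesis by simp
qed

section \<open>Gradient and differences of the linear evolution\<close>

context duhamel_solution
begin

text \<open>Since \<open>p\<^sub>\<alpha>\<close> decays only like \<open>|x|\<^sup>-\<^sup>(\<^sup>\<alpha>\<^sup>+\<^sup>d\<^sup>)\<close>, the derivative is moved to the datum only inside \<open>|x-y| < |x|/2\<close>.\<close>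

lemma semigroup_gradient_bound:
  assumes T: "0 < T" and w: "is_weak_gradient u\<^sub>0 G" and M2: "0 \<le> M2"
    and Gb: "AE y in lborel. norm (G y) \<le> M2 * (1 + norm y) powr (- (\<alpha> + CARD('n) + 1))"
  obtains A where "0 < A" "\<And>t x. 0 < t \<Longrightarrow> t \<le> T \<Longrightarrow> norm (\<integral>y. u\<^sub>0 y *\<^sub>R D t (x - y) \<partial>lborel) \<le> A * (1 + norm x) powr (- (\<alpha> + CARD('n) + 1))"
proof -
  define e where "e = \<alpha> + CARD('n) + 1"
  have e: "1 < e" using \<alpha> by (simp add: e_def)
  define J where "J = (\<integral>y. \<bar>u\<^sub>0 y\<bar> \<partial>lborel)"
  have J: "0 \<le> J" unfolding J_def by (rule Bochner_Integration.integral_nonneg) simp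
  define Q where "Q = C * T * J + 6 * M0 * C + M2 * C"
  have Q: "0 \<le> Q" "M2 * C \<le> Q" using C T J M0 M2 by (auto simp: Q_def)
  define A where "A = Q * 4 powr e + 1"
  have A: "0 < A" using Q by (simp add: A_def add_nonneg_pos)
  have Gm: "G \<in> borel_measurable lborel" using w by (auto simp: is_weak_gradient_def locally_integrable_def)
  have wi: "integrable lborel (\<lambda>y::real^'n. M2 * (1 + norm y) powr (- e))"
    by (intro integrable_mult_right integrable_weight) (use \<alpha> in \<open>simp add: e_def\<close>)
  have Gi: "integrable lborel G"
    by (rule Bochner_Integration.integrable_bound[OF wi Gm]) (use Gb M2 in \<open>auto simp: e_def\<close>)
  note u0i = init_integrable
  show ?thesis
  proof (rule that[OF A])
    fix t :: real and x :: "real^'n" assume t: "0 < t" "t \<le> T"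
    define P where "P z = p_kernel \<alpha> z t" for z :: "real^'n"
    obtain K where Kq: "quadratic_gradient K P (D t)" using kernel_quadratic[OF t(1)] unfolding P_def by auto
    note dP = quadratic_gradient_has_derivative[OF Kq] and cP = quadratic_gradient_continuous[OF Kq]
    note [measurable] = quadratic_gradient_measurable[OF Kq]
    have [measurable]: "G \<in> borel_measurable borel" "u\<^sub>0 \<in> borel_measurable borel" using Gm init_meas by auto
    define BP where "BP = C * t powr (- (CARD('n) / \<alpha>))"
    define BD where "BD = C * t powr (- ((CARD('n) + 1) / \<alpha>))"
    have BP: "\<bar>P z\<bar> \<le> BP" for z unfolding P_def BP_def by (rule kernel_bound[OF t(1)])
    have BD: "norm (D t z) \<le> BD" for z unfolding BD_def by (rule grad_bound[OF t(1)])
    have B0: "0 \<le> BP" "0 \<le> BD" using C by (simp_all add: BP_def BD_def)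
    have Pi: "integrable lborel (\<lambda>y. \<bar>P (x - y)\<bar>)" "(\<integral>y. \<bar>P (x - y)\<bar> \<partial>lborel) \<le> C"
      using lborel_integral_reflect[of "\<lambda>z. \<bar>P z\<bar>" x] kernel_integral[OF t(1)] by (auto simp: P_def)
    have Di: "integrable lborel (\<lambda>y. norm (x - y) * norm (D t (x - y)))" "(\<integral>y. norm (x - y) * norm (D t (x - y)) \<partial>lborel) \<le> C"
      using lborel_integral_reflect[of "\<lambda>z. norm z * norm (D t z)" x] grad_moment[OF t(1)] by auto
    have "norm (\<integral>y. u\<^sub>0 y *\<^sub>R D t (x - y) \<partial>lborel) \<le> Q * 4 powr e * (1 + norm x) powr (- e)"
    \<comment> \<open>For |x| < 1 no decay is at stake: the whole derivative is moved to the datum,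
      and the sup bound of its gradient times the mass of the kernel suffices.\<close>
    proof (cases "norm x < 1")
      case True
      have I1: "(\<integral>y. u\<^sub>0 y *\<^sub>R D t (x - y) \<partial>lborel) = (\<integral>y. P (x - y) *\<^sub>R G y \<partial>lborel)"
        by (rule weak_gradient_reflected_test[OF w u0i Gi dP cP(1), of "max BP BD"]) (use BP BD in \<open>simp_all add: le_max_iff_disj\<close>)
      have "norm (\<integral>y. P (x - y) *\<^sub>R G y \<partial>lborel) \<le> (\<integral>y. M2 * \<bar>P (x - y)\<bar> \<partial>lborel)"
      proof (rule norm_integral_le_AE[OF integrable_mult_right[OF Pi(1)]])
        show "AE y in lborel. norm (P (x - y) *\<^sub>R G y) \<le> M2 * \<bar>P (x - y)\<bar>"
          using Gb
        proof eventually_elim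
          case (elim y)
          have "(1 + norm y) powr (- e) \<le> 1" using powr_mono2'[of "- e" 1 "1 + norm y"] e by simp
          then have "M2 * (1 + norm y) powr (- e) \<le> M2 * 1" using M2 by (intro mult_left_mono) auto
          then have "norm (G y) \<le> M2" using elim by (simp add: e_def)
          then have "\<bar>P (x - y)\<bar> * norm (G y) \<le> \<bar>P (x - y)\<bar> * M2" by (intro mult_left_mono) auto
          then show ?case by (simp add: mult.commute)
        qed
      qed
      moreover have "(\<integral>y. M2 * \<bar>P (x - y)\<bar> \<partial>lborel) \<le> M2 * C" unfolding integral_mult_right_zero by (intro mult_left_mono Pi(2) M2)
      moreover have "Q * 1 \<le> Q * (4 powr e * (1 + norm x) powr (- e))"
      proof (rule mult_left_mono[OF _ Q(1)])
        have "4 powr (- e) \<le> (1 + norm x) powr (- e)" using True e by (intro powr_mono2') (auto simp: add_pos_nonneg)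
        then have "4 powr e * 4 powr (- e) \<le> 4 powr e * (1 + norm x) powr (- e)" by (intro mult_left_mono) auto
        then show "1 \<le> 4 powr e * (1 + norm x) powr (- e)" by (simp flip: powr_add)
      qed
      then have "Q \<le> Q * 4 powr e * (1 + norm x) powr (- e)" by (simp only: mult_1_right mult.assoc)
      ultimately show ?thesis using Q(2) unfolding I1 by linarith
    next
      case False
      define r where "r = norm x / 2"
      have r: "0 < r" "(1 + norm x) / 4 \<le> r" using False by (auto simp: r_def)
      define \<zeta> where "\<zeta> z = bump (z /\<^sub>R r)" for z :: "real^'n"
      define \<zeta>' where "\<zeta>' z = bump_grad (z /\<^sub>R r) /\<^sub>R r" for z :: "real^'n"
      have Xq: "quadratic_gradient (27 / r\<^sup>2) \<zeta> \<zeta>'" unfolding \<zeta>_def \<zeta>'_def by (rule bump_scaled[OF r(1)])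
      note dX = quadratic_gradient_has_derivative[OF Xq] and cX = quadratic_gradient_continuous[OF Xq]
      note [measurable] = quadratic_gradient_measurable[OF Xq]
      have X: "0 \<le> \<zeta> z" "\<zeta> z \<le> 1" "1 - \<zeta> z \<le> 2 * norm z / r" "norm (\<zeta>' z) \<le> 4 / r" for z
        using bump_bounds(1,2)[of "z /\<^sub>R r"] bump_ge[of "z /\<^sub>R r"] bump_grad_bound[of "z /\<^sub>R r"] r
        by (auto simp: \<zeta>_def \<zeta>'_def field_simps)
      have X0: "\<zeta> z = 0" "\<zeta>' z = 0" if "r \<le> norm z" for z
      proof -
        have "1 \<le> norm (z /\<^sub>R r)" using that r by (simp add: field_simps)
        then show "\<zeta> z = 0" "\<zeta>' z = 0" unfolding \<zeta>_def \<zeta>'_def by (simp_all add: bump_bounds(3) bump_grad_outside)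
      qed
      define E where "E z = \<zeta> z *\<^sub>R D t z + P z *\<^sub>R \<zeta>' z" for z
      have dE: "((\<lambda>z. \<zeta> z * P z) has_derivative (\<lambda>h. E z \<bullet> h)) (at z)" for z
        by (rule has_derivative_eq_rhs[OF has_derivative_mult[OF dX dP]]) (auto simp: E_def inner_add_left)
      have cE: "continuous_on UNIV E" unfolding E_def by (intro continuous_intros cX cP)
      have bE: "\<bar>\<zeta> z * P z\<bar> \<le> BP + BD + BP * (4 / r)" "norm (E z) \<le> BP + BD + BP * (4 / r)" for z
      proof -
        have 1: "\<bar>\<zeta> z * P z\<bar> \<le> 1 * BP" unfolding abs_mult using X BP by (intro mult_mono) auto
        have 2: "norm (\<zeta> z *\<^sub>R D t z) \<le> 1 * BD" unfolding norm_scaleR using X BD by (intro mult_mono) auto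
        have 3: "norm (P z *\<^sub>R \<zeta>' z) \<le> BP * (4 / r)" unfolding norm_scaleR using X BP B0 by (intro mult_mono) auto
        show "\<bar>\<zeta> z * P z\<bar> \<le> BP + BD + BP * (4 / r)" using 1 B0 r by (simp add: add_increasing2)
        show "norm (E z) \<le> BP + BD + BP * (4 / r)" unfolding E_def
          using norm_triangle_ineq[of "\<zeta> z *\<^sub>R D t z" "P z *\<^sub>R \<zeta>' z"] 2 3 B0 by linarith
      qed
      have bY: "r \<le> norm y" if "norm (x - y) < r" for y
        using norm_triangle_ineq2[of x y] that by (simp add: r_def)
      have I1: "(\<integral>y. u\<^sub>0 y *\<^sub>R E (x - y) \<partial>lborel) = (\<integral>y. (\<zeta> (x - y) * P (x - y)) *\<^sub>R G y \<partial>lborel)"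
        by (rule weak_gradient_reflected_test[OF w u0i Gi dE cE bE])
      have "norm (\<integral>y. (\<zeta> (x - y) * P (x - y)) *\<^sub>R G y \<partial>lborel) \<le> (\<integral>y. M2 * r powr (- e) * \<bar>P (x - y)\<bar> \<partial>lborel)"
      proof (rule norm_integral_le_AE[OF integrable_mult_right[OF Pi(1)]])
        show "AE y in lborel. norm ((\<zeta> (x - y) * P (x - y)) *\<^sub>R G y) \<le> M2 * r powr (- e) * \<bar>P (x - y)\<bar>"
          using Gb
        proof eventually_elim
          case (elim y)
          show ?case
          proof (cases "norm (x - y) < r")
            case True
            have "(1 + norm y) powr (- e) \<le> r powr (- e)" using bY[OF True] r e by (intro powr_mono2') auto
            then have "M2 * (1 + norm y) powr (- e) \<le> M2 * r powr (- e)" using M2 by (intro mult_left_mono) auto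
            then have "norm (G y) \<le> M2 * r powr (- e)" using elim unfolding e_def[symmetric] by linarith
            then have "\<zeta> (x - y) * \<bar>P (x - y)\<bar> * norm (G y) \<le> 1 * \<bar>P (x - y)\<bar> * (M2 * r powr (- e))"
              using X M2 by (intro mult_mono) auto
            then show ?thesis using X(1)[of "x - y"] by (simp add: abs_mult mult_ac)
          qed (use X0 M2 in simp)
        qed
      qed
      also have "\<dots> = M2 * r powr (- e) * (\<integral>y. \<bar>P (x - y)\<bar> \<partial>lborel)" by (rule integral_mult_right_zero)
      also have "\<dots> \<le> M2 * r powr (- e) * C" using M2 by (intro mult_left_mono Pi(2)) auto
      finally have b1: "norm (\<integral>y. u\<^sub>0 y *\<^sub>R E (x - y) \<partial>lborel) \<le> M2 * r powr (- e) * C" unfolding I1 .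
      \<comment> \<open>Three errors of the cut-off: outside the ball of radius r the kernel
        gradient is at most C T r^(-e); inside, 1 - \<zeta> \<le> 2|z|/r leaves the first moment,
        and |\<zeta>'| \<le> 4/r leaves the mass of the kernel. The loss 1/r combines with the decay
        r^(-(e-1)) of the datum to r^(-e).\<close>
      let ?m = "\<lambda>y. C * T * r powr (- e) * \<bar>u\<^sub>0 y\<bar> + (M0 * r powr (- e) * 2 * (norm (x - y) * norm (D t (x - y))) + M0 * r powr (- e) * 4 * \<bar>P (x - y)\<bar>)"
      have mi: "integrable lborel ?m"
        by (intro Bochner_Integration.integrable_add integrable_mult_right integrable_abs u0i Di(1) Pi(1))
      have AEb: "AE y in lborel. norm (u\<^sub>0 y *\<^sub>R (D t (x - y) - E (x - y))) \<le> ?m y"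
        using init_bound
      proof eventually_elim
        case (elim y)
        define z where "z = x - y"
        have eq: "D t z - E z = (1 - \<zeta> z) *\<^sub>R D t z - P z *\<^sub>R \<zeta>' z" by (simp add: E_def algebra_simps)
        show ?case unfolding z_def[symmetric]
        proof (cases "norm z < r")
          case True
          have "(1 + norm y) powr (- (e - 1)) \<le> r powr (- (e - 1))" using bY[OF True[unfolded z_def]] r e by (intro powr_mono2') auto
          then have "M0 * (1 + norm y) powr (- (e - 1)) \<le> M0 * r powr (- (e - 1))" by (intro mult_left_mono M0)
          then have uy: "\<bar>u\<^sub>0 y\<bar> \<le> M0 * r powr (- (e - 1))" using elim by (simp add: e_def)
          have "r powr (1 + - e) = r powr 1 * r powr (- e)" by (rule powr_add)
          then have re: "r powr (- (e - 1)) = r * r powr (- e)" using r by simp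
          have "norm ((1 - \<zeta> z) *\<^sub>R D t z) \<le> 2 * norm z / r * norm (D t z)"
          proof -
            have "\<bar>1 - \<zeta> z\<bar> \<le> 2 * norm z / r" using X[of z] by simp
            then show ?thesis unfolding norm_scaleR by (rule mult_right_mono) simp
          qed
          moreover have "norm (P z *\<^sub>R \<zeta>' z) \<le> \<bar>P z\<bar> * (4 / r)" unfolding norm_scaleR using X by (intro mult_left_mono) auto
          ultimately have "norm (D t z - E z) \<le> 2 * norm z / r * norm (D t z) + \<bar>P z\<bar> * (4 / r)"
            unfolding eq using norm_triangle_ineq4[of "(1 - \<zeta> z) *\<^sub>R D t z" "P z *\<^sub>R \<zeta>' z"] by linarith
          then have "\<bar>u\<^sub>0 y\<bar> * norm (D t z - E z) \<le> (M0 * r powr (- (e - 1))) * (2 * norm z / r * norm (D t z) + \<bar>P z\<bar> * (4 / r))"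
            using uy M0 by (intro mult_mono) auto
          also have "\<dots> = M0 * r powr (- e) * 2 * (norm z * norm (D t z)) + M0 * r powr (- e) * 4 * \<bar>P z\<bar>"
            unfolding re using r by (simp add: field_simps)
          finally have "\<bar>u\<^sub>0 y\<bar> * norm (D t z - E z) \<le> M0 * r powr (- e) * 2 * (norm z * norm (D t z)) + M0 * r powr (- e) * 4 * \<bar>P z\<bar>" .
          moreover have "0 \<le> C * T * r powr (- e) * \<bar>u\<^sub>0 y\<bar>" using C T by simp
          ultimately show "norm (u\<^sub>0 y *\<^sub>R (D t z - E z)) \<le> C * T * r powr (- e) * \<bar>u\<^sub>0 y\<bar>
            + (M0 * r powr (- e) * 2 * (norm z * norm (D t z)) + M0 * r powr (- e) * 4 * \<bar>P z\<bar>)" unfolding norm_scaleR by linarith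
        next
          case False
          then have zr: "r \<le> norm z" by simp
          then have "z \<noteq> 0" using r by auto
          then have "norm (D t z) \<le> C * t * norm z powr (- e)" unfolding e_def by (rule grad_decay[OF t(1)])
          also have "\<dots> \<le> C * T * r powr (- e)" using C t zr r e by (intro mult_mono powr_mono2') auto
          finally have "\<bar>u\<^sub>0 y\<bar> * norm (D t z) \<le> \<bar>u\<^sub>0 y\<bar> * (C * T * r powr (- e))" by (intro mult_left_mono) auto
          moreover have "0 \<le> M0 * r powr (- e) * 2 * (norm z * norm (D t z)) + M0 * r powr (- e) * 4 * \<bar>P z\<bar>" using M0 by simp
          moreover have "D t z - E z = D t z" unfolding eq X0[OF zr] by simp
          then have "norm (u\<^sub>0 y *\<^sub>R (D t z - E z)) = \<bar>u\<^sub>0 y\<bar> * norm (D t z)" by simp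
          moreover have "C * T * r powr (- e) * \<bar>u\<^sub>0 y\<bar> = \<bar>u\<^sub>0 y\<bar> * (C * T * r powr (- e))" by (rule mult.commute)
          ultimately show "norm (u\<^sub>0 y *\<^sub>R (D t z - E z)) \<le> C * T * r powr (- e) * \<bar>u\<^sub>0 y\<bar>
            + (M0 * r powr (- e) * 2 * (norm z * norm (D t z)) + M0 * r powr (- e) * 4 * \<bar>P z\<bar>)" by linarith
        qed
      qed
      have "norm (\<integral>y. u\<^sub>0 y *\<^sub>R (D t (x - y) - E (x - y)) \<partial>lborel) \<le> (\<integral>y. ?m y \<partial>lborel)"
        by (rule norm_integral_le_AE[OF mi AEb])
      also have "\<dots> = C * T * r powr (- e) * J + (M0 * r powr (- e) * 2 * (\<integral>y. norm (x - y) * norm (D t (x - y)) \<partial>lborel) + M0 * r powr (- e) * 4 * (\<integral>y. \<bar>P (x - y)\<bar> \<partial>lborel))"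
        unfolding J_def
        by (subst Bochner_Integration.integral_add, intro integrable_mult_right integrable_abs u0i,
            intro Bochner_Integration.integrable_add integrable_mult_right Di(1) Pi(1),
            subst Bochner_Integration.integral_add, intro integrable_mult_right Di(1), intro integrable_mult_right Pi(1))
          (simp only: integral_mult_right_zero)
      also have "\<dots> \<le> C * T * r powr (- e) * J + (M0 * r powr (- e) * 2 * C + M0 * r powr (- e) * 4 * C)"
        using M0 by (intro add_left_mono add_mono mult_left_mono Di(2) Pi(2)) auto
      finally have b2: "norm (\<integral>y. u\<^sub>0 y *\<^sub>R (D t (x - y) - E (x - y)) \<partial>lborel)
        \<le> C * T * r powr (- e) * J + (M0 * r powr (- e) * 2 * C + M0 * r powr (- e) * 4 * C)" .
      have iE: "integrable lborel (\<lambda>y. u\<^sub>0 y *\<^sub>R E (x - y))"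
      proof (rule Bochner_Integration.integrable_bound[OF integrable_mult_right[OF integrable_abs[OF u0i], of "BP + BD + BP * (4 / r)"]])
        have [measurable]: "E \<in> borel_measurable borel" by (rule borel_measurable_continuous_onI[OF cE])
        show "(\<lambda>y. u\<^sub>0 y *\<^sub>R E (x - y)) \<in> borel_measurable lborel" by measurable
        show "AE y in lborel. norm (u\<^sub>0 y *\<^sub>R E (x - y)) \<le> norm ((BP + BD + BP * (4 / r)) * \<bar>u\<^sub>0 y\<bar>)"
        proof (intro AE_I2)
          fix y
          have "\<bar>u\<^sub>0 y\<bar> * norm (E (x - y)) \<le> \<bar>u\<^sub>0 y\<bar> * (BP + BD + BP * (4 / r))" by (intro mult_left_mono bE) simp
          moreover have "0 \<le> BP + BD + BP * (4 / r)" using B0 r by simp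
          ultimately show "norm (u\<^sub>0 y *\<^sub>R E (x - y)) \<le> norm ((BP + BD + BP * (4 / r)) * \<bar>u\<^sub>0 y\<bar>)"
            by (simp add: abs_mult mult.commute)
        qed
      qed
      have iDE: "integrable lborel (\<lambda>y. u\<^sub>0 y *\<^sub>R (D t (x - y) - E (x - y)))"
      proof (rule Bochner_Integration.integrable_bound[OF mi])
        have [measurable]: "E \<in> borel_measurable borel" by (rule borel_measurable_continuous_onI[OF cE])
        show "(\<lambda>y. u\<^sub>0 y *\<^sub>R (D t (x - y) - E (x - y))) \<in> borel_measurable lborel" by measurable
        show "AE y in lborel. norm (u\<^sub>0 y *\<^sub>R (D t (x - y) - E (x - y))) \<le> norm (?m y)"
          using AEb by eventually_elim (unfold real_norm_def, erule order_trans, rule abs_ge_self)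
      qed
      have "(\<integral>y. u\<^sub>0 y *\<^sub>R D t (x - y) \<partial>lborel) = (\<integral>y. u\<^sub>0 y *\<^sub>R E (x - y) + u\<^sub>0 y *\<^sub>R (D t (x - y) - E (x - y)) \<partial>lborel)"
        by (simp add: scaleR_diff_right)
      also have "\<dots> = (\<integral>y. u\<^sub>0 y *\<^sub>R E (x - y) \<partial>lborel) + (\<integral>y. u\<^sub>0 y *\<^sub>R (D t (x - y) - E (x - y)) \<partial>lborel)"
        by (rule Bochner_Integration.integral_add[OF iE iDE])
      finally have "norm (\<integral>y. u\<^sub>0 y *\<^sub>R D t (x - y) \<partial>lborel) \<le> M2 * r powr (- e) * C + (C * T * r powr (- e) * J + (M0 * r powr (- e) * 2 * C + M0 * r powr (- e) * 4 * C))"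
        using b1 b2 norm_triangle_ineq[of "\<integral>y. u\<^sub>0 y *\<^sub>R E (x - y) \<partial>lborel" "\<integral>y. u\<^sub>0 y *\<^sub>R (D t (x - y) - E (x - y)) \<partial>lborel"]
        by (simp only:)
      also have "\<dots> = Q * r powr (- e)" by (simp add: Q_def algebra_simps)
      also have "\<dots> \<le> Q * ((1 + norm x) / 4) powr (- e)" using r e Q by (intro mult_left_mono powr_mono2') (auto simp: add_pos_nonneg)
      also have "((1 + norm x) / 4) powr (- e) = 4 powr e * (1 + norm x) powr (- e)" by (simp add: powr_divide powr_minus_divide)
      finally show ?thesis by (simp only: mult.assoc)
    qed
    also have "\<dots> \<le> A * (1 + norm x) powr (- e)" by (simp add: A_def distrib_right)
    finally show "norm (\<integral>y. u\<^sub>0 y *\<^sub>R D t (x - y) \<partial>lborel) \<le> A * (1 + norm x) powr (- (\<alpha> + CARD('n) + 1))" unfolding e_def .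
  qed
qed

lemma semigroup_difference_bound:
  assumes T: "0 < T" and w: "is_weak_gradient u\<^sub>0 G" and M2: "0 \<le> M2"
    and Gb: "AE y in lborel. norm (G y) \<le> M2 * (1 + norm y) powr (- (\<alpha> + CARD('n) + 1))"
  obtains A where "0 < A" "\<And>t x h. 0 < t \<Longrightarrow> t \<le> T \<Longrightarrow> \<bar>semigroup \<alpha> t u\<^sub>0 (x + h) - semigroup \<alpha> t u\<^sub>0 x\<bar>
      \<le> A * (norm h * ((1 + norm x) powr (- (\<alpha> + CARD('n) + 1)) + (1 + norm (x + h)) powr (- (\<alpha> + CARD('n) + 1))))"
proof -
  define e where "e = \<alpha> + CARD('n) + 1"
  have e: "1 < e" using \<alpha> by (simp add: e_def)
  obtain A1 where A1: "0 < A1" "\<And>t x. 0 < t \<Longrightarrow> t \<le> T \<Longrightarrow> norm (\<integral>y. u\<^sub>0 y *\<^sub>R D t (x - y) \<partial>lborel) \<le> A1 * (1 + norm x) powr (- e)"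
    by (rule semigroup_gradient_bound[OF T w M2 Gb, folded e_def]) (rule that)
  obtain A2 where A2: "0 < A2" "\<And>t x. 0 < t \<Longrightarrow> t \<le> T \<Longrightarrow> \<bar>semigroup \<alpha> t u\<^sub>0 x\<bar> \<le> A2 * (1 + norm x) powr (- (\<alpha> + CARD('n)))"
    by (rule semigroup_weight_bound[OF T]) (rule that)
  have weight: "(1 + norm z) powr (- (\<alpha> + CARD('n))) = (1 + norm z) * (1 + norm z) powr (- e)" for z :: "real^'n"
  proof -
    have "(1 + norm z) powr (1 + - e) = (1 + norm z) powr 1 * (1 + norm z) powr (- e)" by (rule powr_add)
    then show ?thesis by (simp add: add_pos_nonneg e_def)
  qed
  define A where "A = A1 * 2 powr e + 3 * A2"
  have A: "0 < A" using A1 A2 by (simp add: A_def add_nonneg_pos)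
  show ?thesis
  proof (rule that[OF A])
    fix t :: real and x h :: "real^'n" assume t: "0 < t" "t \<le> T"
    obtain K where Kq: "quadratic_gradient K (\<lambda>z::real^'n. p_kernel \<alpha> z t) (D t)" using kernel_quadratic[OF t(1)] by auto
    define B where "B = max (C * t powr (- (CARD('n) / \<alpha>))) (C * t powr (- ((CARD('n) + 1) / \<alpha>)))"
    have B: "\<bar>p_kernel \<alpha> z t\<bar> \<le> B" "norm (D t z) \<le> B" for z :: "real^'n"
      unfolding B_def using kernel_bound[OF t(1), of z] grad_bound[OF t(1), of z] by linarith+
    have "\<exists>K. quadratic_gradient K (semigroup \<alpha> t u\<^sub>0) (\<lambda>x. \<integral>y. u\<^sub>0 y *\<^sub>R D t (x - y) \<partial>lborel)"
      using quadratic_gradient_convolution(1)[OF Kq B init_integrable] unfolding semigroup_def by blast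
    then have der: "(semigroup \<alpha> t u\<^sub>0 has_derivative (\<lambda>k. (\<integral>y. u\<^sub>0 y *\<^sub>R D t (z - y) \<partial>lborel) \<bullet> k)) (at z)" for z
      using quadratic_gradient_has_derivative by blast
    let ?w = "\<lambda>z::real^'n. (1 + norm z) powr (- e)"
    have "\<bar>semigroup \<alpha> t u\<^sub>0 (x + h) - semigroup \<alpha> t u\<^sub>0 x\<bar> \<le> A * (norm h * (?w x + ?w (x + h)))"
    proof (cases "norm h \<le> (1 + norm x) / 2")
      case True
      have "norm (semigroup \<alpha> t u\<^sub>0 (x + h) - semigroup \<alpha> t u\<^sub>0 x) \<le> A1 * (2 powr e * ?w x) * norm (x + h - x)"
      proof (rule differentiable_bound[of "cball x (norm h)"])
        fix z assume z: "z \<in> cball x (norm h)"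
        show "(semigroup \<alpha> t u\<^sub>0 has_derivative (\<lambda>k. (\<integral>y. u\<^sub>0 y *\<^sub>R D t (z - y) \<partial>lborel) \<bullet> k)) (at z within cball x (norm h))"
          by (rule has_derivative_at_withinI[OF der])
        have "norm x - norm z \<le> norm (x - z)" by (rule norm_triangle_ineq2)
        then have "(1 + norm x) / 2 \<le> 1 + norm z" using z True by (auto simp: dist_norm)
        then have "?w z \<le> ((1 + norm x) / 2) powr (- e)" using e by (intro powr_mono2') (auto simp: add_pos_nonneg)
        also have "\<dots> = 2 powr e * ?w x" by (simp add: powr_divide powr_minus_divide)
        finally have "A1 * ?w z \<le> A1 * (2 powr e * ?w x)" using A1 by (intro mult_left_mono) auto
        then have "norm (\<integral>y. u\<^sub>0 y *\<^sub>R D t (z - y) \<partial>lborel) \<le> A1 * (2 powr e * ?w x)" using A1(2)[OF t, of z] by linarith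
        moreover have "onorm (\<lambda>k. (\<integral>y. u\<^sub>0 y *\<^sub>R D t (z - y) \<partial>lborel) \<bullet> k) \<le> norm (\<integral>y. u\<^sub>0 y *\<^sub>R D t (z - y) \<partial>lborel)"
          by (rule onorm_bound) (auto simp: Cauchy_Schwarz_ineq2)
        ultimately show "onorm (\<lambda>k. (\<integral>y. u\<^sub>0 y *\<^sub>R D t (z - y) \<partial>lborel) \<bullet> k) \<le> A1 * (2 powr e * ?w x)" by linarith
      qed (auto simp: dist_norm)
      also have "\<dots> = (A1 * 2 powr e) * (norm h * ?w x)" by simp
      also have "\<dots> \<le> A * (norm h * (?w x + ?w (x + h)))"
        using A1 A2 by (intro mult_mono mult_left_mono) (auto simp: A_def)
      finally show ?thesis by simp
    next
      case False
      then have big: "1 + norm x < 2 * norm h" by (simp add: not_le field_simps)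
      have b: "\<bar>semigroup \<alpha> t u\<^sub>0 z\<bar> \<le> 3 * A2 * (norm h * ?w z)" if "1 + norm z \<le> 3 * norm h" for z
      proof -
        have "A2 * ((1 + norm z) * ?w z) \<le> A2 * ((3 * norm h) * ?w z)" using A2 that by (intro mult_left_mono mult_right_mono) auto
        then show ?thesis using A2(2)[OF t, of z] unfolding weight by (simp add: mult_ac)
      qed
      have "\<bar>semigroup \<alpha> t u\<^sub>0 x\<bar> \<le> 3 * A2 * (norm h * ?w x)" using big norm_ge_zero[of h] by (intro b) linarith
      moreover have "\<bar>semigroup \<alpha> t u\<^sub>0 (x + h)\<bar> \<le> 3 * A2 * (norm h * ?w (x + h))"
        using big norm_triangle_ineq[of x h] by (intro b) linarith
      moreover have "3 * A2 * (norm h * (?w x + ?w (x + h))) \<le> A * (norm h * (?w x + ?w (x + h)))"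
        using A1 by (intro mult_right_mono) (auto simp: A_def)
      ultimately show ?thesis by (simp only: distrib_left)
    qed
    then show "\<bar>semigroup \<alpha> t u\<^sub>0 (x + h) - semigroup \<alpha> t u\<^sub>0 x\<bar>
      \<le> A * (norm h * ((1 + norm x) powr (- (\<alpha> + CARD('n) + 1)) + (1 + norm (x + h)) powr (- (\<alpha> + CARD('n) + 1))))" unfolding e_def .
  qed
qed

end

section \<open>Function spaces and the Cauchy problem\<close>

text \<open>By continuity a violation at one point would persist on a ball, which has positive
  measure.\<close>

lemma AE_bound_imp_bound:
  fixes g :: "'a::euclidean_space \<Rightarrow> real"
  assumes c: "continuous_on UNIV g" and AE: "AE y in lborel. \<bar>g y\<bar> \<le> M"
  shows "\<bar>g x\<bar> \<le> M"
proof (rule ccontr)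
  let ?S = "{y. M < \<bar>g y\<bar>}"
  assume "\<not> \<bar>g x\<bar> \<le> M"
  then have x: "x \<in> ?S" by simp
  have "open ?S" by (intro open_Collect_less continuous_on_const continuous_on_rabs c)
  then obtain r where r: "0 < r" "ball x r \<subseteq> ?S" using x by (rule openE)
  have "AE y in lborel. y \<notin> ball x r" using AE
  proof eventually_elim
    case (elim y)
    then show ?case using r(2) by (meson leD mem_Collect_eq subsetD)
  qed
  then have "ball x r \<in> null_sets lborel" by (simp add: AE_iff_null_sets)
  then have "measure lborel (ball x r) = 0" unfolding measure_def by (simp only: null_setsD1 enn2real_0)
  then show False using content_ball_pos[OF r(1), of x] by simp
qed

lemma Lp_norm_1: "Lp_norm 1 g = (\<integral>\<^sup>+x. ennreal (norm (g x)) \<partial>lborel)"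
  by (auto simp: Lp_norm_def Let_def less_top enn2real_nonneg ennreal_enn2real)

lemma in_Lp_1_integrable:
  fixes g :: "'a::euclidean_space \<Rightarrow> real"
  shows "in_Lp 1 g \<longleftrightarrow> integrable lborel g"
  by (simp add: in_Lp_def Lp_norm_1 integrable_iff_bounded)

lemma Lp_norm_1_integrable:
  fixes g :: "'a::euclidean_space \<Rightarrow> real"
  shows "integrable lborel g \<Longrightarrow> Lp_norm 1 g = ennreal (\<integral>x. \<bar>g x\<bar> \<partial>lborel)"
  unfolding Lp_norm_1 by (subst nn_integral_eq_integral) auto

lemma Lp_norm_infinity: "Lp_norm \<infinity> g = esssup lborel (\<lambda>x. ennreal (norm (g x)))"
  by (simp add: Lp_norm_def)

lemma Linf_weighted_norm_AE:
  fixes g :: "'a::euclidean_space \<Rightarrow> 'b::real_normed_vector"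
  assumes "Linf_weighted_norm \<theta> g \<le> ennreal M" "0 \<le> M"
  shows "AE x in lborel. norm (g x) \<le> M * (1 + norm x) powr (- \<theta>)"
  using esssup_AE[of "\<lambda>x. ennreal (norm (g x) * (1 + norm x) powr \<theta>)" lborel]
proof eventually_elim
  case (elim x)
  then have "ennreal (norm (g x) * (1 + norm x) powr \<theta>) \<le> ennreal M"
    using assms(1) unfolding Linf_weighted_norm_def by (rule order_trans)
  then have "norm (g x) * (1 + norm x) powr \<theta> \<le> M" using assms(2) by simp
  then have "norm (g x) * (1 + norm x) powr \<theta> * (1 + norm x) powr (- \<theta>) \<le> M * (1 + norm x) powr (- \<theta>)"
    by (rule mult_right_mono) simp
  moreover have "0 < 1 + norm x" by (simp add: add_pos_nonneg)
  ultimately show ?case by (simp add: mult.assoc flip: powr_add)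
qed

lemma in_Linf_weighted_AE:
  fixes g :: "'a::euclidean_space \<Rightarrow> 'b::real_normed_vector"
  assumes "in_Linf_weighted \<theta> g"
  obtains M where "0 \<le> M" "AE x in lborel. norm (g x) \<le> M * (1 + norm x) powr (- \<theta>)"
proof (rule that)
  show "0 \<le> enn2real (Linf_weighted_norm \<theta> g)" by simp
  show "AE x in lborel. norm (g x) \<le> enn2real (Linf_weighted_norm \<theta> g) * (1 + norm x) powr (- \<theta>)"
    by (rule Linf_weighted_norm_AE) (use assms in \<open>auto simp: in_Linf_weighted_def\<close>)
qed

lemma is_weak_gradient_weak_grad: "weakly_differentiable g \<Longrightarrow> is_weak_gradient g (weak_grad g)"
  using someI_ex[of "is_weak_gradient g"] unfolding weakly_differentiable_def weak_grad_def by blast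

lemma far_field_bigoI:
  "0 < K \<Longrightarrow> (\<And>x t. 1 \<le> norm x \<Longrightarrow> t \<in> I \<Longrightarrow> 0 < t \<Longrightarrow> \<bar>r x t\<bar> \<le> K * g x t) \<Longrightarrow> far_field_bigo I r g"
  unfolding far_field_bigo_def by (rule exI[of _ K], rule conjI, assumption, rule exI[of _ 1]) simp

text \<open>The datum decays at the rate \<alpha>+d > d and so lies in L^1 and L^\<infinity>;
  nonexpansion of these two norms gives the bound M for all times. Continuity of u(t) makes the
  essential bound pointwise.\<close>

lemma (in stable_kernel) duhamel_solution_exists:
  fixes f :: "real \<Rightarrow> real^'n"
  assumes q: "1 < q" and flux: "admissible_flux q f" and init: "in_Linf_weighted (\<alpha> + CARD('n)) u\<^sub>0"
    and sol: "cauchy_solution \<alpha> f u\<^sub>0 u" and st: "standing_properties \<alpha> f u\<^sub>0 u"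
  shows "\<exists>Cf M M0. duhamel_solution \<alpha> C D q Cf M M0 f u\<^sub>0 u"
proof -
  let ?a = "\<alpha> + CARD('n)"
  obtain Cf where Cf: "0 < Cf" "\<And>a. norm (f a) \<le> Cf * \<bar>a\<bar> powr q"
    "\<And>a b. norm (f a - f b) \<le> Cf * \<bar>a - b\<bar> * (\<bar>a\<bar> powr (q - 1) + \<bar>b\<bar> powr (q - 1))"
    using flux unfolding admissible_flux_def by blast
  have fc: "continuous_on UNIV f" using flux unfolding admissible_flux_def by (blast intro: C1_differentiable_imp_continuous_on)
  have um: "u\<^sub>0 \<in> borel_measurable borel" using init by (simp add: in_Linf_weighted_def)
  obtain M0 where M0: "0 \<le> M0" "AE y in lborel. norm (u\<^sub>0 y) \<le> M0 * (1 + norm y) powr (- ?a)"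
    by (rule in_Linf_weighted_AE[OF init]) (rule that)
  have wi: "integrable lborel (\<lambda>y::real^'n. M0 * (1 + norm y) powr (- ?a))"
    by (intro integrable_mult_right integrable_weight) (use \<alpha> in simp)
  have i0: "integrable lborel u\<^sub>0"
    by (rule Bochner_Integration.integrable_bound[OF wi]) (use um M0 in auto)
  have "AE y in lborel. ennreal (norm (u\<^sub>0 y)) \<le> ennreal M0"
    using M0(2)
  proof eventually_elim
    case (elim y)
    have "(1 + norm y) powr (- ?a) \<le> 1" using powr_mono2'[of "- ?a" 1 "1 + norm y"] \<alpha> by simp
    then have "M0 * (1 + norm y) powr (- ?a) \<le> M0 * 1" by (intro mult_left_mono M0(1))
    then show ?case using elim by (intro ennreal_leI) linarith
  qed
  then have inf0: "Lp_norm \<infinity> u\<^sub>0 \<le> ennreal M0" unfolding Lp_norm_infinity using um by (intro esssup_I) auto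
  then have "in_Lp \<infinity> u\<^sub>0" unfolding in_Lp_def using um le_less_trans[OF inf0 ennreal_less_top] by simp
  moreover have "in_Lp 1 u\<^sub>0" unfolding in_Lp_1_integrable by (rule i0)
  ultimately have L0: "in_Lp \<infinity> u\<^sub>0" "in_Lp 1 u\<^sub>0" by simp_all
  define J where "J = (\<integral>y. \<bar>u\<^sub>0 y\<bar> \<partial>lborel)"
  have J: "0 \<le> J" unfolding J_def by (rule Bochner_Integration.integral_nonneg) simp
  define M where "M = M0 + J + 1"
  have M: "0 < M" "M0 \<le> M" "J \<le> M" using M0 J by (auto simp: M_def)
  have uc: "continuous_on UNIV (u t)" if "0 < t" for t using st that unfolding standing_properties_def by blast
  have nonexp: "Lp_norm p (u t) \<le> Lp_norm p u\<^sub>0" if "1 \<le> p" "in_Lp p u\<^sub>0" "0 < t" for p t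
    using st that unfolding standing_properties_def by blast
  have ui: "integrable lborel (u t)" if "0 \<le> t" for t using sol that unfolding cauchy_solution_def in_Lp_1_integrable by blast
  have ub: "\<bar>u t x\<bar> \<le> M" if t: "0 < t" for t x
  proof (rule AE_bound_imp_bound[OF uc[OF t]])
    have "Lp_norm \<infinity> (u t) \<le> ennreal M0" using nonexp[OF _ L0(1) t] inf0 by (auto intro: order_trans)
    then have le: "esssup lborel (\<lambda>x. ennreal (norm (u t x))) \<le> ennreal M0" unfolding Lp_norm_infinity .
    show "AE y in lborel. \<bar>u t y\<bar> \<le> M"
      using esssup_AE[of "\<lambda>x. ennreal (norm (u t x))" lborel]
    proof eventually_elim
      case (elim y)
      then have "ennreal (norm (u t y)) \<le> ennreal M0" using le by (rule order_trans)
      then show ?case using M0(1) M(2) by simp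
    qed
  qed
  have u1: "(\<integral>x. \<bar>u t x\<bar> \<partial>lborel) \<le> M" if t: "0 < t" for t
  proof -
    have "ennreal (\<integral>x. \<bar>u t x\<bar> \<partial>lborel) \<le> ennreal J"
      using nonexp[OF _ L0(2) t] ui[of t] i0 t by (simp add: Lp_norm_1_integrable J_def)
    then show ?thesis using J M(3) by simp
  qed
  have ut: "(\<lambda>k. \<integral>y. \<bar>u (r k) y - u s y\<bar> \<partial>lborel) \<longlonglongrightarrow> 0" if r: "\<And>k::nat. 0 < r k" and s: "0 < s" and lim: "r \<longlonglongrightarrow> s" for r s
  proof (rule tendsto_ennrealD)
    let ?F = "\<lambda>r. Lp_norm 1 (\<lambda>x. u r x - u s x)"
    have "(?F \<longlongrightarrow> 0) (at s within {0..})"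
      using sol s unfolding cauchy_solution_def continuous_in_time_def by auto
    moreover have "?F s = 0" by (simp add: Lp_norm_1)
    ultimately have "continuous (at s within {0..}) ?F" unfolding continuous_within by simp
    from continuous_within_tendsto_compose'[OF this _ lim] have "(\<lambda>k. ?F (r k)) \<longlonglongrightarrow> ?F s" using r by (auto intro: less_imp_le)
    moreover have "?F (r k) = ennreal (\<integral>y. \<bar>u (r k) y - u s y\<bar> \<partial>lborel)" for k
      by (rule Lp_norm_1_integrable) (intro Bochner_Integration.integrable_diff ui less_imp_le r s)
    ultimately show "(\<lambda>k. ennreal (\<integral>y. \<bar>u (r k) y - u s y\<bar> \<partial>lborel)) \<longlonglongrightarrow> ennreal 0" using \<open>?F s = 0\<close> by simp
    show "\<forall>\<^sub>F k in sequentially. 0 \<le> (\<integral>y. \<bar>u (r k) y - u s y\<bar> \<partial>lborel)"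
      by (intro always_eventually allI Bochner_Integration.integral_nonneg) simp
  qed simp
  have "duhamel_solution \<alpha> C D q Cf M M0 f u\<^sub>0 u"
  proof (intro duhamel_solution.intro duhamel_solution_axioms.intro stable_kernel_axioms)
    show "1 < q" "0 < Cf" "0 < M" "0 \<le> M0" "u\<^sub>0 \<in> borel_measurable borel" "continuous_on UNIV f" using q Cf M M0 um fc by simp_all
    show "norm (f a) \<le> Cf * \<bar>a\<bar> powr q" "norm (f a - f b) \<le> Cf * \<bar>a - b\<bar> * (\<bar>a\<bar> powr (q - 1) + \<bar>b\<bar> powr (q - 1))" for a b by (rule Cf)+
    show "AE y in lborel. \<bar>u\<^sub>0 y\<bar> \<le> M0 * (1 + norm y) powr (- ?a)" using M0(2) by simp
    show "\<bar>u t x\<bar> \<le> M" "integrable lborel (u t)" "(\<integral>x. \<bar>u t x\<bar> \<partial>lborel) \<le> M"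
      "u t x = semigroup \<alpha> t u\<^sub>0 x - (LINT s:{0..t}|lborel. grad_semigroup \<alpha> (t - s) (\<lambda>y. f (u s y)) x)" if "0 < t" for t x
      using ub[OF that] ui[of t] u1[OF that] st that unfolding standing_properties_def by simp_all
    show "(\<lambda>k. \<integral>y. \<bar>u (r k) y - u s y\<bar> \<partial>lborel) \<longlonglongrightarrow> 0" if "\<And>k::nat. 0 < r k" "0 < s" "r \<longlonglongrightarrow> s" for r s
      by (rule ut[OF that])
  qed
  then show ?thesis by blast
qed

section \<open>The remainder on bounded and unbounded time intervals\<close>

context duhamel_solution
begin

lemma remainder_bounded_time:
  assumes T: "0 < T"
  shows "far_field_bigo {0..T} (remainder \<alpha> f u\<^sub>0 u)
    (\<lambda>x t. max (norm x powr (- (q * (\<alpha> + CARD('n))))) (norm x powr (- (\<alpha> + CARD('n) + 2))))"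
proof -
  obtain M1 where M1: "0 < M1" "\<And>t x. 0 < t \<Longrightarrow> t \<le> T \<Longrightarrow> \<bar>u t x\<bar> \<le> M1 * (1 + norm x) powr (- (\<alpha> + CARD('n)))"
    by (rule solution_weight_bound[OF T]) (rule that)
  have M10: "0 \<le> M1" using M1(1) by simp
  define g where "g x = max (norm x powr (- (q * (\<alpha> + CARD('n))))) (norm x powr (- (\<alpha> + CARD('n) + 2)))" for x :: "real^'n"
  have g0: "0 \<le> g x" for x by (simp add: g_def le_max_iff_disj)
  show ?thesis
  proof (rule remainder_far_field[OF M10], unfold g_def[symmetric])
    fix K assume K: "0 < K" "\<And>t x. 0 < t \<Longrightarrow> 1 \<le> norm x \<Longrightarrow>
      (\<And>s y. 0 < s \<Longrightarrow> s < t \<Longrightarrow> \<bar>u s y\<bar> \<le> M1 * (1 + s) * (1 + norm y) powr (- (\<alpha> + CARD('n)))) \<Longrightarrow>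
      \<bar>remainder \<alpha> f u\<^sub>0 u x t\<bar> \<le> K * (1 + t) ^ 3 * g x"
    show "far_field_bigo {0..T} (remainder \<alpha> f u\<^sub>0 u) (\<lambda>x t. g x)"
    proof (rule far_field_bigoI[of "K * (1 + T) ^ 3"], goal_cases)
      case (2 x t)
      then have t: "0 < t" "t \<le> T" and x: "1 \<le> norm x" by auto
      have "\<bar>remainder \<alpha> f u\<^sub>0 u x t\<bar> \<le> K * (1 + t) ^ 3 * g x"
      proof (rule K(2)[OF t(1) x])
        fix s :: real and y :: "real^'n" assume s: "0 < s" "s < t"
        have "M1 * 1 * (1 + norm y) powr (- (\<alpha> + CARD('n))) \<le> M1 * (1 + s) * (1 + norm y) powr (- (\<alpha> + CARD('n)))"
          using M1(1) s by (intro mult_right_mono mult_left_mono) auto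
        then show "\<bar>u s y\<bar> \<le> M1 * (1 + s) * (1 + norm y) powr (- (\<alpha> + CARD('n)))" using M1(2)[of s y] s t by simp
      qed
      also have "\<dots> \<le> K * (1 + T) ^ 3 * g x" using K(1) t g0 by (intro mult_right_mono mult_left_mono power_mono) auto
      finally show ?case .
    qed (use K T in auto)
  qed
qed

text \<open>For |x-y| \<le> |x|/2 both weights in the difference bound are of order
  |x|^-(\<alpha>+d+1), the one at y with the factor 2^(\<alpha>+d+1). The gradient hypothesis is
  thus used on the datum alone and reaches later times through the Volterra estimate.\<close>

lemma remainder_bounded_time_gradient:
  assumes T: "0 < T" and w: "weakly_differentiable u\<^sub>0" and G: "in_Linf_weighted (\<alpha> + CARD('n) + 1) (weak_grad u\<^sub>0)"
  shows "far_field_bigo {0..T} (remainder \<alpha> f u\<^sub>0 u)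
    (\<lambda>x t. max (norm x powr (- (q * (\<alpha> + CARD('n))) - 1)) (norm x powr (- (\<alpha> + CARD('n) + 2))))"
proof -
  let ?e = "\<alpha> + CARD('n) + 1"
  obtain M1 where M1: "0 < M1" "\<And>t x. 0 < t \<Longrightarrow> t \<le> T \<Longrightarrow> \<bar>u t x\<bar> \<le> M1 * (1 + norm x) powr (- (\<alpha> + CARD('n)))"
    by (rule solution_weight_bound[OF T]) (rule that)
  obtain M2 where M2: "0 \<le> M2" "AE y in lborel. norm (weak_grad u\<^sub>0 y) \<le> M2 * (1 + norm y) powr (- ?e)"
    by (rule in_Linf_weighted_AE[OF G]) (rule that)
  obtain A where A: "0 < A" "\<And>t x h. 0 < t \<Longrightarrow> t \<le> T \<Longrightarrow> \<bar>semigroup \<alpha> t u\<^sub>0 (x + h) - semigroup \<alpha> t u\<^sub>0 x\<bar>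
      \<le> A * (norm h * ((1 + norm x) powr (- ?e) + (1 + norm (x + h)) powr (- ?e)))"
    by (rule semigroup_difference_bound[OF T is_weak_gradient_weak_grad[OF w] M2]) (rule that)
  obtain L where L: "0 < L" "\<And>t x h. 0 < t \<Longrightarrow> t \<le> T \<Longrightarrow> \<bar>u t (x + h) - u t x\<bar>
      \<le> L * (norm h * ((1 + norm x) powr (- ?e) + (1 + norm (x + h)) powr (- ?e)))"
    by (rule solution_difference_bound[OF T less_imp_le[OF A(1)]]) (rule A(2), assumption, assumption, rule that)
  define M3 where "M3 = max M1 (L * (1 + 2 powr ?e))"
  have M3: "0 \<le> M3" using M1(1) by (simp add: M3_def le_max_iff_disj)
  define g where "g x = max (norm x powr (- (q * (\<alpha> + CARD('n))) - 1)) (norm x powr (- (\<alpha> + CARD('n) + 2)))" for x :: "real^'n"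
  have g0: "0 \<le> g x" for x by (simp add: g_def le_max_iff_disj)
  show ?thesis
  proof (rule remainder_far_field_lipschitz[OF M3], unfold g_def[symmetric])
    fix K assume K: "0 < K" "\<And>t x. 0 < t \<Longrightarrow> 1 \<le> norm x \<Longrightarrow>
      (\<And>s y. 0 < s \<Longrightarrow> s < t \<Longrightarrow> \<bar>u s y\<bar> \<le> M3 * (1 + s) * (1 + norm y) powr (- (\<alpha> + CARD('n)))) \<Longrightarrow>
      (\<And>s y. 0 < s \<Longrightarrow> s < t \<Longrightarrow> norm (x - y) \<le> norm x / 2 \<Longrightarrow> \<bar>u s y - u s x\<bar> \<le> M3 * (1 + s) * norm (x - y) * norm x powr (- (\<alpha> + CARD('n) + 1))) \<Longrightarrow>
      \<bar>remainder \<alpha> f u\<^sub>0 u x t\<bar> \<le> K * (1 + t) ^ 3 * g x"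
    show "far_field_bigo {0..T} (remainder \<alpha> f u\<^sub>0 u) (\<lambda>x t. g x)"
    proof (rule far_field_bigoI[of "K * (1 + T) ^ 3"], goal_cases)
      case (2 x t)
      then have t: "0 < t" "t \<le> T" and x: "1 \<le> norm x" by auto
      have "\<bar>remainder \<alpha> f u\<^sub>0 u x t\<bar> \<le> K * (1 + t) ^ 3 * g x"
      proof (rule K(2)[OF t(1) x])
        fix s :: real and y :: "real^'n" assume s: "0 < s" "s < t"
        have M13: "M1 * 1 \<le> M3 * (1 + s)" using M1(1) s by (intro mult_mono) (auto simp: M3_def)
        have "M1 * 1 * (1 + norm y) powr (- (\<alpha> + CARD('n))) \<le> M3 * (1 + s) * (1 + norm y) powr (- (\<alpha> + CARD('n)))"
          by (intro mult_right_mono M13) simp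
        then show "\<bar>u s y\<bar> \<le> M3 * (1 + s) * (1 + norm y) powr (- (\<alpha> + CARD('n)))" using M1(2)[of s y] s t by simp
        assume y: "norm (x - y) \<le> norm x / 2"
        have y2: "norm x / 2 \<le> norm y" using norm_triangle_ineq2[of x y] y by linarith
        have wx: "(1 + norm x) powr (- ?e) \<le> 1 * norm x powr (- ?e)" using x \<alpha> by (simp, intro powr_mono2') auto
        have wy: "(1 + norm y) powr (- ?e) \<le> 2 powr ?e * norm x powr (- ?e)" using \<alpha> by (intro far_weight_half y2 x) simp
        have "\<bar>u s y - u s x\<bar> \<le> L * (norm (x - y) * ((1 + norm x) powr (- ?e) + (1 + norm y) powr (- ?e)))"
          using L(2)[of s x "y - x"] s t by (simp add: norm_minus_commute)
        also have "\<dots> \<le> L * (norm (x - y) * ((1 + 2 powr ?e) * norm x powr (- ?e)))"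
          using L(1) wx wy by (intro mult_left_mono) (auto simp: distrib_right)
        also have "\<dots> = (L * (1 + 2 powr ?e)) * 1 * (norm (x - y) * norm x powr (- ?e))" by (simp only: mult_ac mult_1_right mult_1_left)
        also have "\<dots> \<le> M3 * (1 + s) * (norm (x - y) * norm x powr (- ?e))"
          using s M3 by (intro mult_right_mono mult_mono) (auto simp: M3_def)
        finally show "\<bar>u s y - u s x\<bar> \<le> M3 * (1 + s) * norm (x - y) * norm x powr (- ?e)" by (simp only: mult.assoc)
      qed
      also have "\<dots> \<le> K * (1 + T) ^ 3 * g x" using K(1) t g0 by (intro mult_right_mono mult_left_mono power_mono) auto
      finally show ?case .
    qed (use K T in auto)
  qed
qed

text \<open>The kernel at time 1+s is at most C (1+s) |y|^-(\<alpha>+d) and also at most C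
  (1+s)^(-d/\<alpha>) \<le> C (1+s). This linear growth is the reason for the factor 1+s in the
  hypotheses of the far-field theorems.\<close>

lemma solution_bound_of_kernel_bound:
  assumes C': "0 < C'" and b: "\<And>t x. 0 < t \<Longrightarrow> \<bar>u t x\<bar> \<le> C' * p_kernel \<alpha> x (1 + t)" and s: "0 < s"
  shows "\<bar>u s y\<bar> \<le> C' * C * 2 powr (\<alpha> + CARD('n)) * (1 + s) * (1 + norm y) powr (- (\<alpha> + CARD('n)))"
proof -
  have s1: "0 < 1 + s" using s by simp
  have le: "\<bar>u s y\<bar> \<le> C' * \<bar>p_kernel \<alpha> y (1 + s)\<bar>"
    using b[OF s, of y] mult_left_mono[OF abs_ge_self, of C' "p_kernel \<alpha> y (1 + s)"] C' by linarith
  have "\<bar>u s y\<bar> \<le> C' * C * (1 + s) * 2 powr (\<alpha> + CARD('n)) * (1 + norm y) powr (- (\<alpha> + CARD('n)))"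
  proof (rule decay_imp_weight_bound[where f="\<lambda>y. \<bar>u s y\<bar>"])
    have "(1 + s) powr (- (CARD('n) / \<alpha>)) \<le> 1 + s"
    proof -
      have "(1 + s) powr (- (CARD('n) / \<alpha>)) \<le> (1 + s) powr 1" using s \<alpha> by (intro powr_mono) (auto intro: order_trans[of _ 0])
      then show ?thesis using s by simp
    qed
    then have "C * (1 + s) powr (- (CARD('n) / \<alpha>)) \<le> C * (1 + s)" using C by (intro mult_left_mono) auto
    then have "\<bar>p_kernel \<alpha> y (1 + s)\<bar> \<le> C * (1 + s)" using kernel_bound[OF s1, of y] by linarith
    then have "C' * \<bar>p_kernel \<alpha> y (1 + s)\<bar> \<le> C' * (C * (1 + s))" using C' by (intro mult_left_mono) auto
    then show "\<bar>u s y\<bar> \<le> C' * C * (1 + s)" using le by (simp only: mult.assoc)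
    assume "y \<noteq> 0"
    then have "C' * \<bar>p_kernel \<alpha> y (1 + s)\<bar> \<le> C' * (C * (1 + s) * norm y powr (- (\<alpha> + CARD('n))))"
      using C' by (intro mult_left_mono kernel_decay[OF s1]) auto
    then show "\<bar>u s y\<bar> \<le> C' * C * (1 + s) * norm y powr (- (\<alpha> + CARD('n)))" using le by (simp only: mult.assoc)
  qed (use C C' s \<alpha> in auto)
  then show ?thesis by (simp only: mult_ac)
qed

lemma remainder_global:
  assumes C': "0 < C'" and b: "\<And>t x. 0 < t \<Longrightarrow> \<bar>u t x\<bar> \<le> C' * p_kernel \<alpha> x (1 + t)"
  shows "far_field_bigo {0..} (remainder \<alpha> f u\<^sub>0 u)
    (\<lambda>x t. (1 + t) powr 3 * max (norm x powr (- (q * (\<alpha> + CARD('n))))) (norm x powr (- (\<alpha> + CARD('n) + 2))))"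
proof -
  define M1 where "M1 = C' * C * 2 powr (\<alpha> + CARD('n))"
  have M1: "0 \<le> M1" using C C' by (simp add: M1_def)
  define g where "g x = max (norm x powr (- (q * (\<alpha> + CARD('n))))) (norm x powr (- (\<alpha> + CARD('n) + 2)))" for x :: "real^'n"
  show ?thesis
  proof (rule remainder_far_field[OF M1], unfold g_def[symmetric])
    fix K assume K: "0 < K" "\<And>t x. 0 < t \<Longrightarrow> 1 \<le> norm x \<Longrightarrow>
      (\<And>s y. 0 < s \<Longrightarrow> s < t \<Longrightarrow> \<bar>u s y\<bar> \<le> M1 * (1 + s) * (1 + norm y) powr (- (\<alpha> + CARD('n)))) \<Longrightarrow>
      \<bar>remainder \<alpha> f u\<^sub>0 u x t\<bar> \<le> K * (1 + t) ^ 3 * g x"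
    show "far_field_bigo {0..} (remainder \<alpha> f u\<^sub>0 u) (\<lambda>x t. (1 + t) powr 3 * g x)"
    proof (rule far_field_bigoI[of K], goal_cases)
      case (2 x t)
      then have "\<bar>remainder \<alpha> f u\<^sub>0 u x t\<bar> \<le> K * (1 + t) ^ 3 * g x"
        unfolding M1_def by (intro K(2)[unfolded M1_def] solution_bound_of_kernel_bound[OF C' b])
      then show ?case using 2 by (simp add: powr_numeral mult.assoc)
    qed (use K in auto)
  qed
qed

lemma remainder_global_gradient:
  assumes C': "0 < C'" and b: "\<And>t x. 0 < t \<Longrightarrow> \<bar>u t x\<bar> \<le> C' * p_kernel \<alpha> x (1 + t)"
    and uc: "\<And>t. 0 < t \<Longrightarrow> continuous_on UNIV (u t)" and uw: "\<And>t. 0 < t \<Longrightarrow> weakly_differentiable (u t)"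
    and C'': "0 < C''" and G: "\<And>t. 0 < t \<Longrightarrow> Linf_weighted_norm (\<alpha> + CARD('n) + 1) (weak_grad (u t)) \<le> ennreal (C'' * (1 + t))"
  shows "far_field_bigo {0..} (remainder \<alpha> f u\<^sub>0 u)
    (\<lambda>x t. (1 + t) powr 3 * max (norm x powr (- (q * (\<alpha> + CARD('n))) - 1)) (norm x powr (- (\<alpha> + CARD('n) + 2))))"
proof -
  let ?e = "\<alpha> + CARD('n) + 1"
  define M1 where "M1 = C' * C * 2 powr (\<alpha> + CARD('n)) + C'' * 4 powr ?e"
  have M1: "C' * C * 2 powr (\<alpha> + CARD('n)) \<le> M1" "C'' * 4 powr ?e \<le> M1" "0 \<le> M1" using C C' C'' by (simp_all add: M1_def)
  define g where "g x = max (norm x powr (- (q * (\<alpha> + CARD('n))) - 1)) (norm x powr (- (\<alpha> + CARD('n) + 2)))" for x :: "real^'n"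
  have ub: "\<bar>u s y\<bar> \<le> C' * C * 2 powr (\<alpha> + CARD('n)) * (1 + s) * (1 + norm y) powr (- (\<alpha> + CARD('n)))" if "0 < s" for s y
    by (rule solution_bound_of_kernel_bound[OF C' b that])
  have lip: "\<bar>u s y - u s x\<bar> \<le> M1 * (1 + s) * norm (x - y) * norm x powr (- ?e)"
    if s: "0 < s" and x: "1 \<le> norm x" and y: "norm (x - y) \<le> norm x / 2" for s x y
  proof -
    have Cs: "0 \<le> C'' * (1 + s)" using C'' s by simp
    have quarter: "(norm x / 4) powr (- e) = 4 powr e * norm x powr (- e)" for e by (simp add: powr_divide powr_minus_divide)
    have "\<bar>u s y - u s x\<bar> \<le> C'' * (1 + s) * (4 powr ?e * norm x powr (- ?e)) * dist y x"
    proof (rule weak_gradient_lipschitz[OF is_weak_gradient_weak_grad[OF uw[OF s]] u_int(1)[OF s] uc[OF s]])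
      show "0 \<le> C'' * (1 + s) * (4 powr ?e * norm x powr (- ?e))" using Cs by simp
      \<comment> \<open>The Lipschitz lemma wants a strict inequality, so the ball is enlarged from
        |x|/2 to 3|x|/4; its points still satisfy |z| > |x|/4, which explains the factor 4 to the
        power \<alpha>+d+1.\<close>
      show "dist y x < 3 * norm x / 4" using y x by (simp add: dist_norm norm_minus_commute)
      show "AE z in lborel. dist z x < 3 * norm x / 4 \<longrightarrow> norm (weak_grad (u s) z) \<le> C'' * (1 + s) * (4 powr ?e * norm x powr (- ?e))"
        using Linf_weighted_norm_AE[OF G[OF s] Cs]
      proof eventually_elim
        case (elim z)
        show ?case
        proof
          assume "dist z x < 3 * norm x / 4"
          then have "norm x / 4 \<le> norm z" using norm_triangle_ineq2[of x z] by (simp add: dist_norm norm_minus_commute)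
          then have "(1 + norm z) powr (- ?e) \<le> (norm x / 4) powr (- ?e)" using x \<alpha> by (intro powr_mono2') auto
          also have "\<dots> = 4 powr ?e * norm x powr (- ?e)" by (rule quarter)
          finally have "C'' * (1 + s) * (1 + norm z) powr (- ?e) \<le> C'' * (1 + s) * (4 powr ?e * norm x powr (- ?e))"
            by (rule mult_left_mono[OF _ Cs])
          then show "norm (weak_grad (u s) z) \<le> C'' * (1 + s) * (4 powr ?e * norm x powr (- ?e))" using elim by linarith
        qed
      qed
    qed
    also have "\<dots> = (C'' * 4 powr ?e) * ((1 + s) * norm (x - y) * norm x powr (- ?e))"
      by (simp only: dist_norm norm_minus_commute[of y x] mult_ac)
    also have "\<dots> \<le> M1 * ((1 + s) * norm (x - y) * norm x powr (- ?e))" using s by (intro mult_right_mono M1(2)) auto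
    finally show ?thesis by (simp only: mult.assoc)
  qed
  show ?thesis
  proof (rule remainder_far_field_lipschitz[OF M1(3)], unfold g_def[symmetric])
    fix K assume K: "0 < K" "\<And>t x. 0 < t \<Longrightarrow> 1 \<le> norm x \<Longrightarrow>
      (\<And>s y. 0 < s \<Longrightarrow> s < t \<Longrightarrow> \<bar>u s y\<bar> \<le> M1 * (1 + s) * (1 + norm y) powr (- (\<alpha> + CARD('n)))) \<Longrightarrow>
      (\<And>s y. 0 < s \<Longrightarrow> s < t \<Longrightarrow> norm (x - y) \<le> norm x / 2 \<Longrightarrow> \<bar>u s y - u s x\<bar> \<le> M1 * (1 + s) * norm (x - y) * norm x powr (- (\<alpha> + CARD('n) + 1))) \<Longrightarrow>
      \<bar>remainder \<alpha> f u\<^sub>0 u x t\<bar> \<le> K * (1 + t) ^ 3 * g x"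
    show "far_field_bigo {0..} (remainder \<alpha> f u\<^sub>0 u) (\<lambda>x t. (1 + t) powr 3 * g x)"
    proof (rule far_field_bigoI[of K], goal_cases)
      case (2 x t)
      then have t: "0 < t" and x: "1 \<le> norm x" by auto
      have "\<bar>remainder \<alpha> f u\<^sub>0 u x t\<bar> \<le> K * (1 + t) ^ 3 * g x"
      proof (rule K(2)[OF t x])
        fix s :: real and y :: "real^'n" assume s: "0 < s" "s < t"
        have "C' * C * 2 powr (\<alpha> + CARD('n)) * ((1 + s) * (1 + norm y) powr (- (\<alpha> + CARD('n)))) \<le> M1 * ((1 + s) * (1 + norm y) powr (- (\<alpha> + CARD('n))))"
          using s by (intro mult_right_mono M1(1)) auto
        then show "\<bar>u s y\<bar> \<le> M1 * (1 + s) * (1 + norm y) powr (- (\<alpha> + CARD('n)))"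
          using ub[OF s(1), of y] by (simp only: mult.assoc)
        show "\<bar>u s y - u s x\<bar> \<le> M1 * (1 + s) * norm (x - y) * norm x powr (- ?e)" if "norm (x - y) \<le> norm x / 2"
          by (rule lip[OF s(1) x that])
      qed
      then show ?case using t by (simp add: powr_numeral mult.assoc)
    qed (use K in auto)
  qed
qed

end

theorem theorem2p1:
  fixes \<alpha> q d :: real
  assumes "1 < \<alpha>" and "\<alpha> < 2" and "1 < q" and "d = real CARD('n::finite)"
  shows "\<exists>N\<le>3. \<exists>N'\<le>3. \<forall>(f :: real \<Rightarrow> real^'n) u\<^sub>0 u.
    admissible_flux q f \<and> in_Linf_weighted (\<alpha> + d) u\<^sub>0 \<and>
    cauchy_solution \<alpha> f u\<^sub>0 u \<and> standing_properties \<alpha> f u\<^sub>0 u \<longrightarrow>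
      (\<forall>T>0. far_field_bigo {0..T} (remainder \<alpha> f u\<^sub>0 u)
         (\<lambda>x t. max (norm x powr (- (q * (\<alpha> + d)))) (norm x powr (- (\<alpha> + d + 2))))) \<and>
      (weakly_differentiable u\<^sub>0 \<and> in_Linf_weighted (\<alpha> + d + 1) (weak_grad u\<^sub>0) \<longrightarrow>
        (\<forall>T>0. far_field_bigo {0..T} (remainder \<alpha> f u\<^sub>0 u)
           (\<lambda>x t. max (norm x powr (- (q * (\<alpha> + d)) - 1)) (norm x powr (- (\<alpha> + d + 2)))))) \<and>
      ((\<exists>C>0. \<forall>x. \<forall>t>0. \<bar>u t x\<bar> \<le> C * p_kernel \<alpha> x (1 + t)) \<longrightarrow>
        far_field_bigo {0..} (remainder \<alpha> f u\<^sub>0 u)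
          (\<lambda>x t. (1 + t) powr N *
             max (norm x powr (- (q * (\<alpha> + d)))) (norm x powr (- (\<alpha> + d + 2)))) \<and>
        ((\<exists>C>0. \<forall>t>0. Linf_weighted_norm (\<alpha> + d + 1) (weak_grad (u t))
              \<le> ennreal (C * (1 + t))) \<longrightarrow>
          far_field_bigo {0..} (remainder \<alpha> f u\<^sub>0 u)
            (\<lambda>x t. (1 + t) powr N' *
               max (norm x powr (- (q * (\<alpha> + d)) - 1)) (norm x powr (- (\<alpha> + d + 2))))))"
proof -
  obtain C and D :: "real \<Rightarrow> real^'n \<Rightarrow> real^'n" where "stable_kernel \<alpha> C D"
    using stable_kernel_exists[OF assms(1,2)] by blast
  then interpret stable_kernel \<alpha> C D .
  show ?thesis
    unfolding assms(4)
  \<comment> \<open>Both exponents are 3, whatever \<alpha>, q and d; lowering q in the two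
    far-field theorems is what makes this possible.\<close>
  proof (rule exI[of _ 3], rule conjI, simp, rule exI[of _ 3], rule conjI, simp, intro allI impI, elim conjE)
    fix f :: "real \<Rightarrow> real^'n" and u\<^sub>0 u
    assume h: "admissible_flux q f" "in_Linf_weighted (\<alpha> + CARD('n)) u\<^sub>0" "cauchy_solution \<alpha> f u\<^sub>0 u" "standing_properties \<alpha> f u\<^sub>0 u"
    obtain Cf M M0 where "duhamel_solution \<alpha> C D q Cf M M0 f u\<^sub>0 u" using duhamel_solution_exists[OF assms(3) h] by blast
    then interpret duhamel_solution \<alpha> C D q Cf M M0 f u\<^sub>0 u .
    have uc: "continuous_on UNIV (u t)" and uw: "weakly_differentiable (u t)" if "0 < t" for t
      using h(4) that unfolding standing_properties_def in_W1p_def by (blast intro: order_refl)+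
    show "(\<forall>T>0. far_field_bigo {0..T} (remainder \<alpha> f u\<^sub>0 u)
         (\<lambda>x t. max (norm x powr (- (q * (\<alpha> + CARD('n))))) (norm x powr (- (\<alpha> + CARD('n) + 2))))) \<and>
      (weakly_differentiable u\<^sub>0 \<and> in_Linf_weighted (\<alpha> + CARD('n) + 1) (weak_grad u\<^sub>0) \<longrightarrow>
        (\<forall>T>0. far_field_bigo {0..T} (remainder \<alpha> f u\<^sub>0 u)
           (\<lambda>x t. max (norm x powr (- (q * (\<alpha> + CARD('n))) - 1)) (norm x powr (- (\<alpha> + CARD('n) + 2)))))) \<and>
      ((\<exists>C>0. \<forall>x. \<forall>t>0. \<bar>u t x\<bar> \<le> C * p_kernel \<alpha> x (1 + t)) \<longrightarrow>
        far_field_bigo {0..} (remainder \<alpha> f u\<^sub>0 u)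
          (\<lambda>x t. (1 + t) powr 3 *
             max (norm x powr (- (q * (\<alpha> + CARD('n))))) (norm x powr (- (\<alpha> + CARD('n) + 2)))) \<and>
        ((\<exists>C>0. \<forall>t>0. Linf_weighted_norm (\<alpha> + CARD('n) + 1) (weak_grad (u t))
              \<le> ennreal (C * (1 + t))) \<longrightarrow>
          far_field_bigo {0..} (remainder \<alpha> f u\<^sub>0 u)
            (\<lambda>x t. (1 + t) powr 3 *
               max (norm x powr (- (q * (\<alpha> + CARD('n))) - 1)) (norm x powr (- (\<alpha> + CARD('n) + 2))))))"
    proof (intro conjI allI impI; (elim conjE exE)?)
      show "far_field_bigo {0..T} (remainder \<alpha> f u\<^sub>0 u)
         (\<lambda>x t. max (norm x powr (- (q * (\<alpha> + CARD('n))))) (norm x powr (- (\<alpha> + CARD('n) + 2))))" if "0 < T" for T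
        by (rule remainder_bounded_time[OF that])
      show "far_field_bigo {0..T} (remainder \<alpha> f u\<^sub>0 u)
           (\<lambda>x t. max (norm x powr (- (q * (\<alpha> + CARD('n))) - 1)) (norm x powr (- (\<alpha> + CARD('n) + 2))))"
        if "0 < T" "weakly_differentiable u\<^sub>0" "in_Linf_weighted (\<alpha> + CARD('n) + 1) (weak_grad u\<^sub>0)" for T
        by (rule remainder_bounded_time_gradient[OF that])
      fix C' assume C': "0 < C'" "\<forall>x. \<forall>t>0. \<bar>u t x\<bar> \<le> C' * p_kernel \<alpha> x (1 + t)"
      show "far_field_bigo {0..} (remainder \<alpha> f u\<^sub>0 u)
          (\<lambda>x t. (1 + t) powr 3 * max (norm x powr (- (q * (\<alpha> + CARD('n))))) (norm x powr (- (\<alpha> + CARD('n) + 2))))"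
        by (rule remainder_global[OF C'(1)]) (use C'(2) in blast)
      fix C'' assume C'': "0 < C''" "\<forall>t>0. Linf_weighted_norm (\<alpha> + CARD('n) + 1) (weak_grad (u t)) \<le> ennreal (C'' * (1 + t))"
      show "far_field_bigo {0..} (remainder \<alpha> f u\<^sub>0 u)
            (\<lambda>x t. (1 + t) powr 3 * max (norm x powr (- (q * (\<alpha> + CARD('n))) - 1)) (norm x powr (- (\<alpha> + CARD('n) + 2))))"
        by (rule remainder_global_gradient[OF C'(1) _ uc uw C''(1)]) (use C'(2) C''(2) in blast)+
    qed
  qed
qed

end
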